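(* Let $0<\beta<\alpha$, $1<p<\infty$ and $1\leq q<\infty$. Then the Bessel fractional derivative $\mathcal{D}^\beta$ is bounded from $F_{p,q}^{\alpha}(\gamma_d)$ into $F_{p,q}^{\alpha-\beta}(\gamma_d)$; that is, $\mathcal{D}^\beta f\in F_{p,q}^{\alpha-\beta}(\gamma_d)$ for every $f\in F_{p,q}^{\alpha}(\gamma_d)$, and there is a constant $C$ independent of $f$ such that $\|\mathcal{D}^\beta f\|_{F_{p,q}^{\alpha-\beta}}\leq C\|f\|_{F_{p,q}^{\alpha}}$.
   Context: Let $\gamma_d(dx)=\pi^{-d/2}e^{-|x|^2}dx$ be the Gaussian measure on $\mathbb{R}^d$, and write $\|\cdot\|_{p,\gamma_d}$ for the norm of $L^p(\gamma_d)$. For a multi-index $\nu=(\nu_1,\dots,\nu_d)$ of nonnegative integers, $|\nu|=\sum_i\nu_i$, $\nu!=\prod_i\nu_i!$, the normalized Hermite polynomial is $h_\nu(x)=(2^{|\nu|}\nu!)^{-1/2}\prod_{i=1}^d(-1)^{\nu_i}e^{x_i^2}\partial_i^{\nu_i}(e^{-x_i^2})$. Ornstein-Uhlenbeck semigroup: $T_tf(x)=\int_{\mathbb{R}^d}f(\sqrt{1-e^{-2t}}\,u+e^{-t}x)\,\gamma_d(du)$, $t\ge 0$. Poisson-Hermite semigroup: $P_tf(x)=\frac{1}{\sqrt{\pi}}\int_0^\infty\frac{e^{-u}}{\sqrt{u}}T_{t^2/(4u)}f(x)\,du$ for $t>0$, $P_0=I$. It satisfies $P_th_\nu=e^{-t\sqrt{|\nu|}}h_\nu$.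 Gaussian Triebel-Lizorkin spaces: for $\alpha\geq 0$, $1\leq p,q<\infty$, let $m$ be the smallest integer greater than $\alpha$. Then $F_{p,q}^{\alpha}(\gamma_d)$ is the set of $f\in L^p(\gamma_d)$ with $$\|f\|_{F_{p,q}^{\alpha}}:=\|f\|_{p,\gamma_d}+\left\|\left(\int_0^\infty\left(t^{m-\alpha}\left|\frac{\partial^mP_tf}{\partial t^m}\right|\right)^q\frac{dt}{t}\right)^{1/q}\right\|_{p,\gamma_d}<\infty.$$ (It is known that replacing $m$ by any other integer greater than $\alpha$ gives the same space with an equivalent norm.) Bessel fractional derivative of order $\beta>0$: on polynomials, $\mathcal{D}^\beta$ is the linear operator with $\mathcal{D}^\beta h_\nu=(1+\sqrt{|\nu|})^{\beta}h_\nu$. With $k$ the smallest integer greater than $\beta$ (so $k-1\leq\beta<k$), it is represented by $$\mathcal{D}^\beta f=\frac{1}{c_\beta^k}\int_0^\infty t^{-\beta-1}(e^{-t}P_t-I)^kf\,dt,\qquad c_\beta^k=\int_0^\infty u^{-\beta-1}(e^{-u}-1)^k\,du,$$ where $(e^{-t}P_t-I)^kf=\sum_{j=0}^k\binom{k}{j}(-1)^je^{-(k-j)t}P_{(k-j)t}f$. For $f\in F_{p,q}^{\alpha}(\gamma_d)$ with $\alpha>\beta$, $\mathcal{D}^\beta f$ is understood as given by this integral formula (for a.e. $x$). *)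

theory Defs
  imports "HOL-Analysis.Analysis"
begin

definition gaussian :: "'a::euclidean_space measure" where
  "gaussian = density lborel (\<lambda>x. ennreal (pi powr (- real DIM('a) / 2) * exp (- (norm x)\<^sup>2)))"

text \<open>Power of an extended nonnegative real, intended for exponents \<open>r > 0\<close> only.\<close>

definition epowr :: "ennreal \<Rightarrow> real \<Rightarrow> ennreal" where
  "epowr x r = (if x = top then top else ennreal (enn2real x powr r))"

text \<open>The quantity \<open>(\<integral> g\<^sup>p d\<gamma>)\<^bsup>1/p\<^esup>\<close> for a \<open>[0,\<infinity>]\<close>-valued \<open>g\<close>; it is \<open>\<infinity>\<close> when the integral diverges.
  Elements of \<open>L\<^sup>p(\<gamma>)\<close> are represented by everywhere defined Borel functions, not by classes modulo
  null sets.\<close>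

definition gaussian_norm :: "real \<Rightarrow> ('a::euclidean_space \<Rightarrow> ennreal) \<Rightarrow> ennreal" where
  "gaussian_norm p g = epowr (\<integral>\<^sup>+ x. epowr (g x) p \<partial>gaussian) (1 / p)"

definition gaussian_Lp :: "real \<Rightarrow> ('a::euclidean_space \<Rightarrow> real) set" where
  "gaussian_Lp p = {f \<in> borel_measurable borel. gaussian_norm p (\<lambda>x. ennreal \<bar>f x\<bar>) < top}"

definition ou_semigroup :: "real \<Rightarrow> ('a::euclidean_space \<Rightarrow> real) \<Rightarrow> 'a \<Rightarrow> real" where
  "ou_semigroup t f x = (\<integral>u. f (sqrt (1 - exp (-2 * t)) *\<^sub>R u + exp (-t) *\<^sub>R x) \<partial>gaussian)"

definition poisson_hermite :: "real \<Rightarrow> ('a::euclidean_space \<Rightarrow> real) \<Rightarrow> 'a \<Rightarrow> real" where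
  "poisson_hermite t f x =
     (if t = 0 then f x
      else 1 / sqrt pi *
        (LINT u:{0<..}|lborel. exp (-u) / sqrt u * ou_semigroup (t\<^sup>2 / (4 * u)) f x))"

text \<open>For \<open>f \<in> L\<^sup>1(\<gamma>)\<close> the map \<open>t \<mapsto> P\<^sub>t f(x)\<close> is smooth on \<open>(0,\<infinity>)\<close> for every \<open>x\<close>, so the total
  function \<open>deriv\<close> returns genuine derivatives below.\<close>

definition tl_square_function ::
  "real \<Rightarrow> real \<Rightarrow> ('a::euclidean_space \<Rightarrow> real) \<Rightarrow> 'a \<Rightarrow> ennreal" where
  "tl_square_function \<alpha> q f x =
     (let m = (LEAST m::nat. \<alpha> < real m) in
      epowr (\<integral>\<^sup>+ t\<in>{0<..}.
          ennreal ((t powr (real m - \<alpha>) * \<bar>(deriv ^^ m) (\<lambda>s. poisson_hermite s f x) t\<bar>) powr q / t)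
        \<partial>lborel) (1 / q))"

definition tl_norm ::
  "real \<Rightarrow> real \<Rightarrow> real \<Rightarrow> ('a::euclidean_space \<Rightarrow> real) \<Rightarrow> ennreal" where
  "tl_norm \<alpha> p q f =
     gaussian_norm p (\<lambda>x. ennreal \<bar>f x\<bar>) + gaussian_norm p (tl_square_function \<alpha> q f)"

definition triebel_lizorkin ::
  "real \<Rightarrow> real \<Rightarrow> real \<Rightarrow> ('a::euclidean_space \<Rightarrow> real) set" where
  "triebel_lizorkin \<alpha> p q = {f \<in> gaussian_Lp p. tl_norm \<alpha> p q f < top}"

text \<open>\<open>(e\<^sup>-\<^sup>t P\<^sub>t - I)\<^sup>k f\<close>, expanded binomially.\<close>

definition bessel_difference ::
  "nat \<Rightarrow> real \<Rightarrow> ('a::euclidean_space \<Rightarrow> real) \<Rightarrow> 'a \<Rightarrow> real" where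
  "bessel_difference k t f x =
     (\<Sum>j=0..k. real (k choose j) * (-1) ^ j * exp (- (real (k - j) * t)) *
        poisson_hermite (real (k - j) * t) f x)"

definition bessel_order :: "real \<Rightarrow> nat" where
  "bessel_order \<beta> = (LEAST k::nat. \<beta> < real k)"

definition bessel_const :: "real \<Rightarrow> real" where
  "bessel_const \<beta> = (LINT u:{0<..}|lborel. u powr (-\<beta> - 1) * (exp (-u) - 1) ^ bessel_order \<beta>)"

definition bessel_integrand ::
  "real \<Rightarrow> ('a::euclidean_space \<Rightarrow> real) \<Rightarrow> 'a \<Rightarrow> real \<Rightarrow> real" where
  "bessel_integrand \<beta> f x t = t powr (-\<beta> - 1) * bessel_difference (bessel_order \<beta>) t f x"

text \<open>At points where the integral does not converge absolutely, the Bochner integral, and hence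
  \<open>bessel_derivative \<beta> f x\<close>, is \<open>0\<close> by convention.\<close>

definition bessel_derivative ::
  "real \<Rightarrow> ('a::euclidean_space \<Rightarrow> real) \<Rightarrow> 'a \<Rightarrow> real" where
  "bessel_derivative \<beta> f x =
     1 / bessel_const \<beta> * (LINT t:{0<..}|lborel. bessel_integrand \<beta> f x t)"

end

theory Submission
  imports Defs "HOL-Probability.Probability"
begin

text \<open>Write \<open>u(t) = e\<^sup>-\<^sup>t P\<^sub>t f(x)\<close>. By Taylor's formula at infinity, the \<open>k\<close>-th difference of \<open>u\<close> at \<open>0\<close> is an
  integral of \<open>u\<^sup>(\<^sup>k\<^sup>)\<close> against a homogeneous kernel, so that up to a constant, whose value is irrelevant,
  \<open>D\<^sup>\<beta> f(x)\<close> is the Weyl fractional integral \<open>\<integral> v\<^bsup>k-\<beta>-1\<^esup> u\<^sup>(\<^sup>k\<^sup>)(v) dv\<close>. Applying \<open>\<partial>\<^sub>t\<^sup>n P\<^sub>t\<close> leads to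
  \<open>\<integral> s\<^bsup>k-\<beta>-1\<^esup> e\<^sup>-\<^sup>s (\<partial> - 1)\<^sup>k \<partial>\<^sup>n P\<^sub>t\<^sub>+\<^sub>s f(x) ds\<close>, and for every fixed \<open>x\<close> Hardy's inequality bounds its square function
  by the one of \<open>f\<close> of order \<open>k + n\<close>, up to terms controlled by the maximal function of \<open>\<bar>f\<bar>\<close>.

  The order \<open>k + n\<close> is reduced to the order \<open>m\<close> in the norm of \<open>f\<close> by the semigroup property and the
  vector-valued inequality for \<open>P\<^sub>t\<close> in \<open>L\<^sup>p(l\<^sup>q)\<close>, which follows by duality from the maximal theorem. The latter
  is the Hopf maximal ergodic theorem combined with the Harnack inequality \<open>P\<^sub>t f \<le> (t / s) P\<^sub>s f\<close> for
  \<open>s \<le> t\<close> and \<open>f \<ge> 0\<close>.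

  All this uses only a symmetric Markov kernel with the Harnack inequality and
  \<open>\<bar>\<partial>\<^sub>t\<^sup>j p\<^sub>t\<bar> \<le> C\<^sub>j t\<^sup>-\<^sup>j p\<^bsub>t/2\<^esub>\<close>. The Poisson-Hermite kernel has these properties because it is the Mehler
  kernel averaged over the one-sided stable density \<open>t / (2 \<surd>\<pi>) r\<^bsup>-3/2\<^esup> exp (-t\<^sup>2 / (4 r))\<close>, which has them.\<close>

section \<open>Powers of extended nonnegative reals\<close>

text \<open>Three difficulties shape the details. The Jensen, maximal and vector-valued inequalities
  come from absorbing half of the left side, so that side must be known to be finite. The last two
  are therefore proved for finite truncations and for times that are multiples of a step h, with
  constants free of h and of the size of the truncation: finite sums stay in the space, suprema over
  a grid are measurable, and finitely many dyadic times are multiples of the smallest one. Monotone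
  convergence removes the truncation. The square function of f sees one order of differentiation,
  whereas the power of (\<partial> - 1) contains all lower orders. Near 0 these are recovered by
  Taylor expansion from the point 2. Their values there, and everything at large times, are bounded
  by A / t^j, with A a multiple of the maximal function. So only the part of the square function
  over (0, 2] has to be raised in order. Each difference also contains f(x) itself, as P_0 f. It is
  tied to P_t f through a sequence of times along which P_t f tends to f almost everywhere,
  extracted from convergence in L^1.\<close>

lemma epowr_ennreal: "0 \<le> a \<Longrightarrow> epowr (ennreal a) r = ennreal (a powr r)"
  by (simp add: epowr_def)

lemma epowr_top [simp]: "epowr top r = top"
  by (simp add: epowr_def)

lemma epowr_eq_top_iff [simp]: "epowr x r = top \<longleftrightarrow> x = top"
  by (simp add: epowr_def)

lemma epowr_less_top_iff [simp]: "epowr x r < top \<longleftrightarrow> x < top"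
  by (simp add: epowr_def less_top)

lemma epowr_0 [simp]: "epowr 0 r = 0"
  by (simp add: epowr_def)

lemma epowr_one [simp]: "epowr x 1 = x"
  by (cases x) (auto simp: epowr_def)

lemma epowr_epowr: "epowr (epowr x r) s = epowr x (r * s)"
  by (cases x) (auto simp: epowr_ennreal powr_powr)

lemma epowr_mult: "epowr (x * y) r = epowr x r * epowr y r"
proof (cases "x = top \<or> y = top")
  case True
  have nz: "epowr z r \<noteq> 0" if "z \<noteq> 0" for z
    using that by (cases z) (auto simp: epowr_ennreal)
  from True show ?thesis
  proof
    assume "x = top"
    then show ?thesis
      by (cases "y = 0") (simp_all add: nz ennreal_top_mult)
  next
    assume "y = top"
    then show ?thesis
      by (cases "x = 0") (simp_all add: nz ennreal_mult_top)
  qed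
next
  case False
  then obtain a b where "x = ennreal a" "0 \<le> a" "y = ennreal b" "0 \<le> b"
    by (metis ennreal_cases)
  then show ?thesis
    by (simp add: epowr_ennreal powr_mult flip: ennreal_mult)
qed

lemma epowr_mono: "x \<le> y \<Longrightarrow> 0 \<le> r \<Longrightarrow> epowr x r \<le> epowr y r"
  by (cases x; cases y) (auto simp: epowr_ennreal powr_mono2 top_unique)

lemma epowr_measurable [measurable]:
  assumes "f \<in> borel_measurable M"
  shows "(\<lambda>x. epowr (f x) r) \<in> borel_measurable M"
  unfolding epowr_def using assms by measurable

lemma epowr_le_iff:
  assumes "0 < r"
  shows "epowr x r \<le> y \<longleftrightarrow> x \<le> epowr y (1 / r)"
proof
  assume "epowr x r \<le> y"
  from epowr_mono[OF this, of "1 / r"] show "x \<le> epowr y (1 / r)"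
    using assms by (simp add: epowr_epowr)
next
  assume "x \<le> epowr y (1 / r)"
  from epowr_mono[OF this, of r] show "epowr x r \<le> y"
    using assms by (simp add: epowr_epowr)
qed

text \<open>A monotone bijection with monotone inverse preserves suprema. This takes powers such as
  \<open>r / q\<close>, on either side of 1, through the increasing limits in monotone
  convergence.\<close>

lemma epowr_SUP:
  assumes "0 < r"
  shows "epowr (\<Squnion>i\<in>I. f i) r = (\<Squnion>i\<in>I. epowr (f i) r)"
proof (rule antisym)
  show "(\<Squnion>i\<in>I. epowr (f i) r) \<le> epowr (\<Squnion>i\<in>I. f i) r"
    using assms by (intro SUP_least epowr_mono SUP_upper) auto
  show "epowr (\<Squnion>i\<in>I. f i) r \<le> (\<Squnion>i\<in>I. epowr (f i) r)"
    unfolding epowr_le_iff[OF assms]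
  proof (rule SUP_least)
    fix i assume "i \<in> I"
    then have "epowr (f i) r \<le> (\<Squnion>i\<in>I. epowr (f i) r)" by (rule SUP_upper)
    then show "f i \<le> epowr (\<Squnion>i\<in>I. epowr (f i) r) (1 / r)"
      by (simp add: epowr_le_iff[OF assms])
  qed
qed

text \<open>Bounding the sum by twice the maximum gives one constant for convex and concave
  exponents alike; the exponent \<open>r / q\<close> can be of either kind.\<close>

lemma epowr_add_le:
  assumes "0 < r"
  shows "epowr (x + y) r \<le> ennreal (2 powr r) * (epowr x r + epowr y r)"
proof -
  have "x + y \<le> 2 * max x y"
    by (metis add_mono max.cobounded1 max.cobounded2 mult_2)
  then have "epowr (x + y) r \<le> epowr (2 * max x y) r"
    using assms by (intro epowr_mono) auto
  also have "\<dots> = ennreal (2 powr r) * epowr (max x y) r"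
    using epowr_ennreal[of 2 r] by (simp add: epowr_mult)
  also have "epowr (max x y) r \<le> epowr x r + epowr y r"
    by (simp add: max_def)
  finally show ?thesis by (simp add: mult_left_mono)
qed

text \<open>A crude form of Young's inequality that replaces Hoelder's inequality and Jensen's inequality
  below: all constants are irrelevant, and a small factor in front of \<open>epowr y p\<close> can be absorbed.\<close>

lemma young_split:
  assumes "1 \<le> p" "0 < K"
  shows "x * epowr y (p - 1) \<le> ennreal (K powr (p - 1)) * epowr x p + ennreal (1 / K) * epowr y p"
proof (cases "x = top \<or> y = top")
  case True
  then show ?thesis
    using assms by (auto simp: ennreal_mult_top)
next
  case False
  then obtain a b where ab: "x = ennreal a" "0 \<le> a" "y = ennreal b" "0 \<le> b"
    by (metis ennreal_cases)
  have "a * b powr (p - 1) \<le> K powr (p - 1) * a powr p + (1 / K) * b powr p"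
  \<comment> \<open>The two terms on the right are what the left side becomes when b is replaced by
    K a, or a by b / K; in each case the replacement only enlarges it.\<close>
  proof (cases "b \<le> K * a")
    case True
    have "a * b powr (p - 1) \<le> a * (K * a) powr (p - 1)"
      using True ab assms by (intro mult_left_mono powr_mono2) auto
    also have "\<dots> = K powr (p - 1) * (a powr 1 * a powr (p - 1))"
      using ab assms by (simp add: powr_mult)
    also have "a powr 1 * a powr (p - 1) = a powr p"
      by (subst powr_add[symmetric]) simp
    also have "K powr (p - 1) * a powr p \<le> K powr (p - 1) * a powr p + (1 / K) * b powr p"
      using assms by simp
    finally show ?thesis .
  next
    case False
    then have "a \<le> (1 / K) * b" using assms by (simp add: field_simps)
    then have "a * b powr (p - 1) \<le> (1 / K) * b * b powr (p - 1)"
      by (intro mult_right_mono) auto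
    also have "\<dots> = (1 / K) * (b powr 1 * b powr (p - 1))"
      using ab by simp
    also have "b powr 1 * b powr (p - 1) = b powr p"
      by (subst powr_add[symmetric]) simp
    finally show ?thesis using assms by (simp add: add_increasing)
  qed
  then show ?thesis
    using ab assms by (simp add: epowr_ennreal flip: ennreal_mult ennreal_plus)
qed

text \<open>Take y = z^(1/(p-1)): then y^(p-1) = z, and y^p is z to the conjugate exponent.\<close>

lemma young_split_conj:
  assumes "1 < p" "0 < K"
  shows "x * z \<le> ennreal (K powr (p - 1)) * epowr x p + ennreal (1 / K) * epowr z (p / (p - 1))"
  using young_split[of p K x "epowr z (1 / (p - 1))"] assms by (simp add: epowr_epowr)

text \<open>For infinite X the second hypothesis says nothing, whence the first. The finiteness
  claims in the proofs below serve to discharge it.\<close>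

lemma ennreal_absorb:
  fixes X A :: ennreal
  assumes "X < top" "X \<le> A + ennreal (1 / 2) * X"
  shows "X \<le> 2 * A"
proof (cases A)
  case (real a)
  obtain b where b: "X = ennreal b" "0 \<le> b" using assms(1) by (metis ennreal_cases less_top)
  have "ennreal b \<le> ennreal (a + 1 / 2 * b)"
    using assms(2) b real by (simp del: ennreal_half flip: ennreal_mult ennreal_plus)
  then have "b \<le> a + 1 / 2 * b" using b real by (subst (asm) ennreal_le_iff) auto
  then have "ennreal b \<le> ennreal (2 * a)" by (intro ennreal_leI) auto
  then show ?thesis using b real by (simp add: ennreal_mult)
qed (simp add: ennreal_mult_top)

text \<open>Write I for the integral of w G. One factor of I^q is kept as an integral and I^(q-1) is
  carried inside it, where Young's inequality applies. The choice K = 2 C makes the second term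
  integrate to at most C / (2 C) = 1/2 of I^q, which is absorbed.\<close>

lemma jensen_crude:
  assumes [measurable]: "w \<in> borel_measurable M" "G \<in> borel_measurable M"
    and q: "1 \<le> q" and C: "0 < C" and w: "(\<integral>\<^sup>+x. w x \<partial>M) \<le> ennreal C"
  shows "epowr (\<integral>\<^sup>+x. w x * G x \<partial>M) q \<le>
    ennreal (2 * (2 * C) powr (q - 1)) * (\<integral>\<^sup>+x. w x * epowr (G x) q \<partial>M)"
proof (cases "(\<integral>\<^sup>+x. w x * epowr (G x) q \<partial>M) = top")
  case True
  then show ?thesis using C by (simp add: ennreal_mult_top)
next
  case False
  let ?I = "\<integral>\<^sup>+x. w x * G x \<partial>M" and ?J = "\<integral>\<^sup>+x. w x * epowr (G x) q \<partial>M"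
  \<comment> \<open>As w has finite mass, this bounds I by that mass plus the right-hand integral,
    so I is finite before absorption.\<close>
  have le: "G x \<le> 1 + epowr (G x) q" for x
  proof (cases "G x")
    case (real a)
    have "a \<le> 1 + a powr q"
    proof (cases "a \<le> 1")
      case True then show ?thesis by (simp add: add_increasing2)
    next
      case False
      then have "a powr 1 \<le> a powr q" using q by (intro powr_mono) auto
      then show ?thesis using False by simp
    qed
    then have "ennreal a \<le> ennreal (1 + a powr q)" by (rule ennreal_leI)
    then show ?thesis using real by (simp add: epowr_ennreal ennreal_plus flip: ennreal_1)
  qed auto
  have "?I \<le> (\<integral>\<^sup>+x. w x * (1 + epowr (G x) q) \<partial>M)"
    by (intro nn_integral_mono mult_left_mono le) auto
  also have "\<dots> = (\<integral>\<^sup>+x. w x \<partial>M) + ?J"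
    by (simp add: distrib_left nn_integral_add)
  also have "\<dots> < top" using le_less_trans[OF w ennreal_less_top] False by (auto simp: less_top)
  finally have fin: "?I < top" .
  have "epowr ?I q = (\<integral>\<^sup>+x. w x * G x \<partial>M) * epowr ?I (q - 1)"
  proof -
    obtain b where b: "?I = ennreal b" "0 \<le> b" using fin by (metis ennreal_cases less_top)
    have "b powr q = b powr 1 * b powr (q - 1)" by (subst powr_add[symmetric]) simp
    then show ?thesis using b by (simp add: epowr_ennreal flip: ennreal_mult)
  qed
  also have "\<dots> = (\<integral>\<^sup>+x. w x * G x * epowr ?I (q - 1) \<partial>M)"
    by (simp add: nn_integral_multc)
  also have "\<dots> = (\<integral>\<^sup>+x. w x * (G x * epowr ?I (q - 1)) \<partial>M)"
    by (simp add: mult.assoc)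
  also have "\<dots> \<le> (\<integral>\<^sup>+x. w x * (ennreal ((2 * C) powr (q - 1)) * epowr (G x) q
      + ennreal (1 / (2 * C)) * epowr ?I q) \<partial>M)"
    using C q by (intro nn_integral_mono mult_left_mono young_split) auto
  also have "\<dots> = (\<integral>\<^sup>+x. ennreal ((2 * C) powr (q - 1)) * (w x * epowr (G x) q)
      + w x * (ennreal (1 / (2 * C)) * epowr ?I q) \<partial>M)"
    by (intro nn_integral_cong) (simp add: distrib_left mult_ac)
  also have "\<dots> = ennreal ((2 * C) powr (q - 1)) * ?J
      + (\<integral>\<^sup>+x. w x \<partial>M) * (ennreal (1 / (2 * C)) * epowr ?I q)"
    by (simp add: nn_integral_add nn_integral_cmult nn_integral_multc)
  also have "(\<integral>\<^sup>+x. w x \<partial>M) * (ennreal (1 / (2 * C)) * epowr ?I q)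
      \<le> ennreal C * (ennreal (1 / (2 * C)) * epowr ?I q)"
    by (intro mult_right_mono w) auto
  also have "\<dots> = ennreal (1 / 2) * epowr ?I q"
    using C by (simp add: mult.assoc[symmetric] flip: ennreal_mult)
  finally have "epowr ?I q \<le> ennreal ((2 * C) powr (q - 1)) * ?J + ennreal (1 / 2) * epowr ?I q"
    by (simp add: add_left_mono)
  then have "epowr ?I q \<le> 2 * (ennreal ((2 * C) powr (q - 1)) * ?J)"
    using fin by (intro ennreal_absorb) auto
  also have "\<dots> = ennreal (2 * (2 * C) powr (q - 1)) * ?J"
    by (simp add: mult.assoc ennreal_mult)
  finally show ?thesis .
qed

section \<open>Hardy's inequality\<close>

lemma nn_integral_of_has_integral:
  fixes f :: "real \<Rightarrow> real"
  assumes "(f has_integral I) S" "S \<in> sets borel" "f \<in> borel_measurable borel" "\<And>x. x \<in> S \<Longrightarrow> 0 \<le> f x"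
  shows "(\<integral>\<^sup>+x\<in>S. ennreal (f x) \<partial>lborel) = ennreal I"
proof -
  have "((\<lambda>x. if x \<in> S then f x else 0) has_integral I) UNIV"
    using assms(1) by (simp add: has_integral_restrict_UNIV)
  moreover have "(\<lambda>x. if x \<in> S then f x else 0) \<in> borel_measurable borel"
    using assms(2,3) by measurable
  ultimately have "(\<integral>\<^sup>+x. ennreal (if x \<in> S then f x else 0) \<partial>lborel) = ennreal I"
    using assms(4) by (intro nn_integral_has_integral_lborel) auto
  moreover have "ennreal (if x \<in> S then f x else 0) = ennreal (f x) * indicator S x" for x
    by auto
  ultimately show ?thesis by simp
qed

section \<open>Integrals of powers over half-lines and intervals\<close>

lemma nn_integral_powr_0:
  assumes "0 < a" "0 \<le> s"
  shows "(\<integral>\<^sup>+x\<in>{0..s}. ennreal (x powr (a - 1)) \<partial>lborel) = ennreal (s powr a / a)"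
  using assms has_integral_powr_from_0[of "a - 1" s] by (intro nn_integral_of_has_integral) auto

lemma nn_integral_powr_inf:
  assumes "0 < a" "0 < t"
  shows "(\<integral>\<^sup>+x\<in>{t..}. ennreal (x powr (- a - 1)) \<partial>lborel) = ennreal (t powr (- a) / a)"
  using assms has_integral_powr_to_inf[of "- a - 1" t] by (intro nn_integral_of_has_integral) auto

lemma nn_integral_powr_shift:
  assumes "0 < b" "t \<le> s"
  shows "(\<integral>\<^sup>+x\<in>{t..s}. ennreal ((x - t) powr (b - 1)) \<partial>lborel) = ennreal ((s - t) powr b / b)"
    and "(\<integral>\<^sup>+x\<in>{t..s}. ennreal ((s - x) powr (b - 1)) \<partial>lborel) = ennreal ((s - t) powr b / b)"
proof -
  have "(\<integral>\<^sup>+x\<in>{t..s}. ennreal ((x - t) powr (b - 1)) \<partial>lborel)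
      = (\<integral>\<^sup>+x. ennreal (x powr (b - 1)) * indicator {0..s-t} x \<partial>lborel)"
    by (subst nn_integral_real_affine[of _ 1 t]) (auto intro!: nn_integral_cong split: split_indicator)
  with nn_integral_powr_0[of b "s - t"] assms
  show "(\<integral>\<^sup>+x\<in>{t..s}. ennreal ((x - t) powr (b - 1)) \<partial>lborel) = ennreal ((s - t) powr b / b)"
    by simp
  have "(\<integral>\<^sup>+x\<in>{t..s}. ennreal ((s - x) powr (b - 1)) \<partial>lborel)
      = (\<integral>\<^sup>+x. ennreal (x powr (b - 1)) * indicator {0..s-t} x \<partial>lborel)"
    by (subst nn_integral_real_affine[of _ "-1" s]) (auto intro!: nn_integral_cong split: split_indicator)
  with nn_integral_powr_0[of b "s - t"] assms
  show "(\<integral>\<^sup>+x\<in>{t..s}. ennreal ((s - x) powr (b - 1)) \<partial>lborel) = ennreal ((s - t) powr b / b)"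
    by simp
qed

text \<open>The absolute value in the constant covers both signs of c; the exponents
  \<open>b - 1\<close> and \<open>a - 1\<close> of the Hardy kernel may be positive or
  negative.\<close>

lemma powr_comparable:
  fixes x y c :: real
  assumes "0 < x" "x / 2 \<le> y" "y \<le> x"
  shows "y powr c \<le> 2 powr \<bar>c\<bar> * x powr c"
proof (cases "0 \<le> c")
  case True
  then have "y powr c \<le> x powr c" using assms by (intro powr_mono2) auto
  also have "\<dots> = 2 powr 0 * x powr c" by simp
  also have "\<dots> \<le> 2 powr \<bar>c\<bar> * x powr c" by (intro mult_right_mono powr_mono) auto
  finally show ?thesis .
next
  case False
  then have "y powr c \<le> (x / 2) powr c" using assms by (intro powr_mono2') auto
  also have "\<dots> = 2 powr \<bar>c\<bar> * x powr c"
    using False assms by (simp add: powr_divide powr_minus divide_simps)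
  finally show ?thesis .
qed

text \<open>\<open>t powr a\<close> is the weight of a square function and
  \<open>(s - t) powr (b - 1)\<close> the kernel of a Weyl fractional integral. The last factor
  strips the weight \<open>s powr (a + b)\<close> that the function under the integral carries in
  its own square function.\<close>

definition hardy_kernel :: "real \<Rightarrow> real \<Rightarrow> real \<Rightarrow> real \<Rightarrow> real" where
  "hardy_kernel a b t s = t powr a * (s - t) powr (b - 1) * s powr (- a - b)"

lemma hardy_kernel_measurable [measurable]:
  assumes "f \<in> borel_measurable M" "g \<in> borel_measurable M"
  shows "(\<lambda>x. hardy_kernel a b (f x) (g x)) \<in> borel_measurable M"
  unfolding hardy_kernel_def using assms by measurable

text \<open>Split at s = 2 t. Below it s is comparable to t and the singularity (s - t)^(b-1) is
  integrable since b > 0; above it s - t is comparable to s and s^(-a-1) is integrable at infinity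
  since a > 0.\<close>

lemma hardy_kernel_bound1:
  assumes "0 < a" "0 < b"  "0 < t"
  shows "(\<integral>\<^sup>+s\<in>{t<..}. ennreal (hardy_kernel a b t s) \<partial>lborel) \<le> ennreal (1 / b + 2 powr \<bar>b - 1\<bar> / a)"
proof -
  let ?c = "2 powr \<bar>b - 1\<bar>"
  have pw: "ennreal (hardy_kernel a b t s) * indicator {t<..} s \<le>
      ennreal (t powr (- b)) * (ennreal ((s - t) powr (b - 1)) * indicator {t..2 * t} s)
      + ennreal (?c * t powr a) * (ennreal (s powr (- a - 1)) * indicator {t..} s)" for s
  proof (cases "t < s")
    case True
    show ?thesis
    proof (cases "s \<le> 2 * t")
      case s: True
      have "s powr (- a - b) \<le> t powr (- a - b)"
        using True assms by (intro powr_mono2') auto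
      then have "hardy_kernel a b t s \<le> t powr a * (s - t) powr (b - 1) * t powr (- a - b)"
        unfolding hardy_kernel_def by (intro mult_left_mono) auto
      also have "\<dots> = t powr (- b) * (s - t) powr (b - 1)"
        using assms by (simp add: powr_diff powr_minus field_simps)
      finally show ?thesis
        using True s assms by (simp add: add_increasing2 ennreal_leI flip: ennreal_mult)
    next
      case s: False
      have "(s - t) powr (b - 1) \<le> ?c * s powr (b - 1)"
        using True s assms by (intro powr_comparable) auto
      then have "hardy_kernel a b t s \<le> t powr a * (?c * s powr (b - 1)) * s powr (- a - b)"
        unfolding hardy_kernel_def by (intro mult_left_mono mult_right_mono) auto
      also have "\<dots> = ?c * t powr a * (s powr (b - 1) * s powr (- a - b))"
        by (simp add: mult_ac)
      also have "s powr (b - 1) * s powr (- a - b) = s powr (- a - 1)"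
        unfolding powr_add[symmetric] by (rule arg_cong[where f="(powr) s"]) simp
      finally show ?thesis
        using True s assms by (simp add: ennreal_leI flip: ennreal_mult)
    qed
  qed auto
  have "(\<integral>\<^sup>+s\<in>{t<..}. ennreal (hardy_kernel a b t s) \<partial>lborel) \<le>
    (\<integral>\<^sup>+s. ennreal (t powr (- b)) * (ennreal ((s - t) powr (b - 1)) * indicator {t..2 * t} s)
      + ennreal (?c * t powr a) * (ennreal (s powr (- a - 1)) * indicator {t..} s) \<partial>lborel)"
    by (intro nn_integral_mono pw)
  also have "\<dots> = ennreal (t powr (- b)) * ennreal (t powr b / b) + ennreal (?c * t powr a) * ennreal (t powr (- a) / a)"
    using assms nn_integral_powr_shift(1)[of b t "2 * t"] nn_integral_powr_inf[of a t]
    by (simp add: nn_integral_add nn_integral_cmult)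
  also have "\<dots> = ennreal (t powr (- b) * (t powr b / b) + ?c * t powr a * (t powr (- a) / a))"
    using assms by (simp flip: ennreal_mult ennreal_plus)
  also have "t powr (- b) * (t powr b / b) + ?c * t powr a * (t powr (- a) / a) = 1 / b + ?c / a"
    using assms by (simp add: powr_minus field_simps)
  finally show ?thesis .
qed

text \<open>Split at t = s / 2. Below it s - t is comparable to s and t^(a-1) is integrable at 0;
  above it t is comparable to s and (s - t)^(b-1) is integrable at s.\<close>

lemma hardy_kernel_bound2:
  assumes "0 < a" "0 < b"  "0 < s"
  shows "(\<integral>\<^sup>+t\<in>{0<..<s}. ennreal (hardy_kernel a b t s / t) \<partial>lborel)
    \<le> ennreal ((2 powr \<bar>b - 1\<bar> / a + 2 powr \<bar>a - 1\<bar> / b) / s)"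
proof -
  let ?c = "2 powr \<bar>b - 1\<bar>" and ?d = "2 powr \<bar>a - 1\<bar>"
  have pw: "ennreal (hardy_kernel a b t s / t) * indicator {0<..<s} t \<le>
      ennreal (?c * s powr (- a - 1)) * (ennreal (t powr (a - 1)) * indicator {0..s} t)
      + ennreal (?d * s powr (- b - 1)) * (ennreal ((s - t) powr (b - 1)) * indicator {0..s} t)" for t
  proof (cases "0 < t \<and> t < s")
    case True
    then have eq: "hardy_kernel a b t s / t = t powr (a - 1) * (s - t) powr (b - 1) * s powr (- a - b)"
      unfolding hardy_kernel_def by (simp add: powr_diff)
    show ?thesis
    proof (cases "t \<le> s / 2")
      case t: True
      have "(s - t) powr (b - 1) \<le> ?c * s powr (b - 1)"
        using True t assms by (intro powr_comparable) auto
      then have "hardy_kernel a b t s / t \<le> t powr (a - 1) * (?c * s powr (b - 1)) * s powr (- a - b)"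
        unfolding eq by (intro mult_left_mono mult_right_mono) auto
      also have "\<dots> = ?c * (s powr (b - 1) * s powr (- a - b)) * t powr (a - 1)"
        by (simp add: mult_ac)
      also have "s powr (b - 1) * s powr (- a - b) = s powr (- a - 1)"
        unfolding powr_add[symmetric] by (rule arg_cong[where f="(powr) s"]) simp
      finally show ?thesis
        using True t assms by (simp add: ennreal_leI add_increasing2 flip: ennreal_mult)
    next
      case t: False
      have "t powr (a - 1) \<le> ?d * s powr (a - 1)"
        using True t assms by (intro powr_comparable) auto
      then have "hardy_kernel a b t s / t \<le> (?d * s powr (a - 1)) * (s - t) powr (b - 1) * s powr (- a - b)"
        unfolding eq by (intro mult_right_mono) auto
      also have "\<dots> = ?d * (s powr (a - 1) * s powr (- a - b)) * (s - t) powr (b - 1)"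
        by (simp add: mult_ac)
      also have "s powr (a - 1) * s powr (- a - b) = s powr (- b - 1)"
        unfolding powr_add[symmetric] by (rule arg_cong[where f="(powr) s"]) simp
      finally show ?thesis
        using True t assms by (simp add: ennreal_leI add_increasing flip: ennreal_mult)
    qed
  qed auto
  have "(\<integral>\<^sup>+t\<in>{0<..<s}. ennreal (hardy_kernel a b t s / t) \<partial>lborel) \<le>
    (\<integral>\<^sup>+t. ennreal (?c * s powr (- a - 1)) * (ennreal (t powr (a - 1)) * indicator {0..s} t)
      + ennreal (?d * s powr (- b - 1)) * (ennreal ((s - t) powr (b - 1)) * indicator {0..s} t) \<partial>lborel)"
    by (intro nn_integral_mono pw)
  also have "\<dots> = ennreal (?c * s powr (- a - 1)) * ennreal (s powr a / a)
      + ennreal (?d * s powr (- b - 1)) * ennreal (s powr b / b)"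
    using assms nn_integral_powr_shift(2)[of b 0 s] nn_integral_powr_0[of a s]
    by (simp add: nn_integral_add nn_integral_cmult)
  also have "\<dots> = ennreal (?c * s powr (- a - 1) * (s powr a / a) + ?d * s powr (- b - 1) * (s powr b / b))"
    using assms by (simp flip: ennreal_mult ennreal_plus)
  also have "?c * s powr (- a - 1) * (s powr a / a) + ?d * s powr (- b - 1) * (s powr b / b) = (?c / a + ?d / b) / s"
    using assms by (simp add: powr_minus powr_diff field_simps)
  finally show ?thesis .
qed

text \<open>Hardy's inequality: \<open>hardy_kernel a b t s\<close> is homogeneous of degree \<open>-1\<close>, so it acts
  boundedly on \<open>L\<^sup>q\<close> with respect to the measure \<open>dt / t\<close>.\<close>

lemma hardy_inequality:
  assumes ab: "0 < a" "0 < b" and q: "1 \<le> (q :: real)"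
  obtains C where "0 < C" "\<And>G. G \<in> borel_measurable borel \<Longrightarrow>
    (\<integral>\<^sup>+t\<in>{0<..}. epowr (\<integral>\<^sup>+s\<in>{t<..}. ennreal (hardy_kernel a b t s) * G s \<partial>lborel) q * ennreal (1 / t) \<partial>lborel)
    \<le> ennreal C * (\<integral>\<^sup>+s\<in>{0<..}. epowr (G s) q * ennreal (1 / s) \<partial>lborel)"
proof -
  define C1 where "C1 = 1 / b + 2 powr \<bar>b - 1\<bar> / a"
  define C2 where "C2 = 2 powr \<bar>b - 1\<bar> / a + 2 powr \<bar>a - 1\<bar> / b"
  define D where "D = 2 * (2 * C1) powr (q - 1)"
  have pos: "0 < C1" "0 < C2"
    using ab by (auto simp: C1_def C2_def intro!: add_pos_pos)
  then have pos: "0 < C1" "0 < C2" "0 < D"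
    by (auto simp: D_def)
  show ?thesis
  proof (rule that[of "D * C2"])
    show "0 < D * C2" using pos by simp
    fix G :: "real \<Rightarrow> ennreal" assume [measurable]: "G \<in> borel_measurable borel"
    let ?w = "\<lambda>t s. ennreal (hardy_kernel a b t s) * indicator {t<..} s"
    \<comment> \<open>A Schur test: the mass of the kernel in s, bounded by \<open>C1\<close>, feeds
      Jensen's inequality for each t. After Fubini its mass in t with respect to dt / t, bounded by
      \<open>C2 / s\<close>, remains.\<close>
    have 1: "epowr (\<integral>\<^sup>+s\<in>{t<..}. ennreal (hardy_kernel a b t s) * G s \<partial>lborel) q * ennreal (1 / t) * indicator {0<..} t
      \<le> (\<integral>\<^sup>+s. ennreal D * (ennreal (hardy_kernel a b t s / t) * indicator {0<..<s} t * epowr (G s) q) \<partial>lborel)" for t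
    proof (cases "0 < t")
      case True
      have "epowr (\<integral>\<^sup>+s\<in>{t<..}. ennreal (hardy_kernel a b t s) * G s \<partial>lborel) q
          = epowr (\<integral>\<^sup>+s. ?w t s * G s \<partial>lborel) q"
        by (simp add: mult_ac)
      also have "\<dots> \<le> ennreal D * (\<integral>\<^sup>+s. ?w t s * epowr (G s) q \<partial>lborel)"
        using hardy_kernel_bound1[OF ab True] pos(1) q unfolding D_def C1_def
        by (intro jensen_crude) auto
      finally have "epowr (\<integral>\<^sup>+s\<in>{t<..}. ennreal (hardy_kernel a b t s) * G s \<partial>lborel) q * ennreal (1 / t) * indicator {0<..} t
        \<le> ennreal D * (\<integral>\<^sup>+s. ?w t s * epowr (G s) q \<partial>lborel) * ennreal (1 / t) * indicator {0<..} t"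
        by (intro mult_right_mono) auto
      also have "\<dots> = (\<integral>\<^sup>+s. ennreal D * (?w t s * epowr (G s) q) * ennreal (1 / t) * indicator {0<..} t \<partial>lborel)"
        by (simp add: nn_integral_cmult nn_integral_multc)
      also have "\<dots> = (\<integral>\<^sup>+s. ennreal D * (ennreal (hardy_kernel a b t s / t) * indicator {0<..<s} t * epowr (G s) q) \<partial>lborel)"
        using True by (intro nn_integral_cong)
          (auto simp: mult_ac divide_inverse ennreal_mult hardy_kernel_def split: split_indicator)
      finally show ?thesis .
    qed auto
    have "(\<integral>\<^sup>+t\<in>{0<..}. epowr (\<integral>\<^sup>+s\<in>{t<..}. ennreal (hardy_kernel a b t s) * G s \<partial>lborel) q * ennreal (1 / t) \<partial>lborel)
      \<le> (\<integral>\<^sup>+t. (\<integral>\<^sup>+s. ennreal D * (ennreal (hardy_kernel a b t s / t) * indicator {0<..<s} t * epowr (G s) q) \<partial>lborel) \<partial>lborel)"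
      by (intro nn_integral_mono 1)
    also have "\<dots> = (\<integral>\<^sup>+s. (\<integral>\<^sup>+t. ennreal D * (ennreal (hardy_kernel a b t s / t) * indicator {0<..<s} t * epowr (G s) q) \<partial>lborel) \<partial>lborel)"
      unfolding greaterThanLessThan_def greaterThan_def lessThan_def
      by (rule lborel_pair.Fubini') measurable
    also have "\<dots> = (\<integral>\<^sup>+s. ennreal D * ((\<integral>\<^sup>+t\<in>{0<..<s}. ennreal (hardy_kernel a b t s / t) \<partial>lborel) * epowr (G s) q) \<partial>lborel)"
      by (simp add: nn_integral_cmult nn_integral_multc)
    also have "\<dots> \<le> (\<integral>\<^sup>+s. ennreal D * (ennreal C2 * (epowr (G s) q * ennreal (1 / s) * indicator {0<..} s)) \<partial>lborel)"
    proof (intro nn_integral_mono mult_left_mono)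
      fix s :: real
      show "(\<integral>\<^sup>+t\<in>{0<..<s}. ennreal (hardy_kernel a b t s / t) \<partial>lborel) * epowr (G s) q
        \<le> ennreal C2 * (epowr (G s) q * ennreal (1 / s) * indicator {0<..} s)"
      proof (cases "0 < s")
        case True
        have "(\<integral>\<^sup>+t\<in>{0<..<s}. ennreal (hardy_kernel a b t s / t) \<partial>lborel) * epowr (G s) q
          \<le> ennreal (C2 * (1 / s)) * epowr (G s) q"
          using hardy_kernel_bound2[OF ab True] by (intro mult_right_mono) (auto simp: C2_def)
        then show ?thesis using True pos by (simp add: ennreal_mult mult_ac del: times_divide_eq_right)
      qed auto
    qed auto
    also have "\<dots> = ennreal (D * C2) * (\<integral>\<^sup>+s\<in>{0<..}. epowr (G s) q * ennreal (1 / s) \<partial>lborel)"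
      using pos by (simp add: nn_integral_cmult ennreal_mult mult.assoc)
    finally show "(\<integral>\<^sup>+t\<in>{0<..}. epowr (\<integral>\<^sup>+s\<in>{t<..}. ennreal (hardy_kernel a b t s) * G s \<partial>lborel) q * ennreal (1 / t) \<partial>lborel)
      \<le> ennreal (D * C2) * (\<integral>\<^sup>+s\<in>{0<..}. epowr (G s) q * ennreal (1 / s) \<partial>lborel)" .
  qed
qed

section \<open>Pointwise bounds for Weyl fractional integrals\<close>

text \<open>The Taylor polynomial of \<open>H l\<close> as a function of its centre \<open>v\<close>: its derivative telescopes.\<close>

lemma taylor_centre_deriv:
  fixes H :: "nat \<Rightarrow> real \<Rightarrow> real"
  assumes "\<And>j. (H j has_real_derivative H (Suc j) v) (at v)"
  shows "((\<lambda>v. \<Sum>i\<le>M. (r - v) ^ i / fact i * H (l + i) v) has_real_derivative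
           (r - v) ^ M / fact M * H (Suc (l + M)) v) (at v)"
proof (induction M)
  case 0
  then show ?case using assms by simp
next
  case (Suc M)
  have "((\<lambda>v. (r - v) ^ Suc M / fact (Suc M)) has_real_derivative (- ((r - v) ^ M / fact M))) (at v)"
    by (auto intro!: derivative_eq_intros simp del: power_Suc fact_Suc)
      (simp add: divide_simps del: of_nat_Suc)
  from DERIV_mult[OF this assms[of "l + Suc M"]]
  have "((\<lambda>v. (r - v) ^ Suc M / fact (Suc M) * H (l + Suc M) v) has_real_derivative
      - ((r - v) ^ M / fact M) * H (l + Suc M) v + H (Suc (l + Suc M)) v * ((r - v) ^ Suc M / fact (Suc M))) (at v)" .
  from DERIV_add[OF Suc this] show ?case
    by (simp del: power_Suc fact_Suc add: mult.commute)
qed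

lemma nn_integral_FTC_abs:
  fixes F F' :: "real \<Rightarrow> real"
  assumes "a \<le> b" "\<And>x. a \<le> x \<Longrightarrow> x \<le> b \<Longrightarrow> (F has_real_derivative F' x) (at x)"
    "continuous_on {a..b} F'"
  shows "ennreal \<bar>F b - F a\<bar> \<le> (\<integral>\<^sup>+x\<in>{a..b}. ennreal \<bar>F' x\<bar> \<partial>lborel)"
proof -
  have eq: "(\<integral>x. indicator {a..b} x *\<^sub>R F' x \<partial>lborel) = F b - F a"
    using assms by (intro integral_FTC_atLeastAtMost)
      (auto simp: has_real_derivative_iff_has_vector_derivative intro: has_vector_derivative_at_within)
  have "ennreal \<bar>F b - F a\<bar> \<le> (\<integral>\<^sup>+x. ennreal (norm (indicator {a..b} x *\<^sub>R F' x)) \<partial>lborel)"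
  proof (cases "integrable lborel (\<lambda>x. indicator {a..b} x *\<^sub>R F' x)")
    case True
    from integral_norm_bound_ennreal[OF this] show ?thesis by (simp only: eq real_norm_def)
  next
    \<comment> \<open>The integral is then 0 by default, and so is \<open>F b - F a\<close> by
      \<open>eq\<close>.\<close>
    case False
    then show ?thesis using eq by (simp add: not_integrable_integral_eq)
  qed
  also have "\<dots> = (\<integral>\<^sup>+x\<in>{a..b}. ennreal \<bar>F' x\<bar> \<partial>lborel)"
    by (intro nn_integral_cong) (auto split: split_indicator)
  finally show ?thesis .
qed

text \<open>Move the centre v of the Taylor polynomial of \<open>H l\<close>, evaluated at r, from r
  to 2. At v = r its value is \<open>H l r\<close>; at v = 2 it has at most N terms, each at most
  2^N A because the distance from r to 2 is at most 2. The difference is the integral of its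
  derivative in v, which contains only \<open>H N\<close>.\<close>

lemma lower_order_bound:
  fixes H :: "nat \<Rightarrow> real \<Rightarrow> real"
  assumes H: "\<And>j v. 0 < v \<Longrightarrow> (H j has_real_derivative H (Suc j) v) (at v)"
    and A: "0 \<le> A" "\<And>j. j \<le> N \<Longrightarrow> \<bar>H j 2\<bar> \<le> A"
    and l: "l < N" and r: "0 < r" "r \<le> 2"
  shows "ennreal \<bar>H l r\<bar> \<le> ennreal (real N * 2 ^ N * A)
      + (\<integral>\<^sup>+v\<in>{r..2}. ennreal (v ^ (N - l - 1) * \<bar>H N v\<bar>) \<partial>lborel)"
proof -
  define M where "M = N - l - 1"
  have N: "N = Suc (l + M)" using l by (simp add: M_def)
  define R where "R v = (\<Sum>i\<le>M. (r - v) ^ i / fact i * H (l + i) v)" for v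
  define R' where "R' v = (r - v) ^ M / fact M * H N v" for v
  have R: "(R has_real_derivative R' v) (at v)" if "0 < v" for v
    unfolding R_def[abs_def] R'_def N using H[OF that] by (intro taylor_centre_deriv) auto
  have "continuous_on {r..2} (H N)"
    using r by (intro DERIV_continuous_on[where D="H (Suc N)"]) (auto intro: has_field_derivative_at_within[OF H])
  then have "continuous_on {r..2} R'"
    unfolding R'_def by (intro continuous_intros) auto
  then have "ennreal \<bar>R 2 - R r\<bar> \<le> (\<integral>\<^sup>+x\<in>{r..2}. ennreal \<bar>R' x\<bar> \<partial>lborel)"
    using r R by (intro nn_integral_FTC_abs) auto
  also have "\<dots> \<le> (\<integral>\<^sup>+v\<in>{r..2}. ennreal (v ^ M * \<bar>H N v\<bar>) \<partial>lborel)"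
  proof (intro nn_integral_mono)
    fix v :: real
    have "\<bar>R' v\<bar> \<le> v ^ M * \<bar>H N v\<bar>" if "r \<le> v"
    proof -
      have "\<bar>r - v\<bar> ^ M / fact M \<le> v ^ M / 1"
        using that r by (intro frac_le power_mono) auto
      then show ?thesis
        unfolding R'_def abs_mult abs_divide power_abs by (intro mult_right_mono) auto
    qed
    then show "ennreal \<bar>R' v\<bar> * indicator {r..2} v \<le> ennreal (v ^ M * \<bar>H N v\<bar>) * indicator {r..2} v"
      by (auto simp: ennreal_leI split: split_indicator)
  qed
  finally have 1: "ennreal \<bar>R 2 - R r\<bar> \<le> (\<integral>\<^sup>+v\<in>{r..2}. ennreal (v ^ M * \<bar>H N v\<bar>) \<partial>lborel)" .
  have Rr: "R r = H l r"
    unfolding R_def by (subst sum.atMost_shift) simp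
  have "\<bar>R 2\<bar> \<le> (\<Sum>i\<le>M. 2 ^ N * A)"
    unfolding R_def
  proof (rule order_trans[OF sum_abs], rule sum_mono)
    fix i assume i: "i \<in> {..M}"
    have "\<bar>r - 2\<bar> ^ i / fact i \<le> 2 ^ i / 1"
      using r by (intro frac_le power_mono) auto
    also have "\<dots> \<le> 2 ^ N" using i by (simp only: div_by_1) (intro power_increasing, auto simp: N)
    finally show "\<bar>(r - 2) ^ i / fact i * H (l + i) 2\<bar> \<le> 2 ^ N * A"
      unfolding abs_mult abs_divide power_abs using i A by (intro mult_mono) (auto simp: N)
  qed
  also have "\<dots> \<le> real N * 2 ^ N * A"
    using A by (simp add: N mult_right_mono)
  finally have 2: "\<bar>R 2\<bar> \<le> real N * 2 ^ N * A" .
  have "ennreal \<bar>H l r\<bar> \<le> ennreal (\<bar>R 2\<bar> + \<bar>R 2 - R r\<bar>)"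
    unfolding Rr[symmetric] by (intro ennreal_leI) linarith
  also have "\<dots> = ennreal \<bar>R 2\<bar> + ennreal \<bar>R 2 - R r\<bar>" by simp
  finally show ?thesis
    using 1 2 unfolding M_def[symmetric] by (meson add_mono ennreal_leI order_trans)
qed

lemma sum_atMost_const_ennreal:
  assumes "0 \<le> x"
  shows "(\<Sum>l\<le>k. ennreal x + Z) = ennreal (real (Suc k) * x) + ennreal (real (Suc k)) * Z"
proof -
  have "(\<Sum>l\<le>k. ennreal x + Z) = ennreal (real (Suc k)) * (ennreal x + Z)"
    by (simp only: sum_constant card_atMost ennreal_of_nat_eq_real_of_nat)
  then show ?thesis using assms by (simp only: distrib_left ennreal_mult of_nat_0_le_iff)
qed

lemma nn_integral_powr_exp:
  assumes "0 < b" "b \<le> 1"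
  shows "(\<integral>\<^sup>+s\<in>{0<..}. ennreal (s powr (b - 1) * exp (- s)) \<partial>lborel) \<le> ennreal (1 / b + 1)"
proof -
  have pw: "ennreal (s powr (b - 1) * exp (- s)) * indicator {0<..} s \<le>
      ennreal (s powr (b - 1)) * indicator {0..1} s + ennreal (exp (- 1 * s)) * indicator {0..} s" for s
  proof (cases "0 < s")
    case True
    show ?thesis
    proof (cases "s \<le> 1")
      case s: True
      have "s powr (b - 1) * exp (- s) \<le> s powr (b - 1) * 1"
        using True by (intro mult_left_mono) auto
      then show ?thesis using True s by (simp add: add_increasing2 ennreal_leI)
    next
      case s: False
      have "s powr (b - 1) \<le> s powr 0" using s assms by (intro powr_mono) auto
      then have "s powr (b - 1) * exp (- s) \<le> 1 * exp (- s)"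
        using True by (intro mult_right_mono) auto
      then show ?thesis using True s by (simp add: add_increasing ennreal_leI)
    qed
  qed auto
  have "(\<integral>\<^sup>+s\<in>{0<..}. ennreal (s powr (b - 1) * exp (- s)) \<partial>lborel) \<le>
    (\<integral>\<^sup>+s. ennreal (s powr (b - 1)) * indicator {0..1} s + ennreal (exp (- 1 * s)) * indicator {0..} s \<partial>lborel)"
    by (intro nn_integral_mono pw)
  also have "\<dots> = ennreal (1 powr b / b) + ennreal (exp (- 1 * 0) / 1)"
    using assms nn_integral_powr_0[of b 1]
      nn_integral_of_has_integral[OF has_integral_exp_minus_to_infinity[of 1 0]]
    by (subst nn_integral_add) auto
  also have "\<dots> = ennreal (1 / b + 1)" using assms by simp
  finally show ?thesis .
qed

text \<open>Cut off at 2, the base point of the Taylor expansions. The cut also lets the dyadic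
  blocks be indexed by natural numbers, starting from the largest one.\<close>

definition local_square :: "real \<Rightarrow> real \<Rightarrow> nat \<Rightarrow> (nat \<Rightarrow> real \<Rightarrow> real) \<Rightarrow> ennreal" where
  "local_square \<alpha> q N H =
     (\<integral>\<^sup>+t\<in>{0<..2}. epowr (ennreal (t powr (real N - \<alpha>) * \<bar>H N t\<bar>)) q * ennreal (1 / t) \<partial>lborel)"

text \<open>\<open>H j\<close> stands for the j-th time derivative of P_t f at a fixed point, and A
  for a multiple of the maximal function there. The decay \<open>A / v ^ j\<close> is the
  scale-invariant one; it is imposed only away from 0.\<close>

definition smooth_decay :: "nat \<Rightarrow> real \<Rightarrow> (nat \<Rightarrow> real \<Rightarrow> real) \<Rightarrow> bool" where
  "smooth_decay N A H \<longleftrightarrow> 0 \<le> A \<and> (\<forall>j. H j \<in> borel_measurable borel) \<and>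
     (\<forall>j v. 0 < v \<longrightarrow> (H j has_real_derivative H (Suc j) v) (at v)) \<and>
     (\<forall>j v. j \<le> N \<longrightarrow> 1 \<le> v \<longrightarrow> \<bar>H j v\<bar> \<le> A / v ^ j)"

lemma smooth_decayD:
  assumes "smooth_decay N A H"
  shows "0 \<le> A" "\<And>j. H j \<in> borel_measurable borel"
    "\<And>j v. 0 < v \<Longrightarrow> (H j has_real_derivative H (Suc j) v) (at v)"
    "\<And>j v. j \<le> N \<Longrightarrow> 1 \<le> v \<Longrightarrow> \<bar>H j v\<bar> \<le> A / v ^ j"
    "\<And>j v. j \<le> N \<Longrightarrow> 1 \<le> v \<Longrightarrow> \<bar>H j v\<bar> \<le> A"
proof -
  fix j :: nat and v :: real
  assume j: "j \<le> N" "1 \<le> v"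
  have "\<bar>H j v\<bar> \<le> A / v ^ j" using assms j by (auto simp: smooth_decay_def)
  also have "\<dots> \<le> A / 1" using assms j by (intro divide_left_mono) (auto simp: smooth_decay_def)
  finally show "\<bar>H j v\<bar> \<le> A" by simp
qed (use assms in \<open>auto simp: smooth_decay_def\<close>)

text \<open>The lower derivatives are integrals of \<open>H N\<close> over (s, 2), up to a multiple
  of A. Exchanging the integrals leaves the integral over (0, 2] of v^(\<delta>-1) times
  v^(N-\<alpha>) \<bar>H N v\<bar>, with \<delta> = \<alpha> - \<beta> > 0, and this weight has
  finite mass.\<close>

lemma bessel_pointwise_bound:
  fixes \<alpha> \<beta> q :: real and k n :: nat
  assumes "\<beta> < \<alpha>" "1 \<le> q" "real k - 1 \<le> \<beta>" "\<beta> < real k" "1 \<le> n"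
  obtains C where "0 < C" "\<And>A H. smooth_decay (k + n) A H \<Longrightarrow>
    epowr (\<integral>\<^sup>+s\<in>{0<..}. ennreal (s powr (real k - \<beta> - 1) * exp (- s) * (\<Sum>l\<le>k. \<bar>H l s\<bar>)) \<partial>lborel) q
    \<le> ennreal C * (ennreal (A powr q) + local_square \<alpha> q (k + n) H)"
proof -
  define N where "N = k + n"
  define m where "m = n - 1"
  then have n: "n = Suc m" using assms by simp
  define b where "b = real k - \<beta>"
  define \<delta> where "\<delta> = \<alpha> - \<beta>"
  have b: "0 < b" "b \<le> 1" and \<delta>: "0 < \<delta>" using assms by (auto simp: b_def \<delta>_def)
  define c1 where "c1 = real (Suc k) * (real N * 2 ^ N + 1)"
  define c2 where "c2 = real (Suc k) * 2 ^ k"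
  define M where "M = 2 powr \<delta> / \<delta>"
  define D where "D = 2 * (2 * M) powr (q - 1)"
  have pos: "0 < c1" "0 < c2" "0 < M" "0 < D" using \<delta> by (auto simp: c1_def c2_def M_def D_def add_nonneg_pos)
  define c3 where "c3 = 2 powr q * ((c1 * (1 / b + 1)) powr q + (c2 / b) powr q * D * 2 powr \<delta>)"
  have "0 < c3" unfolding c3_def using pos b by (intro mult_pos_pos add_nonneg_pos) auto
  show ?thesis
  proof (rule that[OF \<open>0 < c3\<close>])
    fix A H assume sd: "smooth_decay (k + n) A H"
    note A = smooth_decayD(1)[OF sd] and [measurable] = smooth_decayD(2)[OF sd]
      and H = smooth_decayD(3)[OF sd] and dec = smooth_decayD(5)[OF sd, folded N_def]
    let ?S = "\<lambda>s. \<Sum>l\<le>k. \<bar>H l s\<bar>"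
    let ?h = "\<lambda>v. ennreal (v ^ m * \<bar>H N v\<bar>)"
    have S: "ennreal (?S s) \<le> ennreal (c1 * A) + ennreal c2 * (\<integral>\<^sup>+v\<in>{s..2}. ?h v \<partial>lborel)" if s: "0 < s" for s
    proof -
      \<comment> \<open>The summand 1 in the constant serves s > 2, where the decay alone gives
        A.\<close>
      have "ennreal \<bar>H l s\<bar> \<le> ennreal ((real N * 2 ^ N + 1) * A) + ennreal (2 ^ k) * (\<integral>\<^sup>+v\<in>{s..2}. ?h v \<partial>lborel)"
        if l: "l \<in> {..k}" for l
      proof (cases "s \<le> 2")
        case True
        have "ennreal \<bar>H l s\<bar> \<le> ennreal (real N * 2 ^ N * A)
          + (\<integral>\<^sup>+v\<in>{s..2}. ennreal (v ^ (N - l - 1) * \<bar>H N v\<bar>) \<partial>lborel)"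
          using l A s True H assms by (intro lower_order_bound dec) (auto simp: N_def)
        also have "\<dots> \<le> ennreal ((real N * 2 ^ N + 1) * A) + (\<integral>\<^sup>+v. ennreal (2 ^ k) * (?h v * indicator {s..2} v) \<partial>lborel)"
        proof (intro add_mono nn_integral_mono ennreal_leI)
          fix v :: real
          have "v ^ (N - l - 1) * \<bar>H N v\<bar> \<le> 2 ^ k * (v ^ m * \<bar>H N v\<bar>)" if "s \<le> v" "v \<le> 2"
          proof -
            have "v ^ (N - l - 1) = v ^ (k - l) * v ^ m"
              using l by (simp add: N_def n flip: power_add)
            also have "v ^ (k - l) \<le> 2 ^ (k - l)" using that s by (intro power_mono) auto
            also have "(2::real) ^ (k - l) \<le> 2 ^ k" by (intro power_increasing) auto
            finally have "v ^ (N - l - 1) \<le> 2 ^ k * v ^ m" using that s by (simp add: mult_right_mono)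
            then show ?thesis by (simp add: mult_right_mono flip: mult.assoc)
          qed
          then show "ennreal (v ^ (N - l - 1) * \<bar>H N v\<bar>) * indicator {s..2} v \<le> ennreal (2 ^ k) * (?h v * indicator {s..2} v)"
            by (auto split: split_indicator simp: ennreal_leI simp flip: ennreal_mult')
        qed (use A in \<open>auto simp: algebra_simps\<close>)
        also have "\<dots> = ennreal ((real N * 2 ^ N + 1) * A) + ennreal (2 ^ k) * (\<integral>\<^sup>+v\<in>{s..2}. ?h v \<partial>lborel)"
          by (simp add: nn_integral_cmult)
        finally show ?thesis .
      next
        case False
        have "ennreal \<bar>H l s\<bar> \<le> ennreal ((real N * 2 ^ N + 1) * A)"
          using dec[of l s] l A False mult_right_mono[of 1 "real N * 2 ^ N + 1" A]
          by (intro ennreal_leI) (auto simp: N_def)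
        then show ?thesis by (rule order_trans) simp
      qed
      then have "(\<Sum>l\<le>k. ennreal \<bar>H l s\<bar>) \<le> (\<Sum>l\<le>k. ennreal ((real N * 2 ^ N + 1) * A) + ennreal (2 ^ k) * (\<integral>\<^sup>+v\<in>{s..2}. ?h v \<partial>lborel))"
        by (rule sum_mono)
      also have "\<dots> = ennreal (c1 * A) + ennreal c2 * (\<integral>\<^sup>+v\<in>{s..2}. ?h v \<partial>lborel)"
        using A by (subst sum_atMost_const_ennreal) (auto simp: c1_def c2_def ennreal_mult mult.assoc simp del: of_nat_Suc)
      finally show ?thesis by (subst sum_ennreal[symmetric]) auto
    qed
    let ?I1 = "\<integral>\<^sup>+s\<in>{0<..}. ennreal (s powr (b - 1) * exp (- s)) \<partial>lborel"
    let ?I2 = "\<integral>\<^sup>+s\<in>{0<..}. ennreal (s powr (b - 1)) * (\<integral>\<^sup>+v\<in>{s..2}. ?h v \<partial>lborel) \<partial>lborel"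
    have [measurable]: "(\<lambda>s. \<integral>\<^sup>+v\<in>{s..2}. ?h v \<partial>lborel) \<in> borel_measurable borel"
      unfolding atLeastAtMost_def atLeast_def atMost_def by measurable
    have "(\<integral>\<^sup>+s\<in>{0<..}. ennreal (s powr (b - 1) * exp (- s) * ?S s) \<partial>lborel)
      \<le> (\<integral>\<^sup>+s. ennreal (c1 * A) * (ennreal (s powr (b - 1) * exp (- s)) * indicator {0<..} s)
          + ennreal c2 * (ennreal (s powr (b - 1)) * (\<integral>\<^sup>+v\<in>{s..2}. ?h v \<partial>lborel) * indicator {0<..} s) \<partial>lborel)"
    proof (intro nn_integral_mono)
      fix s :: real
      show "ennreal (s powr (b - 1) * exp (- s) * ?S s) * indicator {0<..} s
        \<le> ennreal (c1 * A) * (ennreal (s powr (b - 1) * exp (- s)) * indicator {0<..} s)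
          + ennreal c2 * (ennreal (s powr (b - 1)) * (\<integral>\<^sup>+v\<in>{s..2}. ?h v \<partial>lborel) * indicator {0<..} s)"
      proof (cases "0 < s")
        case True
        have "ennreal (s powr (b - 1) * exp (- s) * ?S s) = ennreal (s powr (b - 1) * exp (- s)) * ennreal (?S s)"
          by (intro ennreal_mult) (auto intro: sum_nonneg)
        also have "\<dots> \<le> ennreal (s powr (b - 1) * exp (- s)) * (ennreal (c1 * A) + ennreal c2 * (\<integral>\<^sup>+v\<in>{s..2}. ?h v \<partial>lborel))"
          by (intro mult_left_mono S True) auto
        also have "\<dots> = ennreal (c1 * A) * ennreal (s powr (b - 1) * exp (- s))
           + ennreal c2 * (ennreal (s powr (b - 1) * exp (- s)) * (\<integral>\<^sup>+v\<in>{s..2}. ?h v \<partial>lborel))"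
          by (simp only: distrib_left mult.commute mult.left_commute)
        also have "\<dots> \<le> ennreal (c1 * A) * ennreal (s powr (b - 1) * exp (- s))
           + ennreal c2 * (ennreal (s powr (b - 1)) * (\<integral>\<^sup>+v\<in>{s..2}. ?h v \<partial>lborel))"
        proof (intro add_left_mono mult_left_mono mult_right_mono ennreal_leI)
          show "s powr (b - 1) * exp (- s) \<le> s powr (b - 1)" using True by (simp add: mult_left_le)
        qed auto
        finally show ?thesis using True by simp
      qed simp
    qed
    also have "\<dots> = ennreal (c1 * A) * ?I1 + ennreal c2 * ?I2"
      by (subst nn_integral_add) (auto simp: nn_integral_cmult)
    also have "?I1 \<le> ennreal (1 / b + 1)" by (rule nn_integral_powr_exp) (use b in auto)
    also have "?I2 = (\<integral>\<^sup>+s. \<integral>\<^sup>+v. ennreal (s powr (b - 1)) * indicator {0<..} s * (?h v * indicator {s..2} v) \<partial>lborel \<partial>lborel)"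
      by (auto intro!: nn_integral_cong simp: nn_integral_cmult[symmetric] mult_ac)
    also have "\<dots> = (\<integral>\<^sup>+v. \<integral>\<^sup>+s. ennreal (s powr (b - 1)) * indicator {0<..} s * (?h v * indicator {s..2} v) \<partial>lborel \<partial>lborel)"
      unfolding atLeastAtMost_def atLeast_def atMost_def
      by (rule lborel_pair.Fubini') measurable
    \<comment> \<open>The inner integral of s^(b-1) over (0, v) is v^b / b, and the exponents match:
      b + m = (\<delta> - 1) + (N - \<alpha>).\<close>
    also have "\<dots> \<le> (\<integral>\<^sup>+v. ennreal (1 / b) * (ennreal (v powr (\<delta> - 1)) * indicator {0<..2} v * ennreal (v powr (real N - \<alpha>) * \<bar>H N v\<bar>)) \<partial>lborel)"
    proof (intro nn_integral_mono)
      fix v :: real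
      show "(\<integral>\<^sup>+s. ennreal (s powr (b - 1)) * indicator {0<..} s * (?h v * indicator {s..2} v) \<partial>lborel)
        \<le> ennreal (1 / b) * (ennreal (v powr (\<delta> - 1)) * indicator {0<..2} v * ennreal (v powr (real N - \<alpha>) * \<bar>H N v\<bar>))"
      proof (cases "0 < v \<and> v \<le> 2")
        case True
        have "(\<integral>\<^sup>+s. ennreal (s powr (b - 1)) * indicator {0<..} s * (?h v * indicator {s..2} v) \<partial>lborel)
          \<le> (\<integral>\<^sup>+s. (ennreal (s powr (b - 1)) * indicator {0..v} s) * ?h v \<partial>lborel)"
          using True by (intro nn_integral_mono) (auto split: split_indicator)
        also have "\<dots> = ennreal (v powr b / b) * ?h v"
          using nn_integral_powr_0[of b v] b True by (simp add: nn_integral_multc)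
        also have "\<dots> = ennreal (1 / b * (v powr b * v ^ m) * \<bar>H N v\<bar>)"
          using b True by (simp flip: ennreal_mult)
        also have "v powr b * v ^ m = v powr (\<delta> - 1) * v powr (real N - \<alpha>)"
        proof -
          have "v ^ m = v powr real m"
            using True by (simp add: powr_realpow)
          then show ?thesis by (simp add: N_def n \<delta>_def b_def flip: powr_add) (simp add: algebra_simps)
        qed
        finally show ?thesis using True b by (simp add: mult.assoc flip: ennreal_mult)
      next
        case False
        then have "(\<integral>\<^sup>+s. ennreal (s powr (b - 1)) * indicator {0<..} s * (?h v * indicator {s..2} v) \<partial>lborel)
            = (\<integral>\<^sup>+s. 0 \<partial>(lborel :: real measure))"
          by (intro nn_integral_cong) (auto split: split_indicator)
        then show ?thesis by (simp only: nn_integral_const mult_zero_left zero_le)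
      qed
    qed
    also have "\<dots> = ennreal (1 / b) * (\<integral>\<^sup>+v. ennreal (v powr (\<delta> - 1)) * indicator {0<..2} v * ennreal (v powr (real N - \<alpha>) * \<bar>H N v\<bar>) \<partial>lborel)"
      by (simp add: nn_integral_cmult)
    finally have 1: "(\<integral>\<^sup>+s\<in>{0<..}. ennreal (s powr (b - 1) * exp (- s) * ?S s) \<partial>lborel)
      \<le> ennreal (c1 * A) * ennreal (1 / b + 1) + ennreal c2 * (ennreal (1 / b) *
        (\<integral>\<^sup>+v. ennreal (v powr (\<delta> - 1)) * indicator {0<..2} v * ennreal (v powr (real N - \<alpha>) * \<bar>H N v\<bar>) \<partial>lborel))"
      (is "_ \<le> _ + _ * (_ * ?J)") by (simp add: add_mono mult_left_mono)
    \<comment> \<open>Jensen's inequality for the weight v^(\<delta>-1), of mass at most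
      \<open>M\<close> on (0, 2]; passing from it to dv / v costs v^\<delta> \<le>
      2^\<delta>.\<close>
    have 2: "epowr ?J q \<le> ennreal D * (ennreal (2 powr \<delta>) * local_square \<alpha> q N H)"
    proof -
      have "epowr ?J q \<le> ennreal D * (\<integral>\<^sup>+v. ennreal (v powr (\<delta> - 1)) * indicator {0<..2} v * epowr (ennreal (v powr (real N - \<alpha>) * \<bar>H N v\<bar>)) q \<partial>lborel)"
        unfolding D_def
      proof (intro jensen_crude)
        have "(\<integral>\<^sup>+x. ennreal (x powr (\<delta> - 1)) * indicator {0<..2} x \<partial>lborel)
          \<le> (\<integral>\<^sup>+x. ennreal (x powr (\<delta> - 1)) * indicator {0..2} x \<partial>lborel)"
          by (intro nn_integral_mono) (auto split: split_indicator)
        also have "\<dots> = ennreal M" using nn_integral_powr_0[of \<delta> 2] \<delta> by (simp add: M_def)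
        finally show "(\<integral>\<^sup>+x. ennreal (x powr (\<delta> - 1)) * indicator {0<..2} x \<partial>lborel) \<le> ennreal M" .
      qed (use pos assms in auto)
      also have "(\<integral>\<^sup>+v. ennreal (v powr (\<delta> - 1)) * indicator {0<..2} v * epowr (ennreal (v powr (real N - \<alpha>) * \<bar>H N v\<bar>)) q \<partial>lborel)
        \<le> (\<integral>\<^sup>+v. ennreal (2 powr \<delta>) * (epowr (ennreal (v powr (real N - \<alpha>) * \<bar>H N v\<bar>)) q * ennreal (1 / v) * indicator {0<..2} v) \<partial>lborel)"
      proof (intro nn_integral_mono)
        fix v :: real
        show "ennreal (v powr (\<delta> - 1)) * indicator {0<..2} v * epowr (ennreal (v powr (real N - \<alpha>) * \<bar>H N v\<bar>)) q
          \<le> ennreal (2 powr \<delta>) * (epowr (ennreal (v powr (real N - \<alpha>) * \<bar>H N v\<bar>)) q * ennreal (1 / v) * indicator {0<..2} v)"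
        proof (cases "0 < v \<and> v \<le> 2")
          case True
          then have "v powr (\<delta> - 1) \<le> 2 powr \<delta> * (1 / v)"
            using \<delta> by (simp add: powr_diff divide_right_mono powr_mono2)
          then have "ennreal (v powr (\<delta> - 1)) \<le> ennreal (2 powr \<delta>) * ennreal (1 / v)"
            using True by (subst ennreal_mult[symmetric]) (auto intro: ennreal_leI)
          then have "ennreal (v powr (\<delta> - 1)) * epowr (ennreal (v powr (real N - \<alpha>) * \<bar>H N v\<bar>)) q
            \<le> ennreal (2 powr \<delta>) * ennreal (1 / v) * epowr (ennreal (v powr (real N - \<alpha>) * \<bar>H N v\<bar>)) q"
            by (rule mult_right_mono) simp
          then show ?thesis using True by (simp add: mult_ac)
        qed auto
      qed
      also have "\<dots> = ennreal (2 powr \<delta>) * local_square \<alpha> q N H"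
        unfolding local_square_def by (simp add: nn_integral_cmult)
      finally show ?thesis by (simp add: mult_left_mono)
    qed
    have "epowr (\<integral>\<^sup>+s\<in>{0<..}. ennreal (s powr (b - 1) * exp (- s) * ?S s) \<partial>lborel) q
      \<le> epowr (ennreal (c1 * A) * ennreal (1 / b + 1) + ennreal c2 * (ennreal (1 / b) * ?J)) q"
      using assms by (intro epowr_mono 1) auto
    also have "\<dots> \<le> ennreal (2 powr q) * (epowr (ennreal (c1 * A) * ennreal (1 / b + 1)) q + epowr (ennreal c2 * (ennreal (1 / b) * ?J)) q)"
      using assms by (intro epowr_add_le) auto
    also have "epowr (ennreal (c1 * A) * ennreal (1 / b + 1)) q = ennreal ((c1 * (1 / b + 1)) powr q) * ennreal (A powr q)"
      using pos A b by (subst ennreal_mult[symmetric], simp, simp)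
        (subst epowr_ennreal, simp, simp add: powr_mult ennreal_mult mult_ac del: ennreal_plus)
    also have "epowr (ennreal c2 * (ennreal (1 / b) * ?J)) q = ennreal ((c2 / b) powr q) * epowr ?J q"
      using pos b by (simp add: epowr_mult mult.assoc[symmetric] epowr_ennreal powr_mult flip: ennreal_mult)
    also have "\<dots> \<le> ennreal ((c2 / b) powr q) * (ennreal D * (ennreal (2 powr \<delta>) * local_square \<alpha> q N H))"
      by (intro mult_left_mono 2) auto
    also have "\<dots> = ennreal ((c2 / b) powr q * D * 2 powr \<delta>) * local_square \<alpha> q N H"
      using pos by (simp add: ennreal_mult mult.assoc)
    also have "ennreal (2 powr q) * (ennreal ((c1 * (1 / b + 1)) powr q) * ennreal (A powr q) + ennreal ((c2 / b) powr q * D * 2 powr \<delta>) * local_square \<alpha> q N H)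
      \<le> ennreal (2 powr q) * (ennreal ((c1 * (1 / b + 1)) powr q + (c2 / b) powr q * D * 2 powr \<delta>) * (ennreal (A powr q) + local_square \<alpha> q N H))"
      unfolding distrib_left using pos by (intro add_mono mult_left_mono mult_right_mono ennreal_leI) auto
    also have "\<dots> = ennreal c3 * (ennreal (A powr q) + local_square \<alpha> q N H)"
      unfolding c3_def using pos by (subst ennreal_mult[of "2 powr q"]) (auto simp: mult.assoc)
    finally show "epowr (\<integral>\<^sup>+s\<in>{0<..}. ennreal (s powr (real k - \<beta> - 1) * exp (- s) * ?S s) \<partial>lborel) q
      \<le> ennreal c3 * (ennreal (A powr q) + local_square \<alpha> q (k + n) H)"
      by (simp add: N_def b_def add_left_mono mult_left_mono)
  qed
qed

text \<open>For t > 1 the decay of the derivatives of order at least n gives t^(-n), and t^(a-n) =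
  t^(-\<delta>) lies in L^q(dt / t) at infinity. For t \<le> 1 every order is reduced to
  \<open>H N\<close>, which leads to a Weyl integral with exponent b - 1. Multiplied by t^a it is
  the Hardy operator applied to v^(N-\<alpha>) \<bar>H N v\<bar>, since a + b = N -
  \<alpha>.\<close>

lemma bessel_square_bound:
  fixes \<alpha> \<beta> q :: real and k n :: nat
  assumes "\<beta> < \<alpha>" "1 \<le> q" "real k - 1 \<le> \<beta>" "\<beta> < real k" "1 \<le> n" "\<alpha> - \<beta> < real n"
  obtains C where "0 < C" "\<And>A H. smooth_decay (k + n) A H \<Longrightarrow>
    (\<integral>\<^sup>+t\<in>{0<..}. epowr (ennreal (t powr (real n - (\<alpha> - \<beta>))) *
        (\<integral>\<^sup>+s\<in>{0<..}. ennreal (s powr (real k - \<beta> - 1) * exp (- s) * (\<Sum>l\<le>k. \<bar>H (l + n) (t + s)\<bar>)) \<partial>lborel)) q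
      * ennreal (1 / t) \<partial>lborel)
    \<le> ennreal C * (ennreal (A powr q) + local_square \<alpha> q (k + n) H)"
proof -
  define N where "N = k + n"
  define b where "b = real k - \<beta>"
  define a where "a = real n - (\<alpha> - \<beta>)"
  define \<delta> where "\<delta> = \<alpha> - \<beta>"
  have b: "0 < b" "b \<le> 1" and \<delta>: "0 < \<delta>" and a: "0 < a" using assms by (auto simp: b_def \<delta>_def a_def)
  obtain K where K: "0 < K" "\<And>G. G \<in> borel_measurable borel \<Longrightarrow>
    (\<integral>\<^sup>+t\<in>{0<..}. epowr (\<integral>\<^sup>+s\<in>{t<..}. ennreal (hardy_kernel a b t s) * G s \<partial>lborel) q * ennreal (1 / t) \<partial>lborel)
    \<le> ennreal K * (\<integral>\<^sup>+s\<in>{0<..}. epowr (G s) q * ennreal (1 / s) \<partial>lborel)"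
    by (rule hardy_inequality[OF a b(1) assms(2)]) (rule that)
  define c1 where "c1 = real (Suc k) * (real N * 2 ^ N + 1)"
  define c2 where "c2 = real (Suc k) * 2 ^ N"
  define c3 where "c3 = c1 * (1 / b + 1)"
  define c4 where "c4 = 2 * c2 / b + real (Suc k)"
  have c12: "0 < c1" "0 < c2"
    unfolding c1_def c2_def by (intro mult_pos_pos add_nonneg_pos; simp)+
  have c34: "0 < c3" "0 < c4"
    unfolding c3_def c4_def using c12 b by (intro mult_pos_pos add_pos_pos divide_pos_pos; simp)+
  note pos = c12 c34
  define c5 where "c5 = c3 powr q * (1 / (a * q) + 1 / (\<delta> * q))"
  define C where "C = 2 powr q * (c5 + c4 powr q * K)"
  have c5: "0 < c5" unfolding c5_def using pos a \<delta> assms by (intro mult_pos_pos add_pos_pos) auto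
  have "0 < C" unfolding C_def using c5 pos K(1) by (intro mult_pos_pos add_pos_pos) auto
  show ?thesis
  proof (rule that[OF \<open>0 < C\<close>])
    fix A H assume sd: "smooth_decay (k + n) A H"
    note A = smooth_decayD(1)[OF sd] and [measurable] = smooth_decayD(2)[OF sd]
      and H = smooth_decayD(3)[OF sd] and dec = smooth_decayD(5)[OF sd, folded N_def]
      and dec' = smooth_decayD(4)[OF sd, folded N_def]
    let ?W = "\<lambda>t. \<integral>\<^sup>+s\<in>{0<..}. ennreal (s powr (b - 1) * exp (- s) * (\<Sum>l\<le>k. \<bar>H (l + n) (t + s)\<bar>)) \<partial>lborel"
    let ?h = "\<lambda>v. ennreal \<bar>H N v\<bar> * indicator {0<..2} v"
    define G where "G v = ennreal (v powr (real N - \<alpha>) * \<bar>H N v\<bar>) * indicator {0<..2} v" for v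
    have [measurable]: "G \<in> borel_measurable borel" unfolding G_def by measurable
    define T where "T t = (\<integral>\<^sup>+s\<in>{t<..}. ennreal (hardy_kernel a b t s) * G s \<partial>lborel)" for t
    have [measurable]: "T \<in> borel_measurable borel"
      unfolding T_def greaterThan_def by measurable
    let ?g = "\<lambda>s. ennreal (s powr (b - 1) * exp (- s)) * indicator {0<..} s"
    have g: "(\<integral>\<^sup>+s. ?g s \<partial>lborel) \<le> ennreal (1 / b + 1)"
      by (rule nn_integral_powr_exp) (use b in auto)
    \<comment> \<open>The factor exp (-s) makes s^(b-1) integrable; dropping s in the decay of the
      derivatives leaves t^(-n).\<close>
    have W_large: "?W t \<le> ennreal (c3 * A * t powr (- real n))" if t: "1 < t" for t
    proof -
      have "?W t \<le> (\<integral>\<^sup>+s. ?g s * ennreal (real (Suc k) * A * t powr (- real n)) \<partial>lborel)"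
      proof (intro nn_integral_mono)
        fix s :: real
        show "ennreal (s powr (b - 1) * exp (- s) * (\<Sum>l\<le>k. \<bar>H (l + n) (t + s)\<bar>)) * indicator {0<..} s
          \<le> ?g s * ennreal (real (Suc k) * A * t powr (- real n))"
        proof (cases "0 < s")
          case True
          have "\<bar>H (l + n) (t + s)\<bar> \<le> A * t powr (- real n)" if "l \<in> {..k}" for l
          proof -
            have "\<bar>H (l + n) (t + s)\<bar> \<le> A / (t + s) ^ (l + n)"
              using that True t by (intro dec') (auto simp: N_def)
            also have "\<dots> \<le> A / t ^ n"
            proof (intro divide_left_mono)
              have "t ^ n \<le> (t + s) ^ n" using t True by (intro power_mono) auto
              also have "\<dots> \<le> (t + s) ^ (l + n)" using t True by (intro power_increasing) auto
              finally show "t ^ n \<le> (t + s) ^ (l + n)" .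
            qed (use A t True in auto)
            finally show ?thesis using t by (simp add: powr_minus powr_realpow divide_inverse)
          qed
          then have "(\<Sum>l\<le>k. \<bar>H (l + n) (t + s)\<bar>) \<le> (\<Sum>l\<le>k. A * t powr (- real n))"
            by (rule sum_mono)
          also have "\<dots> = real (Suc k) * A * t powr (- real n)" by simp
          finally have "s powr (b - 1) * exp (- s) * (\<Sum>l\<le>k. \<bar>H (l + n) (t + s)\<bar>)
            \<le> s powr (b - 1) * exp (- s) * (real (Suc k) * A * t powr (- real n))"
            by (intro mult_left_mono) auto
          then show ?thesis
            using A True by (subst mult.right_neutral[symmetric]) (auto simp: ennreal_leI simp flip: ennreal_mult)
        qed simp
      qed
      also have "\<dots> = (\<integral>\<^sup>+s. ?g s \<partial>lborel) * ennreal (real (Suc k) * A * t powr (- real n))"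
        by (simp add: nn_integral_multc)
      also have "\<dots> \<le> ennreal (1 / b + 1) * ennreal (real (Suc k) * A * t powr (- real n))"
        by (intro mult_right_mono g) auto
      also have "\<dots> = ennreal ((1 / b + 1) * (real (Suc k) * A * t powr (- real n)))"
        using A b by (subst ennreal_mult) auto
      also have "\<dots> \<le> ennreal (c3 * A * t powr (- real n))"
      proof (rule ennreal_leI)
        have "real (Suc k) * 1 \<le> c1" unfolding c1_def by (intro mult_left_mono) auto
        then have "(1 / b + 1) * real (Suc k) * (A * t powr (- real n)) \<le> (1 / b + 1) * c1 * (A * t powr (- real n))"
          using A b by (intro mult_right_mono mult_left_mono) auto
        then show "(1 / b + 1) * (real (Suc k) * A * t powr (- real n)) \<le> c3 * A * t powr (- real n)"
          by (simp add: c3_def mult_ac)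
      qed
      finally show ?thesis .
    qed
    have S: "ennreal (\<Sum>l\<le>k. \<bar>H (l + n) r\<bar>) \<le> ennreal (c1 * A) + (ennreal c2 * (\<integral>\<^sup>+v\<in>{r..}. ?h v \<partial>lborel) + ennreal (real (Suc k)) * ?h r)"
      if r: "0 < r" for r
    proof -
      \<comment> \<open>For l = k the derivative is \<open>H N\<close> itself and there is nothing
        to expand, which is the origin of the extra term \<open>?h r\<close>.\<close>
      have "ennreal \<bar>H (l + n) r\<bar> \<le> ennreal ((real N * 2 ^ N + 1) * A) + (ennreal (2 ^ N) * (\<integral>\<^sup>+v\<in>{r..}. ?h v \<partial>lborel) + ?h r)"
        if l: "l \<in> {..k}" for l
      proof (cases "r \<le> 2")
        case True
        show ?thesis
        proof (cases "l = k")
          case True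
          then show ?thesis using \<open>r \<le> 2\<close> r by (simp add: N_def add_increasing)
        next
          case False
          have "ennreal \<bar>H (l + n) r\<bar> \<le> ennreal (real N * 2 ^ N * A)
            + (\<integral>\<^sup>+v\<in>{r..2}. ennreal (v ^ (N - (l + n) - 1) * \<bar>H N v\<bar>) \<partial>lborel)"
            using l A r True H assms False by (intro lower_order_bound dec) (auto simp: N_def)
          also have "\<dots> \<le> ennreal ((real N * 2 ^ N + 1) * A) + (\<integral>\<^sup>+v. ennreal (2 ^ N) * (?h v * indicator {r..} v) \<partial>lborel)"
          proof (intro add_mono nn_integral_mono ennreal_leI)
            fix v :: real
            have "v ^ (N - (l + n) - 1) * \<bar>H N v\<bar> \<le> 2 ^ N * \<bar>H N v\<bar>" if "r \<le> v" "v \<le> 2"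
            proof -
              have "v ^ (N - (l + n) - 1) \<le> 2 ^ (N - (l + n) - 1)" using that r by (intro power_mono) auto
              also have "(2::real) ^ (N - (l + n) - 1) \<le> 2 ^ N" by (intro power_increasing) auto
              finally show ?thesis by (simp add: mult_right_mono)
            qed
            then show "ennreal (v ^ (N - (l + n) - 1) * \<bar>H N v\<bar>) * indicator {r..2} v \<le> ennreal (2 ^ N) * (?h v * indicator {r..} v)"
              using r by (auto split: split_indicator simp: ennreal_leI simp flip: ennreal_mult')
          qed (use A in \<open>auto simp: algebra_simps\<close>)
          also have "\<dots> = ennreal ((real N * 2 ^ N + 1) * A) + ennreal (2 ^ N) * (\<integral>\<^sup>+v\<in>{r..}. ?h v \<partial>lborel)"
            by (simp add: nn_integral_cmult)
          finally show ?thesis by (simp add: add.assoc[symmetric] add_increasing2)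
        qed
      next
        case False
        have "ennreal \<bar>H (l + n) r\<bar> \<le> ennreal ((real N * 2 ^ N + 1) * A)"
          using dec[of "l + n" r] l A False mult_right_mono[of 1 "real N * 2 ^ N + 1" A]
          by (intro ennreal_leI) (auto simp: N_def)
        then show ?thesis by (rule order_trans) simp
      qed
      then have "(\<Sum>l\<le>k. ennreal \<bar>H (l + n) r\<bar>)
        \<le> (\<Sum>l\<le>k. ennreal ((real N * 2 ^ N + 1) * A) + (ennreal (2 ^ N) * (\<integral>\<^sup>+v\<in>{r..}. ?h v \<partial>lborel) + ?h r))"
        by (rule sum_mono)
      also have "\<dots> = ennreal (c1 * A) + (ennreal c2 * (\<integral>\<^sup>+v\<in>{r..}. ?h v \<partial>lborel) + ennreal (real (Suc k)) * ?h r)"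
      proof -
        have "ennreal c2 = ennreal (real (Suc k)) * ennreal (2 ^ N)"
          unfolding c2_def by (intro ennreal_mult) auto
        moreover have "0 \<le> (real N * 2 ^ N + 1) * A" using A by simp
        ultimately show ?thesis
          by (simp only: sum_atMost_const_ennreal c1_def distrib_left[where 'a=ennreal] mult.assoc)
      qed
      finally show ?thesis by (subst sum_ennreal[symmetric]) auto
    qed
    let ?g1 = "\<lambda>s. ennreal (s powr (b - 1)) * indicator {0<..} s"
    have [measurable]: "(\<lambda>s. \<integral>\<^sup>+v\<in>{t+s..}. ?h v \<partial>lborel) \<in> borel_measurable borel" for t
      unfolding atLeast_def by measurable
    have W_small: "?W t \<le> ennreal (c3 * A) + ennreal c4 * (\<integral>\<^sup>+v\<in>{t<..}. ennreal ((v - t) powr (b - 1)) * ?h v \<partial>lborel)"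
      if t: "0 < t" for t
    proof -
      let ?J = "\<integral>\<^sup>+v\<in>{t<..}. ennreal ((v - t) powr (b - 1)) * ?h v \<partial>lborel"
      have "?W t \<le> (\<integral>\<^sup>+s. ennreal (c1 * A) * ?g s
        + (ennreal c2 * (?g1 s * (\<integral>\<^sup>+v\<in>{t+s..}. ?h v \<partial>lborel)) + ennreal (real (Suc k)) * (?g1 s * ?h (t + s))) \<partial>lborel)"
      proof (intro nn_integral_mono)
        fix s :: real
        let ?X = "ennreal c2 * (\<integral>\<^sup>+v\<in>{t+s..}. ?h v \<partial>lborel) + ennreal (real (Suc k)) * ?h (t + s)"
        show "ennreal (s powr (b - 1) * exp (- s) * (\<Sum>l\<le>k. \<bar>H (l + n) (t + s)\<bar>)) * indicator {0<..} s
          \<le> ennreal (c1 * A) * ?g s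
            + (ennreal c2 * (?g1 s * (\<integral>\<^sup>+v\<in>{t+s..}. ?h v \<partial>lborel)) + ennreal (real (Suc k)) * (?g1 s * ?h (t + s)))"
        proof (cases "0 < s")
          case True
          have "ennreal (s powr (b - 1) * exp (- s) * (\<Sum>l\<le>k. \<bar>H (l + n) (t + s)\<bar>))
            = ennreal (s powr (b - 1) * exp (- s)) * ennreal (\<Sum>l\<le>k. \<bar>H (l + n) (t + s)\<bar>)"
            by (intro ennreal_mult) (auto intro: sum_nonneg)
          also have "\<dots> \<le> ennreal (s powr (b - 1) * exp (- s)) * (ennreal (c1 * A) + ?X)"
            using True t by (intro mult_left_mono S) auto
          also have "\<dots> = ennreal (c1 * A) * ennreal (s powr (b - 1) * exp (- s)) + ennreal (s powr (b - 1) * exp (- s)) * ?X"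
            by (subst distrib_left) (simp only: mult.commute[of "ennreal (c1 * A)"])
          also have "\<dots> \<le> ennreal (c1 * A) * ennreal (s powr (b - 1) * exp (- s)) + ennreal (s powr (b - 1)) * ?X"
          proof (intro add_left_mono mult_right_mono ennreal_leI)
            show "s powr (b - 1) * exp (- s) \<le> s powr (b - 1)" using True by (simp add: mult_left_le)
          qed auto
          finally show ?thesis using True by (simp add: distrib_left mult_ac)
        qed simp
      qed
      also have "\<dots> = ennreal (c1 * A) * (\<integral>\<^sup>+s. ?g s \<partial>lborel)
          + (ennreal c2 * (\<integral>\<^sup>+s. ?g1 s * (\<integral>\<^sup>+v\<in>{t+s..}. ?h v \<partial>lborel) \<partial>lborel)
            + ennreal (real (Suc k)) * (\<integral>\<^sup>+s. ?g1 s * ?h (t + s) \<partial>lborel))"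
        by (simp add: nn_integral_add nn_integral_cmult del: of_nat_Suc)
      also have "(\<integral>\<^sup>+s. ?g1 s * ?h (t + s) \<partial>lborel) = ?J"
        by (subst (2) nn_integral_real_affine[of _ 1 t])
          (auto intro!: nn_integral_cong simp: mult_ac split: split_indicator)
      also have "(\<integral>\<^sup>+s. ?g1 s * (\<integral>\<^sup>+v\<in>{t+s..}. ?h v \<partial>lborel) \<partial>lborel)
        = (\<integral>\<^sup>+s. \<integral>\<^sup>+v. ?g1 s * (?h v * indicator {t+s..} v) \<partial>lborel \<partial>lborel)"
        by (auto intro!: nn_integral_cong simp: nn_integral_cmult[symmetric])
      also have "\<dots> = (\<integral>\<^sup>+v. \<integral>\<^sup>+s. ?g1 s * (?h v * indicator {t+s..} v) \<partial>lborel \<partial>lborel)"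
        unfolding atLeast_def by (rule lborel_pair.Fubini') measurable
      also have "\<dots> \<le> (\<integral>\<^sup>+v. ennreal (2 / b) * (ennreal ((v - t) powr (b - 1)) * ?h v * indicator {t<..} v) \<partial>lborel)"
      proof (intro nn_integral_mono)
        fix v :: real
        show "(\<integral>\<^sup>+s. ?g1 s * (?h v * indicator {t+s..} v) \<partial>lborel)
          \<le> ennreal (2 / b) * (ennreal ((v - t) powr (b - 1)) * ?h v * indicator {t<..} v)"
        proof (cases "t < v \<and> v \<le> 2")
          case True
          have "(\<integral>\<^sup>+s. ?g1 s * (?h v * indicator {t+s..} v) \<partial>lborel)
            \<le> (\<integral>\<^sup>+s. (ennreal (s powr (b - 1)) * indicator {0..v - t} s) * ?h v \<partial>lborel)"
            using True by (intro nn_integral_mono) (auto split: split_indicator)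
          also have "\<dots> = ennreal ((v - t) powr b / b) * ?h v"
            using nn_integral_powr_0[of b "v - t"] b True by (simp add: nn_integral_multc)
          \<comment> \<open>The orders below N yield the smoother kernel (v - t)^b. Since v \<le> 2
            it is dominated by the kernel (v - t)^(b-1) that the top order yields.\<close>
          also have "\<dots> \<le> ennreal (2 / b * (v - t) powr (b - 1)) * ?h v"
          proof (intro mult_right_mono ennreal_leI)
            have "(v - t) powr b = (v - t) * (v - t) powr (b - 1)"
              using True by (simp add: powr_diff)
            also have "\<dots> \<le> 2 * (v - t) powr (b - 1)"
              using True t by (intro mult_right_mono) auto
            finally show "(v - t) powr b / b \<le> 2 / b * (v - t) powr (b - 1)"
              using b by (simp add: divide_right_mono)
          qed auto
          also have "ennreal (2 / b * (v - t) powr (b - 1)) * ?h v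
            = ennreal (2 / b) * (ennreal ((v - t) powr (b - 1)) * ?h v * indicator {t<..} v)"
            using True b by (subst ennreal_mult) (auto simp: mult.assoc)
          finally show ?thesis .
        next
          case False
          then have "(\<integral>\<^sup>+s. ?g1 s * (?h v * indicator {t+s..} v) \<partial>lborel) = (\<integral>\<^sup>+s. 0 \<partial>(lborel :: real measure))"
            by (intro nn_integral_cong) (auto split: split_indicator)
          then show ?thesis by (simp only: nn_integral_const mult_zero_left zero_le)
        qed
      qed
      also have "\<dots> = ennreal (2 / b) * ?J"
        by (rule nn_integral_cmult) measurable
      finally have "?W t \<le> ennreal (c1 * A) * (\<integral>\<^sup>+s. ?g s \<partial>lborel) + (ennreal c2 * (ennreal (2 / b) * ?J) + ennreal (real (Suc k)) * ?J)"
        by (simp add: add_mono mult_left_mono del: of_nat_Suc)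
      also have "\<dots> \<le> ennreal (c1 * A) * ennreal (1 / b + 1) + (ennreal c2 * (ennreal (2 / b) * ?J) + ennreal (real (Suc k)) * ?J)"
        by (intro add_right_mono mult_left_mono g) auto
      also have "ennreal (c1 * A) * ennreal (1 / b + 1) = ennreal (c3 * A)"
        using pos A b by (subst ennreal_mult[symmetric]) (auto simp: c3_def mult_ac)
      also have "ennreal c2 * (ennreal (2 / b) * ?J) + ennreal (real (Suc k)) * ?J = ennreal c4 * ?J"
      proof -
        have "ennreal c4 = ennreal c2 * ennreal (2 / b) + ennreal (real (Suc k))"
          unfolding c4_def using pos b by (subst ennreal_plus) (auto simp: mult.commute simp flip: ennreal_mult)
        then show ?thesis by (simp add: distrib_right mult.assoc)
      qed
      finally show ?thesis .
    qed
    \<comment> \<open>The contribution of A: t^a near 0, where the lower orders are merely bounded,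
      and t^(-\<delta>) at infinity. Both pieces are in L^q(dt / t) because a and \<delta> are
      positive.\<close>
    define f where "f t = ennreal (c3 * A) * (ennreal (t powr a) * indicator {0..1} t + ennreal (t powr (- \<delta>)) * indicator {1..} t)" for t
    have TW: "ennreal (t powr a) * ?W t \<le> f t + ennreal c4 * T t" if t: "0 < t" for t
    proof (cases "t \<le> 1")
      case True
      have "ennreal (t powr a) * ?W t \<le> ennreal (t powr a) * (ennreal (c3 * A) + ennreal c4 * (\<integral>\<^sup>+v\<in>{t<..}. ennreal ((v - t) powr (b - 1)) * ?h v \<partial>lborel))"
        by (intro mult_left_mono W_small t) auto
      also have "\<dots> = ennreal (c3 * A) * ennreal (t powr a) + ennreal c4 * (\<integral>\<^sup>+v. ennreal (t powr a) * (ennreal ((v - t) powr (b - 1)) * ?h v * indicator {t<..} v) \<partial>lborel)"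
        by (simp add: nn_integral_cmult distrib_left mult_ac)
      also have "(\<integral>\<^sup>+v. ennreal (t powr a) * (ennreal ((v - t) powr (b - 1)) * ?h v * indicator {t<..} v) \<partial>lborel) = T t"
        unfolding T_def
      proof (intro nn_integral_cong)
        fix v :: real
        show "ennreal (t powr a) * (ennreal ((v - t) powr (b - 1)) * ?h v * indicator {t<..} v) = ennreal (hardy_kernel a b t v) * G v * indicator {t<..} v"
        proof (cases "t < v \<and> v \<le> 2")
          case True
          have "v powr (- a - b) * v powr (real N - \<alpha>) = 1"
            using True t unfolding powr_add[symmetric] by (simp add: a_def b_def N_def)
          then have "hardy_kernel a b t v * (v powr (real N - \<alpha>) * \<bar>H N v\<bar>) = t powr a * ((v - t) powr (b - 1) * \<bar>H N v\<bar>)"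
            unfolding hardy_kernel_def by (simp add: mult_ac)
          moreover have "0 \<le> hardy_kernel a b t v" by (simp add: hardy_kernel_def)
          ultimately have "ennreal (hardy_kernel a b t v) * ennreal (v powr (real N - \<alpha>) * \<bar>H N v\<bar>)
              = ennreal (t powr a) * (ennreal ((v - t) powr (b - 1)) * ennreal \<bar>H N v\<bar>)"
            by (simp flip: ennreal_mult)
          then show ?thesis
            using True t by (simp add: G_def)
        qed (auto simp: G_def split: split_indicator)
      qed
      finally have "ennreal (t powr a) * ?W t \<le> ennreal (c3 * A) * ennreal (t powr a) + ennreal c4 * T t" .
      moreover have "ennreal (c3 * A) * ennreal (t powr a) \<le> f t"
        unfolding f_def using True t by (intro mult_left_mono) auto
      ultimately show ?thesis by (meson add_right_mono order_trans)
    next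
      case False
      have "ennreal (t powr a) * ?W t \<le> ennreal (t powr a) * ennreal (c3 * A * t powr (- real n))"
        using False by (intro mult_left_mono W_large) auto
      also have "\<dots> = ennreal (c3 * A * (t powr a * t powr (- real n)))"
        using pos A by (simp add: mult_ac flip: ennreal_mult)
      also have "t powr a * t powr (- real n) = t powr (- \<delta>)"
        using t unfolding powr_add[symmetric] by (simp add: a_def \<delta>_def)
      also have "ennreal (c3 * A * t powr (- \<delta>)) = f t"
        using False pos A by (simp add: f_def ennreal_mult)
      finally show ?thesis by (simp add: add_increasing2)
    qed
    have [measurable]: "f \<in> borel_measurable borel" unfolding f_def by measurable
    have f_int: "(\<integral>\<^sup>+t\<in>{0<..}. epowr (f t) q * ennreal (1 / t) \<partial>lborel) \<le> ennreal c5 * ennreal (A powr q)"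
    proof -
      have "(\<integral>\<^sup>+t\<in>{0<..}. epowr (f t) q * ennreal (1 / t) \<partial>lborel)
        \<le> (\<integral>\<^sup>+t. ennreal ((c3 * A) powr q) * (ennreal (t powr (a * q - 1)) * indicator {0..1} t
           + ennreal (t powr (- (\<delta> * q) - 1)) * indicator {1..} t) \<partial>lborel)"
      proof (rule nn_integral_mono_AE)
        \<comment> \<open>At t = 1 both indicators in \<open>f\<close> are 1, and the power of the
          sum is not the sum of the powers.\<close>
        have "AE t in lborel. t \<noteq> (1::real)" by (rule AE_lborel_singleton)
        then show "AE t in lborel. epowr (f t) q * ennreal (1 / t) * indicator {0<..} t \<le>
          ennreal ((c3 * A) powr q) * (ennreal (t powr (a * q - 1)) * indicator {0..1} t
           + ennreal (t powr (- (\<delta> * q) - 1)) * indicator {1..} t)"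
        proof eventually_elim
          case (elim t)
          then consider "t \<le> 0" | "0 < t" "t < 1" | "1 < t" by linarith
          then show ?case
          proof cases
            case 2
            then show ?thesis using A pos
              by (simp add: f_def epowr_mult epowr_ennreal powr_mult powr_powr powr_diff flip: ennreal_mult)
          next
            case 3
            then show ?thesis using A pos
              by (simp add: f_def epowr_mult epowr_ennreal powr_mult powr_powr powr_diff flip: ennreal_mult)
          qed auto
        qed
      qed
      also have "\<dots> = ennreal ((c3 * A) powr q) * (ennreal (1 / (a * q)) + ennreal (1 / (\<delta> * q)))"
        using nn_integral_powr_0[of "a * q" 1] nn_integral_powr_inf[of "\<delta> * q" 1] a \<delta> assms
        by (simp add: nn_integral_cmult nn_integral_add)
      also have "\<dots> = ennreal c5 * ennreal (A powr q)"
        using a \<delta> assms pos A by (simp add: c5_def powr_mult mult_ac flip: ennreal_plus ennreal_mult)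
      finally show ?thesis .
    qed
    have T_int: "(\<integral>\<^sup>+t\<in>{0<..}. epowr (T t) q * ennreal (1 / t) \<partial>lborel) \<le> ennreal K * local_square \<alpha> q N H"
    proof -
      have "(\<integral>\<^sup>+t\<in>{0<..}. epowr (T t) q * ennreal (1 / t) \<partial>lborel) \<le> ennreal K * (\<integral>\<^sup>+s\<in>{0<..}. epowr (G s) q * ennreal (1 / s) \<partial>lborel)"
        unfolding T_def by (rule K) measurable
      also have "(\<integral>\<^sup>+s\<in>{0<..}. epowr (G s) q * ennreal (1 / s) \<partial>lborel) = local_square \<alpha> q N H"
        unfolding local_square_def G_def by (intro nn_integral_cong) (auto split: split_indicator)
      finally show ?thesis .
    qed
    have "(\<integral>\<^sup>+t\<in>{0<..}. epowr (ennreal (t powr a) * ?W t) q * ennreal (1 / t) \<partial>lborel)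
      \<le> (\<integral>\<^sup>+t. ennreal (2 powr q) * (epowr (f t) q * ennreal (1 / t) * indicator {0<..} t
          + ennreal (c4 powr q) * (epowr (T t) q * ennreal (1 / t) * indicator {0<..} t)) \<partial>lborel)"
    proof (intro nn_integral_mono)
      fix t :: real
      show "epowr (ennreal (t powr a) * ?W t) q * ennreal (1 / t) * indicator {0<..} t
        \<le> ennreal (2 powr q) * (epowr (f t) q * ennreal (1 / t) * indicator {0<..} t
          + ennreal (c4 powr q) * (epowr (T t) q * ennreal (1 / t) * indicator {0<..} t))"
      proof (cases "0 < t")
        case True
        have "epowr (ennreal (t powr a) * ?W t) q \<le> epowr (f t + ennreal c4 * T t) q"
          using assms by (intro epowr_mono TW True) auto
        also have "\<dots> \<le> ennreal (2 powr q) * (epowr (f t) q + epowr (ennreal c4 * T t) q)"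
          using assms by (intro epowr_add_le) auto
        also have "epowr (ennreal c4 * T t) q = ennreal (c4 powr q) * epowr (T t) q"
          using pos by (simp add: epowr_mult epowr_ennreal)
        finally have "epowr (ennreal (t powr a) * ?W t) q * ennreal (1 / t)
          \<le> ennreal (2 powr q) * (epowr (f t) q + ennreal (c4 powr q) * epowr (T t) q) * ennreal (1 / t)"
          by (rule mult_right_mono) simp
        then show ?thesis using True by (simp add: distrib_left distrib_right mult.assoc)
      qed simp
    qed
    also have "\<dots> = ennreal (2 powr q) * ((\<integral>\<^sup>+t\<in>{0<..}. epowr (f t) q * ennreal (1 / t) \<partial>lborel)
       + ennreal (c4 powr q) * (\<integral>\<^sup>+t\<in>{0<..}. epowr (T t) q * ennreal (1 / t) \<partial>lborel))"
      by (simp add: nn_integral_cmult nn_integral_add)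
    also have "\<dots> \<le> ennreal (2 powr q) * (ennreal c5 * ennreal (A powr q)
       + ennreal (c4 powr q) * (ennreal K * local_square \<alpha> q N H))"
      by (intro mult_left_mono add_mono f_int T_int) auto
    also have "\<dots> \<le> ennreal (2 powr q) * (ennreal (c5 + c4 powr q * K) * (ennreal (A powr q) + local_square \<alpha> q N H))"
    proof (intro mult_left_mono)
      have "ennreal c5 * ennreal (A powr q) + ennreal (c4 powr q) * (ennreal K * local_square \<alpha> q N H)
        = ennreal c5 * ennreal (A powr q) + ennreal (c4 powr q * K) * local_square \<alpha> q N H"
        using K(1) by (simp add: ennreal_mult mult.assoc)
      also have "\<dots> \<le> ennreal (c5 + c4 powr q * K) * ennreal (A powr q) + ennreal (c5 + c4 powr q * K) * local_square \<alpha> q N H"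
        using c5 K(1) by (intro add_mono mult_right_mono ennreal_leI) auto
      finally show "ennreal c5 * ennreal (A powr q) + ennreal (c4 powr q) * (ennreal K * local_square \<alpha> q N H)
        \<le> ennreal (c5 + c4 powr q * K) * (ennreal (A powr q) + local_square \<alpha> q N H)"
        by (simp only: distrib_left)
    qed simp
    also have "\<dots> = ennreal C * (ennreal (A powr q) + local_square \<alpha> q N H)"
      unfolding C_def using c5 K(1) by (subst ennreal_mult[of "2 powr q"]) (auto simp: mult.assoc)
    finally show "(\<integral>\<^sup>+t\<in>{0<..}. epowr (ennreal (t powr (real n - (\<alpha> - \<beta>))) *
        (\<integral>\<^sup>+s\<in>{0<..}. ennreal (s powr (real k - \<beta> - 1) * exp (- s) * (\<Sum>l\<le>k. \<bar>H (l + n) (t + s)\<bar>)) \<partial>lborel)) q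
      * ennreal (1 / t) \<partial>lborel)
      \<le> ennreal C * (ennreal (A powr q) + local_square \<alpha> q (k + n) H)"
      by (simp only: a_def[symmetric] b_def[symmetric] N_def[symmetric])
  qed
qed

section \<open>Symmetric semigroups with a Harnack inequality\<close>

text \<open>By the mean value inequality w dominates the difference quotients as well as the
  derivatives, so dominated convergence applies along every sequence tending to t.\<close>

lemma has_real_derivative_integral:
  fixes F F' :: "real \<Rightarrow> 'a \<Rightarrow> real"
  assumes t: "a < t" "t < b"
    and deriv: "\<And>s y. a < s \<Longrightarrow> s < b \<Longrightarrow> ((\<lambda>s. F s y) has_real_derivative F' s y) (at s)"
    and int: "\<And>s. a < s \<Longrightarrow> s < b \<Longrightarrow> integrable M (F s)"
    and [measurable]: "F' t \<in> borel_measurable M"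
    and w: "integrable M w" "\<And>s y. a < s \<Longrightarrow> s < b \<Longrightarrow> \<bar>F' s y\<bar> \<le> w y"
  shows "((\<lambda>s. \<integral>y. F s y \<partial>M) has_real_derivative (\<integral>y. F' t y \<partial>M)) (at t)"
proof -
  have at: "at t = at t within {a<..<b}"
    using t by (intro at_within_open[symmetric]) auto
  have "((\<lambda>s. ((\<integral>y. F s y \<partial>M) - (\<integral>y. F t y \<partial>M)) / (s - t)) \<longlongrightarrow> (\<integral>y. F' t y \<partial>M)) (at t within {a<..<b})"
    unfolding tendsto_at_iff_sequentially comp_def
  proof (intro allI impI)
    fix X :: "nat \<Rightarrow> real" assume X: "\<forall>i. X i \<in> {a<..<b} - {t}" "X \<longlonglongrightarrow> t"
    have eq: "((\<integral>y. F (X i) y \<partial>M) - (\<integral>y. F t y \<partial>M)) / (X i - t) = (\<integral>y. (F (X i) y - F t y) / (X i - t) \<partial>M)" for i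
      using X(1) int[OF t] int[of "X i"] by simp
    show "(\<lambda>i. ((\<integral>y. F (X i) y \<partial>M) - (\<integral>y. F t y \<partial>M)) / (X i - t)) \<longlonglongrightarrow> (\<integral>y. F' t y \<partial>M)"
      unfolding eq
    proof (rule integral_dominated_convergence[where w=w])
      show "(\<lambda>y. (F (X i) y - F t y) / (X i - t)) \<in> borel_measurable M" for i
        using X(1) int[OF t] int[of "X i"] by auto
      show "AE y in M. (\<lambda>i. (F (X i) y - F t y) / (X i - t)) \<longlonglongrightarrow> F' t y"
      proof (rule AE_I2)
        fix y
        have "((\<lambda>s. (F s y - F t y) / (s - t)) \<longlongrightarrow> F' t y) (at t within {a<..<b})"
          using deriv[OF t, of y] unfolding has_field_derivative_iff at .
        then show "(\<lambda>i. (F (X i) y - F t y) / (X i - t)) \<longlonglongrightarrow> F' t y"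
          using X unfolding tendsto_at_iff_sequentially comp_def by blast
      qed
      show "AE y in M. norm ((F (X i) y - F t y) / (X i - t)) \<le> w y" for i
      proof (rule AE_I2)
        fix y
        have "norm (F (X i) y - F t y) \<le> w y * norm (X i - t)"
          using X(1) t w(2)
          by (intro field_differentiable_bound[where S="{a<..<b}" and f'="\<lambda>s. F' s y"])
            (auto intro: has_field_derivative_at_within deriv)
        then show "norm ((F (X i) y - F t y) / (X i - t)) \<le> w y"
          using X(1) by (simp add: divide_le_eq)
      qed
    qed (use w in auto)
  qed
  then show ?thesis unfolding has_field_derivative_iff at .
qed

text \<open>\<open>p j\<close> is the j-th time derivative of the density \<open>p 0\<close> of P_t
  with respect to M. By \<open>p_bounded\<close> the operators are given by convergent integrals at
  every point, not just almost everywhere, for each integrable f; derivatives in t at a fixed x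
  therefore make sense. \<open>p_bound\<close> halves the time, and \<open>p_harnack\<close> repairs
  this at the cost of a constant.\<close>

locale poisson_kernel = prob_space M for M :: "'a measure" +
  fixes p :: "nat \<Rightarrow> real \<Rightarrow> 'a \<Rightarrow> 'a \<Rightarrow> real" and D :: "nat \<Rightarrow> real"
  assumes space_M [simp]: "space M = UNIV"
    and p_measurable_triple: "(\<lambda>z. p j (fst z) (fst (snd z)) (snd (snd z))) \<in> borel_measurable (borel \<Otimes>\<^sub>M (M \<Otimes>\<^sub>M M))"
    and p_nonneg: "0 < t \<Longrightarrow> 0 \<le> p 0 t x y"
    and p_sym: "0 < t \<Longrightarrow> p 0 t x y = p 0 t y x"
    and p_total: "0 < t \<Longrightarrow> (\<integral>\<^sup>+y. ennreal (p 0 t x y) \<partial>M) = 1"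
    and p_semigroup: "0 < s \<Longrightarrow> 0 < t \<Longrightarrow>
      (\<integral>\<^sup>+z. ennreal (p 0 s x z) * ennreal (p 0 t z y) \<partial>M) = ennreal (p 0 (s + t) x y)"
    and p_deriv: "0 < t \<Longrightarrow> ((\<lambda>t. p j t x y) has_real_derivative p (Suc j) t x y) (at t)"
    and D_pos: "0 < D j"
    and p_bound: "0 < t \<Longrightarrow> \<bar>p j t x y\<bar> \<le> D j / t ^ j * p 0 (t / 2) x y"
    and p_harnack: "0 < s \<Longrightarrow> s \<le> t \<Longrightarrow> p 0 t x y \<le> t / s * p 0 s x y"
    and p_bounded: "0 < t \<Longrightarrow> \<exists>B. \<forall>y. p 0 t x y \<le> B"
begin

section \<open>The integral operators of the kernel and their semigroup law\<close>

lemma p_measurable [measurable (raw)]: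
  assumes [measurable]: "f \<in> borel_measurable N" "g \<in> N \<rightarrow>\<^sub>M M" "h \<in> N \<rightarrow>\<^sub>M M"
  shows "(\<lambda>x. p j (f x) (g x) (h x)) \<in> borel_measurable N"
proof -
  have "(\<lambda>x. (f x, g x, h x)) \<in> N \<rightarrow>\<^sub>M borel \<Otimes>\<^sub>M (M \<Otimes>\<^sub>M M)" by measurable
  from measurable_compose[OF this p_measurable_triple[of j]] show ?thesis by simp
qed

sublocale pair: pair_sigma_finite M M ..

definition Q :: "nat \<Rightarrow> real \<Rightarrow> ('a \<Rightarrow> real) \<Rightarrow> 'a \<Rightarrow> real" where
  "Q j t f x = (\<integral>y. p j t x y * f y \<partial>M)"

lemma Q_measurable [measurable (raw)]:
  assumes [measurable]: "f \<in> borel_measurable M" "g \<in> borel_measurable N" "h \<in> N \<rightarrow>\<^sub>M M"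
  shows "(\<lambda>x. Q j (g x) f (h x)) \<in> borel_measurable N"
  unfolding Q_def by measurable

lemma p_integrable:
  assumes f: "integrable M f" and t: "0 < t"
  shows "integrable M (\<lambda>y. p j t x y * f y)"
proof -
  have [measurable]: "f \<in> borel_measurable M" using f by auto
  obtain B where B: "\<And>y. p 0 (t / 2) x y \<le> B" using p_bounded[of "t / 2" x] t by auto
  show ?thesis
  proof (rule Bochner_Integration.integrable_bound)
    show "integrable M (\<lambda>y. D j / t ^ j * B * \<bar>f y\<bar>)" using f by auto
    show "AE y in M. norm (p j t x y * f y) \<le> norm (D j / t ^ j * B * \<bar>f y\<bar>)"
    proof (rule AE_I2)
      fix y
      have "\<bar>p j t x y\<bar> \<le> D j / t ^ j * p 0 (t / 2) x y" by (rule p_bound[OF t])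
      also have "\<dots> \<le> D j / t ^ j * B" using D_pos[of j] t by (intro mult_left_mono B) auto
      finally have 1: "\<bar>p j t x y\<bar> \<le> D j / t ^ j * B" .
      then show "norm (p j t x y * f y) \<le> norm (D j / t ^ j * B * \<bar>f y\<bar>)"
        unfolding real_norm_def abs_mult[of _ "f y"] abs_mult[of _ "\<bar>f y\<bar>"] abs_abs[of "f y"]
        by (intro mult_right_mono) linarith+
    qed
  qed measurable
qed

lemma Q_nonneg:
  assumes "\<And>y. 0 \<le> f y" "0 < t"
  shows "0 \<le> Q 0 t f x"
  unfolding Q_def using assms p_nonneg by (intro integral_nonneg_AE) auto

lemma Q_nn_integral:
  assumes "integrable M f" "\<And>y. 0 \<le> f y" "0 < t"
  shows "ennreal (Q 0 t f x) = (\<integral>\<^sup>+y. ennreal (p 0 t x y) * ennreal (f y) \<partial>M)"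
proof -
  have "(\<integral>\<^sup>+y. ennreal (p 0 t x y * f y) \<partial>M) = ennreal (Q 0 t f x)"
    unfolding Q_def using assms p_nonneg by (intro nn_integral_eq_integral p_integrable) auto
  then show ?thesis using assms p_nonneg by (simp add: ennreal_mult)
qed

lemma Q_mono:
  assumes "integrable M f" "integrable M g" "\<And>y. f y \<le> g y" "0 < t"
  shows "Q 0 t f x \<le> Q 0 t g x"
  unfolding Q_def using assms p_nonneg by (intro integral_mono p_integrable) (auto intro: mult_left_mono)

lemma Q_abs_bound:
  assumes f: "integrable M f" and t: "0 < t"
  shows "\<bar>Q j t f x\<bar> \<le> D j / t ^ j * Q 0 (t / 2) (\<lambda>y. \<bar>f y\<bar>) x"
proof -
  have "\<bar>Q j t f x\<bar> \<le> (\<integral>y. \<bar>p j t x y * f y\<bar> \<partial>M)"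
    unfolding Q_def by (rule integral_abs_bound)
  also have "\<dots> \<le> (\<integral>y. D j / t ^ j * (p 0 (t / 2) x y * \<bar>f y\<bar>) \<partial>M)"
  proof (rule integral_mono)
    show "integrable M (\<lambda>y. D j / t ^ j * (p 0 (t / 2) x y * \<bar>f y\<bar>))"
      using p_integrable[of "\<lambda>y. \<bar>f y\<bar>" "t / 2" 0 x] f t by auto
    fix y show "\<bar>p j t x y * f y\<bar> \<le> D j / t ^ j * (p 0 (t / 2) x y * \<bar>f y\<bar>)"
      unfolding abs_mult mult.assoc[symmetric] by (intro mult_right_mono p_bound t) auto
  qed (use p_integrable[OF f t] in auto)
  also have "\<dots> = D j / t ^ j * Q 0 (t / 2) (\<lambda>y. \<bar>f y\<bar>) x"
    unfolding Q_def by (rule integral_mult_right_zero)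
  finally show ?thesis .
qed

lemma Q_harnack:
  assumes f: "integrable M f" "\<And>y. 0 \<le> f y" and t: "0 < s" "s \<le> t"
  shows "Q 0 t f x \<le> t / s * Q 0 s f x"
proof -
  have "Q 0 t f x \<le> (\<integral>y. t / s * (p 0 s x y * f y) \<partial>M)"
    unfolding Q_def
  proof (rule integral_mono)
    fix y show "p 0 t x y * f y \<le> t / s * (p 0 s x y * f y)"
      unfolding mult.assoc[symmetric] using t f by (intro mult_right_mono p_harnack) auto
  qed (use p_integrable[OF f(1), of s] p_integrable[OF f(1), of t] t in auto)
  then show ?thesis by (simp only: Q_def integral_mult_right_zero)
qed

text \<open>By symmetry the kernel also has mass 1 in its first variable.\<close>

lemma Q_integral:
  assumes "integrable M f" "\<And>y. 0 \<le> f y" "0 < t"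
  shows "(\<integral>\<^sup>+x. ennreal (Q 0 t f x) \<partial>M) = (\<integral>\<^sup>+x. ennreal (f x) \<partial>M)"
proof -
  have [measurable]: "f \<in> borel_measurable M" using assms by auto
  have "(\<integral>\<^sup>+x. ennreal (Q 0 t f x) \<partial>M) = (\<integral>\<^sup>+x. \<integral>\<^sup>+y. ennreal (p 0 t x y) * ennreal (f y) \<partial>M \<partial>M)"
    using assms by (simp add: Q_nn_integral)
  also have "\<dots> = (\<integral>\<^sup>+y. \<integral>\<^sup>+x. ennreal (p 0 t x y) * ennreal (f y) \<partial>M \<partial>M)"
    by (rule pair.Fubini') measurable
  also have "\<dots> = (\<integral>\<^sup>+y. ennreal (f y) \<partial>M)"
    using assms p_total p_sym by (simp add: nn_integral_multc)
  finally show ?thesis .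
qed

lemma Q_integrable:
  assumes "integrable M f" "0 < t"
  shows "integrable M (Q j t f)"
proof -
  have [measurable]: "f \<in> borel_measurable M" using assms by auto
  have "(\<integral>\<^sup>+x. ennreal (Q 0 (t / 2) (\<lambda>y. \<bar>f y\<bar>) x) \<partial>M) < \<infinity>"
    using Q_integral[of "\<lambda>y. \<bar>f y\<bar>" "t / 2"] assms by (simp add: integrable_iff_bounded)
  then have "integrable M (Q 0 (t / 2) (\<lambda>y. \<bar>f y\<bar>))"
    using Q_nonneg[of "\<lambda>y. \<bar>f y\<bar>" "t / 2"] assms by (intro integrableI_nonneg) auto
  then have "integrable M (\<lambda>x. D j / t ^ j * Q 0 (t / 2) (\<lambda>y. \<bar>f y\<bar>) x)" by auto
  then show ?thesis
  proof (rule Bochner_Integration.integrable_bound)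
    show "AE x in M. norm (Q j t f x) \<le> norm (D j / t ^ j * Q 0 (t / 2) (\<lambda>y. \<bar>f y\<bar>) x)"
      unfolding real_norm_def by (intro AE_I2 order_trans[OF Q_abs_bound[OF assms] abs_ge_self])
  qed measurable
qed

lemma Q_sym:
  assumes f: "integrable M f" "\<And>y. 0 \<le> f y" and g: "integrable M g" "\<And>y. 0 \<le> g y" and t: "0 < t"
  shows "(\<integral>\<^sup>+x. ennreal (Q 0 t f x) * ennreal (g x) \<partial>M) = (\<integral>\<^sup>+x. ennreal (f x) * ennreal (Q 0 t g x) \<partial>M)"
proof -
  have [measurable]: "f \<in> borel_measurable M" "g \<in> borel_measurable M" using f g by auto
  have "(\<integral>\<^sup>+x. ennreal (Q 0 t f x) * ennreal (g x) \<partial>M) = (\<integral>\<^sup>+x. \<integral>\<^sup>+y. ennreal (p 0 t x y) * ennreal (f y) * ennreal (g x) \<partial>M \<partial>M)"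
    using f t by (simp add: Q_nn_integral nn_integral_multc)
  also have "\<dots> = (\<integral>\<^sup>+y. \<integral>\<^sup>+x. ennreal (p 0 t x y) * ennreal (f y) * ennreal (g x) \<partial>M \<partial>M)"
    by (rule pair.Fubini') measurable
  also have "\<dots> = (\<integral>\<^sup>+y. \<integral>\<^sup>+x. ennreal (f y) * (ennreal (p 0 t y x) * ennreal (g x)) \<partial>M \<partial>M)"
    using p_sym[OF t] by (simp add: mult_ac)
  also have "\<dots> = (\<integral>\<^sup>+x. ennreal (f x) * ennreal (Q 0 t g x) \<partial>M)"
    using g t by (simp add: Q_nn_integral nn_integral_cmult)
  finally show ?thesis .
qed

lemma Q_diff:
  assumes "integrable M f" "integrable M g" "0 < t"
  shows "Q j t (\<lambda>y. f y - g y) x = Q j t f x - Q j t g x"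
  unfolding Q_def right_diff_distrib using assms by (intro Bochner_Integration.integral_diff p_integrable)

lemma Q_semigroup_nonneg:
  assumes f: "integrable M f" "\<And>y. 0 \<le> f y" and t: "0 < s" "0 < t"
  shows "Q 0 s (Q 0 t f) x = Q 0 (s + t) f x"
proof -
  have [measurable]: "f \<in> borel_measurable M" using f by auto
  have "ennreal (Q 0 s (Q 0 t f) x) = (\<integral>\<^sup>+z. ennreal (p 0 s x z) * (\<integral>\<^sup>+y. ennreal (p 0 t z y) * ennreal (f y) \<partial>M) \<partial>M)"
    using f t by (simp add: Q_nn_integral Q_integrable Q_nonneg)
  also have "\<dots> = (\<integral>\<^sup>+z. \<integral>\<^sup>+y. ennreal (p 0 s x z) * ennreal (p 0 t z y) * ennreal (f y) \<partial>M \<partial>M)"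
    by (simp add: nn_integral_cmult[symmetric] mult.assoc)
  also have "\<dots> = (\<integral>\<^sup>+y. \<integral>\<^sup>+z. ennreal (p 0 s x z) * ennreal (p 0 t z y) * ennreal (f y) \<partial>M \<partial>M)"
    by (rule pair.Fubini') measurable
  also have "\<dots> = ennreal (Q 0 (s + t) f x)"
    using f t by (simp add: nn_integral_multc p_semigroup Q_nn_integral)
  finally show ?thesis
    using f t by (subst (asm) ennreal_inj) (auto intro!: Q_nonneg)
qed

text \<open>Positive and negative parts reduce this to the nonnegative case, where Tonelli's theorem
  applies.\<close>

lemma Q_semigroup_0:
  assumes f: "integrable M f" and t: "0 < s" "0 < t"
  shows "Q 0 s (Q 0 t f) x = Q 0 (s + t) f x"
proof -
  define g where "g y = max (f y) 0" for y
  define h where "h y = max (- f y) 0" for y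
  have gh: "integrable M g" "integrable M h" "\<And>y. 0 \<le> g y" "\<And>y. 0 \<le> h y"
    using f by (auto simp: g_def[abs_def] h_def[abs_def])
  have f_eq: "f = (\<lambda>y. g y - h y)" by (auto simp: g_def h_def fun_eq_iff)
  have "Q 0 s (Q 0 t f) x = Q 0 s (\<lambda>z. Q 0 t g z - Q 0 t h z) x"
    unfolding f_eq using Q_diff[OF gh(1,2) t(2), of 0] by presburger
  also have "\<dots> = Q 0 s (Q 0 t g) x - Q 0 s (Q 0 t h) x"
    using gh t by (intro Q_diff Q_integrable)
  also have "\<dots> = Q 0 (s + t) f x"
    unfolding f_eq using gh t by (simp add: Q_diff Q_semigroup_nonneg)
  finally show ?thesis .
qed

text \<open>A majorant independent of t in (a, b), needed to differentiate under the integral: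
  Harnack's inequality carries the time t / 2 down to the fixed time a / 2.\<close>

lemma Q_local_bound:
  assumes f: "integrable M f" and t: "0 < a" "a < t" "t < b"
  shows "\<bar>Q j t f x\<bar> \<le> D j / a ^ j * (b / a) * Q 0 (a / 2) (\<lambda>y. \<bar>f y\<bar>) x"
proof -
  have nn: "0 \<le> Q 0 (a / 2) (\<lambda>y. \<bar>f y\<bar>) x" using t by (intro Q_nonneg) auto
  have "\<bar>Q j t f x\<bar> \<le> D j / t ^ j * Q 0 (t / 2) (\<lambda>y. \<bar>f y\<bar>) x"
    using t by (intro Q_abs_bound f) auto
  also have "\<dots> \<le> D j / a ^ j * (b / a * Q 0 (a / 2) (\<lambda>y. \<bar>f y\<bar>) x)"
  proof (intro mult_mono)
    show "D j / t ^ j \<le> D j / a ^ j"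
      using t D_pos[of j] by (intro divide_left_mono power_mono) auto
    have "Q 0 (t / 2) (\<lambda>y. \<bar>f y\<bar>) x \<le> (t / 2) / (a / 2) * Q 0 (a / 2) (\<lambda>y. \<bar>f y\<bar>) x"
      using t f by (intro Q_harnack) auto
    also have "\<dots> \<le> b / a * Q 0 (a / 2) (\<lambda>y. \<bar>f y\<bar>) x"
      using t nn by (intro mult_right_mono) (auto simp: divide_right_mono)
    finally show "Q 0 (t / 2) (\<lambda>y. \<bar>f y\<bar>) x \<le> b / a * Q 0 (a / 2) (\<lambda>y. \<bar>f y\<bar>) x" .
  qed (use t less_imp_le[OF D_pos[of j]] in \<open>auto intro!: Q_nonneg\<close>)
  finally show ?thesis by (simp add: mult.assoc)
qed

lemma p_local_bound:
  assumes t: "0 < a" "a < t" "t < b"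
  shows "\<bar>p j t x y\<bar> \<le> D j / a ^ j * (b / a) * p 0 (a / 2) x y"
proof -
  have "\<bar>p j t x y\<bar> \<le> D j / t ^ j * p 0 (t / 2) x y"
    using t by (intro p_bound) auto
  also have "\<dots> \<le> D j / a ^ j * (b / a * p 0 (a / 2) x y)"
  proof (intro mult_mono)
    show "D j / t ^ j \<le> D j / a ^ j"
      using t D_pos[of j] by (intro divide_left_mono power_mono) auto
    have "p 0 (t / 2) x y \<le> (t / 2) / (a / 2) * p 0 (a / 2) x y"
      using t by (intro p_harnack) auto
    also have "\<dots> \<le> b / a * p 0 (a / 2) x y"
      using t p_nonneg[of "a / 2" x y] by (intro mult_right_mono) (auto simp: divide_right_mono)
    finally show "p 0 (t / 2) x y \<le> b / a * p 0 (a / 2) x y" .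
  qed (use t less_imp_le[OF D_pos[of j]] in \<open>auto intro!: p_nonneg\<close>)
  finally show ?thesis by (simp add: mult.assoc)
qed

lemma Q_deriv:
  assumes f: "integrable M f" and t: "0 < t"
  shows "((\<lambda>t. Q j t f x) has_real_derivative Q (Suc j) t f x) (at t)"
proof -
  have [measurable]: "f \<in> borel_measurable M" using f by auto
  define a where "a = t / 2"
  have a: "0 < a" "a < t" "t < 2 * t" using t by (auto simp: a_def)
  show ?thesis
    unfolding Q_def
  proof (rule has_real_derivative_integral[where a=a and b="2 * t"
        and w="\<lambda>y. D (Suc j) / a ^ Suc j * (2 * t / a) * (p 0 (a / 2) x y * \<bar>f y\<bar>)"])
    fix s y assume s: "a < s" "s < 2 * t"
    then have "0 < s" using a by simp
    from DERIV_mult[OF p_deriv[OF this, of j x y] DERIV_const[of "f y"]]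
    show "((\<lambda>s. p j s x y * f y) has_real_derivative p (Suc j) s x y * f y) (at s)"
      by simp
    show "\<bar>p (Suc j) s x y * f y\<bar> \<le> D (Suc j) / a ^ Suc j * (2 * t / a) * (p 0 (a / 2) x y * \<bar>f y\<bar>)"
      unfolding abs_mult mult.assoc[symmetric]
      using s a by (intro mult_right_mono p_local_bound[of a s "2 * t"]) auto
  qed (use a f t in \<open>auto intro!: p_integrable integrable_mult_right\<close>)
qed

text \<open>In the induction both sides for j, as functions of t, are equal and differentiable, so
  their derivatives agree. On the left the derivative passes under \<open>Q 0 s\<close> by the local
  bound.\<close>

lemma Q_semigroup_right:
  assumes f: "integrable M f" and t: "0 < s" "0 < t"
  shows "Q 0 s (Q j t f) x = Q j (s + t) f x"
  using t(2)
proof (induction j arbitrary: t)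
  case 0
  then show ?case using f t(1) by (simp add: Q_semigroup_0)
next
  case (Suc j)
  have [measurable]: "f \<in> borel_measurable M" using f by auto
  define a where "a = t / 2"
  have a: "0 < a" "a < t" "t < 2 * t" using Suc.prems by (auto simp: a_def)
  have "((\<lambda>t. Q 0 s (Q j t f) x) has_real_derivative Q 0 s (Q (Suc j) t f) x) (at t)"
    unfolding Q_def[of 0]
  proof (rule has_real_derivative_integral[where a=a and b="2 * t"
        and w="\<lambda>z. D (Suc j) / a ^ Suc j * (2 * t / a) * (p 0 s x z * Q 0 (a / 2) (\<lambda>y. \<bar>f y\<bar>) z)"])
    fix r z assume r: "a < r" "r < 2 * t"
    then have "0 < r" using a by simp
    from DERIV_cmult[OF Q_deriv[OF f this, of j z]]
    show "((\<lambda>r. p 0 s x z * Q j r f z) has_real_derivative p 0 s x z * Q (Suc j) r f z) (at r)" .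
    have "\<bar>Q (Suc j) r f z\<bar> \<le> D (Suc j) / a ^ Suc j * (2 * t / a) * Q 0 (a / 2) (\<lambda>y. \<bar>f y\<bar>) z"
      using r a f by (intro Q_local_bound) auto
    then have "p 0 s x z * \<bar>Q (Suc j) r f z\<bar> \<le> p 0 s x z * (D (Suc j) / a ^ Suc j * (2 * t / a) * Q 0 (a / 2) (\<lambda>y. \<bar>f y\<bar>) z)"
      using p_nonneg[OF t(1)] by (rule mult_left_mono)
    then show "\<bar>p 0 s x z * Q (Suc j) r f z\<bar> \<le> D (Suc j) / a ^ Suc j * (2 * t / a) * (p 0 s x z * Q 0 (a / 2) (\<lambda>y. \<bar>f y\<bar>) z)"
      using p_nonneg[OF t(1)] by (simp add: abs_mult mult_ac)
  qed (use a f t Suc.prems in \<open>auto intro!: p_integrable integrable_mult_right Q_integrable\<close>)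
  moreover have "((\<lambda>t. Q 0 s (Q j t f) x) has_real_derivative Q (Suc j) (s + t) f x) (at t)"
  proof (rule has_field_derivative_transform_within_open[where S="{0<..}"])
    have "((\<lambda>t. Q j t f x) has_real_derivative Q (Suc j) (s + t) f x) (at (s + t))"
      using Suc.prems t by (intro Q_deriv f) auto
    then show "((\<lambda>t. Q j (s + t) f x) has_real_derivative Q (Suc j) (s + t) f x) (at t)"
      by (simp only: add.commute[of s] DERIV_shift)
  qed (use Suc in auto)
  ultimately show ?case by (rule DERIV_unique)
qed

text \<open>The same argument with the roles exchanged: differentiate in the outer time s.\<close>

lemma Q_semigroup:
  assumes f: "integrable M f" and t: "0 < s" "0 < t"
  shows "Q i s (Q j t f) x = Q (i + j) (s + t) f x"
  using t(1)
proof (induction i arbitrary: s)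
  case 0
  then show ?case using Q_semigroup_right[OF f _ t(2)] by simp
next
  case (Suc i)
  have "((\<lambda>s. Q i s (Q j t f) x) has_real_derivative Q (Suc i) s (Q j t f) x) (at s)"
    using Suc.prems t by (intro Q_deriv Q_integrable f)
  moreover have "((\<lambda>s. Q i s (Q j t f) x) has_real_derivative Q (Suc (i + j)) (s + t) f x) (at s)"
  proof (rule has_field_derivative_transform_within_open[where S="{0<..}"])
    have "((\<lambda>t. Q (i + j) t f x) has_real_derivative Q (Suc (i + j)) (s + t) f x) (at (s + t))"
      using Suc.prems t by (intro Q_deriv f) auto
    then show "((\<lambda>s. Q (i + j) (s + t) f x) has_real_derivative Q (Suc (i + j)) (s + t) f x) (at s)"
      by (simp only: DERIV_shift)
  qed (use Suc in auto)
  ultimately show ?case by (metis DERIV_unique add_Suc)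
qed

lemma Q_power_le:
  assumes [measurable]: "f \<in> borel_measurable M" and f: "integrable M f" "\<And>y. 0 \<le> f y" and t: "0 < t" and q: "1 \<le> q"
  shows "epowr (ennreal (Q 0 t f x)) q \<le> ennreal (2 powr q) * (\<integral>\<^sup>+y. ennreal (p 0 t x y) * epowr (ennreal (f y)) q \<partial>M)"
proof -
  have "epowr (\<integral>\<^sup>+y. ennreal (p 0 t x y) * ennreal (f y) \<partial>M) q
    \<le> ennreal (2 * (2 * 1) powr (q - 1)) * (\<integral>\<^sup>+y. ennreal (p 0 t x y) * epowr (ennreal (f y)) q \<partial>M)"
    using q p_total[OF t] by (intro jensen_crude) auto
  then show ?thesis using f t by (simp add: Q_nn_integral powr_diff)
qed

lemma Q_power_integral_le:
  assumes [measurable]: "f \<in> borel_measurable M" and f: "integrable M f" "\<And>y. 0 \<le> f y" and t: "0 < t" and q: "1 \<le> q"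
  shows "(\<integral>\<^sup>+x. epowr (ennreal (Q 0 t f x)) q \<partial>M) \<le> ennreal (2 powr q) * (\<integral>\<^sup>+y. epowr (ennreal (f y)) q \<partial>M)"
proof -
  have "(\<integral>\<^sup>+x. epowr (ennreal (Q 0 t f x)) q \<partial>M)
    \<le> (\<integral>\<^sup>+x. ennreal (2 powr q) * (\<integral>\<^sup>+y. ennreal (p 0 t x y) * epowr (ennreal (f y)) q \<partial>M) \<partial>M)"
    by (intro nn_integral_mono Q_power_le assms)
  also have "\<dots> = ennreal (2 powr q) * (\<integral>\<^sup>+x. \<integral>\<^sup>+y. ennreal (p 0 t x y) * epowr (ennreal (f y)) q \<partial>M \<partial>M)"
    by (rule nn_integral_cmult) measurable
  also have "(\<integral>\<^sup>+x. \<integral>\<^sup>+y. ennreal (p 0 t x y) * epowr (ennreal (f y)) q \<partial>M \<partial>M)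
    = (\<integral>\<^sup>+y. \<integral>\<^sup>+x. ennreal (p 0 t x y) * epowr (ennreal (f y)) q \<partial>M \<partial>M)"
    by (rule pair.Fubini') measurable
  also have "\<dots> = (\<integral>\<^sup>+y. epowr (ennreal (f y)) q \<partial>M)"
    using t p_total p_sym by (simp add: nn_integral_multc)
  finally show ?thesis .
qed

end

section \<open>The maximal theorem\<close>

text \<open>The source of a priori finiteness for absorption. The bound implicit in it grows with n,
  and this is harmless because only finiteness is retained.\<close>

lemma nn_integral_epowr_sum_finite:
  fixes g :: "nat \<Rightarrow> 'a \<Rightarrow> ennreal"
  assumes "\<And>i. i < n \<Longrightarrow> g i \<in> borel_measurable M" "0 < r"
    "\<And>i. i < n \<Longrightarrow> (\<integral>\<^sup>+x. epowr (g i x) r \<partial>M) < top"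
  shows "(\<integral>\<^sup>+x. epowr (\<Sum>i<n. g i x) r \<partial>M) < top"
  using assms
proof (induction n)
  case (Suc n)
  have [measurable]: "\<And>i. i < Suc n \<Longrightarrow> g i \<in> borel_measurable M" by (rule Suc.prems)
  then have [measurable]: "(\<lambda>x. \<Sum>i<n. g i x) \<in> borel_measurable M" "g n \<in> borel_measurable M" by auto
  have "(\<integral>\<^sup>+x. epowr (\<Sum>i<Suc n. g i x) r \<partial>M)
    \<le> (\<integral>\<^sup>+x. ennreal (2 powr r) * (epowr (\<Sum>i<n. g i x) r + epowr (g n x) r) \<partial>M)"
    unfolding sum.lessThan_Suc using Suc.prems by (intro nn_integral_mono epowr_add_le) auto
  also have "\<dots> = ennreal (2 powr r) * ((\<integral>\<^sup>+x. epowr (\<Sum>i<n. g i x) r \<partial>M) + (\<integral>\<^sup>+x. epowr (g n x) r \<partial>M))"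
    by (simp add: nn_integral_cmult nn_integral_add)
  also have "\<dots> < top"
    using Suc by (auto simp: ennreal_mult_less_top)
  finally show ?case .
qed simp

lemma layer_cake:
  assumes "0 < r" "0 \<le> a"
  shows "(\<integral>\<^sup>+l. ennreal (l powr (r - 1)) * indicator {0<..<a} l \<partial>lborel) = ennreal (a powr r / r)"
proof -
  have ne: "AE l in lborel. l \<noteq> (0::real)" "AE l in lborel. l \<noteq> (a::real)"
    by (rule AE_lborel_singleton)+
  have "AE l in lborel. ennreal (l powr (r - 1)) * indicator {0<..<a} l = ennreal (l powr (r - 1)) * indicator {0..a} l"
    using ne by eventually_elim (auto split: split_indicator)
  then have "(\<integral>\<^sup>+l. ennreal (l powr (r - 1)) * indicator {0<..<a} l \<partial>lborel)
    = (\<integral>\<^sup>+l\<in>{0..a}. ennreal (l powr (r - 1)) \<partial>lborel)"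
    by (rule nn_integral_cong_AE)
  then show ?thesis using nn_integral_powr_0[OF assms] by simp
qed

context poisson_kernel
begin

lemma integrable_of_Lp:
  assumes [measurable]: "f \<in> borel_measurable M" and "1 \<le> r" "(\<integral>\<^sup>+x. epowr (ennreal \<bar>f x\<bar>) r \<partial>M) < top"
  shows "integrable M f"
proof -
  have le: "ennreal \<bar>f x\<bar> \<le> 1 + epowr (ennreal \<bar>f x\<bar>) r" for x
  proof (cases "\<bar>f x\<bar> \<le> 1")
    case False
    then have "\<bar>f x\<bar> powr 1 \<le> \<bar>f x\<bar> powr r" using assms by (intro powr_mono) auto
    then have "\<bar>f x\<bar> \<le> \<bar>f x\<bar> powr r" by simp
    then show ?thesis by (simp add: epowr_ennreal ennreal_leI add_increasing)
  qed (simp add: add_increasing2)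
  have "(\<integral>\<^sup>+x. ennreal (norm (f x)) \<partial>M) \<le> (\<integral>\<^sup>+x. 1 + epowr (ennreal \<bar>f x\<bar>) r \<partial>M)"
    unfolding real_norm_def by (intro nn_integral_mono le)
  also have "\<dots> = emeasure M (space M) + (\<integral>\<^sup>+x. epowr (ennreal \<bar>f x\<bar>) r \<partial>M)"
    by (subst nn_integral_add) auto
  also have "\<dots> < \<infinity>" using assms by (simp add: less_top[symmetric])
  finally show ?thesis by (simp add: integrable_iff_bounded)
qed

lemma Q_const: "0 < t \<Longrightarrow> Q 0 t (\<lambda>_. c) x = c"
proof -
  assume t: "0 < t"
  have "ennreal (Q 0 t (\<lambda>_. 1) x) = 1"
    using t p_total by (subst Q_nn_integral) auto
  then have "Q 0 t (\<lambda>_. 1) x = 1"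
    using Q_nonneg[of "\<lambda>_. 1" t x] t by simp
  then show ?thesis unfolding Q_def by simp
qed

lemma Q_integral_real:
  assumes "integrable M f" "\<And>y. 0 \<le> f y" "0 < t"
  shows "(\<integral>x. Q 0 t f x \<partial>M) = (\<integral>x. f x \<partial>M)"
  using assms by (simp add: integral_eq_nn_integral Q_integral Q_nonneg Q_integrable borel_measurable_integrable)

text \<open>The powers of the operator P_h. The power 0 has to be set apart, since the kernel is
  specified at positive times only.\<close>

definition iter :: "real \<Rightarrow> ('a \<Rightarrow> real) \<Rightarrow> nat \<Rightarrow> 'a \<Rightarrow> real" where
  "iter h f j x = (if j = 0 then f x else Q 0 (real j * h) f x)"

text \<open>The maximal function of the ergodic averages of P_h, truncated at n so that it lies in
  L^r whenever f does.\<close>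

definition ergodic_max :: "real \<Rightarrow> ('a \<Rightarrow> real) \<Rightarrow> nat \<Rightarrow> 'a \<Rightarrow> real" where
  "ergodic_max h f n x = Max ((\<lambda>k. (\<Sum>j\<le>k. iter h f j x) / real (Suc k)) ` {..n})"

lemma iter_integrable: "integrable M f \<Longrightarrow> 0 < h \<Longrightarrow> integrable M (iter h f j)"
  unfolding iter_def[abs_def] by (cases "j = 0") (auto intro!: Q_integrable simp: fun_eq_iff[symmetric])

lemma iter_nonneg: "(\<And>y. 0 \<le> f y) \<Longrightarrow> 0 < h \<Longrightarrow> 0 \<le> iter h f j x"
  unfolding iter_def by (auto intro!: Q_nonneg)

lemma iter_Suc:
  assumes "integrable M f" "0 < h"
  shows "Q 0 h (iter h f j) x = iter h f (Suc j) x"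
proof (cases "j = 0")
  case True
  have "iter h f 0 = f" by (rule ext) (simp add: iter_def)
  then show ?thesis using True by (simp add: iter_def)
next
  case False
  then have "iter h f j = Q 0 (real j * h) f" by (auto simp: iter_def)
  then show ?thesis
    using False assms by (simp add: iter_def Q_semigroup_0 algebra_simps)
qed

text \<open>The maximal ergodic theorem (Hopf), with Garsia's proof.\<close>

lemma maximal_ergodic:
  assumes f: "integrable M f" "\<And>y. 0 \<le> f y" and h: "0 < h" and l: "0 < l"
  shows "ennreal l * emeasure M {x. l < ergodic_max h f n x} \<le> (\<integral>\<^sup>+x. ennreal (f x) * indicator {x. l < ergodic_max h f n x} x \<partial>M)"
proof -
  define R where "R k x = (\<Sum>j<k. iter h f j x - l)" for k x
  have R_int [intro]: "integrable M (R k)" for k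
    unfolding R_def[abs_def] using f h by (auto intro!: iter_integrable)
  \<comment> \<open>P_h maps the partial sum with k terms to the one with k + 1 terms without its
    initial term; it fixes the constant l because the kernel has mass 1.\<close>
  have R_Suc: "R (Suc k) x = f x - l + Q 0 h (R k) x" for k x
  proof -
    have "Q 0 h (R k) x = (\<integral>y. (\<Sum>j<k. p 0 h x y * (iter h f j y - l)) \<partial>M)"
      unfolding Q_def R_def by (simp add: sum_distrib_left)
    also have "\<dots> = (\<Sum>j<k. Q 0 h (\<lambda>y. iter h f j y - l) x)"
      unfolding Q_def using f h by (intro Bochner_Integration.integral_sum p_integrable) (auto intro: iter_integrable)
    also have "\<dots> = (\<Sum>j<k. iter h f (Suc j) x - l)"
      using f h by (intro sum.cong) (simp_all add: Q_diff iter_integrable Q_const iter_Suc)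
    finally have "Q 0 h (R k) x = (\<Sum>j<k. iter h f (Suc j) x - l)" .
    moreover have "R (Suc k) x = (iter h f 0 x - l) + (\<Sum>j<k. iter h f (Suc j) x - l)"
      unfolding R_def by (rule sum.lessThan_Suc_shift)
    ultimately show ?thesis by (simp add: iter_def)
  qed
  \<comment> \<open>The index 0, where the sum is empty, belongs to the maximum and makes G
    nonnegative; G > 0 means that some nonempty partial sum is positive.\<close>
  define G where "G x = Max ((\<lambda>k. R k x) ` {..Suc n})" for x
  have G_int: "integrable M G"
    unfolding G_def[abs_def] by (intro integrable_MAX) auto
  then have [measurable]: "G \<in> borel_measurable M" by auto
  have R_le: "R k x \<le> G x" if "k \<le> Suc n" for k x
    unfolding G_def using that by (intro Max_ge) auto
  have G_nn: "0 \<le> G x" for x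
    using R_le[of 0 x] by (simp add: R_def)
  have G_obtain: "\<exists>k\<le>Suc n. G x = R k x" for x
  proof -
    have "G x \<in> (\<lambda>k. R k x) ` {..Suc n}" unfolding G_def by (intro Max_in) auto
    then show ?thesis by auto
  qed
  have E: "{x. l < ergodic_max h f n x} = {x. 0 < G x}"
  proof (rule Collect_cong)
    fix x
    have "l < ergodic_max h f n x \<longleftrightarrow> (\<exists>k\<le>n. l < (\<Sum>j\<le>k. iter h f j x) / real (Suc k))"
      unfolding ergodic_max_def by (subst Max_gr_iff) auto
    also have "\<dots> \<longleftrightarrow> (\<exists>k\<le>n. 0 < R (Suc k) x)"
      by (intro ex_cong1 conj_cong refl) (simp add: R_def sum_subtractf lessThan_Suc_atMost field_simps del: of_nat_Suc sum.lessThan_Suc)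
    also have "\<dots> \<longleftrightarrow> 0 < G x"
    proof
      assume "\<exists>k\<le>n. 0 < R (Suc k) x"
      then obtain k where "k \<le> n" "0 < R (Suc k) x" by auto
      then show "0 < G x" using R_le[of "Suc k" x] by simp
    next
      assume G: "0 < G x"
      obtain k where k: "k \<le> Suc n" "G x = R k x" using G_obtain by auto
      have "R 0 x = 0" by (simp add: R_def)
      with G k have "k \<noteq> 0" by (metis less_irrefl)
      then obtain k' where "k = Suc k'" by (cases k) auto
      then show "\<exists>k\<le>n. 0 < R (Suc k) x" using k G by auto
    qed
    finally show "l < ergodic_max h f n x \<longleftrightarrow> 0 < G x" .
  qed
  define E' where "E' = {x. 0 < G x}"
  have [measurable]: "E' \<in> sets M"
  proof -
    have "E' = {x \<in> space M. 0 < G x}" by (simp add: E'_def)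
    also have "\<dots> \<in> sets M" by measurable
    finally show ?thesis .
  qed
  have QG: "integrable M (Q 0 h G)" "\<And>x. 0 \<le> Q 0 h G x" "(\<integral>x. Q 0 h G x \<partial>M) = (\<integral>x. G x \<partial>M)"
    using G_int G_nn h by (auto intro!: Q_integrable Q_nonneg Q_integral_real)
  \<comment> \<open>Garsia's inequality. Where G > 0, the maximal partial sum is f - l plus P_h of a
    shorter one, hence at most f - l + P_h G; where G = 0, the left side is 0 and P_h G is
    nonnegative. Integration cancels G against P_h G.\<close>
  have key: "indicator E' x * (f x - l) \<ge> G x - Q 0 h G x" for x
  proof (cases "0 < G x")
    case True
    obtain k where k: "k \<le> Suc n" "G x = R k x" using G_obtain by auto
    have "R 0 x = 0" by (simp add: R_def)
    with True k have "k \<noteq> 0" by (metis less_irrefl)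
    then obtain k' where k': "k = Suc k'" by (cases k) auto
    have "G x = f x - l + Q 0 h (R k') x" unfolding k(2) k' by (rule R_Suc)
    also have "Q 0 h (R k') x \<le> Q 0 h G x"
      using k k' h G_int by (intro Q_mono R_le) auto
    finally show ?thesis using True by (simp add: E'_def)
  next
    case False
    then have "G x = 0" using G_nn[of x] by simp
    then show ?thesis using False QG(2)[of x] by (simp add: E'_def)
  qed
  have "0 = (\<integral>x. G x - Q 0 h G x \<partial>M)"
    using G_int QG by simp
  also have "\<dots> \<le> (\<integral>x. indicator E' x * (f x - l) \<partial>M)"
    using f G_int QG by (intro integral_mono key integrable_real_mult_indicator
        Bochner_Integration.integrable_diff) (auto simp: mult.commute[of "indicator E' _"] intro!: integrable_real_mult_indicator)
  also have "\<dots> = (\<integral>x. indicator E' x * f x \<partial>M) - l * measure M E'"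
  proof -
    have "integrable M (\<lambda>x. indicator E' x * f x)" "integrable M (\<lambda>x. l * indicator E' x)"
      using f by (auto simp: mult.commute[of "indicator E' _"] less_top[symmetric]
          intro!: integrable_real_mult_indicator integrable_mult_right integrable_real_indicator)
    then show ?thesis
      by (simp add: right_diff_distrib mult.commute[of _ l])
  qed
  finally have le: "l * measure M E' \<le> (\<integral>x. indicator E' x * f x \<partial>M)" by simp
  have "ennreal l * emeasure M E' = ennreal (l * measure M E')"
    using l by (simp add: emeasure_eq_measure ennreal_mult)
  also have "\<dots> \<le> ennreal (\<integral>x. indicator E' x * f x \<partial>M)" by (intro ennreal_leI le)
  also have "\<dots> = (\<integral>\<^sup>+x. ennreal (indicator E' x * f x) \<partial>M)"
    using f by (intro nn_integral_eq_integral[symmetric])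
      (auto simp: mult.commute[of "indicator E' _"] integrable_real_mult_indicator)
  also have "\<dots> = (\<integral>\<^sup>+x. ennreal (f x) * indicator E' x \<partial>M)"
    by (intro nn_integral_cong) (auto split: split_indicator)
  finally show ?thesis unfolding E E'_def .
qed

lemma ergodic_max_measurable [measurable]:
  assumes "integrable M f" "0 < h"
  shows "ergodic_max h f n \<in> borel_measurable M"
proof -
  have [measurable]: "iter h f j \<in> borel_measurable M" for j
    using iter_integrable[OF assms] by auto
  show ?thesis unfolding ergodic_max_def[abs_def] by measurable
qed

lemma ergodic_max_nonneg:
  assumes "\<And>y. 0 \<le> f y" "0 < h"
  shows "0 \<le> ergodic_max h f n x"
proof -
  have "0 \<le> iter h f 0 x" using assms by (intro iter_nonneg)
  also have "\<dots> \<le> ergodic_max h f n x"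
    unfolding ergodic_max_def by (intro Max_ge) (auto intro!: image_eqI[of _ _ 0])
  finally show ?thesis .
qed

text \<open>The usual passage from a weak-type bound to L^r, by integrating over the levels l. It
  leaves r / (r - 1) times the integral of f a^(r-1), with a the ergodic maximal function; Young's
  inequality with K = 2 r / (r - 1) splits this so that half of the left side can be
  absorbed.\<close>

lemma ergodic_max_Lp:
  assumes r: "1 < r" and f: "integrable M f" "\<And>y. 0 \<le> f y" "(\<integral>\<^sup>+x. epowr (ennreal (f x)) r \<partial>M) < top" and h: "0 < h"
  shows "(\<integral>\<^sup>+x. epowr (ennreal (ergodic_max h f n x)) r \<partial>M)
    \<le> ennreal (2 * (r / (r - 1)) * (2 * (r / (r - 1))) powr (r - 1)) * (\<integral>\<^sup>+x. epowr (ennreal (f x)) r \<partial>M)"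
proof -
  let ?a = "ergodic_max h f n" and ?c = "r / (r - 1)"
  let ?X = "\<integral>\<^sup>+x. epowr (ennreal (?a x)) r \<partial>M" and ?F = "\<integral>\<^sup>+x. epowr (ennreal (f x)) r \<partial>M"
  have c: "0 < ?c" using r by simp
  have [measurable]: "f \<in> borel_measurable M" "?a \<in> borel_measurable M" using f h by (auto intro: ergodic_max_measurable)
  have a_nn: "0 \<le> ?a x" for x using f h by (intro ergodic_max_nonneg)
  interpret prod_lborel: pair_sigma_finite M "lborel :: real measure" by standard
  let ?I = "\<lambda>x (l::real). indicator {0<..<?a x} l :: ennreal"
  have I_meas [measurable]: "(\<lambda>(x, l). ?I x l) \<in> borel_measurable (M \<Otimes>\<^sub>M lborel)"
    unfolding greaterThanLessThan_def greaterThan_def lessThan_def by measurable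
  \<comment> \<open>Each average is at most the sum of the finitely many iterates, all of which are
    in L^r.\<close>
  have fin: "?X < top"
  proof -
    have "?a x \<le> (\<Sum>j<Suc n. iter h f j x)" for x
      unfolding ergodic_max_def
    proof (subst Max_le_iff; (intro ballI)?)
      fix z assume "z \<in> (\<lambda>k. (\<Sum>j\<le>k. iter h f j x) / real (Suc k)) ` {..n}"
      then obtain k where k: "k \<le> n" "z = (\<Sum>j\<le>k. iter h f j x) / real (Suc k)" by auto
      have nn: "0 \<le> (\<Sum>j\<le>k. iter h f j x)" using f h by (intro sum_nonneg iter_nonneg)
      have "z \<le> (\<Sum>j\<le>k. iter h f j x) / 1" unfolding k(2) by (rule divide_left_mono) (use nn in auto)
      also have "\<dots> \<le> (\<Sum>j<Suc n. iter h f j x)"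
        unfolding lessThan_Suc_atMost div_by_1 using k f h by (intro sum_mono2) (auto intro: iter_nonneg)
      finally show "z \<le> (\<Sum>j<Suc n. iter h f j x)" .
    qed auto
    then have "?X \<le> (\<integral>\<^sup>+x. epowr (\<Sum>j<Suc n. ennreal (iter h f j x)) r \<partial>M)"
      using r f h by (intro nn_integral_mono epowr_mono) (auto simp: sum_ennreal iter_nonneg ennreal_leI simp del: sum.lessThan_Suc)
    also have "\<dots> < top"
    proof (rule nn_integral_epowr_sum_finite)
      fix j
      show "(\<lambda>x. ennreal (iter h f j x)) \<in> borel_measurable M"
        using iter_integrable[OF f(1) h] by auto
      show "(\<integral>\<^sup>+x. epowr (ennreal (iter h f j x)) r \<partial>M) < top"
      proof (cases "j = 0")
        case False
        have "(\<integral>\<^sup>+x. epowr (ennreal (Q 0 (real j * h) f x)) r \<partial>M) \<le> ennreal (2 powr r) * ?F"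
          using r f h False by (intro Q_power_integral_le) auto
        also have "\<dots> < top" using f by (simp add: ennreal_mult_less_top)
        finally show ?thesis using False by (simp add: iter_def)
      qed (use f in \<open>simp add: iter_def\<close>)
    qed (use r in auto)
    finally show ?thesis .
  qed
  have "ennreal (1 / r) * ?X = (\<integral>\<^sup>+x. ennreal (1 / r) * epowr (ennreal (?a x)) r \<partial>M)"
    by (simp add: nn_integral_cmult)
  also have "\<dots> = (\<integral>\<^sup>+x. \<integral>\<^sup>+l. ennreal (l powr (r - 1)) * ?I x l \<partial>lborel \<partial>M)"
    using r a_nn by (intro nn_integral_cong) (simp add: layer_cake epowr_ennreal flip: ennreal_mult)
  also have "\<dots> = (\<integral>\<^sup>+l. \<integral>\<^sup>+x. ennreal (l powr (r - 1)) * ?I x l \<partial>M \<partial>lborel)"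
    by (rule prod_lborel.Fubini'[symmetric]) measurable
  \<comment> \<open>One factor l is split off from l^(r-1) and traded for f by the maximal ergodic
    theorem at level l.\<close>
  also have "\<dots> \<le> (\<integral>\<^sup>+l. \<integral>\<^sup>+x. ennreal (l powr (r - 1 - 1)) * ?I x l * ennreal (f x) \<partial>M \<partial>lborel)"
  proof (rule nn_integral_mono)
    fix l :: real
    show "(\<integral>\<^sup>+x. ennreal (l powr (r - 1)) * ?I x l \<partial>M) \<le> (\<integral>\<^sup>+x. ennreal (l powr (r - 1 - 1)) * ?I x l * ennreal (f x) \<partial>M)"
    proof (cases "0 < l")
      case True
      have meas: "{x. l < ?a x} \<in> sets M"
      proof -
        have "{x. l < ?a x} = {x \<in> space M. l < ?a x}" by simp
        also have "\<dots> \<in> sets M" by measurable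
        finally show ?thesis .
      qed
      have I: "?I x l = indicator {x. l < ?a x} x" for x using True by (auto split: split_indicator)
      have l_eq: "l powr (r - 1) = l powr (r - 1 - 1) * l"
        using powr_add[of l "r - 1 - 1" 1] True by simp
      have "(\<integral>\<^sup>+x. ennreal (l powr (r - 1)) * ?I x l \<partial>M) = ennreal (l powr (r - 1 - 1) * l) * emeasure M {x. l < ?a x}"
        unfolding I l_eq using meas by (simp add: nn_integral_cmult)
      also have "ennreal (l powr (r - 1 - 1) * l) * emeasure M {x. l < ?a x} = ennreal (l powr (r - 1 - 1)) * (ennreal l * emeasure M {x. l < ?a x})"
        using True by (simp add: mult.assoc[symmetric] flip: ennreal_mult)
      also have "\<dots> \<le> ennreal (l powr (r - 1 - 1)) * (\<integral>\<^sup>+x. ennreal (f x) * indicator {x. l < ?a x} x \<partial>M)"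
        using f h True by (intro mult_left_mono maximal_ergodic) auto
      also have "\<dots> = (\<integral>\<^sup>+x. ennreal (l powr (r - 1 - 1)) * ?I x l * ennreal (f x) \<partial>M)"
        unfolding I using meas by (subst nn_integral_cmult[symmetric]) (auto simp: mult_ac)
      finally show ?thesis .
    next
      case False
      then have "?I x l = 0" for x by auto
      then show ?thesis by simp
    qed
  qed
  also have "\<dots> = (\<integral>\<^sup>+x. \<integral>\<^sup>+l. ennreal (l powr (r - 1 - 1)) * ?I x l * ennreal (f x) \<partial>lborel \<partial>M)"
    by (rule prod_lborel.Fubini') measurable
  also have "\<dots> = (\<integral>\<^sup>+x. ennreal (1 / (r - 1)) * (ennreal (f x) * epowr (ennreal (?a x)) (r - 1)) \<partial>M)"
  proof (rule nn_integral_cong)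
    fix x
    have "(\<integral>\<^sup>+l. ennreal (l powr (r - 1 - 1)) * ?I x l * ennreal (f x) \<partial>lborel)
      = (\<integral>\<^sup>+l. ennreal (l powr (r - 1 - 1)) * ?I x l \<partial>lborel) * ennreal (f x)"
      by (rule nn_integral_multc) measurable
    also have "\<dots> = ennreal (?a x powr (r - 1) / (r - 1)) * ennreal (f x)"
      using r a_nn by (subst layer_cake) auto
    finally show "(\<integral>\<^sup>+l. ennreal (l powr (r - 1 - 1)) * ?I x l * ennreal (f x) \<partial>lborel)
      = ennreal (1 / (r - 1)) * (ennreal (f x) * epowr (ennreal (?a x)) (r - 1))"
      using r a_nn f by (simp add: epowr_ennreal mult_ac flip: ennreal_mult)
  qed
  also have "\<dots> = ennreal (1 / (r - 1)) * (\<integral>\<^sup>+x. ennreal (f x) * epowr (ennreal (?a x)) (r - 1) \<partial>M)"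
    by (rule nn_integral_cmult) measurable
  also have "\<dots> \<le> ennreal (1 / (r - 1)) * (\<integral>\<^sup>+x. ennreal ((2 * ?c) powr (r - 1)) * epowr (ennreal (f x)) r
        + ennreal (1 / (2 * ?c)) * epowr (ennreal (?a x)) r \<partial>M)"
    using r c by (intro mult_left_mono nn_integral_mono young_split) auto
  also have "\<dots> = ennreal (1 / (r - 1)) * (ennreal ((2 * ?c) powr (r - 1)) * ?F + ennreal (1 / (2 * ?c)) * ?X)"
    by (simp add: nn_integral_add nn_integral_cmult)
  finally have "ennreal r * (ennreal (1 / r) * ?X)
    \<le> ennreal r * (ennreal (1 / (r - 1)) * (ennreal ((2 * ?c) powr (r - 1)) * ?F + ennreal (1 / (2 * ?c)) * ?X))"
    by (rule mult_left_mono) simp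
  also have "\<dots> = ennreal ?c * (ennreal ((2 * ?c) powr (r - 1)) * ?F) + ennreal (1 / 2) * ?X"
    using r by (simp add: distrib_left mult.assoc[symmetric] del: ennreal_half flip: ennreal_mult)
  also have "ennreal r * (ennreal (1 / r) * ?X) = ?X"
    using r by (simp add: mult.assoc[symmetric] flip: ennreal_mult)
  finally have "?X \<le> ennreal ?c * (ennreal ((2 * ?c) powr (r - 1)) * ?F) + ennreal (1 / 2) * ?X" .
  then have "?X \<le> 2 * (ennreal ?c * (ennreal ((2 * ?c) powr (r - 1)) * ?F))"
    by (rule ennreal_absorb[OF fin])
  also have "\<dots> = ennreal (2 * ?c * (2 * ?c) powr (r - 1)) * ?F"
  proof -
    have "2 * (ennreal u * (ennreal v * w)) = ennreal (2 * u * v) * w" if "0 < u" "0 \<le> v" for u v w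
      using that by (simp add: ennreal_mult mult.assoc)
    from this[OF c] show ?thesis by simp
  qed
  finally show ?thesis .
qed

text \<open>Harnack's inequality bounds \<open>P\<^bsub>Kh\<^esub> f\<close> by twice the average of \<open>P\<^bsub>jh\<^esub> f\<close> over \<open>j \<le> K\<close>, so the
  maximal function of the semigroup is controlled by that of the ergodic averages.\<close>

lemma Q_le_ergodic_max:
  assumes f: "integrable M f" "\<And>y. 0 \<le> f y" and h: "0 < h" and K: "k \<le> n"
  shows "Q 0 (real (Suc k) * h) f x \<le> 2 * ergodic_max h f (Suc n) x"
proof -
  define K where "K = Suc k"
  have K0: "0 < real K" by (simp add: K_def)
  have "real K / 2 * Q 0 (real K * h) f x \<le> (\<Sum>j\<le>K. iter h f j x) - 1 / 2 * Q 0 (real K * h) f x"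
  proof -
    \<comment> \<open>Harnack's inequality between the times j h and K h costs the factor K / j. The
      weights j / K add up to (K + 1) / 2, which is half the number of terms of the average over 0,
      ..., K.\<close>
    have *: "(\<Sum>j=1..K. real j / real K * Q 0 (real K * h) f x) \<le> (\<Sum>j=1..K. iter h f j x)"
    proof (rule sum_mono)
      fix j assume j: "j \<in> {1..K}"
      have "Q 0 (real K * h) f x \<le> (real K * h) / (real j * h) * Q 0 (real j * h) f x"
        using j h f by (intro Q_harnack) auto
      then show "real j / real K * Q 0 (real K * h) f x \<le> iter h f j x"
        using j h K0 by (simp add: iter_def field_simps)
    qed
    have "(\<Sum>j=1..K. real j) = real K * (real K + 1) / 2"
      by (induction K) (auto simp: field_simps)
    moreover have "(\<Sum>j=1..K. real j / real K * Q 0 (real K * h) f x) = (\<Sum>j=1..K. real j) / real K * Q 0 (real K * h) f x"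
      by (simp only: sum_divide_distrib sum_distrib_right)
    ultimately have "(\<Sum>j=1..K. real j / real K * Q 0 (real K * h) f x)
        = (real K * (real K + 1) / 2) / real K * Q 0 (real K * h) f x"
      by (simp only:)
    also have "\<dots> = (real K + 1) / 2 * Q 0 (real K * h) f x" using K0 by simp
    finally have "(\<Sum>j=1..K. real j / real K * Q 0 (real K * h) f x) = (real K + 1) / 2 * Q 0 (real K * h) f x" .
    moreover have "(\<Sum>j=1..K. iter h f j x) \<le> (\<Sum>j\<le>K. iter h f j x)"
      using f h by (intro sum_mono2) (auto intro: iter_nonneg)
    ultimately show ?thesis using * by (simp add: field_simps)
  qed
  then have "Q 0 (real K * h) f x * real (Suc K) \<le> 2 * (\<Sum>j\<le>K. iter h f j x)"
    by (simp add: field_simps)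
  then have "Q 0 (real K * h) f x \<le> 2 * ((\<Sum>j\<le>K. iter h f j x) / real (Suc K))"
    by (simp add: field_simps)
  also have "\<dots> \<le> 2 * ergodic_max h f (Suc n) x"
    unfolding ergodic_max_def using K
    by (intro mult_left_mono Max_ge) (auto intro!: image_eqI[of _ _ K] simp: K_def)
  finally show ?thesis by (simp add: K_def)
qed

definition max_const :: "real \<Rightarrow> real" where
  "max_const r = 2 powr r * (2 * (r / (r - 1)) * (2 * (r / (r - 1))) powr (r - 1))"

lemma max_const_pos: "1 < r \<Longrightarrow> 0 < max_const r"
  by (simp add: max_const_def)

text \<open>The constant does not depend on h, so the grid may be refined with the problem. The
  extra factor 2^r in \<open>max_const\<close> pays for the 2 lost in passing to ergodic
  averages.\<close>

lemma maximal_inequality: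
  assumes r: "1 < r" and f: "integrable M f" "\<And>y. 0 \<le> f y" "(\<integral>\<^sup>+x. epowr (ennreal (f x)) r \<partial>M) < top" and h: "0 < h"
  shows "(\<integral>\<^sup>+x. epowr (\<Squnion>k. ennreal (Q 0 (real (Suc k) * h) f x)) r \<partial>M)
    \<le> ennreal (max_const r) * (\<integral>\<^sup>+x. epowr (ennreal (f x)) r \<partial>M)"
proof -
  have [measurable]: "f \<in> borel_measurable M" using f by auto
  let ?s = "\<lambda>n x. \<Squnion>k\<in>{..n}. ennreal (Q 0 (real (Suc k) * h) f x)"
  have SUP: "(\<Squnion>k. ennreal (Q 0 (real (Suc k) * h) f x)) = (\<Squnion>n. ?s n x)" for x
    by (intro antisym SUP_least) (auto intro!: SUP_upper2[of k UNIV for k] SUP_upper)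
  have "(\<integral>\<^sup>+x. epowr (\<Squnion>k. ennreal (Q 0 (real (Suc k) * h) f x)) r \<partial>M)
    = (\<integral>\<^sup>+x. (\<Squnion>n. epowr (?s n x) r) \<partial>M)"
    unfolding SUP using r by (subst epowr_SUP) auto
  also have "\<dots> = (\<Squnion>n. \<integral>\<^sup>+x. epowr (?s n x) r \<partial>M)"
  proof (rule nn_integral_monotone_convergence_SUP)
    show "incseq (\<lambda>n x. epowr (?s n x) r)"
      using r by (intro incseq_SucI le_funI epowr_mono SUP_subset_mono) auto
  qed measurable
  also have "\<dots> \<le> ennreal (max_const r) * (\<integral>\<^sup>+x. epowr (ennreal (f x)) r \<partial>M)"
  proof (rule SUP_least)
    fix n
    have "(\<integral>\<^sup>+x. epowr (?s n x) r \<partial>M) \<le> (\<integral>\<^sup>+x. ennreal (2 powr r) * epowr (ennreal (ergodic_max h f (Suc n) x)) r \<partial>M)"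
    proof (rule nn_integral_mono)
      fix x
      have "?s n x \<le> ennreal (2 * ergodic_max h f (Suc n) x)"
        using f h by (intro SUP_least ennreal_leI Q_le_ergodic_max) auto
      then have "epowr (?s n x) r \<le> epowr (ennreal (2 * ergodic_max h f (Suc n) x)) r"
        using r by (intro epowr_mono) auto
      also have "\<dots> = ennreal (2 powr r) * epowr (ennreal (ergodic_max h f (Suc n) x)) r"
        using ergodic_max_nonneg[of f h "Suc n" x] f h
        by (subst epowr_ennreal) (auto simp: epowr_ennreal powr_mult simp flip: ennreal_mult)
      finally show "epowr (?s n x) r \<le> ennreal (2 powr r) * epowr (ennreal (ergodic_max h f (Suc n) x)) r" .
    qed
    also have "\<dots> = ennreal (2 powr r) * (\<integral>\<^sup>+x. epowr (ennreal (ergodic_max h f (Suc n) x)) r \<partial>M)"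
      using f h by (intro nn_integral_cmult) (auto intro!: epowr_measurable ergodic_max_measurable measurable_compose[OF _ measurable_ennreal])
    also have "\<dots> \<le> ennreal (2 powr r) * (ennreal (2 * (r / (r - 1)) * (2 * (r / (r - 1))) powr (r - 1)) * (\<integral>\<^sup>+x. epowr (ennreal (f x)) r \<partial>M))"
      by (intro mult_left_mono ergodic_max_Lp assms) auto
    also have "\<dots> = ennreal (max_const r) * (\<integral>\<^sup>+x. epowr (ennreal (f x)) r \<partial>M)"
      using r unfolding max_const_def by (subst ennreal_mult[of "2 powr r"]) (auto simp: mult.assoc)
    finally show "(\<integral>\<^sup>+x. epowr (?s n x) r \<partial>M) \<le> ennreal (max_const r) * (\<integral>\<^sup>+x. epowr (ennreal (f x)) r \<partial>M)" .
  qed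
  finally show ?thesis .
qed

end

section \<open>The vector-valued inequality\<close>

text \<open>Young's inequality after normalising both norms to 1. The factors 1 / q and 1 / q' are
  dropped there, which makes the constant 2; if a norm vanishes, so does every product.\<close>

lemma sum_mult_le_Hoelder:
  fixes x y :: "nat \<Rightarrow> real"
  assumes q: "1 < q" and nn: "\<And>i. i < n \<Longrightarrow> 0 \<le> x i" "\<And>i. i < n \<Longrightarrow> 0 \<le> y i"
  shows "(\<Sum>i<n. x i * y i) \<le> 2 * ((\<Sum>i<n. x i powr q) powr (1 / q) * (\<Sum>i<n. y i powr (q / (q - 1))) powr (1 / (q / (q - 1))))"
proof -
  define q' where "q' = q / (q - 1)"
  have q': "1 < q'" "1 / q + 1 / q' = 1" using q by (auto simp: q'_def field_simps)
  define X where "X = (\<Sum>i<n. x i powr q) powr (1 / q)"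
  define Y where "Y = (\<Sum>i<n. y i powr q') powr (1 / q')"
  have Xq: "X powr q = (\<Sum>i<n. x i powr q)"
    unfolding X_def using q by (simp add: powr_powr sum_nonneg)
  have Yq: "Y powr q' = (\<Sum>i<n. y i powr q')"
    unfolding Y_def using q' by (simp add: powr_powr sum_nonneg)
  have nnXY: "0 \<le> X" "0 \<le> Y" by (auto simp: X_def Y_def)
  have "(\<Sum>i<n. x i * y i) \<le> 2 * (X * Y)"
  proof (cases "X = 0 \<or> Y = 0")
    case True
    have "x i * y i = 0" if "i < n" for i
      using True
    proof
      assume "X = 0"
      then have "(\<Sum>i<n. x i powr q) = 0" using Xq by simp
      then have "\<forall>i\<in>{..<n}. x i powr q = 0" by (subst (asm) sum_nonneg_eq_0_iff) auto
      then show ?thesis using that by auto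
    next
      assume "Y = 0"
      then have "(\<Sum>i<n. y i powr q') = 0" using Yq by simp
      then have "\<forall>i\<in>{..<n}. y i powr q' = 0" by (subst (asm) sum_nonneg_eq_0_iff) auto
      then show ?thesis using that by auto
    qed
    then have "(\<Sum>i<n. x i * y i) = 0" by (intro sum.neutral) auto
    then show ?thesis using nnXY by simp
  next
    case False
    then have pos: "0 < X" "0 < Y" using nnXY by auto
    have "(\<Sum>i<n. (x i / X) * (y i / Y)) \<le> (\<Sum>i<n. x i powr q / X powr q + y i powr q' / Y powr q')"
    proof (rule sum_mono)
      fix i assume i: "i \<in> {..<n}"
      have "(x i / X) * (y i / Y) \<le> (x i / X) powr q / q + (y i / Y) powr q' / q'"
        using i nn pos q q' by (intro Youngs_inequality) auto
      also have "\<dots> \<le> (x i / X) powr q / 1 + (y i / Y) powr q' / 1"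
        using q q' by (intro add_mono divide_left_mono) auto
      finally show "(x i / X) * (y i / Y) \<le> x i powr q / X powr q + y i powr q' / Y powr q'"
        using i nn pos by (simp add: powr_divide)
    qed
    also have "\<dots> = 2"
      using pos by (simp add: sum.distrib sum_divide_distrib[symmetric] Xq[symmetric] Yq[symmetric])
    finally show ?thesis
      using pos by (simp add: sum_divide_distrib[symmetric] field_simps)
  qed
  then show ?thesis by (simp add: X_def Y_def q'_def)
qed

lemma powr_mult_self:
  assumes "0 \<le> (x::real)" shows "x * x powr (r - 1) = x powr r"
proof -
  have "x * x powr (r - 1) = x powr 1 * x powr (r - 1)" using assms by simp
  also have "\<dots> = x powr r" by (subst powr_add[symmetric]) simp
  finally show ?thesis .
qed

context poisson_kernel
begin

definition dual_const :: "real \<Rightarrow> real" where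
  "dual_const r = 2 * (2 * max_const (r / (r - 1))) powr (r - 1)"

text \<open>The L^r(l^1) bound, dual to the maximal theorem in L^r'(l^\<infinity>). Test the sum S
  of the functions P F_i against S^(r-1), move each operator to the test function by symmetry, and
  dominate all the results by one maximal function. Only times on the grid are covered by that
  maximal function.\<close>

lemma maximal_dual:
  fixes n :: nat
  assumes r: "1 < r" and h: "0 < h"
    and F: "\<And>i. i < n \<Longrightarrow> F i \<in> borel_measurable M" "\<And>i y. i < n \<Longrightarrow> 0 \<le> F i y"
      "\<And>i. i < n \<Longrightarrow> (\<integral>\<^sup>+x. epowr (ennreal (F i x)) r \<partial>M) < top"
  shows "(\<integral>\<^sup>+x. epowr (\<Sum>i<n. ennreal (Q 0 (real (Suc (K i)) * h) (F i) x)) r \<partial>M)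
    \<le> ennreal (dual_const r) * (\<integral>\<^sup>+x. epowr (\<Sum>i<n. ennreal (F i x)) r \<partial>M)"
proof -
  define t where "t i = real (Suc (K i)) * h" for i
  have t: "0 < t i" for i using h by (simp add: t_def)
  define r' where "r' = r / (r - 1)"
  have r': "1 < r'" "(r - 1) * r' = r" using r by (auto simp: r'_def field_simps)
  have F_int: "integrable M (F i)" if "i < n" for i
    using that r F by (intro integrable_of_Lp[of _ r]) auto
  have [measurable]: "i < n \<Longrightarrow> F i \<in> borel_measurable M" for i by (rule F)
  have [measurable]: "i < n \<Longrightarrow> Q 0 (t i) (F i) \<in> borel_measurable M" for i by measurable
  have QF_nn: "0 \<le> Q 0 (t i) (F i) x" if "i < n" for i x
    using that F t by (intro Q_nonneg) auto
  define S where "S x = (\<Sum>i<n. Q 0 (t i) (F i) x)" for x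
  have [measurable]: "S \<in> borel_measurable M" unfolding S_def[abs_def] by measurable
  have S_nn: "0 \<le> S x" for x unfolding S_def using QF_nn by (intro sum_nonneg) auto
  have S_eq: "(\<Sum>i<n. ennreal (Q 0 (t i) (F i) x)) = ennreal (S x)" for x
    unfolding S_def using QF_nn by (intro sum_ennreal) auto
  \<comment> \<open>The extremal test function: its r'-th power is S^r, so the maximal theorem
    returns the left side, to be absorbed.\<close>
  define \<phi> where "\<phi> x = S x powr (r - 1)" for x
  have [measurable]: "\<phi> \<in> borel_measurable M" unfolding \<phi>_def[abs_def] by measurable
  let ?Y = "\<integral>\<^sup>+x. epowr (ennreal (S x)) r \<partial>M"
  have Y_fin: "?Y < top"
    unfolding S_eq[symmetric]
  proof (rule nn_integral_epowr_sum_finite)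
    fix i assume i: "i < n"
    have "(\<integral>\<^sup>+x. epowr (ennreal (Q 0 (t i) (F i) x)) r \<partial>M) \<le> ennreal (2 powr r) * (\<integral>\<^sup>+x. epowr (ennreal (F i x)) r \<partial>M)"
      using i r t F F_int by (intro Q_power_integral_le) auto
    also have "\<dots> < top" using F(3)[OF i] by (simp add: ennreal_mult_less_top)
    finally show "(\<integral>\<^sup>+x. epowr (ennreal (Q 0 (t i) (F i) x)) r \<partial>M) < top" .
  qed (use r in auto)
  have \<phi>_r': "epowr (ennreal \<bar>\<phi> x\<bar>) r' = epowr (ennreal (S x)) r" "epowr (ennreal (\<phi> x)) r' = epowr (ennreal (S x)) r" for x
    using S_nn[of x] r' by (auto simp: \<phi>_def epowr_ennreal powr_powr)
  have \<phi>_nn: "0 \<le> \<phi> x" for x by (simp add: \<phi>_def)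
  have \<phi>_int: "integrable M \<phi>"
    using r' Y_fin by (intro integrable_of_Lp[of _ r']) (auto simp: \<phi>_r')
  define G where "G x = (\<Squnion>k. ennreal (Q 0 (real (Suc k) * h) \<phi> x))" for x
  have [measurable]: "G \<in> borel_measurable M" unfolding G_def[abs_def] by measurable
  have G_le: "(\<integral>\<^sup>+x. epowr (G x) r' \<partial>M) \<le> ennreal (max_const r') * ?Y"
    unfolding G_def \<phi>_r'(2)[symmetric] using r' \<phi>_int h Y_fin
    by (intro maximal_inequality) (auto simp: \<phi>_r' \<phi>_nn)
  have mc: "0 < max_const r'" using r' by (intro max_const_pos)
  have "?Y = (\<integral>\<^sup>+x. (\<Sum>i<n. ennreal (Q 0 (t i) (F i) x) * ennreal (\<phi> x)) \<partial>M)"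
    using S_nn by (intro nn_integral_cong)
      (simp add: sum_distrib_right[symmetric] S_eq \<phi>_def epowr_ennreal powr_mult_self flip: ennreal_mult)
  also have "\<dots> = (\<Sum>i<n. \<integral>\<^sup>+x. ennreal (Q 0 (t i) (F i) x) * ennreal (\<phi> x) \<partial>M)"
    by (rule nn_integral_sum) auto
  also have "\<dots> = (\<Sum>i<n. \<integral>\<^sup>+x. ennreal (F i x) * ennreal (Q 0 (t i) \<phi> x) \<partial>M)"
    using F F_int \<phi>_int t by (intro sum.cong Q_sym) (auto simp: \<phi>_nn)
  also have "\<dots> \<le> (\<Sum>i<n. \<integral>\<^sup>+x. ennreal (F i x) * G x \<partial>M)"
    unfolding G_def t_def by (intro sum_mono nn_integral_mono mult_left_mono SUP_upper) auto
  also have "\<dots> = (\<integral>\<^sup>+x. (\<Sum>i<n. ennreal (F i x) * G x) \<partial>M)"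
    by (rule nn_integral_sum[symmetric]) auto
  also have "\<dots> = (\<integral>\<^sup>+x. (\<Sum>i<n. ennreal (F i x)) * G x \<partial>M)"
    by (simp add: sum_distrib_right)
  also have "\<dots> \<le> (\<integral>\<^sup>+x. ennreal ((2 * max_const r') powr (r - 1)) * epowr (\<Sum>i<n. ennreal (F i x)) r
      + ennreal (1 / (2 * max_const r')) * epowr (G x) r' \<partial>M)"
    unfolding r'_def using r mc[unfolded r'_def] by (intro nn_integral_mono young_split_conj) auto
  also have "\<dots> = ennreal ((2 * max_const r') powr (r - 1)) * (\<integral>\<^sup>+x. epowr (\<Sum>i<n. ennreal (F i x)) r \<partial>M)
      + ennreal (1 / (2 * max_const r')) * (\<integral>\<^sup>+x. epowr (G x) r' \<partial>M)"
    by (subst nn_integral_add) (auto simp: nn_integral_cmult)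
  also have "\<dots> \<le> ennreal ((2 * max_const r') powr (r - 1)) * (\<integral>\<^sup>+x. epowr (\<Sum>i<n. ennreal (F i x)) r \<partial>M)
      + ennreal (1 / (2 * max_const r')) * (ennreal (max_const r') * ?Y)"
    by (intro add_left_mono mult_left_mono G_le) auto
  also have "ennreal (1 / (2 * max_const r')) * (ennreal (max_const r') * ?Y) = ennreal (1 / 2) * ?Y"
    using mc by (simp add: mult.assoc[symmetric] del: ennreal_half flip: ennreal_mult)
  finally have "?Y \<le> 2 * (ennreal ((2 * max_const r') powr (r - 1)) * (\<integral>\<^sup>+x. epowr (\<Sum>i<n. ennreal (F i x)) r \<partial>M))"
    by (rule ennreal_absorb[OF Y_fin])
  also have "\<dots> = ennreal (dual_const r) * (\<integral>\<^sup>+x. epowr (\<Sum>i<n. ennreal (F i x)) r \<partial>M)"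
    by (simp add: dual_const_def r'_def ennreal_mult mult.assoc)
  finally show ?thesis by (simp only: S_eq[symmetric] t_def)
qed

text \<open>The L^r(l^q) inequality for finite families, raised to the power r. The constant is
  uniform in the step h, the number n of functions and the grid times; finiteness of each L^r norm
  is the a priori knowledge for absorption.\<close>

definition vector_bound :: "real \<Rightarrow> real \<Rightarrow> real \<Rightarrow> bool" where
  "vector_bound C q r \<longleftrightarrow> (\<forall>h (n::nat) K F. 0 < h \<longrightarrow>
    (\<forall>i<n. F i \<in> borel_measurable M \<and> (\<forall>y. 0 \<le> F i y) \<and> (\<integral>\<^sup>+x. epowr (ennreal (F i x)) r \<partial>M) < top) \<longrightarrow>
    (\<integral>\<^sup>+x. epowr (\<Sum>i<n. epowr (ennreal (Q 0 (real (Suc (K i)) * h) (F i) x)) q) (r / q) \<partial>M)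
    \<le> ennreal C * (\<integral>\<^sup>+x. epowr (\<Sum>i<n. epowr (ennreal (F i x)) q) (r / q) \<partial>M))"

text \<open>Jensen's inequality moves the q-th power inside P, leaving an l^1 inequality for the
  functions F_i^q with exponent r / q \<ge> 1.\<close>

lemma vector_inequality_le:
  assumes qr: "1 \<le> q" "q \<le> r"
  obtains C where "0 < C" "vector_bound C q r"
proof -
  define C where "C = (2 powr q) powr (r / q) * max 1 (dual_const (r / q))"
  have C: "0 < C" by (auto simp: C_def intro!: mult_pos_pos)
  show ?thesis
  proof (rule that[OF C])
    show "vector_bound C q r"
      unfolding vector_bound_def
    proof (intro allI impI)
    fix h :: real and n :: nat and K :: "nat \<Rightarrow> nat" and F :: "nat \<Rightarrow> 'a \<Rightarrow> real"
    assume h: "0 < h" and F0: "\<forall>i<n. F i \<in> borel_measurable M \<and> (\<forall>y. 0 \<le> F i y) \<and> (\<integral>\<^sup>+x. epowr (ennreal (F i x)) r \<partial>M) < top"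
    then have F: "\<And>i. i < n \<Longrightarrow> F i \<in> borel_measurable M" "\<And>i y. i < n \<Longrightarrow> 0 \<le> F i y"
      "\<And>i. i < n \<Longrightarrow> (\<integral>\<^sup>+x. epowr (ennreal (F i x)) r \<partial>M) < top" by auto
    define t where "t i = real (Suc (K i)) * h" for i
    have t: "0 < t i" for i using h by (simp add: t_def)
    define E where "E i x = F i x powr q" for i x
    have [measurable]: "i < n \<Longrightarrow> F i \<in> borel_measurable M" for i by (rule F)
    have [measurable]: "i < n \<Longrightarrow> E i \<in> borel_measurable M" for i unfolding E_def[abs_def] by measurable
    have E: "epowr (ennreal (F i x)) q = ennreal (E i x)" if "i < n" for i x
      using F(2)[OF that] by (simp add: E_def epowr_ennreal)
    have E_pow: "epowr (ennreal (E i x)) (r / q) = epowr (ennreal (F i x)) r" if "i < n" for i x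
      using qr by (simp add: E[OF that, symmetric] epowr_epowr)
    have E_nn: "0 \<le> E i x" for i x by (simp add: E_def)
    have F_int: "integrable M (F i)" if "i < n" for i
      using that qr F by (intro integrable_of_Lp[of _ r]) auto
    have E_int: "integrable M (E i)" if "i < n" for i
      using that qr F E_nn by (intro integrable_of_Lp[of _ "r / q"]) (auto simp: E_pow)
    have le: "epowr (ennreal (Q 0 (t i) (F i) x)) q \<le> ennreal (2 powr q) * ennreal (Q 0 (t i) (E i) x)" if "i < n" for i x
    proof -
      have "epowr (ennreal (Q 0 (t i) (F i) x)) q \<le> ennreal (2 powr q) * (\<integral>\<^sup>+y. ennreal (p 0 (t i) x y) * epowr (ennreal (F i y)) q \<partial>M)"
        using that F F_int t qr by (intro Q_power_le) auto
      also have "(\<integral>\<^sup>+y. ennreal (p 0 (t i) x y) * epowr (ennreal (F i y)) q \<partial>M) = ennreal (Q 0 (t i) (E i) x)"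
        using that t E_int E_nn by (simp add: E Q_nn_integral)
      finally show ?thesis .
    qed
    have "(\<integral>\<^sup>+x. epowr (\<Sum>i<n. epowr (ennreal (Q 0 (t i) (F i) x)) q) (r / q) \<partial>M)
      \<le> (\<integral>\<^sup>+x. ennreal ((2 powr q) powr (r / q)) * epowr (\<Sum>i<n. ennreal (Q 0 (t i) (E i) x)) (r / q) \<partial>M)"
    proof (rule nn_integral_mono)
      fix x
      have "(\<Sum>i<n. epowr (ennreal (Q 0 (t i) (F i) x)) q) \<le> (\<Sum>i<n. ennreal (2 powr q) * ennreal (Q 0 (t i) (E i) x))"
        by (intro sum_mono le) auto
      then have "epowr (\<Sum>i<n. epowr (ennreal (Q 0 (t i) (F i) x)) q) (r / q) \<le> epowr (ennreal (2 powr q) * (\<Sum>i<n. ennreal (Q 0 (t i) (E i) x))) (r / q)"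
        using qr by (intro epowr_mono) (auto simp: sum_distrib_left)
      then show "epowr (\<Sum>i<n. epowr (ennreal (Q 0 (t i) (F i) x)) q) (r / q)
        \<le> ennreal ((2 powr q) powr (r / q)) * epowr (\<Sum>i<n. ennreal (Q 0 (t i) (E i) x)) (r / q)"
        by (simp add: epowr_mult epowr_ennreal)
    qed
    also have "\<dots> = ennreal ((2 powr q) powr (r / q)) * (\<integral>\<^sup>+x. epowr (\<Sum>i<n. ennreal (Q 0 (t i) (E i) x)) (r / q) \<partial>M)"
      by (rule nn_integral_cmult) (auto intro!: epowr_measurable borel_measurable_sum)
    also have "(\<integral>\<^sup>+x. epowr (\<Sum>i<n. ennreal (Q 0 (t i) (E i) x)) (r / q) \<partial>M)
      \<le> ennreal (max 1 (dual_const (r / q))) * (\<integral>\<^sup>+x. epowr (\<Sum>i<n. ennreal (E i x)) (r / q) \<partial>M)"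
    \<comment> \<open>The duality argument requires an exponent above 1; for exponent 1,
      conservation of mass gives equality.\<close>
    proof (cases "r = q")
      case True
      have "(\<integral>\<^sup>+x. epowr (\<Sum>i<n. ennreal (Q 0 (t i) (E i) x)) (r / q) \<partial>M) = (\<Sum>i<n. \<integral>\<^sup>+x. ennreal (Q 0 (t i) (E i) x) \<partial>M)"
        using True qr by (simp, subst nn_integral_sum) auto
      also have "\<dots> = (\<Sum>i<n. \<integral>\<^sup>+x. ennreal (E i x) \<partial>M)"
        using t E_int E_nn by (intro sum.cong Q_integral) auto
      also have "\<dots> = 1 * (\<integral>\<^sup>+x. epowr (\<Sum>i<n. ennreal (E i x)) (r / q) \<partial>M)"
        using True qr by (simp, subst nn_integral_sum) auto
      also have "\<dots> \<le> ennreal (max 1 (dual_const (r / q))) * (\<integral>\<^sup>+x. epowr (\<Sum>i<n. ennreal (E i x)) (r / q) \<partial>M)"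
        by (intro mult_right_mono) (auto simp flip: ennreal_1 intro: ennreal_leI)
      finally show ?thesis .
    next
      case False
      then have "1 < r / q" using qr by simp
      then have "(\<integral>\<^sup>+x. epowr (\<Sum>i<n. ennreal (Q 0 (t i) (E i) x)) (r / q) \<partial>M)
        \<le> ennreal (dual_const (r / q)) * (\<integral>\<^sup>+x. epowr (\<Sum>i<n. ennreal (E i x)) (r / q) \<partial>M)"
        unfolding t_def using h F E_nn by (intro maximal_dual) (auto simp: E_pow)
      also have "\<dots> \<le> ennreal (max 1 (dual_const (r / q))) * (\<integral>\<^sup>+x. epowr (\<Sum>i<n. ennreal (E i x)) (r / q) \<partial>M)"
        by (intro mult_right_mono ennreal_leI) auto
      finally show ?thesis .
    qed
    also have "(\<integral>\<^sup>+x. epowr (\<Sum>i<n. ennreal (E i x)) (r / q) \<partial>M) = (\<integral>\<^sup>+x. epowr (\<Sum>i<n. epowr (ennreal (F i x)) q) (r / q) \<partial>M)"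
      using E by (intro nn_integral_cong) simp
    finally have "(\<integral>\<^sup>+x. epowr (\<Sum>i<n. epowr (ennreal (Q 0 (t i) (F i) x)) q) (r / q) \<partial>M)
      \<le> ennreal ((2 powr q) powr (r / q)) * (ennreal (max 1 (dual_const (r / q))) * (\<integral>\<^sup>+x. epowr (\<Sum>i<n. epowr (ennreal (F i x)) q) (r / q) \<partial>M))"
      by (simp add: mult_left_mono)
    also have "\<dots> = ennreal C * (\<integral>\<^sup>+x. epowr (\<Sum>i<n. epowr (ennreal (F i x)) q) (r / q) \<partial>M)"
      unfolding C_def by (subst ennreal_mult[of "(2 powr q) powr (r / q)"]) (auto simp: mult.assoc)
    finally show "(\<integral>\<^sup>+x. epowr (\<Sum>i<n. epowr (ennreal (Q 0 (real (Suc (K i)) * h) (F i) x)) q) (r / q) \<partial>M)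
      \<le> ennreal C * (\<integral>\<^sup>+x. epowr (\<Sum>i<n. epowr (ennreal (F i x)) q) (r / q) \<partial>M)"
      by (simp only: t_def)
    qed
  qed
qed

text \<open>For q > r the conjugate exponents satisfy q' \<le> r', the case already settled.
  Symmetry of P transfers that bound to its predual, by testing against the extremal family.\<close>

lemma vector_inequality:
  assumes q: "1 \<le> q" and r: "1 < r"
  obtains C where "0 < C" "vector_bound C q r"
proof (cases "q \<le> r")
  case True
  show ?thesis by (rule vector_inequality_le[OF q True]) (rule that)
next
  case False
  then have qr: "r < q" "1 < q" using r by auto
  define q' where "q' = q / (q - 1)"
  define r' where "r' = r / (r - 1)"
  have q': "1 < q'" and r': "1 < r'" using r qr by (auto simp: q'_def r'_def)
  have le': "q' \<le> r'" using r qr by (simp add: q'_def r'_def field_simps)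
  \<comment> \<open>Arithmetic of conjugate exponents which makes the L^r'(l^q') norm of the test
    family \<open>\<Phi>\<close>, raised to the power r', equal to \<open>?Z\<close>.\<close>
  have exps: "(q - 1) * q' = q" "1 + (r / q - 1) * q' = r / q * (q' / r')"
    using qr r by (simp_all add: q'_def r'_def field_simps)
  obtain C where C: "0 < C" "vector_bound C q' r'"
    by (rule vector_inequality_le[OF less_imp_le[OF q'] le']) (rule that)
  \<comment> \<open>The outer 2 comes from absorption, the inner 2 from Hoelder's inequality. With K
    = 4 C in Young's inequality the other term is 2 C / (4 C) = 1/2 of \<open>?Z\<close>.\<close>
  define C' where "C' = 2 * (2 * (4 * C) powr (r - 1))"
  have "0 < C'" using C(1) by (simp add: C'_def)
  show ?thesis
  proof (rule that[OF \<open>0 < C'\<close>])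
    show "vector_bound C' q r"
      unfolding vector_bound_def
    proof (intro allI impI)
    fix h :: real and n :: nat and K :: "nat \<Rightarrow> nat" and F :: "nat \<Rightarrow> 'a \<Rightarrow> real"
    assume h: "0 < h" and F0: "\<forall>i<n. F i \<in> borel_measurable M \<and> (\<forall>y. 0 \<le> F i y) \<and> (\<integral>\<^sup>+x. epowr (ennreal (F i x)) r \<partial>M) < top"
    then have F: "\<And>i. i < n \<Longrightarrow> F i \<in> borel_measurable M" "\<And>i y. i < n \<Longrightarrow> 0 \<le> F i y"
      "\<And>i. i < n \<Longrightarrow> (\<integral>\<^sup>+x. epowr (ennreal (F i x)) r \<partial>M) < top" by auto
    define t where "t i = real (Suc (K i)) * h" for i
    have t: "0 < t i" for i using h by (simp add: t_def)
    have [measurable]: "i < n \<Longrightarrow> F i \<in> borel_measurable M" for i by (rule F)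
    have F_int: "integrable M (F i)" if "i < n" for i
      using that r F by (intro integrable_of_Lp[of _ r]) auto
    define H where "H i x = Q 0 (t i) (F i) x" for i x
    have [measurable]: "i < n \<Longrightarrow> H i \<in> borel_measurable M" for i unfolding H_def[abs_def] by measurable
    have H_nn: "0 \<le> H i x" if "i < n" for i x
      unfolding H_def using that F t by (intro Q_nonneg) auto
    define X where "X x = (\<Sum>i<n. H i x powr q)" for x
    have X_nn: "0 \<le> X x" for x unfolding X_def by (intro sum_nonneg) auto
    have [measurable]: "X \<in> borel_measurable M" unfolding X_def[abs_def] by measurable
    \<comment> \<open>The exponent r / q - 1 is negative; where X is 0 the power is 0 by convention,
      consistently with all \<open>H i\<close> being 0 there.\<close>
    define \<Phi> where "\<Phi> i x = H i x powr (q - 1) * X x powr (r / q - 1)" for i x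
    have [measurable]: "i < n \<Longrightarrow> \<Phi> i \<in> borel_measurable M" for i unfolding \<Phi>_def[abs_def] by measurable
    have \<Phi>_nn: "0 \<le> \<Phi> i x" for i x by (simp add: \<Phi>_def)
    let ?Z = "\<integral>\<^sup>+x. epowr (ennreal (X x)) (r / q) \<partial>M"
    have X_eq: "(\<Sum>i<n. epowr (ennreal (H i x)) q) = ennreal (X x)" for x
      unfolding X_def by (subst sum_ennreal[symmetric]) (auto simp: epowr_ennreal H_nn)
    have Z_fin: "?Z < top"
      unfolding X_eq[symmetric]
    proof (rule nn_integral_epowr_sum_finite)
      fix i assume i: "i < n"
      have "(\<integral>\<^sup>+x. epowr (ennreal (H i x)) r \<partial>M) \<le> ennreal (2 powr r) * (\<integral>\<^sup>+x. epowr (ennreal (F i x)) r \<partial>M)"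
        unfolding H_def using i r t F F_int by (intro Q_power_integral_le) auto
      also have "\<dots> < top" using F(3)[OF i] by (simp add: ennreal_mult_less_top)
      finally show "(\<integral>\<^sup>+x. epowr (epowr (ennreal (H i x)) q) (r / q) \<partial>M) < top"
        using qr by (simp add: epowr_epowr)
    qed (use r qr in auto)
    have \<Phi>_sum: "(\<Sum>i<n. \<Phi> i x powr q') = X x powr (r / q * (q' / r'))" for x
    proof -
      have "(\<Sum>i<n. \<Phi> i x powr q') = (\<Sum>i<n. H i x powr q * X x powr ((r / q - 1) * q'))"
        by (simp add: \<Phi>_def powr_mult powr_powr exps)
      also have "\<dots> = X x * X x powr ((r / q - 1) * q')"
        unfolding X_def by (simp add: sum_distrib_right)
      also have "\<dots> = X x powr 1 * X x powr ((r / q - 1) * q')" using X_nn[of x] by simp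
      also have "\<dots> = X x powr (r / q * (q' / r'))" by (subst powr_add[symmetric]) (simp only: exps)
      finally show ?thesis .
    qed
    have \<Phi>_pow: "epowr (\<Sum>i<n. epowr (ennreal (\<Phi> i x)) q') (r' / q') = epowr (ennreal (X x)) (r / q)" for x
    proof -
      have "(\<Sum>i<n. epowr (ennreal (\<Phi> i x)) q') = ennreal (X x powr (r / q * (q' / r')))"
        unfolding \<Phi>_sum[symmetric] by (subst sum_ennreal[symmetric]) (auto simp: epowr_ennreal \<Phi>_nn)
      moreover have "r / q * (q' / r') * (r' / q') = r / q" using q' r' by simp
      ultimately show ?thesis using X_nn[of x] by (simp only: epowr_ennreal powr_powr powr_ge_zero)
    qed
    have \<Phi>_fin: "(\<integral>\<^sup>+x. epowr (ennreal (\<Phi> i x)) r' \<partial>M) < top" if i: "i < n" for i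
    proof -
      have "(\<integral>\<^sup>+x. epowr (ennreal (\<Phi> i x)) r' \<partial>M) \<le> ?Z"
      proof (rule nn_integral_mono)
        fix x
        have "epowr (ennreal (\<Phi> i x)) r' = epowr (epowr (ennreal (\<Phi> i x)) q') (r' / q')"
          using q' by (simp add: epowr_epowr)
        also have "\<dots> \<le> epowr (\<Sum>i<n. epowr (ennreal (\<Phi> i x)) q') (r' / q')"
          using i q' r' by (intro epowr_mono member_le_sum) auto
        finally show "epowr (ennreal (\<Phi> i x)) r' \<le> epowr (ennreal (X x)) (r / q)" by (simp only: \<Phi>_pow)
      qed
      then show ?thesis using Z_fin by (rule le_less_trans)
    qed
    have \<Phi>_int: "integrable M (\<Phi> i)" if "i < n" for i
      using that \<Phi>_fin[OF that] r' \<Phi>_nn by (intro integrable_of_Lp[of _ r']) auto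
    define G where "G i x = Q 0 (t i) (\<Phi> i) x" for i x
    have [measurable]: "i < n \<Longrightarrow> G i \<in> borel_measurable M" for i unfolding G_def[abs_def] by measurable
    have G_nn: "0 \<le> G i x" for i x
      unfolding G_def using \<Phi>_nn t by (intro Q_nonneg) auto
    let ?f = "\<lambda>x. epowr (\<Sum>i<n. epowr (ennreal (F i x)) q) (1 / q)"
    let ?g = "\<lambda>x. epowr (\<Sum>i<n. epowr (ennreal (G i x)) q') (1 / q')"
    have [measurable]: "?f \<in> borel_measurable M" "?g \<in> borel_measurable M" by measurable
    have "?Z = (\<integral>\<^sup>+x. (\<Sum>i<n. ennreal (H i x) * ennreal (\<Phi> i x)) \<partial>M)"
    proof (rule nn_integral_cong)
      fix x
      have "(\<Sum>i<n. H i x * \<Phi> i x) = (\<Sum>i<n. H i x powr q * X x powr (r / q - 1))"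
        using H_nn by (intro sum.cong) (auto simp: \<Phi>_def powr_mult_self mult.assoc[symmetric])
      also have "\<dots> = X x * X x powr (r / q - 1)"
        by (simp add: X_def sum_distrib_right)
      also have "\<dots> = X x powr (r / q)" using X_nn by (rule powr_mult_self)
      finally have "ennreal (\<Sum>i<n. H i x * \<Phi> i x) = epowr (ennreal (X x)) (r / q)"
        using X_nn by (simp add: epowr_ennreal)
      also have "ennreal (\<Sum>i<n. H i x * \<Phi> i x) = (\<Sum>i<n. ennreal (H i x) * ennreal (\<Phi> i x))"
        using H_nn \<Phi>_nn by (subst sum_ennreal[symmetric]) (auto simp: ennreal_mult)
      finally show "epowr (ennreal (X x)) (r / q) = (\<Sum>i<n. ennreal (H i x) * ennreal (\<Phi> i x))" by simp
    qed
    also have "\<dots> = (\<Sum>i<n. \<integral>\<^sup>+x. ennreal (H i x) * ennreal (\<Phi> i x) \<partial>M)"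
      by (rule nn_integral_sum) auto
    also have "\<dots> = (\<Sum>i<n. \<integral>\<^sup>+x. ennreal (F i x) * ennreal (G i x) \<partial>M)"
      unfolding H_def G_def using F F_int \<Phi>_int \<Phi>_nn t by (intro sum.cong Q_sym) auto
    also have "\<dots> = (\<integral>\<^sup>+x. (\<Sum>i<n. ennreal (F i x) * ennreal (G i x)) \<partial>M)"
      by (rule nn_integral_sum[symmetric]) auto
    also have "\<dots> \<le> (\<integral>\<^sup>+x. 2 * (?f x * ?g x) \<partial>M)"
    proof (rule nn_integral_mono)
      fix x
      have f: "?f x = ennreal ((\<Sum>i<n. F i x powr q) powr (1 / q))"
        by (subst epowr_ennreal[symmetric]) (auto simp: sum_nonneg epowr_ennreal F simp flip: sum_ennreal)
      have g: "?g x = ennreal ((\<Sum>i<n. G i x powr q') powr (1 / q'))"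
        by (subst epowr_ennreal[symmetric]) (auto simp: sum_nonneg epowr_ennreal G_nn simp flip: sum_ennreal)
      have "(\<Sum>i<n. ennreal (F i x) * ennreal (G i x)) = ennreal (\<Sum>i<n. F i x * G i x)"
        using F G_nn by (subst sum_ennreal[symmetric]) (auto simp: ennreal_mult)
      also have "\<dots> \<le> ennreal (2 * ((\<Sum>i<n. F i x powr q) powr (1 / q) * (\<Sum>i<n. G i x powr q') powr (1 / q')))"
        unfolding q'_def using qr F G_nn by (intro ennreal_leI sum_mult_le_Hoelder) auto
      also have "\<dots> = 2 * (?f x * ?g x)"
        unfolding f g by (simp add: ennreal_mult)
      finally show "(\<Sum>i<n. ennreal (F i x) * ennreal (G i x)) \<le> 2 * (?f x * ?g x)" .
    qed
    also have "\<dots> \<le> (\<integral>\<^sup>+x. 2 * (ennreal ((4 * C) powr (r - 1)) * epowr (?f x) r + ennreal (1 / (4 * C)) * epowr (?g x) r') \<partial>M)"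
      unfolding r'_def using r C(1) by (intro nn_integral_mono mult_left_mono young_split_conj) auto
    also have "\<dots> = 2 * (ennreal ((4 * C) powr (r - 1)) * (\<integral>\<^sup>+x. epowr (?f x) r \<partial>M) + ennreal (1 / (4 * C)) * (\<integral>\<^sup>+x. epowr (?g x) r' \<partial>M))"
      by (simp add: nn_integral_add nn_integral_cmult)
    also have "(\<integral>\<^sup>+x. epowr (?g x) r' \<partial>M) \<le> ennreal C * ?Z"
    proof -
      have "(\<integral>\<^sup>+x. epowr (?g x) r' \<partial>M) = (\<integral>\<^sup>+x. epowr (\<Sum>i<n. epowr (ennreal (Q 0 (real (Suc (K i)) * h) (\<Phi> i) x)) q') (r' / q') \<partial>M)"
        by (simp add: G_def t_def epowr_epowr)
      also have "\<dots> \<le> ennreal C * (\<integral>\<^sup>+x. epowr (\<Sum>i<n. epowr (ennreal (\<Phi> i x)) q') (r' / q') \<partial>M)"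
        using h \<Phi>_nn \<Phi>_fin by (intro C(2)[unfolded vector_bound_def, rule_format]) auto
      finally show ?thesis by (simp only: \<Phi>_pow)
    qed
    finally have "?Z \<le> 2 * (ennreal ((4 * C) powr (r - 1)) * (\<integral>\<^sup>+x. epowr (?f x) r \<partial>M) + ennreal (1 / (4 * C)) * (ennreal C * ?Z))"
      by (simp add: mult_left_mono add_left_mono)
    also have "\<dots> = 2 * (ennreal ((4 * C) powr (r - 1)) * (\<integral>\<^sup>+x. epowr (?f x) r \<partial>M)) + ennreal (1 / 2) * ?Z"
    proof -
      have "2 * (ennreal (1 / (4 * C)) * (ennreal C * ?Z)) = ennreal 2 * (ennreal (1 / (4 * C)) * (ennreal C * ?Z))"
        by simp
      also have "\<dots> = ennreal (1 / 2) * ?Z"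
        using C(1) by (simp add: mult.assoc[symmetric] del: ennreal_half ennreal_numeral flip: ennreal_mult)
      finally show ?thesis by (simp only: distrib_left)
    qed
    finally have "?Z \<le> 2 * (2 * (ennreal ((4 * C) powr (r - 1)) * (\<integral>\<^sup>+x. epowr (?f x) r \<partial>M)))"
      by (rule ennreal_absorb[OF Z_fin])
    also have "\<dots> = ennreal C' * (\<integral>\<^sup>+x. epowr (\<Sum>i<n. epowr (ennreal (F i x)) q) (r / q) \<partial>M)"
      using C(1) by (simp add: C'_def ennreal_mult mult.assoc epowr_epowr)
    finally show "(\<integral>\<^sup>+x. epowr (\<Sum>i<n. epowr (ennreal (Q 0 (real (Suc (K i)) * h) (F i) x)) q) (r / q) \<partial>M)
      \<le> ennreal C' * (\<integral>\<^sup>+x. epowr (\<Sum>i<n. epowr (ennreal (F i x)) q) (r / q) \<partial>M)"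
      by (simp only: X_eq[symmetric] H_def t_def)
    qed
  qed
qed

end

section \<open>The Bessel difference integral as a Weyl fractional integral\<close>

text \<open>\<open>exp t\<close> times the \<open>j\<close>-th derivative of \<open>exp (-t) * H l t\<close>, where \<open>H (Suc i)\<close> is the derivative of \<open>H i\<close>.\<close>

fun damped_deriv :: "nat \<Rightarrow> (nat \<Rightarrow> real) \<Rightarrow> nat \<Rightarrow> real" where
  "damped_deriv 0 H l = H l"
| "damped_deriv (Suc j) H l = damped_deriv j H (Suc l) - damped_deriv j H l"

text \<open>\<open>damped_deriv j\<close> is (\<partial> - 1)^j, whose binomial coefficients have
  sum 2^j.\<close>

lemma damped_deriv_bound: "\<bar>damped_deriv j H l\<bar> \<le> 2 ^ j * (\<Sum>i\<le>j. \<bar>H (i + l)\<bar>)"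
proof (induction j arbitrary: l)
  case (Suc j)
  have "\<bar>damped_deriv (Suc j) H l\<bar> \<le> \<bar>damped_deriv j H (Suc l)\<bar> + \<bar>damped_deriv j H l\<bar>"
    by simp
  also have "\<dots> \<le> 2 ^ j * (\<Sum>i\<le>j. \<bar>H (i + Suc l)\<bar>) + 2 ^ j * (\<Sum>i\<le>j. \<bar>H (i + l)\<bar>)"
    by (intro add_mono Suc)
  also have "\<dots> \<le> 2 ^ j * (\<Sum>i\<le>Suc j. \<bar>H (i + l)\<bar>) + 2 ^ j * (\<Sum>i\<le>Suc j. \<bar>H (i + l)\<bar>)"
  proof (intro add_mono mult_left_mono)
    show "(\<Sum>i\<le>j. \<bar>H (i + Suc l)\<bar>) \<le> (\<Sum>i\<le>Suc j. \<bar>H (i + l)\<bar>)"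
      by (subst sum.atMost_Suc_shift) simp
  qed auto
  finally show ?case by simp
qed simp

lemma damped_deriv_measurable [measurable (raw)]:
  assumes "\<And>i. (\<lambda>x. H i x) \<in> borel_measurable M"
  shows "(\<lambda>x. damped_deriv j (\<lambda>i. H i x) l) \<in> borel_measurable M"
  using assms by (induction j arbitrary: l) simp_all

lemma damped_deriv_has_derivative:
  assumes "\<And>i. (H i has_real_derivative H (Suc i) t) (at t)"
  shows "((\<lambda>t. damped_deriv j (\<lambda>i. H i t) l) has_real_derivative damped_deriv j (\<lambda>i. H i t) (Suc l)) (at t)"
  using assms by (induction j arbitrary: l) (auto intro!: DERIV_diff)

lemma damped_exp_has_derivative:
  assumes "\<And>i. (H i has_real_derivative H (Suc i) t) (at t)"
  shows "((\<lambda>t. exp (- t) * damped_deriv j (\<lambda>i. H i t) 0) has_real_derivative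
           exp (- t) * damped_deriv (Suc j) (\<lambda>i. H i t) 0) (at t)"
proof -
  have "((\<lambda>t. exp (- t)) has_real_derivative - exp (- t)) (at t)"
    by (auto intro!: derivative_eq_intros)
  from DERIV_mult[OF this damped_deriv_has_derivative[where H=H and j=j and l=0, OF assms]]
  show ?thesis by (simp add: algebra_simps)
qed

text \<open>A k-th difference annihilates polynomials of degree below k. Pascal's rule turns the
  difference of order k + 1 into one of order k applied to a first difference, which lowers the
  degree by one.\<close>

lemma alternating_binomial_power:
  fixes x y :: real
  assumes "l < k"
  shows "(\<Sum>j\<le>k. (-1) ^ j * real (k choose j) * (x + real j * y) ^ l) = 0"
  using assms
proof (induction k arbitrary: l)
  case (Suc k)
  let ?g = "\<lambda>j. (x + real j * y) ^ l"
  have "(\<Sum>j\<le>Suc k. (-1) ^ j * real (Suc k choose j) * ?g j)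
      = ?g 0 + (\<Sum>j\<le>k. (-1) ^ Suc j * real (Suc k choose Suc j) * ?g (Suc j))"
    by (subst sum.atMost_Suc_shift) simp
  also have "\<dots> = ?g 0 + (\<Sum>j\<le>k. (-1) ^ Suc j * real (k choose Suc j) * ?g (Suc j))
      + (\<Sum>j\<le>k. (-1) ^ Suc j * real (k choose j) * ?g (Suc j))"
    by (simp add: sum.distrib[symmetric] algebra_simps)
  also have "?g 0 + (\<Sum>j\<le>k. (-1) ^ Suc j * real (k choose Suc j) * ?g (Suc j))
      = (\<Sum>j\<le>Suc k. (-1) ^ j * real (k choose j) * ?g j)"
    by (subst sum.atMost_Suc_shift) simp
  also have "\<dots> = (\<Sum>j\<le>k. (-1) ^ j * real (k choose j) * ?g j)"
    by simp
  also have "(\<Sum>j\<le>k. (-1) ^ j * real (k choose j) * ?g j) + (\<Sum>j\<le>k. (-1) ^ Suc j * real (k choose j) * ?g (Suc j))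
      = (\<Sum>j\<le>k. (-1) ^ j * real (k choose j) * (?g j - ?g (Suc j)))"
    by (simp add: sum.distrib[symmetric] algebra_simps)
  also have "\<dots> = (\<Sum>j\<le>k. (-1) ^ j * real (k choose j) * - (\<Sum>i<l. real (l choose i) * (x + real j * y) ^ i * y ^ (l - i)))"
  proof (intro sum.cong refl arg_cong2[where f="(*)"])
    fix j
    have "?g (Suc j) = (\<Sum>i\<le>l. real (l choose i) * (x + real j * y) ^ i * y ^ (l - i))"
      by (subst binomial_ring[symmetric]) (simp add: algebra_simps)
    also have "\<dots> = (\<Sum>i<l. real (l choose i) * (x + real j * y) ^ i * y ^ (l - i)) + ?g j"
      by (subst lessThan_Suc_atMost[symmetric]) simp
    finally show "?g j - ?g (Suc j) = - (\<Sum>i<l. real (l choose i) * (x + real j * y) ^ i * y ^ (l - i))"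
      by simp
  qed
  also have "\<dots> = - (\<Sum>i<l. real (l choose i) * y ^ (l - i) * (\<Sum>j\<le>k. (-1) ^ j * real (k choose j) * (x + real j * y) ^ i))"
    unfolding sum_distrib_left sum_negf mult_minus_right
    by (subst sum.swap) (simp add: mult_ac)
  also have "\<dots> = 0"
    using Suc.prems by (simp add: Suc.IH)
  finally show ?case .
qed simp

text \<open>Representation of a decaying function by its \<open>k\<close>-th derivative: the Taylor polynomial at \<open>v\<close>,
  evaluated at \<open>y\<close>, vanishes as \<open>v\<close> tends to infinity.\<close>

lemma weyl_representation:
  fixes U :: "nat \<Rightarrow> real \<Rightarrow> real"
  assumes U: "\<And>j v. 0 < v \<Longrightarrow> (U j has_real_derivative U (Suc j) v) (at v)"
    and dec: "\<And>j v. j \<le> M \<Longrightarrow> 1 \<le> v \<Longrightarrow> \<bar>U j v\<bar> \<le> B * exp (- v)"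
    and y: "0 < y"
    and int: "set_integrable lborel {y..} (\<lambda>v. (y - v) ^ M * U (Suc M) v)"
  shows "U 0 y = - (LINT v:{y..}|lborel. (y - v) ^ M * U (Suc M) v) / fact M"
proof -
  define R where "R v = (\<Sum>i\<le>M. (y - v) ^ i / fact i * U (0 + i) v)" for v
  have R: "(R has_real_derivative (y - v) ^ M / fact M * U (Suc (0 + M)) v) (at v)" if "0 < v" for v
    unfolding R_def[abs_def] using U[OF that] by (intro taylor_centre_deriv) auto
  have cont: "continuous_on {y..b} (\<lambda>v. (y - v) ^ M / fact M * U (Suc (0 + M)) v)" for b
  proof -
    have "continuous_on {y..b} (U (Suc M))"
      using y by (intro DERIV_continuous_on[where D="U (Suc (Suc M))"]) (auto intro: has_field_derivative_at_within[OF U])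
    then show ?thesis by (auto intro!: continuous_intros)
  qed
  have Rb: "(LINT v:{y..b}|lborel. (y - v) ^ M * U (Suc M) v) = fact M * (R b - R y)" if "y \<le> b" for b
  proof -
    have "(\<integral>v. indicator {y..b} v *\<^sub>R ((y - v) ^ M / fact M * U (Suc (0 + M)) v) \<partial>lborel) = R b - R y"
      using that y R cont by (intro integral_FTC_atLeastAtMost)
        (auto simp: has_real_derivative_iff_has_vector_derivative intro: has_vector_derivative_at_within)
    moreover have "(LINT v:{y..b}|lborel. (y - v) ^ M * U (Suc M) v)
      = (\<integral>v. fact M * (indicator {y..b} v *\<^sub>R ((y - v) ^ M / fact M * U (Suc (0 + M)) v)) \<partial>lborel)"
      unfolding set_lebesgue_integral_def by (intro Bochner_Integration.integral_cong) auto
    ultimately show ?thesis by (simp only: integral_mult_right_zero)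
  qed
  have "(R \<longlongrightarrow> 0) at_top"
    unfolding R_def
  proof (rule tendsto_null_sum)
    fix i assume i: "i \<in> {..M}"
    have "((\<lambda>b. \<bar>B\<bar> / fact i * (b ^ i / exp b)) \<longlongrightarrow> \<bar>B\<bar> / fact i * 0) at_top"
      by (intro tendsto_mult tendsto_const tendsto_power_div_exp_0)
    then have "((\<lambda>b. \<bar>B\<bar> / fact i * (b ^ i / exp b)) \<longlongrightarrow> 0) at_top" by simp
    moreover have "eventually (\<lambda>b. norm ((y - b) ^ i / fact i * U (0 + i) b) \<le> \<bar>B\<bar> / fact i * (b ^ i / exp b)) at_top"
      using eventually_ge_at_top[of "max 1 y"]
    proof eventually_elim
      case (elim b)
      have "norm ((y - b) ^ i / fact i * U (0 + i) b) = \<bar>y - b\<bar> ^ i / fact i * \<bar>U i b\<bar>"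
        by (simp add: abs_mult power_abs)
      also have "\<dots> \<le> b ^ i / fact i * (\<bar>B\<bar> * exp (- b))"
      proof (intro mult_mono divide_right_mono power_mono)
        show "\<bar>U i b\<bar> \<le> \<bar>B\<bar> * exp (- b)"
          using dec[of i b] i elim by (intro order_trans[OF dec[of i b]] mult_right_mono) auto
      qed (use elim y in auto)
      finally show ?case by (simp add: exp_minus field_simps)
    qed
    ultimately show "((\<lambda>b. (y - b) ^ i / fact i * U (0 + i) b) \<longlongrightarrow> 0) at_top"
      by (rule Lim_null_comparison[rotated])
  qed
  then have "((\<lambda>b. fact M * (R b - R y)) \<longlongrightarrow> fact M * (0 - R y)) at_top"
    by (intro tendsto_intros)
  moreover have "((\<lambda>b. fact M * (R b - R y)) \<longlongrightarrow> (LINT v:{y..}|lborel. (y - v) ^ M * U (Suc M) v)) at_top"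
  proof (rule Lim_transform_eventually)
    show "((\<lambda>b. LINT v:{y..b}|lborel. (y - v) ^ M * U (Suc M) v) \<longlongrightarrow> (LINT v:{y..}|lborel. (y - v) ^ M * U (Suc M) v)) at_top"
      using int by (intro tendsto_set_lebesgue_integral_at_top) auto
    show "eventually (\<lambda>b. (LINT v:{y..b}|lborel. (y - v) ^ M * U (Suc M) v) = fact M * (R b - R y)) at_top"
      using eventually_ge_at_top[of y] by eventually_elim (rule Rb)
  qed
  ultimately have "fact M * (0 - R y) = (LINT v:{y..}|lborel. (y - v) ^ M * U (Suc M) v)"
    by (intro tendsto_unique[where F="at_top :: real filter"]) auto
  moreover have "R y = U 0 y"
    unfolding R_def by (subst sum.atMost_shift) simp
  ultimately show ?thesis by (simp add: field_simps)
qed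

text \<open>The k-th difference with step s at 0 is the integral over v of this kernel times the
  k-th derivative at v. Each summand is the Weyl representation of the value at (k - j) s, an
  integral over v \<ge> (k - j) s, which explains the truncation.\<close>

definition difference_kernel :: "nat \<Rightarrow> real \<Rightarrow> real \<Rightarrow> real" where
  "difference_kernel k s v = - (\<Sum>j\<le>k. (-1) ^ j * real (k choose j) *
     (if real (k - j) * s \<le> v then (real (k - j) * s - v) ^ (k - 1) else 0)) / fact (k - 1)"

lemma difference_kernel_measurable [measurable (raw)]:
  assumes [measurable]: "f \<in> borel_measurable M" "g \<in> borel_measurable M"
  shows "(\<lambda>x. difference_kernel k (f x) (g x)) \<in> borel_measurable M"
  unfolding difference_kernel_def by measurable

text \<open>For v > k s no truncation is active, and the sum is a k-th difference of a polynomial of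
  degree k - 1, hence 0. This cancellation keeps s away from 0 for fixed v, so that s^(-\<beta>-1)
  becomes integrable.\<close>

lemma difference_kernel_bound:
  assumes k: "1 \<le> k" and s: "0 < s" and v: "0 < v"
  shows "\<bar>difference_kernel k s v\<bar> \<le> 2 ^ k * v ^ (k - 1) * indicator {v / k..} s"
proof (cases "real k * s < v")
  case True
  have le: "real (k - j) * s \<le> v" for j
  proof -
    have "real (k - j) * s \<le> real k * s" using s by (intro mult_right_mono) auto
    then show ?thesis using True by simp
  qed
  have "(\<Sum>j\<le>k. (-1) ^ j * real (k choose j) * (if real (k - j) * s \<le> v then (real (k - j) * s - v) ^ (k - 1) else 0))
     = (\<Sum>j\<le>k. (-1) ^ j * real (k choose j) * ((real k * s - v) + real j * (- s)) ^ (k - 1))"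
  proof (intro sum.cong refl arg_cong2[where f="(*)"])
    fix j assume "j \<in> {..k}"
    then have "real (k - j) * s - v = (real k * s - v) + real j * (- s)"
      by (simp add: of_nat_diff algebra_simps)
    then show "(if real (k - j) * s \<le> v then (real (k - j) * s - v) ^ (k - 1) else 0)
      = ((real k * s - v) + real j * (- s)) ^ (k - 1)"
      using le[of j] by (simp only: if_True)
  qed
  also have "\<dots> = 0" using k by (intro alternating_binomial_power) auto
  finally have "difference_kernel k s v = 0" by (simp add: difference_kernel_def)
  then show ?thesis using v by simp
next
  case False
  then have ind: "indicator {v / k..} s = (1::real)" using k by (simp add: field_simps)
  have "\<bar>\<Sum>j\<le>k. (-1) ^ j * real (k choose j) * (if real (k - j) * s \<le> v then (real (k - j) * s - v) ^ (k - 1) else 0)\<bar>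
    \<le> (\<Sum>j\<le>k. real (k choose j) * v ^ (k - 1))"
  proof (rule order_trans[OF sum_abs], rule sum_mono)
    fix j
    have "\<bar>real (k - j) * s - v\<bar> ^ (k - 1) \<le> v ^ (k - 1)" if "real (k - j) * s \<le> v"
      using that s by (intro power_mono) auto
    then show "\<bar>(-1) ^ j * real (k choose j) * (if real (k - j) * s \<le> v then (real (k - j) * s - v) ^ (k - 1) else 0)\<bar>
      \<le> real (k choose j) * v ^ (k - 1)"
      using v by (auto simp: abs_mult power_abs intro!: mult_left_mono)
  qed
  also have "\<dots> = 2 ^ k * v ^ (k - 1)"
    unfolding sum_distrib_right[symmetric] of_nat_sum[symmetric] choose_row_sum by simp
  finally have "\<bar>difference_kernel k s v\<bar> \<le> 2 ^ k * v ^ (k - 1) / fact (k - 1)"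
    unfolding difference_kernel_def by (simp add: divide_right_mono)
  also have "\<dots> \<le> 2 ^ k * v ^ (k - 1) / 1"
    using v by (intro divide_left_mono) auto
  finally show ?thesis by (simp add: ind)
qed

text \<open>Homogeneity of degree k - 1 in the two variables jointly; for \<beta> > 0 it reduces the
  s-integral for every v to the one for v = 1.\<close>

lemma difference_kernel_scale:
  assumes "0 < v"
  shows "difference_kernel k (v * s) v = v ^ (k - 1) * difference_kernel k s 1"
proof -
  have scale: "(if c * (v * s) \<le> v then (c * (v * s) - v) ^ (k - 1) else 0)
    = v ^ (k - 1) * (if c * s \<le> 1 then (c * s - 1) ^ (k - 1) else 0)" for c
  proof -
    have "c * (v * s) \<le> v \<longleftrightarrow> c * s \<le> 1"
      using mult_le_cancel_left_pos[OF assms, of "c * s" 1] by (simp add: mult_ac)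
    moreover have "c * (v * s) - v = v * (c * s - 1)" by (simp add: algebra_simps)
    ultimately show ?thesis by (simp add: power_mult_distrib)
  qed
  show ?thesis
    unfolding difference_kernel_def scale
    by (simp add: sum_distrib_left mult_ac)
qed

text \<open>The factor that remains when homogeneity has scaled v out of the s-integral.\<close>

definition weyl_const :: "nat \<Rightarrow> real \<Rightarrow> real" where
  "weyl_const k \<beta> = (LINT s:{0<..}|lborel. s powr (- \<beta> - 1) * difference_kernel k s 1)"

text \<open>Insert the Weyl representation into every term of the difference and exchange the
  integrals. The value \<open>u 0\<close> is not among the \<open>U 0 y\<close> with y > 0 and
  enters through a limit along one sequence of times.\<close>

lemma bessel_weyl:
  fixes U :: "nat \<Rightarrow> real \<Rightarrow> real" and u :: "real \<Rightarrow> real"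
  assumes k: "1 \<le> k" and \<beta>: "0 < \<beta>"
    and U: "\<And>j v. 0 < v \<Longrightarrow> (U j has_real_derivative U (Suc j) v) (at v)"
    and [measurable]: "U k \<in> borel_measurable borel"
    and dec: "\<And>j v. j \<le> k \<Longrightarrow> 1 \<le> v \<Longrightarrow> \<bar>U j v\<bar> \<le> B * exp (- v)"
    and fin: "(\<integral>\<^sup>+v\<in>{0<..}. ennreal (v powr (real k - \<beta> - 1) * \<bar>U k v\<bar>) \<partial>lborel) < top"
    and u: "\<And>y. 0 < y \<Longrightarrow> u y = U 0 y"
    and lim: "\<And>i. 0 < (X::nat \<Rightarrow> real) i" "X \<longlonglongrightarrow> 0" "(\<lambda>i. U 0 (X i)) \<longlonglongrightarrow> u 0"
  shows "set_integrable lborel {0<..} (\<lambda>s. s powr (- \<beta> - 1) * (\<Sum>j=0..k. real (k choose j) * (-1) ^ j * u (real (k - j) * s)))"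
    and "(LINT s:{0<..}|lborel. s powr (- \<beta> - 1) * (\<Sum>j=0..k. real (k choose j) * (-1) ^ j * u (real (k - j) * s)))
      = weyl_const k \<beta> * (LINT v:{0<..}|lborel. v powr (real k - \<beta> - 1) * U k v)"
proof -
  define M where "M = k - 1"
  have kM: "k = Suc M" using k by (simp add: M_def)
  have B: "0 \<le> B"
    using dec[of 0 1] by (auto intro: ccontr simp: mult_less_0_iff not_le[symmetric])
      (meson abs_ge_zero exp_ge_zero mult_le_0_iff order_trans linorder_not_le exp_gt_zero zero_le_mult_iff)
  \<comment> \<open>Integrability of the top derivative against v^(k-1): for v \<le> 1 this weight
    is below the one in \<open>fin\<close>, and for v > 1 the exponential decay takes over.\<close>
  have w_int: "set_integrable lborel {0<..} (\<lambda>v. v ^ M * \<bar>U k v\<bar>)"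
    unfolding set_integrable_def
  proof (rule integrableI_bounded)
    have "(\<integral>\<^sup>+v. ennreal (norm (indicator {0<..} v *\<^sub>R (v ^ M * \<bar>U k v\<bar>))) \<partial>lborel)
      \<le> (\<integral>\<^sup>+v. ennreal (v powr (real k - \<beta> - 1) * \<bar>U k v\<bar>) * indicator {0<..} v
          + ennreal B * (ennreal (v ^ M * exp (- v)) * indicator {0..} v) \<partial>lborel)"
    proof (rule nn_integral_mono)
      fix v :: real
      show "ennreal (norm (indicator {0<..} v *\<^sub>R (v ^ M * \<bar>U k v\<bar>)))
        \<le> ennreal (v powr (real k - \<beta> - 1) * \<bar>U k v\<bar>) * indicator {0<..} v + ennreal B * (ennreal (v ^ M * exp (- v)) * indicator {0..} v)"
      proof (cases "0 < v")
        case True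
        show ?thesis
        proof (cases "v \<le> 1")
          case v: True
          have "v ^ M = v powr (real k - 1)" using True by (simp add: kM powr_realpow)
          also have "\<dots> \<le> v powr (real k - \<beta> - 1)" using True v \<beta> by (intro powr_mono') auto
          finally have "v ^ M * \<bar>U k v\<bar> \<le> v powr (real k - \<beta> - 1) * \<bar>U k v\<bar>" by (rule mult_right_mono) simp
          then show ?thesis using True by (simp add: add_increasing2 ennreal_leI abs_mult)
        next
          case False
          have "v ^ M * \<bar>U k v\<bar> \<le> v ^ M * (B * exp (- v))"
            using False by (intro mult_left_mono dec) auto
          then have "ennreal (v ^ M * \<bar>U k v\<bar>) \<le> ennreal (B * (v ^ M * exp (- v)))"
            by (intro ennreal_leI) (simp add: mult_ac)
          also have "\<dots> = ennreal B * ennreal (v ^ M * exp (- v))"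
            using B True by (intro ennreal_mult) auto
          finally show ?thesis using True by (simp add: add_increasing abs_mult)
        qed
      qed simp
    qed
    also have "\<dots> = (\<integral>\<^sup>+v\<in>{0<..}. ennreal (v powr (real k - \<beta> - 1) * \<bar>U k v\<bar>) \<partial>lborel)
      + ennreal B * (\<integral>\<^sup>+v. ennreal (v ^ M * exp (- v)) * indicator {0..} v \<partial>lborel)"
      by (simp add: nn_integral_add nn_integral_cmult)
    also have "\<dots> < \<infinity>"
      using fin nn_intergal_power_times_exp_Ici[of M] by (simp add: ennreal_mult_less_top)
    finally show "(\<integral>\<^sup>+v. ennreal (norm (indicator {0<..} v *\<^sub>R (v ^ M * \<bar>U k v\<bar>))) \<partial>lborel) < \<infinity>" .
  qed measurable
  let ?w = "\<lambda>v. indicator {0<..} v * (v ^ M * \<bar>U k v\<bar>)"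
  let ?h = "\<lambda>y v. if y \<le> v \<and> 0 < v then (y - v) ^ M * U k v else 0"
  have w: "integrable lborel ?w" using w_int by (simp add: set_integrable_def)
  have h_bound: "norm (?h y v) \<le> norm (?w v)" if "0 \<le> y" for y v
  proof -
    have "\<bar>y - v\<bar> ^ M \<le> v ^ M" if "y \<le> v" using that \<open>0 \<le> y\<close> by (intro power_mono) auto
    then show ?thesis by (auto simp: abs_mult power_abs intro!: mult_right_mono)
  qed
  have h_int: "integrable lborel (?h y)" if "0 \<le> y" for y
    using h_bound[OF that] by (intro Bochner_Integration.integrable_bound[OF w]) auto
  have rep_pos: "u y = - (\<integral>v. ?h y v \<partial>lborel) / fact M" if y: "0 < y" for y
  proof -
    have eq: "indicator {y..} v *\<^sub>R ((y - v) ^ M * U (Suc M) v) = ?h y v" for v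
      using y by (auto simp: kM split: split_indicator)
    have "U 0 y = - (LINT v:{y..}|lborel. (y - v) ^ M * U (Suc M) v) / fact M"
    proof (rule weyl_representation[where B=B])
      show "set_integrable lborel {y..} (\<lambda>v. (y - v) ^ M * U (Suc M) v)"
        unfolding set_integrable_def eq using h_int[of y] y by simp
    qed (use U dec y in \<open>auto simp: kM\<close>)
    then show ?thesis using u[OF y] by (simp only: set_lebesgue_integral_def eq)
  qed
  \<comment> \<open>The representation extends to 0 by dominated convergence with the majorant
    \<open>?w\<close>, since the values at the times \<open>X i\<close> tend to
    \<open>u 0\<close>.\<close>
  have rep_0: "u 0 = - (\<integral>v. ?h 0 v \<partial>lborel) / fact M"
  proof -
    have "(\<lambda>i. \<integral>v. ?h (X i) v \<partial>lborel) \<longlonglongrightarrow> (\<integral>v. ?h 0 v \<partial>lborel)"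
    proof (rule integral_dominated_convergence[where w="\<lambda>v. norm (?w v)"])
      show "AE v in lborel. (\<lambda>i. ?h (X i) v) \<longlonglongrightarrow> ?h 0 v"
      proof (rule AE_I2)
        fix v :: real
        show "(\<lambda>i. ?h (X i) v) \<longlonglongrightarrow> ?h 0 v"
        proof (cases "0 < v")
          case True
          have "(\<lambda>i. (X i - v) ^ M * U k v) \<longlonglongrightarrow> (0 - v) ^ M * U k v"
            by (intro tendsto_intros lim)
          moreover have "eventually (\<lambda>i. (X i - v) ^ M * U k v = ?h (X i) v) sequentially"
            using order_tendstoD(2)[OF lim(2) True] by eventually_elim (use True in auto)
          ultimately have "(\<lambda>i. ?h (X i) v) \<longlonglongrightarrow> (0 - v) ^ M * U k v" by (rule Lim_transform_eventually)
          then show ?thesis using True by simp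
        qed simp
      qed
      show "AE v in lborel. norm (?h (X i) v) \<le> norm (?w v)" for i
        using h_bound[of "X i"] lim(1)[of i] by (intro AE_I2) auto
    qed (use w in auto)
    then have "(\<lambda>i. - (\<integral>v. ?h (X i) v \<partial>lborel) / fact M) \<longlonglongrightarrow> - (\<integral>v. ?h 0 v \<partial>lborel) / fact M"
      by (intro tendsto_intros) auto
    then have "(\<lambda>i. U 0 (X i)) \<longlonglongrightarrow> - (\<integral>v. ?h 0 v \<partial>lborel) / fact M"
      by (simp only: rep_pos[OF lim(1), symmetric] u[OF lim(1)])
    then show ?thesis using lim(3) LIMSEQ_unique by blast
  qed
  have rep: "u y = - (\<integral>v. ?h y v \<partial>lborel) / fact M" if "0 \<le> y" for y
    using that rep_pos[of y] rep_0 by (cases "y = 0") auto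
  let ?\<Delta> = "\<lambda>s. \<Sum>j=0..k. real (k choose j) * (-1) ^ j * u (real (k - j) * s)"
  let ?b = "\<lambda>s v. indicator {0<..} s * s powr (- \<beta> - 1) * (indicator {0<..} v * (difference_kernel k s v * U k v))"
  have \<Delta>: "indicator {0<..} s *\<^sub>R (s powr (- \<beta> - 1) * ?\<Delta> s) = (\<integral>v. ?b s v \<partial>lborel)" for s
  proof (cases "0 < s")
    case True
    have "?\<Delta> s = (\<Sum>j\<le>k. real (k choose j) * (-1) ^ j * (- (\<integral>v. ?h (real (k - j) * s) v \<partial>lborel) / fact M))"
      unfolding atLeast0AtMost using True by (intro sum.cong refl arg_cong2[where f="(*)"] rep) auto
    also have "\<dots> = (\<Sum>j\<le>k. (\<integral>v. - (real (k choose j) * (-1) ^ j / fact M) * ?h (real (k - j) * s) v \<partial>lborel))"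
      by (intro sum.cong refl) (subst integral_mult_right_zero, simp)
    also have "\<dots> = (\<integral>v. (\<Sum>j\<le>k. - (real (k choose j) * (-1) ^ j / fact M) * ?h (real (k - j) * s) v) \<partial>lborel)"
      using True by (intro Bochner_Integration.integral_sum[symmetric] integrable_mult_right h_int) auto
    also have "\<dots> = (\<integral>v. indicator {0<..} v * (difference_kernel k s v * U k v) \<partial>lborel)"
    proof (rule Bochner_Integration.integral_cong[OF refl])
      fix v :: real
      show "(\<Sum>j\<le>k. - (real (k choose j) * (-1) ^ j / fact M) * ?h (real (k - j) * s) v)
        = indicator {0<..} v * (difference_kernel k s v * U k v)"
      proof (cases "0 < v")
        case True
        then show ?thesis
          unfolding difference_kernel_def M_def[symmetric]
          by (auto simp: sum_distrib_right sum_divide_distrib sum_negf[symmetric] intro!: sum.cong)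
      qed simp
    qed
    finally have "?\<Delta> s = (\<integral>v. indicator {0<..} v * (difference_kernel k s v * U k v) \<partial>lborel)" .
    then show ?thesis using True by simp
  qed simp
  have meas: "(\<lambda>(s, v). ?b s v) \<in> borel_measurable (lborel \<Otimes>\<^sub>M lborel)"
    by measurable
  \<comment> \<open>Absolute convergence for Fubini: on the support of the kernel s \<ge> v / k, so
    the s-integral is of order v^(k-1) (v / k)^(-\<beta>) / \<beta>, which is a multiple of the
    weight in \<open>fin\<close>.\<close>
  have "integrable (lborel \<Otimes>\<^sub>M lborel) (\<lambda>(s, v). ?b s v)"
  proof (rule integrableI_bounded[OF meas])
    have "(\<integral>\<^sup>+z. ennreal (norm (case z of (s, v) \<Rightarrow> ?b s v)) \<partial>(lborel \<Otimes>\<^sub>M lborel))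
      = (\<integral>\<^sup>+v. \<integral>\<^sup>+s. ennreal (norm (?b s v)) \<partial>lborel \<partial>lborel)"
      using meas by (subst lborel_pair.nn_integral_snd[symmetric]) auto
    also have "\<dots> \<le> (\<integral>\<^sup>+v. ennreal (2 ^ k * real k powr \<beta> / \<beta>) * (ennreal (v powr (real k - \<beta> - 1) * \<bar>U k v\<bar>) * indicator {0<..} v) \<partial>lborel)"
    proof (rule nn_integral_mono)
      fix v :: real
      show "(\<integral>\<^sup>+s. ennreal (norm (?b s v)) \<partial>lborel) \<le> ennreal (2 ^ k * real k powr \<beta> / \<beta>) * (ennreal (v powr (real k - \<beta> - 1) * \<bar>U k v\<bar>) * indicator {0<..} v)"
      proof (cases "0 < v")
        case True
        have "(\<integral>\<^sup>+s. ennreal (norm (?b s v)) \<partial>lborel)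
          \<le> (\<integral>\<^sup>+s. ennreal (2 ^ k * v ^ M * \<bar>U k v\<bar>) * (ennreal (s powr (- \<beta> - 1)) * indicator {v / real k..} s) \<partial>lborel)"
        proof (rule nn_integral_mono)
          fix s :: real
          show "ennreal (norm (?b s v)) \<le> ennreal (2 ^ k * v ^ M * \<bar>U k v\<bar>) * (ennreal (s powr (- \<beta> - 1)) * indicator {v / real k..} s)"
          proof (cases "0 < s")
            case s: True
            have "\<bar>difference_kernel k s v\<bar> * (s powr (- \<beta> - 1) * \<bar>U k v\<bar>)
              \<le> 2 ^ k * v ^ (k - 1) * indicator {v / real k..} s * (s powr (- \<beta> - 1) * \<bar>U k v\<bar>)"
              by (intro mult_right_mono difference_kernel_bound k s True) auto
            moreover have "norm (?b s v) = \<bar>difference_kernel k s v\<bar> * (s powr (- \<beta> - 1) * \<bar>U k v\<bar>)"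
              using s True by (simp add: abs_mult)
            moreover have "ennreal (2 ^ k * v ^ (k - 1) * indicator {v / real k..} s * (s powr (- \<beta> - 1) * \<bar>U k v\<bar>))
              = ennreal (2 ^ k * v ^ M * \<bar>U k v\<bar>) * (ennreal (s powr (- \<beta> - 1)) * indicator {v / real k..} s)"
              using True by (cases "v / real k \<le> s") (simp_all add: M_def mult_ac flip: ennreal_mult)
            ultimately show ?thesis by (metis ennreal_leI)
          qed simp
        qed
        also have "\<dots> = ennreal (2 ^ k * v ^ M * \<bar>U k v\<bar>) * ennreal ((v / real k) powr (- \<beta>) / \<beta>)"
          using nn_integral_powr_inf[of \<beta> "v / real k"] True k \<beta> by (simp add: nn_integral_cmult)
        also have "\<dots> = ennreal (2 ^ k * real k powr \<beta> / \<beta> * (v powr (real k - \<beta> - 1) * \<bar>U k v\<bar>))"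
        proof -
          have "v ^ M = v powr (real k - 1)" using True by (simp add: kM powr_realpow)
          moreover have "(v / real k) powr (- \<beta>) = v powr (- \<beta>) * real k powr \<beta>"
            using True k by (simp add: powr_divide powr_minus field_simps)
          moreover have "v powr (real k - 1) * v powr (- \<beta>) = v powr (real k - \<beta> - 1)"
            unfolding powr_add[symmetric] by (simp add: algebra_simps)
          ultimately have "v ^ M * (v / real k) powr (- \<beta>) = real k powr \<beta> * v powr (real k - \<beta> - 1)"
            by simp
          then have "2 ^ k * \<bar>U k v\<bar> / \<beta> * (v ^ M * (v / real k) powr (- \<beta>)) = 2 ^ k * \<bar>U k v\<bar> / \<beta> * (real k powr \<beta> * v powr (real k - \<beta> - 1))"
            by simp
          then show ?thesis
            using True \<beta> by (subst ennreal_mult[symmetric]) (auto simp: mult_ac)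
        qed
        also have "\<dots> = ennreal (2 ^ k * real k powr \<beta> / \<beta>) * ennreal (v powr (real k - \<beta> - 1) * \<bar>U k v\<bar>)"
          using \<beta> by (intro ennreal_mult) auto
        finally show ?thesis using True by simp
      qed simp
    qed
    also have "\<dots> < \<infinity>"
      using fin by (subst nn_integral_cmult) (auto simp: ennreal_mult_less_top)
    finally show "(\<integral>\<^sup>+z. ennreal (norm (case z of (s, v) \<Rightarrow> ?b s v)) \<partial>(lborel \<Otimes>\<^sub>M lborel)) < \<infinity>" .
  qed
  note int = this
  show "set_integrable lborel {0<..} (\<lambda>s. s powr (- \<beta> - 1) * ?\<Delta> s)"
    unfolding set_integrable_def \<Delta> using lborel_pair.integrable_fst'[OF int] by simp
  have "(LINT s:{0<..}|lborel. s powr (- \<beta> - 1) * ?\<Delta> s) = (\<integral>s. \<integral>v. ?b s v \<partial>lborel \<partial>lborel)"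
    unfolding set_lebesgue_integral_def \<Delta> ..
  also have "\<dots> = (\<integral>v. \<integral>s. ?b s v \<partial>lborel \<partial>lborel)"
    by (rule lborel_pair.Fubini_integral[symmetric]) (rule int)
  also have "\<dots> = (\<integral>v. weyl_const k \<beta> * (indicator {0<..} v *\<^sub>R (v powr (real k - \<beta> - 1) * U k v)) \<partial>lborel)"
  proof (rule Bochner_Integration.integral_cong[OF refl])
    fix v :: real
    show "(\<integral>s. ?b s v \<partial>lborel) = weyl_const k \<beta> * (indicator {0<..} v *\<^sub>R (v powr (real k - \<beta> - 1) * U k v))"
    proof (cases "0 < v")
      case True
      \<comment> \<open>The substitution s \<mapsto> v s: the Jacobian v, the weight v^(-\<beta>-1)
        and the kernel v^(k-1) combine to v^(k-\<beta>-1).\<close>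
      have "(\<integral>s. ?b s v \<partial>lborel) = v * (\<integral>s. ?b (v * s) v \<partial>lborel)"
        using True by (subst lborel_integral_real_affine[where c=v and t=0]) auto
      also have "\<dots> = v * (\<integral>s. v powr (- \<beta> - 1) * v ^ M * U k v * (indicator {0<..} s *\<^sub>R (s powr (- \<beta> - 1) * difference_kernel k s 1)) \<partial>lborel)"
      proof (rule arg_cong2[where f="(*)", OF refl], rule Bochner_Integration.integral_cong[OF refl])
        fix s :: real
        show "?b (v * s) v = v powr (- \<beta> - 1) * v ^ M * U k v * (indicator {0<..} s *\<^sub>R (s powr (- \<beta> - 1) * difference_kernel k s 1))"
          using True by (cases "0 < s") (auto simp: difference_kernel_scale M_def powr_mult zero_less_mult_iff)
      qed
      also have "\<dots> = v * (v powr (- \<beta> - 1) * v ^ M * U k v * weyl_const k \<beta>)"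
        by (simp add: weyl_const_def set_lebesgue_integral_def)
      also have "v * (v powr (- \<beta> - 1) * v ^ M * U k v * weyl_const k \<beta>) = weyl_const k \<beta> * (v powr (real k - \<beta> - 1) * U k v)"
      proof -
        have "v ^ M = v powr (real k - 1)" using True by (simp add: kM powr_realpow)
        then have "v * (v powr (- \<beta> - 1) * v ^ M) = v powr 1 * (v powr (- \<beta> - 1) * v powr (real k - 1))"
          using True by simp
        also have "\<dots> = v powr (real k - \<beta> - 1)"
          unfolding powr_add[symmetric] by (simp add: algebra_simps)
        finally show ?thesis by (simp add: mult_ac)
      qed
      finally show ?thesis using True by simp
    qed simp
  qed
  also have "\<dots> = weyl_const k \<beta> * (LINT v:{0<..}|lborel. v powr (real k - \<beta> - 1) * U k v)"
    by (simp add: set_lebesgue_integral_def)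
  finally show "(LINT s:{0<..}|lborel. s powr (- \<beta> - 1) * ?\<Delta> s)
      = weyl_const k \<beta> * (LINT v:{0<..}|lborel. v powr (real k - \<beta> - 1) * U k v)" .
qed

section \<open>Raising the order of the square function\<close>

text \<open>With \<tau> = (1/2)^(i+2) these are the intervals from 2^(-i) to 2^(1-i), written as
  multiples of the time \<tau> at which the semigroup will act.\<close>

lemma dyadic_interval_exists:
  assumes "0 < t" "t \<le> (2::real)"
  shows "\<exists>i. t \<in> {4 * (1 / 2) ^ (i + 2)<..8 * (1 / 2) ^ (i + 2)}"
proof -
  define i where "i = (LEAST i. (1 / 2) ^ i < t)"
  have "\<exists>i. (1 / 2) ^ i < t" using assms by (intro real_arch_pow_inv) auto
  then have i: "(1 / 2) ^ i < t" unfolding i_def by (rule LeastI_ex)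
  have "t \<le> 2 * (1 / 2) ^ i"
  proof (cases i)
    case (Suc j)
    then have "\<not> (1 / 2) ^ j < t" using not_less_Least[of j "\<lambda>i. (1 / 2) ^ i < t"] by (simp add: i_def)
    then show ?thesis using Suc by simp
  qed (use assms in simp)
  then show ?thesis using i by (intro exI[of _ i]) (simp add: power_add)
qed

context poisson_kernel
begin

text \<open>The q-th power of the square function. The root is left out, so L^r norms of square
  functions appear with the exponent \<open>r / q\<close>.\<close>

definition kernel_square :: "real \<Rightarrow> real \<Rightarrow> nat \<Rightarrow> ('a \<Rightarrow> real) \<Rightarrow> 'a \<Rightarrow> ennreal" where
  "kernel_square \<alpha> q m f x =
     (\<integral>\<^sup>+t\<in>{0<..}. epowr (ennreal (t powr (real m - \<alpha>) * \<bar>Q m t f x\<bar>)) q * ennreal (1 / t) \<partial>lborel)"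

lemma kernel_square_measurable [measurable]:
  assumes [measurable]: "f \<in> borel_measurable M"
  shows "kernel_square \<alpha> q m f \<in> borel_measurable M"
  unfolding kernel_square_def[abs_def] by measurable

text \<open>Raising the order of differentiation: by the semigroup property \<open>\<partial>\<^sub>t\<^sup>N P\<^sub>t f\<close> on a dyadic block is
  \<open>\<partial>\<^sup>N\<^sup>-\<^sup>m P\<close> applied to \<open>\<partial>\<^sup>m P f\<close> on an earlier block, averaged over that block.\<close>

lemma square_raise:
  assumes r: "1 < r" and q: "1 \<le> q" and m: "\<alpha> < real m" "m \<le> N"
  obtains C where "0 < C" "\<And>f. integrable M f \<Longrightarrow>
    (\<integral>\<^sup>+x. epowr (local_square \<alpha> q N (\<lambda>j t. Q j t f x)) (r / q) \<partial>M)
    \<le> ennreal C * (\<integral>\<^sup>+x. epowr (kernel_square \<alpha> q m f x) (r / q) \<partial>M)"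
proof -
  obtain C0 where C0: "0 < C0" "vector_bound C0 q r"
    by (rule vector_inequality[OF q r]) (rule that)
  define d where "d = D (N - m)"
  have d: "0 < d" using D_pos by (simp add: d_def)
  \<comment> \<open>The 4 is the Harnack loss, d comes from differentiating the kernel N - m times,
    and the power of 8 from t \<le> 8 \<tau>.\<close>
  define c where "c = 4 * d * 8 powr (real N - \<alpha>)"
  have c: "0 < c" using d by (simp add: c_def)
  define C where "C = (c powr q) powr (r / q) * (C0 * (2 * 2 powr q) powr (r / q))"
  have "0 < C" using c C0(1) by (simp add: C_def)
  show ?thesis
  proof (rule that[OF \<open>0 < C\<close>])
    fix f :: "'a \<Rightarrow> real" assume f: "integrable M f"
    then have [measurable]: "f \<in> borel_measurable M" by auto
    let ?S = "kernel_square \<alpha> q m f"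
    show "(\<integral>\<^sup>+x. epowr (local_square \<alpha> q N (\<lambda>j t. Q j t f x)) (r / q) \<partial>M)
      \<le> ennreal C * (\<integral>\<^sup>+x. epowr (?S x) (r / q) \<partial>M)"
    proof (cases "(\<integral>\<^sup>+x. epowr (?S x) (r / q) \<partial>M) = top")
      case True
      then show ?thesis using \<open>0 < C\<close> by (simp add: ennreal_mult_top)
    next
      case False
      then have S_fin: "(\<integral>\<^sup>+x. epowr (?S x) (r / q) \<partial>M) < top" by (simp add: less_top)
      \<comment> \<open>For s in the block (\<tau>, 2 \<tau>] and t in (4 \<tau>, 8 \<tau>] the
        remaining time satisfies (t - s) / 2 \<ge> \<tau>. Harnack's inequality then replaces it by
        the single time \<tau>, so that one operator serves the whole block.\<close>
      define \<tau> :: "nat \<Rightarrow> real" where "\<tau> i = (1 / 2) ^ (i + 2)" for i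
      have \<tau>: "0 < \<tau> i" for i by (simp add: \<tau>_def)
      define J where "J i = {\<tau> i<..2 * \<tau> i}" for i
      have [measurable]: "J i \<in> sets borel" for i by (simp add: J_def)
      define w where "w i s = ennreal (1 / \<tau> i) * indicator (J i) s" for i s
      have [measurable]: "w i \<in> borel_measurable borel" for i unfolding w_def[abs_def] by measurable
      have w_total: "(\<integral>\<^sup>+s. w i s \<partial>lborel) = 1" for i
        unfolding w_def J_def using \<tau>[of i] by (simp add: nn_integral_cmult flip: ennreal_mult)
      define \<psi> where "\<psi> i y = (\<integral>\<^sup>+s. w i s * ennreal \<bar>Q m s f y\<bar> \<partial>lborel)" for i y
      have [measurable]: "\<psi> i \<in> borel_measurable M" for i unfolding \<psi>_def[abs_def] by measurable
      have \<psi>_fin: "\<psi> i y < top" for i y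
      proof -
        let ?B = "D m / \<tau> i ^ m * (3 * \<tau> i / \<tau> i) * Q 0 (\<tau> i / 2) (\<lambda>y. \<bar>f y\<bar>) y"
        have "\<psi> i y \<le> (\<integral>\<^sup>+s. w i s * ennreal ?B \<partial>lborel)"
          unfolding \<psi>_def
        proof (rule nn_integral_mono)
          fix s :: real
          show "w i s * ennreal \<bar>Q m s f y\<bar> \<le> w i s * ennreal ?B"
          proof (cases "s \<in> J i")
            case True
            then have "\<bar>Q m s f y\<bar> \<le> ?B"
              using \<tau>[of i] by (intro Q_local_bound f) (auto simp: J_def)
            then show ?thesis by (intro mult_left_mono ennreal_leI) auto
          qed (simp add: w_def)
        qed
        also have "\<dots> = ennreal ?B" by (simp add: nn_integral_multc w_total)
        finally show ?thesis by (rule le_less_trans) simp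
      qed
      \<comment> \<open>The weighted average of the m-th derivative over a block. By Jensen's
        inequality its q-th power is bounded by the part of \<open>?S\<close> over that block, and
        the blocks are disjoint.\<close>
      define E where "E i y = \<tau> i powr (real m - \<alpha>) * enn2real (\<psi> i y)" for i y
      have [measurable]: "E i \<in> borel_measurable M" for i unfolding E_def[abs_def] by measurable
      have E_nn: "0 \<le> E i y" for i y by (simp add: E_def)
      have E_eq: "ennreal (E i y) = ennreal (\<tau> i powr (real m - \<alpha>)) * \<psi> i y" for i y
        unfolding E_def using \<psi>_fin[of i y] by (simp add: ennreal_mult)
      let ?\<phi> = "\<lambda>y s. epowr (ennreal (s powr (real m - \<alpha>) * \<bar>Q m s f y\<bar>)) q * ennreal (1 / s)"
      have E_pow: "epowr (ennreal (E i y)) q \<le> ennreal (2 * 2 powr q) * (\<integral>\<^sup>+s. ?\<phi> y s * indicator (J i) s \<partial>lborel)" for i y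
      proof -
        have "epowr (\<psi> i y) q \<le> ennreal (2 * (2 * 1) powr (q - 1)) * (\<integral>\<^sup>+s. w i s * epowr (ennreal \<bar>Q m s f y\<bar>) q \<partial>lborel)"
          unfolding \<psi>_def using q w_total[of i] by (intro jensen_crude) auto
        then have "epowr (ennreal (E i y)) q \<le> epowr (ennreal (\<tau> i powr (real m - \<alpha>))) q * (ennreal (2 powr q) * (\<integral>\<^sup>+s. w i s * epowr (ennreal \<bar>Q m s f y\<bar>) q \<partial>lborel))"
          unfolding E_eq epowr_mult by (intro mult_left_mono) (auto simp: powr_diff)
        also have "\<dots> = ennreal (2 powr q) * (\<integral>\<^sup>+s. epowr (ennreal (\<tau> i powr (real m - \<alpha>))) q * (w i s * epowr (ennreal \<bar>Q m s f y\<bar>) q) \<partial>lborel)"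
          by (subst nn_integral_cmult) (auto simp: mult_ac)
        also have "\<dots> \<le> ennreal (2 powr q) * (\<integral>\<^sup>+s. 2 * (?\<phi> y s * indicator (J i) s) \<partial>lborel)"
        proof (intro mult_left_mono nn_integral_mono)
          fix s :: real
          show "epowr (ennreal (\<tau> i powr (real m - \<alpha>))) q * (w i s * epowr (ennreal \<bar>Q m s f y\<bar>) q) \<le> 2 * (?\<phi> y s * indicator (J i) s)"
          proof (cases "s \<in> J i")
            case True
            then have s: "\<tau> i < s" "s \<le> 2 * \<tau> i" "0 < s" using \<tau>[of i] by (auto simp: J_def)
            have "ennreal (\<tau> i powr (real m - \<alpha>)) \<le> ennreal (s powr (real m - \<alpha>))"
              using s m \<tau>[of i] by (intro ennreal_leI powr_mono2) auto
            then have 1: "epowr (ennreal (\<tau> i powr (real m - \<alpha>))) q \<le> epowr (ennreal (s powr (real m - \<alpha>))) q"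
              using q by (intro epowr_mono) auto
            have "1 / \<tau> i \<le> 2 * (1 / s)" using s \<tau>[of i] by (simp add: field_simps)
            then have "w i s \<le> ennreal (2 * (1 / s))" using True by (simp add: w_def ennreal_leI)
            also have "\<dots> = 2 * ennreal (1 / s)" using s by (subst ennreal_mult) auto
            finally have "epowr (ennreal (\<tau> i powr (real m - \<alpha>))) q * (w i s * epowr (ennreal \<bar>Q m s f y\<bar>) q)
              \<le> epowr (ennreal (s powr (real m - \<alpha>))) q * ((2 * ennreal (1 / s)) * epowr (ennreal \<bar>Q m s f y\<bar>) q)"
              using 1 by (intro mult_mono) auto
            also have "\<dots> = 2 * (?\<phi> y s * indicator (J i) s)"
              using True by (simp add: ennreal_mult epowr_mult mult_ac)
            finally show ?thesis .
          qed (simp add: w_def)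
        qed auto
        also have "\<dots> = ennreal (2 powr q) * (2 * (\<integral>\<^sup>+s. ?\<phi> y s * indicator (J i) s \<partial>lborel))"
          by (subst nn_integral_cmult) auto
        also have "\<dots> = ennreal (2 * 2 powr q) * (\<integral>\<^sup>+s. ?\<phi> y s * indicator (J i) s \<partial>lborel)"
          by (simp add: ennreal_mult mult_ac)
        finally show ?thesis .
      qed
      have disj: "disjoint_family_on J UNIV"
        unfolding disjoint_family_on_def
      proof (intro ballI impI)
        have "J i \<inter> J j = {}" if "i < j" for i j
        proof -
          have "2 * \<tau> j = (1 / 2) ^ (j + 1)" by (simp add: \<tau>_def)
          also have "\<dots> \<le> \<tau> i" unfolding \<tau>_def using that by (intro power_decreasing) auto
          finally show ?thesis by (auto simp: J_def)
        qed
        then show "J i \<inter> J j = {}" if "i \<noteq> j" for i j using that by (metis Int_commute nat_neq_iff)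
      qed
      have E_sum: "(\<Sum>i<n. epowr (ennreal (E i y)) q) \<le> ennreal (2 * 2 powr q) * ?S y" for n y
      proof -
        have "(\<Sum>i<n. epowr (ennreal (E i y)) q) \<le> (\<Sum>i<n. ennreal (2 * 2 powr q) * (\<integral>\<^sup>+s. ?\<phi> y s * indicator (J i) s \<partial>lborel))"
          by (intro sum_mono E_pow)
        also have "\<dots> = ennreal (2 * 2 powr q) * (\<integral>\<^sup>+s. (\<Sum>i<n. ?\<phi> y s * indicator (J i) s) \<partial>lborel)"
          by (subst nn_integral_sum) (auto simp: sum_distrib_left)
        also have "\<dots> \<le> ennreal (2 * 2 powr q) * (\<integral>\<^sup>+s. ?\<phi> y s * indicator {0<..} s \<partial>lborel)"
        proof (intro mult_left_mono nn_integral_mono)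
          fix s :: real
          have "(\<Sum>i<n. indicator (J i) s :: ennreal) = indicator (\<Union>i<n. J i) s"
            using disj by (intro indicator_UN_disjoint[symmetric]) (auto simp: disjoint_family_on_def)
          also have "\<dots> \<le> indicator {0<..} s"
            by (auto simp: J_def intro: less_trans[OF \<tau>] split: split_indicator)
          finally have "(\<Sum>i<n. indicator (J i) s :: ennreal) \<le> indicator {0<..} s" .
          then show "(\<Sum>i<n. ?\<phi> y s * indicator (J i) s) \<le> ?\<phi> y s * indicator {0<..} s"
            unfolding sum_distrib_left[symmetric] by (rule mult_left_mono) simp
        qed auto
        finally show ?thesis by (simp add: kernel_square_def)
      qed
      \<comment> \<open>A single term of the sum in \<open>E_sum\<close> gives the L^r bound that
        \<open>vector_bound\<close> asks of each function.\<close>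
      have E_Lr: "(\<integral>\<^sup>+y. epowr (ennreal (E i y)) r \<partial>M) < top" for i
      proof -
        have "(\<integral>\<^sup>+y. epowr (ennreal (E i y)) r \<partial>M) \<le> (\<integral>\<^sup>+y. epowr (ennreal (2 * 2 powr q)) (r / q) * epowr (?S y) (r / q) \<partial>M)"
        proof (rule nn_integral_mono)
          fix y
          have "epowr (ennreal (E i y)) q \<le> (\<Sum>i<Suc i. epowr (ennreal (E i y)) q)" by simp
          also have "\<dots> \<le> ennreal (2 * 2 powr q) * ?S y" by (rule E_sum)
          finally have "epowr (epowr (ennreal (E i y)) q) (r / q) \<le> epowr (ennreal (2 * 2 powr q) * ?S y) (r / q)"
            using q r by (intro epowr_mono) auto
          then show "epowr (ennreal (E i y)) r \<le> epowr (ennreal (2 * 2 powr q)) (r / q) * epowr (?S y) (r / q)"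
            using q by (simp add: epowr_epowr epowr_mult)
        qed
        also have "\<dots> = epowr (ennreal (2 * 2 powr q)) (r / q) * (\<integral>\<^sup>+y. epowr (?S y) (r / q) \<partial>M)"
          by (rule nn_integral_cmult) auto
        also have "\<dots> < top" using S_fin by (simp add: ennreal_mult_less_top)
        finally show ?thesis .
      qed
      have E_int: "integrable M (E i)" for i
        using E_Lr[of i] r E_nn by (intro integrable_of_Lp[of _ r]) auto
      have main: "ennreal (t powr (real N - \<alpha>) * \<bar>Q N t f x\<bar>) \<le> ennreal c * ennreal (Q 0 (\<tau> i) (E i) x)"
        if t: "t \<in> {4 * \<tau> i<..8 * \<tau> i}" for t i x
      proof -
        let ?P = "\<lambda>s. \<integral>\<^sup>+y. ennreal (p 0 (\<tau> i) x y) * ennreal \<bar>Q m s f y\<bar> \<partial>M"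
        let ?K = "4 * d / \<tau> i ^ (N - m)"
        have K: "0 \<le> ?K" using d \<tau>[of i] by simp
        have step: "ennreal \<bar>Q N t f x\<bar> \<le> ennreal ?K * ?P s" if s: "s \<in> J i" for s
        proof -
          have st: "0 < s" "2 * \<tau> i \<le> t - s" "t - s \<le> 8 * \<tau> i" using s t \<tau>[of i] by (auto simp: J_def)
          have g: "integrable M (\<lambda>y. \<bar>Q m s f y\<bar>)" using Q_integrable[OF f st(1), of m] by auto
          have nn: "0 \<le> Q 0 (\<tau> i) (\<lambda>y. \<bar>Q m s f y\<bar>) x" using \<tau> by (intro Q_nonneg) auto
          \<comment> \<open>Here m of the N derivatives go to the time s and the other N - m to the
            kernel at time t - s, which costs (t - s)^(-(N-m)).\<close>
          have "Q N t f x = Q (N - m) (t - s) (Q m s f) x"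
            using Q_semigroup[OF f, of "t - s" s "N - m" m x] st \<tau>[of i] m by simp
          then have "\<bar>Q N t f x\<bar> \<le> d / (t - s) ^ (N - m) * Q 0 ((t - s) / 2) (\<lambda>y. \<bar>Q m s f y\<bar>) x"
            unfolding d_def using st \<tau>[of i] f by (simp only:) (intro Q_abs_bound Q_integrable, auto)
          also have "\<dots> \<le> d / \<tau> i ^ (N - m) * (4 * Q 0 (\<tau> i) (\<lambda>y. \<bar>Q m s f y\<bar>) x)"
          proof (intro mult_mono)
            show "d / (t - s) ^ (N - m) \<le> d / \<tau> i ^ (N - m)"
              using d st \<tau>[of i] by (intro divide_left_mono power_mono) auto
            have "Q 0 ((t - s) / 2) (\<lambda>y. \<bar>Q m s f y\<bar>) x \<le> ((t - s) / 2) / \<tau> i * Q 0 (\<tau> i) (\<lambda>y. \<bar>Q m s f y\<bar>) x"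
              using st \<tau>[of i] g by (intro Q_harnack) auto
            also have "\<dots> \<le> 4 * Q 0 (\<tau> i) (\<lambda>y. \<bar>Q m s f y\<bar>) x"
              using st \<tau>[of i] nn by (intro mult_right_mono) (auto simp: field_simps)
            finally show "Q 0 ((t - s) / 2) (\<lambda>y. \<bar>Q m s f y\<bar>) x \<le> 4 * Q 0 (\<tau> i) (\<lambda>y. \<bar>Q m s f y\<bar>) x" .
          qed (use d \<tau>[of i] st in \<open>auto intro!: Q_nonneg\<close>)
          finally have "ennreal \<bar>Q N t f x\<bar> \<le> ennreal (?K * Q 0 (\<tau> i) (\<lambda>y. \<bar>Q m s f y\<bar>) x)"
            by (intro ennreal_leI) (simp add: mult_ac)
          also have "\<dots> = ennreal ?K * ?P s"
            using K nn g \<tau>[of i] by (subst ennreal_mult) (auto simp: Q_nn_integral)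
          finally show ?thesis .
        qed
        interpret prod_lborel: pair_sigma_finite M "lborel :: real measure" by standard
        have "ennreal \<bar>Q N t f x\<bar> = (\<integral>\<^sup>+s. w i s * ennreal \<bar>Q N t f x\<bar> \<partial>lborel)"
          by (simp add: nn_integral_multc w_total)
        also have "\<dots> \<le> (\<integral>\<^sup>+s. w i s * (ennreal ?K * ?P s) \<partial>lborel)"
        proof (rule nn_integral_mono)
          fix s :: real
          show "w i s * ennreal \<bar>Q N t f x\<bar> \<le> w i s * (ennreal ?K * ?P s)"
            using step[of s] by (cases "s \<in> J i") (auto simp: w_def mult_left_mono)
        qed
        also have "\<dots> = ennreal ?K * (\<integral>\<^sup>+s. \<integral>\<^sup>+y. ennreal (p 0 (\<tau> i) x y) * (w i s * ennreal \<bar>Q m s f y\<bar>) \<partial>M \<partial>lborel)"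
          by (subst nn_integral_cmult[symmetric])
            (auto intro!: nn_integral_cong simp: nn_integral_cmult[symmetric] mult_ac)
        also have "(\<integral>\<^sup>+s. \<integral>\<^sup>+y. ennreal (p 0 (\<tau> i) x y) * (w i s * ennreal \<bar>Q m s f y\<bar>) \<partial>M \<partial>lborel)
          = (\<integral>\<^sup>+y. \<integral>\<^sup>+s. ennreal (p 0 (\<tau> i) x y) * (w i s * ennreal \<bar>Q m s f y\<bar>) \<partial>lborel \<partial>M)"
          by (rule prod_lborel.Fubini') measurable
        also have "\<dots> = (\<integral>\<^sup>+y. ennreal (p 0 (\<tau> i) x y) * \<psi> i y \<partial>M)"
          unfolding \<psi>_def by (intro nn_integral_cong nn_integral_cmult) measurable
        finally have 1: "ennreal \<bar>Q N t f x\<bar> \<le> ennreal ?K * (\<integral>\<^sup>+y. ennreal (p 0 (\<tau> i) x y) * \<psi> i y \<partial>M)" .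
        have 2: "ennreal (Q 0 (\<tau> i) (E i) x) = ennreal (\<tau> i powr (real m - \<alpha>)) * (\<integral>\<^sup>+y. ennreal (p 0 (\<tau> i) x y) * \<psi> i y \<partial>M)"
          using E_int E_nn \<tau>[of i] by (subst Q_nn_integral) (auto simp: E_eq nn_integral_cmult[symmetric] mult_ac)
        have "t powr (real N - \<alpha>) \<le> (8 * \<tau> i) powr (real N - \<alpha>)"
          using t \<tau>[of i] m by (intro powr_mono2) auto
        then have "t powr (real N - \<alpha>) * ?K \<le> (8 * \<tau> i) powr (real N - \<alpha>) * ?K"
          using K by (rule mult_right_mono)
        also have "\<dots> = c * (\<tau> i powr (real N - \<alpha>) / \<tau> i ^ (N - m))"
          using \<tau>[of i] by (simp add: c_def powr_mult)
        also have "\<tau> i powr (real N - \<alpha>) / \<tau> i ^ (N - m) = \<tau> i powr (real m - \<alpha>)"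
        proof -
          have "\<tau> i ^ (N - m) = \<tau> i powr (real N - real m)"
            using \<tau>[of i] m by (simp add: powr_realpow[symmetric] of_nat_diff)
          then show ?thesis by (simp add: powr_diff[symmetric])
        qed
        finally have 3: "t powr (real N - \<alpha>) * ?K \<le> c * \<tau> i powr (real m - \<alpha>)" .
        have "ennreal (t powr (real N - \<alpha>) * \<bar>Q N t f x\<bar>) = ennreal (t powr (real N - \<alpha>)) * ennreal \<bar>Q N t f x\<bar>"
          by (rule ennreal_mult) auto
        also have "\<dots> \<le> ennreal (t powr (real N - \<alpha>)) * (ennreal ?K * (\<integral>\<^sup>+y. ennreal (p 0 (\<tau> i) x y) * \<psi> i y \<partial>M))"
          by (intro mult_left_mono 1) auto
        also have "\<dots> = ennreal (t powr (real N - \<alpha>) * ?K) * (\<integral>\<^sup>+y. ennreal (p 0 (\<tau> i) x y) * \<psi> i y \<partial>M)"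
          using K by (subst ennreal_mult) (auto simp: mult.assoc)
        also have "\<dots> \<le> ennreal (c * \<tau> i powr (real m - \<alpha>)) * (\<integral>\<^sup>+y. ennreal (p 0 (\<tau> i) x y) * \<psi> i y \<partial>M)"
          by (intro mult_right_mono ennreal_leI 3) auto
        also have "\<dots> = ennreal c * ennreal (Q 0 (\<tau> i) (E i) x)"
          unfolding 2 using c by (subst ennreal_mult) (auto simp: mult.assoc)
        finally show ?thesis .
      qed
      let ?Y = "\<lambda>x i. epowr (ennreal (Q 0 (\<tau> i) (E i) x)) q"
      have local_le: "local_square \<alpha> q N (\<lambda>j t. Q j t f x) \<le> (\<Squnion>n. \<Sum>i<n. ennreal (c powr q) * ?Y x i)" for x
      proof -
        let ?I = "\<lambda>i. {4 * \<tau> i<..8 * \<tau> i}"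
        let ?f = "\<lambda>t. epowr (ennreal (t powr (real N - \<alpha>) * \<bar>Q N t f x\<bar>)) q * ennreal (1 / t)"
        have "local_square \<alpha> q N (\<lambda>j t. Q j t f x) \<le> (\<integral>\<^sup>+t. (\<Sum>i. ?f t * indicator (?I i) t) \<partial>lborel)"
          unfolding local_square_def
        proof (rule nn_integral_mono)
          fix t :: real
          show "?f t * indicator {0<..2} t \<le> (\<Sum>i. ?f t * indicator (?I i) t)"
          proof (cases "0 < t \<and> t \<le> 2")
            case True
            then obtain i where i: "t \<in> ?I i" using dyadic_interval_exists[of t] by (auto simp: \<tau>_def)
            have "?f t * indicator {0<..2} t = (\<Sum>i\<in>{i}. ?f t * indicator (?I i) t)" using True i by simp
            also have "\<dots> \<le> (\<Sum>i. ?f t * indicator (?I i) t)" by (intro sum_le_suminf) auto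
            finally show ?thesis .
          qed auto
        qed
        also have "\<dots> = (\<Sum>i. \<integral>\<^sup>+t. ?f t * indicator (?I i) t \<partial>lborel)"
          by (rule nn_integral_suminf) measurable
        also have "\<dots> \<le> (\<Sum>i. ennreal (c powr q) * ?Y x i)"
        proof (rule suminf_le)
          fix i
          have "(\<integral>\<^sup>+t. ?f t * indicator (?I i) t \<partial>lborel) \<le> (\<integral>\<^sup>+t. ennreal (c powr q) * ?Y x i * ennreal (1 / (4 * \<tau> i)) * indicator (?I i) t \<partial>lborel)"
          proof (rule nn_integral_mono)
            fix t :: real
            show "?f t * indicator (?I i) t \<le> ennreal (c powr q) * ?Y x i * ennreal (1 / (4 * \<tau> i)) * indicator (?I i) t"
            proof (cases "t \<in> ?I i")
              case True
              have "epowr (ennreal (t powr (real N - \<alpha>) * \<bar>Q N t f x\<bar>)) q \<le> epowr (ennreal c * ennreal (Q 0 (\<tau> i) (E i) x)) q"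
                using q by (intro epowr_mono main True) auto
              also have "\<dots> = ennreal (c powr q) * ?Y x i"
                using c by (simp add: epowr_mult epowr_ennreal)
              finally have "?f t \<le> ennreal (c powr q) * ?Y x i * ennreal (1 / (4 * \<tau> i))"
                using True \<tau>[of i] by (intro mult_mono ennreal_leI) (auto simp: field_simps)
              then show ?thesis using True by simp
            qed simp
          qed
          also have "\<dots> = ennreal (c powr q) * ?Y x i * (ennreal (1 / (4 * \<tau> i)) * ennreal (4 * \<tau> i))"
            using \<tau>[of i] by (simp add: nn_integral_cmult mult.assoc)
          also have "ennreal (1 / (4 * \<tau> i)) * ennreal (4 * \<tau> i) = 1"
            using \<tau>[of i] by (simp flip: ennreal_mult)
          finally show "(\<integral>\<^sup>+t. ?f t * indicator (?I i) t \<partial>lborel) \<le> ennreal (c powr q) * ?Y x i" by simp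
        qed auto
        also have "\<dots> = (\<Squnion>n. \<Sum>i<n. ennreal (c powr q) * ?Y x i)" by (rule suminf_eq_SUP)
        finally show ?thesis .
      qed
      have partial: "(\<integral>\<^sup>+x. epowr (\<Sum>i<n. ennreal (c powr q) * ?Y x i) (r / q) \<partial>M) \<le> ennreal C * (\<integral>\<^sup>+x. epowr (?S x) (r / q) \<partial>M)" for n
      proof -
        \<comment> \<open>The smallest step in play: for i < n the time \<open>\<tau> i\<close> is
          2^(n-i) times h, which puts the first n times on one grid. As \<open>C0\<close> is
          independent of h and n, the limit n \<rightarrow> \<infinity> is harmless.\<close>
        define h :: real where "h = (1 / 2) ^ (n + 2)"
        have times: "real (Suc (2 ^ (n - i) - 1)) * h = \<tau> i" if "i < n" for i
        proof -
          have "real (Suc (2 ^ (n - i) - 1)) = 2 ^ (n - i)" by (simp add: of_nat_diff)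
          moreover have "h = (1 / 2) ^ (n - i) * \<tau> i" using that by (simp add: h_def \<tau>_def flip: power_add)
          ultimately show ?thesis by (simp add: power_one_over)
        qed
        have "(\<integral>\<^sup>+x. epowr (\<Sum>i<n. epowr (ennreal (Q 0 (real (Suc (2 ^ (n - i) - 1)) * h) (E i) x)) q) (r / q) \<partial>M)
          \<le> ennreal C0 * (\<integral>\<^sup>+x. epowr (\<Sum>i<n. epowr (ennreal (E i x)) q) (r / q) \<partial>M)"
          using E_nn E_Lr by (intro C0(2)[unfolded vector_bound_def, rule_format]) (auto simp: h_def)
        then have 1: "(\<integral>\<^sup>+x. epowr (\<Sum>i<n. ?Y x i) (r / q) \<partial>M)
          \<le> ennreal C0 * (\<integral>\<^sup>+x. epowr (\<Sum>i<n. epowr (ennreal (E i x)) q) (r / q) \<partial>M)"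
          using times by simp
        have "(\<integral>\<^sup>+x. epowr (\<Sum>i<n. epowr (ennreal (E i x)) q) (r / q) \<partial>M) \<le> (\<integral>\<^sup>+x. epowr (ennreal (2 * 2 powr q) * ?S x) (r / q) \<partial>M)"
          using q r by (intro nn_integral_mono epowr_mono E_sum) auto
        also have "\<dots> = ennreal ((2 * 2 powr q) powr (r / q)) * (\<integral>\<^sup>+x. epowr (?S x) (r / q) \<partial>M)"
          unfolding epowr_mult by (subst nn_integral_cmult) (auto simp: epowr_ennreal)
        finally have 2: "(\<integral>\<^sup>+x. epowr (\<Sum>i<n. ?Y x i) (r / q) \<partial>M)
          \<le> ennreal C0 * (ennreal ((2 * 2 powr q) powr (r / q)) * (\<integral>\<^sup>+x. epowr (?S x) (r / q) \<partial>M))"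
          using 1 by (meson mult_left_mono order_trans zero_le)
        have "(\<integral>\<^sup>+x. epowr (\<Sum>i<n. ennreal (c powr q) * ?Y x i) (r / q) \<partial>M)
          = ennreal ((c powr q) powr (r / q)) * (\<integral>\<^sup>+x. epowr (\<Sum>i<n. ?Y x i) (r / q) \<partial>M)"
          unfolding sum_distrib_left[symmetric] epowr_mult
          by (subst nn_integral_cmult) (auto simp: epowr_ennreal)
        also have "\<dots> \<le> ennreal ((c powr q) powr (r / q)) * (ennreal C0 * (ennreal ((2 * 2 powr q) powr (r / q)) * (\<integral>\<^sup>+x. epowr (?S x) (r / q) \<partial>M)))"
          by (intro mult_left_mono 2) auto
        also have "\<dots> = ennreal C * (\<integral>\<^sup>+x. epowr (?S x) (r / q) \<partial>M)"
          unfolding C_def using C0(1) by (simp add: ennreal_mult mult.assoc)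
        finally show ?thesis .
      qed
      have "(\<integral>\<^sup>+x. epowr (local_square \<alpha> q N (\<lambda>j t. Q j t f x)) (r / q) \<partial>M)
        \<le> (\<integral>\<^sup>+x. epowr (\<Squnion>n. \<Sum>i<n. ennreal (c powr q) * ?Y x i) (r / q) \<partial>M)"
        using r q by (intro nn_integral_mono epowr_mono local_le) auto
      also have "\<dots> = (\<integral>\<^sup>+x. (\<Squnion>n. epowr (\<Sum>i<n. ennreal (c powr q) * ?Y x i) (r / q)) \<partial>M)"
        using r q by (subst epowr_SUP) auto
      also have "\<dots> = (\<Squnion>n. \<integral>\<^sup>+x. epowr (\<Sum>i<n. ennreal (c powr q) * ?Y x i) (r / q) \<partial>M)"
      proof (rule nn_integral_monotone_convergence_SUP)
        show "incseq (\<lambda>n x. epowr (\<Sum>i<n. ennreal (c powr q) * ?Y x i) (r / q))"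
          using r q by (intro incseq_SucI le_funI epowr_mono) auto
      qed measurable
      also have "\<dots> \<le> ennreal C * (\<integral>\<^sup>+x. epowr (?S x) (r / q) \<partial>M)"
        by (intro SUP_least partial)
      finally show ?thesis .
    qed
  qed
qed

end

section \<open>Bessel derivatives for symmetric semigroups\<close>

lemma local_square_measurable [measurable (raw)]:
  assumes "\<And>j. (\<lambda>(x, t). H x j t) \<in> borel_measurable (M \<Otimes>\<^sub>M borel)"
  shows "(\<lambda>x. local_square \<alpha> q N (H x)) \<in> borel_measurable M"
proof -
  have [measurable]: "(\<lambda>(x, t). H x N t) \<in> borel_measurable (M \<Otimes>\<^sub>M lborel)"
    using assms[of N] by (simp cong: measurable_cong_sets)
  show ?thesis unfolding local_square_def by measurable
qed

context poisson_kernel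
begin

section \<open>Damped derivatives, the maximal function and the Weyl form of the operator\<close>

lemma damped_deriv_Q_integrable:
  assumes "integrable M f" "0 < v"
  shows "integrable M (\<lambda>y. damped_deriv k (\<lambda>i. Q i v f y) l)"
  using assms by (induction k arbitrary: l) (auto intro: Q_integrable)

lemma Q_damped_deriv:
  assumes "integrable M f" "0 < t" "0 < v"
  shows "Q j t (\<lambda>y. damped_deriv k (\<lambda>i. Q i v f y) l) x = damped_deriv k (\<lambda>i. Q i (t + v) f x) (l + j)"
proof (induction k arbitrary: l)
  case 0
  then show ?case using Q_semigroup[OF assms, of j l x] by (simp add: add.commute)
next
  case (Suc k)
  then show ?case
    using assms by (simp add: Q_diff damped_deriv_Q_integrable)
qed

text \<open>Step 1/2, because for v \<ge> 1 the kernel bound leads to times v / 2 \<ge> 1/2.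
  Multiples of 1/2 suffice: Harnack's inequality reaches the times in between.\<close>

definition grand_max :: "('a \<Rightarrow> real) \<Rightarrow> 'a \<Rightarrow> ennreal" where
  "grand_max f x = (\<Squnion>k. ennreal (Q 0 (real (Suc k) * (1 / 2)) (\<lambda>y. \<bar>f y\<bar>) x))"

lemma grand_max_measurable [measurable]:
  assumes [measurable]: "f \<in> borel_measurable M"
  shows "grand_max f \<in> borel_measurable M"
  unfolding grand_max_def[abs_def] by measurable

lemma Q_smooth_decay:
  assumes f: "integrable M f" and fin: "grand_max f x < top"
  shows "smooth_decay N (2 * (\<Sum>j\<le>N. D j) * enn2real (grand_max f x)) (\<lambda>j t. Q j t f x)"
  unfolding smooth_decay_def
proof (intro conjI allI impI)
  have [measurable]: "f \<in> borel_measurable M" using f by auto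
  have af: "integrable M (\<lambda>y. \<bar>f y\<bar>)" using f by auto
  have sum_D: "0 \<le> (\<Sum>j\<le>N. D j)" by (intro sum_nonneg) (auto intro: less_imp_le D_pos)
  then show "0 \<le> 2 * (\<Sum>j\<le>N. D j) * enn2real (grand_max f x)" by simp
  show "(\<lambda>t. Q j t f x) \<in> borel_measurable borel" for j
    by measurable
  show "((\<lambda>t. Q j t f x) has_real_derivative Q (Suc j) v f x) (at v)" if "0 < v" for j v
    using f that by (rule Q_deriv)
  fix j v assume j: "j \<le> N" and v: "1 \<le> (v :: real)"
  \<comment> \<open>\<open>Suc i\<close> is the integer part of v. Rounding v / 2 down to the grid
    changes the time by a factor at most 2, hence the 2 in the constant.\<close>
  define i where "i = nat \<lfloor>v\<rfloor> - 1"
  have i: "real (Suc i) \<le> v" "v \<le> 2 * real (Suc i)"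
  proof -
    have fl: "1 \<le> \<lfloor>v\<rfloor>" using v by (simp add: le_floor_iff)
    then have eq: "real (Suc i) = of_int \<lfloor>v\<rfloor>" by (simp add: i_def of_nat_diff)
    show "real (Suc i) \<le> v" unfolding eq by simp
    have "v < real (Suc i) + 1" unfolding eq using floor_correct[of v] by simp
    then show "v \<le> 2 * real (Suc i)" by simp
  qed
  let ?Qi = "Q 0 (real (Suc i) * (1 / 2)) (\<lambda>y. \<bar>f y\<bar>) x"
  have "ennreal ?Qi \<le> grand_max f x"
    unfolding grand_max_def by (rule SUP_upper) simp
  then have "ennreal ?Qi \<le> ennreal (enn2real (grand_max f x))" using fin by simp
  then have Qi: "?Qi \<le> enn2real (grand_max f x)" by (simp add: ennreal_le_iff)
  have Qi_nn: "0 \<le> ?Qi" by (intro Q_nonneg) auto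
  have "\<bar>Q j v f x\<bar> \<le> D j / v ^ j * Q 0 (v / 2) (\<lambda>y. \<bar>f y\<bar>) x"
    using v by (intro Q_abs_bound f) auto
  also have "\<dots> \<le> (\<Sum>j\<le>N. D j) / v ^ j * (2 * enn2real (grand_max f x))"
  proof (intro mult_mono)
    show "D j / v ^ j \<le> (\<Sum>j\<le>N. D j) / v ^ j"
      using v j by (intro divide_right_mono member_le_sum) (auto intro: less_imp_le D_pos)
    have "Q 0 (v / 2) (\<lambda>y. \<bar>f y\<bar>) x \<le> (v / 2) / (real (Suc i) * (1 / 2)) * ?Qi"
      using i v af by (intro Q_harnack) auto
    also have "\<dots> \<le> 2 * ?Qi"
      using i Qi_nn by (intro mult_right_mono) (auto simp: field_simps)
    finally show "Q 0 (v / 2) (\<lambda>y. \<bar>f y\<bar>) x \<le> 2 * enn2real (grand_max f x)" using Qi by linarith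
  qed (use v sum_D in \<open>auto intro!: Q_nonneg\<close>)
  finally show "\<bar>Q j v f x\<bar> \<le> 2 * (\<Sum>j\<le>N. D j) * enn2real (grand_max f x) / v ^ j"
    by (simp add: mult_ac)
qed

text \<open>The case distinction encodes P_0 f = f; the kernel is specified at positive times
  only.\<close>

definition damped :: "('a \<Rightarrow> real) \<Rightarrow> 'a \<Rightarrow> real \<Rightarrow> real" where
  "damped f x y = (if y = 0 then f x else exp (- y) * Q 0 y f x)"

definition bessel_diff :: "nat \<Rightarrow> real \<Rightarrow> ('a \<Rightarrow> real) \<Rightarrow> 'a \<Rightarrow> real \<Rightarrow> real" where
  "bessel_diff k \<beta> f x s = s powr (- \<beta> - 1) * (\<Sum>j=0..k. real (k choose j) * (-1) ^ j * damped f x (real (k - j) * s))"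

definition bessel_op :: "real \<Rightarrow> nat \<Rightarrow> real \<Rightarrow> ('a \<Rightarrow> real) \<Rightarrow> 'a \<Rightarrow> real" where
  "bessel_op c k \<beta> f x = c * (LINT s:{0<..}|lborel. bessel_diff k \<beta> f x s)"

text \<open>One sequence of times and almost every x are all that the representation of the
  difference at 0 uses, and this much follows from convergence in L^1.\<close>

definition approx_identity :: "('a \<Rightarrow> real) \<Rightarrow> bool" where
  "approx_identity f \<longleftrightarrow> (\<exists>X :: nat \<Rightarrow> real. (\<forall>i. 0 < X i) \<and> X \<longlonglongrightarrow> 0 \<and> (AE x in M. (\<lambda>i. Q 0 (X i) f x) \<longlonglongrightarrow> f x))"

text \<open>An absolute majorant, up to 2^k, of the integral defining \<open>weyl_op\<close>. Its
  finiteness at x gives convergence there; its integrability over M gives Fubini's theorem in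
  \<open>Q_weyl_op\<close>.\<close>

definition bessel_mass :: "nat \<Rightarrow> real \<Rightarrow> ('a \<Rightarrow> real) \<Rightarrow> 'a \<Rightarrow> ennreal" where
  "bessel_mass k \<beta> f x = (\<integral>\<^sup>+s\<in>{0<..}. ennreal (s powr (real k - \<beta> - 1) * exp (- s) * (\<Sum>l\<le>k. \<bar>Q l s f x\<bar>)) \<partial>lborel)"

definition weyl_op :: "nat \<Rightarrow> real \<Rightarrow> ('a \<Rightarrow> real) \<Rightarrow> 'a \<Rightarrow> real" where
  "weyl_op k \<beta> f x = (LINT v:{0<..}|lborel. v powr (real k - \<beta> - 1) * (exp (- v) * damped_deriv k (\<lambda>i. Q i v f x) 0))"

lemma bessel_mass_measurable [measurable]:
  assumes [measurable]: "f \<in> borel_measurable M"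
  shows "bessel_mass k \<beta> f \<in> borel_measurable M"
  unfolding bessel_mass_def[abs_def] by measurable

lemma bessel_op_measurable [measurable]:
  assumes [measurable]: "f \<in> borel_measurable M"
  shows "bessel_op c k \<beta> f \<in> borel_measurable M"
  unfolding bessel_op_def[abs_def] bessel_diff_def damped_def set_lebesgue_integral_def by measurable

lemma weyl_op_measurable [measurable]:
  assumes [measurable]: "f \<in> borel_measurable M"
  shows "weyl_op k \<beta> f \<in> borel_measurable M"
  unfolding weyl_op_def[abs_def] set_lebesgue_integral_def by measurable

lemma damped_nn_integral_le:
  assumes [measurable]: "f \<in> borel_measurable M"
  shows "(\<integral>\<^sup>+v\<in>{0<..}. ennreal (v powr (real k - \<beta> - 1) * \<bar>exp (- v) * damped_deriv k (\<lambda>i. Q i v f x) 0\<bar>) \<partial>lborel)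
    \<le> ennreal (2 ^ k) * bessel_mass k \<beta> f x"
proof -
  have "(\<integral>\<^sup>+v\<in>{0<..}. ennreal (v powr (real k - \<beta> - 1) * \<bar>exp (- v) * damped_deriv k (\<lambda>i. Q i v f x) 0\<bar>) \<partial>lborel)
    \<le> (\<integral>\<^sup>+v. ennreal (2 ^ k) * (ennreal (v powr (real k - \<beta> - 1) * exp (- v) * (\<Sum>l\<le>k. \<bar>Q l v f x\<bar>)) * indicator {0<..} v) \<partial>lborel)"
  proof (rule nn_integral_mono)
    fix v :: real
    have "v powr (real k - \<beta> - 1) * \<bar>exp (- v) * damped_deriv k (\<lambda>i. Q i v f x) 0\<bar>
      \<le> v powr (real k - \<beta> - 1) * (exp (- v) * (2 ^ k * (\<Sum>l\<le>k. \<bar>Q (l + 0) v f x\<bar>)))"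
      unfolding abs_mult abs_exp_cancel by (intro mult_left_mono damped_deriv_bound) auto
    also have "\<dots> = 2 ^ k * (v powr (real k - \<beta> - 1) * exp (- v) * (\<Sum>l\<le>k. \<bar>Q l v f x\<bar>))"
      by (simp add: mult_ac)
    finally have "ennreal (v powr (real k - \<beta> - 1) * \<bar>exp (- v) * damped_deriv k (\<lambda>i. Q i v f x) 0\<bar>)
      \<le> ennreal (2 ^ k) * ennreal (v powr (real k - \<beta> - 1) * exp (- v) * (\<Sum>l\<le>k. \<bar>Q l v f x\<bar>))"
      by (subst ennreal_mult[symmetric]) (auto intro!: ennreal_leI sum_nonneg mult_nonneg_nonneg)
    then show "ennreal (v powr (real k - \<beta> - 1) * \<bar>exp (- v) * damped_deriv k (\<lambda>i. Q i v f x) 0\<bar>) * indicator {0<..} v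
      \<le> ennreal (2 ^ k) * (ennreal (v powr (real k - \<beta> - 1) * exp (- v) * (\<Sum>l\<le>k. \<bar>Q l v f x\<bar>)) * indicator {0<..} v)"
      by (auto split: split_indicator)
  qed
  also have "\<dots> = ennreal (2 ^ k) * bessel_mass k \<beta> f x"
    unfolding bessel_mass_def by (rule nn_integral_cmult) measurable
  finally show ?thesis .
qed

lemma weyl_op_le:
  assumes [measurable]: "f \<in> borel_measurable M"
  shows "ennreal \<bar>weyl_op k \<beta> f x\<bar> \<le> ennreal (2 ^ k) * bessel_mass k \<beta> f x"
proof -
  let ?h = "\<lambda>v. indicator {0<..} v *\<^sub>R (v powr (real k - \<beta> - 1) * (exp (- v) * damped_deriv k (\<lambda>i. Q i v f x) 0))"
  have "ennreal \<bar>weyl_op k \<beta> f x\<bar> \<le> (\<integral>\<^sup>+v. ennreal (norm (?h v)) \<partial>lborel)"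
  proof (cases "integrable lborel ?h")
    case True
    from integral_norm_bound_ennreal[OF this] show ?thesis by (simp only: weyl_op_def set_lebesgue_integral_def real_norm_def)
  next
    case False
    then show ?thesis by (simp add: weyl_op_def set_lebesgue_integral_def not_integrable_integral_eq)
  qed
  also have "\<dots> = (\<integral>\<^sup>+v\<in>{0<..}. ennreal (v powr (real k - \<beta> - 1) * \<bar>exp (- v) * damped_deriv k (\<lambda>i. Q i v f x) 0\<bar>) \<partial>lborel)"
    by (intro nn_integral_cong) (auto simp: abs_mult split: split_indicator)
  also have "\<dots> \<le> ennreal (2 ^ k) * bessel_mass k \<beta> f x" by (rule damped_nn_integral_le) measurable
  finally show ?thesis .
qed

text \<open>At a point where the maximal function and the mass are finite and P_t f converges along
  X, the function u(t) = exp (-t) P_t f(x) meets all requirements of the scalar result; its decay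
  comes from the maximal function.\<close>

lemma bessel_op_eq_weyl_op:
  assumes f: "integrable M f" and k: "1 \<le> k" and \<beta>: "0 < \<beta>"
    and fin: "grand_max f x < top" "bessel_mass k \<beta> f x < top"
    and X: "\<And>i. 0 < (X :: nat \<Rightarrow> real) i" "X \<longlonglongrightarrow> 0" "(\<lambda>i. Q 0 (X i) f x) \<longlonglongrightarrow> f x"
  shows "set_integrable lborel {0<..} (bessel_diff k \<beta> f x)"
    and "bessel_op c k \<beta> f x = c * weyl_const k \<beta> * weyl_op k \<beta> f x"
proof -
  have [measurable]: "f \<in> borel_measurable M" using f by auto
  define U where "U j v = exp (- v) * damped_deriv j (\<lambda>i. Q i v f x) 0" for j v
  define A where "A = 2 * (\<Sum>j\<le>k. D j) * enn2real (grand_max f x)"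
  note decay = Q_smooth_decay[OF f fin(1), of k, folded A_def]
  have A: "0 \<le> A" by (rule smooth_decayD(1)[OF decay])
  have bound: "\<bar>U j v\<bar> \<le> (2 ^ k * (real (Suc k) * A)) * exp (- v)" if "j \<le> k" "1 \<le> v" for j v
  proof -
    have "\<bar>damped_deriv j (\<lambda>i. Q i v f x) 0\<bar> \<le> 2 ^ j * (\<Sum>i\<le>j. \<bar>Q (i + 0) v f x\<bar>)" by (rule damped_deriv_bound)
    also have "\<dots> \<le> 2 ^ k * (\<Sum>i\<le>k. \<bar>Q i v f x\<bar>)"
      using that by (intro mult_mono power_increasing) (auto intro!: sum_mono2 sum_nonneg)
    also have "\<dots> \<le> 2 ^ k * (\<Sum>i\<le>k. A)"
      using that smooth_decayD(5)[OF decay] by (intro mult_left_mono sum_mono) auto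
    also have "\<dots> = 2 ^ k * (real (Suc k) * A)" by simp
    finally show ?thesis unfolding U_def by (simp add: abs_mult mult.commute)
  qed
  have lim: "(\<lambda>i. U 0 (X i)) \<longlonglongrightarrow> damped f x 0"
  proof -
    have "(\<lambda>i. exp (- X i) * Q 0 (X i) f x) \<longlonglongrightarrow> exp (- 0) * f x"
      by (intro tendsto_intros X)
    then show ?thesis by (simp add: U_def damped_def)
  qed
  have fin': "(\<integral>\<^sup>+v\<in>{0<..}. ennreal (v powr (real k - \<beta> - 1) * \<bar>U k v\<bar>) \<partial>lborel) < top"
    unfolding U_def using fin(2)
    by (intro le_less_trans[OF damped_nn_integral_le]) (auto simp: ennreal_mult_less_top)
  have U_deriv: "(U j has_real_derivative U (Suc j) v) (at v)" if "0 < v" for j v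
    unfolding U_def[abs_def] using Q_deriv[OF f that] by (intro damped_exp_has_derivative)
  have U_meas: "U k \<in> borel_measurable borel" unfolding U_def[abs_def] by measurable
  have u: "damped f x y = U 0 y" if "0 < y" for y using that by (simp add: damped_def U_def)
  note W = bessel_weyl[where U=U and u="damped f x" and X=X and B="2 ^ k * (real (Suc k) * A)",
      OF k \<beta> U_deriv U_meas bound fin' u X(1,2) lim]
  show "set_integrable lborel {0<..} (bessel_diff k \<beta> f x)"
    using W(1) by (simp add: bessel_diff_def[abs_def])
  show "bessel_op c k \<beta> f x = c * weyl_const k \<beta> * weyl_op k \<beta> f x"
    using W(2) by (simp add: bessel_op_def bessel_diff_def weyl_op_def U_def)
qed

text \<open>For fixed x the kernel of the n-th derivative is bounded in y, so integrability of the
  mass allows the exchange of integrals. The semigroup law then merges t and s. The formula holds at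
  every x, not just almost everywhere.\<close>

lemma Q_weyl_op:
  assumes f: "integrable M f" and mass: "(\<integral>\<^sup>+x. bessel_mass k \<beta> f x \<partial>M) < top" and t: "0 < t"
  shows "Q n t (weyl_op k \<beta> f) x
    = (LINT s:{0<..}|lborel. s powr (real k - \<beta> - 1) * (exp (- s) * damped_deriv k (\<lambda>i. Q i (t + s) f x) n))"
proof -
  have [measurable]: "f \<in> borel_measurable M" using f by auto
  interpret prod_lborel: pair_sigma_finite M "lborel :: real measure" by standard
  obtain B where B: "\<And>y. p 0 (t / 2) x y \<le> B" using p_bounded[of "t / 2" x] t by auto
  define B' where "B' = D n / t ^ n * \<bar>B\<bar>"
  have p_le: "\<bar>p n t x y\<bar> \<le> B'" for y
  proof -
    have "\<bar>p n t x y\<bar> \<le> D n / t ^ n * p 0 (t / 2) x y" by (rule p_bound[OF t])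
    also have "\<dots> \<le> D n / t ^ n * \<bar>B\<bar>"
      using D_pos[of n] t B[of y] by (intro mult_left_mono) auto
    finally show ?thesis by (simp add: B'_def)
  qed
  have B'_nn: "0 \<le> B'" using order_trans[OF abs_ge_zero p_le] .
  let ?h = "\<lambda>y s. indicator {0<..} s * (s powr (real k - \<beta> - 1) * (exp (- s) * damped_deriv k (\<lambda>i. Q i s f y) 0))"
  have meas: "(\<lambda>(y, s). p n t x y * ?h y s) \<in> borel_measurable (M \<Otimes>\<^sub>M lborel)"
    by measurable
  have int: "integrable (M \<Otimes>\<^sub>M lborel) (\<lambda>(y, s). p n t x y * ?h y s)"
  proof (rule integrableI_bounded[OF meas])
    have "(\<integral>\<^sup>+z. ennreal (norm (case z of (y, s) \<Rightarrow> p n t x y * ?h y s)) \<partial>(M \<Otimes>\<^sub>M lborel))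
      = (\<integral>\<^sup>+y. \<integral>\<^sup>+s. ennreal (norm (p n t x y * ?h y s)) \<partial>lborel \<partial>M)"
      using meas by (subst lborel.nn_integral_fst[symmetric]) auto
    also have "\<dots> \<le> (\<integral>\<^sup>+y. ennreal B' * (ennreal (2 ^ k) * bessel_mass k \<beta> f y) \<partial>M)"
    proof (rule nn_integral_mono)
      fix y
      have "(\<integral>\<^sup>+s. ennreal (norm (p n t x y * ?h y s)) \<partial>lborel)
        \<le> (\<integral>\<^sup>+s. ennreal B' * (ennreal (s powr (real k - \<beta> - 1) * \<bar>exp (- s) * damped_deriv k (\<lambda>i. Q i s f y) 0\<bar>) * indicator {0<..} s) \<partial>lborel)"
      proof (rule nn_integral_mono)
        fix s :: real
        have "\<bar>p n t x y\<bar> * (s powr (real k - \<beta> - 1) * \<bar>exp (- s) * damped_deriv k (\<lambda>i. Q i s f y) 0\<bar>)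
          \<le> B' * (s powr (real k - \<beta> - 1) * \<bar>exp (- s) * damped_deriv k (\<lambda>i. Q i s f y) 0\<bar>)"
          by (intro mult_right_mono p_le) auto
        then show "ennreal (norm (p n t x y * ?h y s))
          \<le> ennreal B' * (ennreal (s powr (real k - \<beta> - 1) * \<bar>exp (- s) * damped_deriv k (\<lambda>i. Q i s f y) 0\<bar>) * indicator {0<..} s)"
          using B'_nn by (auto simp: abs_mult ennreal_leI split: split_indicator simp flip: ennreal_mult)
      qed
      also have "\<dots> = ennreal B' * (\<integral>\<^sup>+s\<in>{0<..}. ennreal (s powr (real k - \<beta> - 1) * \<bar>exp (- s) * damped_deriv k (\<lambda>i. Q i s f y) 0\<bar>) \<partial>lborel)"
        by (rule nn_integral_cmult) measurable
      also have "\<dots> \<le> ennreal B' * (ennreal (2 ^ k) * bessel_mass k \<beta> f y)"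
        by (intro mult_left_mono damped_nn_integral_le) auto
      finally show "(\<integral>\<^sup>+s. ennreal (norm (p n t x y * ?h y s)) \<partial>lborel) \<le> ennreal B' * (ennreal (2 ^ k) * bessel_mass k \<beta> f y)" .
    qed
    also have "\<dots> = ennreal B' * (ennreal (2 ^ k) * (\<integral>\<^sup>+y. bessel_mass k \<beta> f y \<partial>M))"
      by (simp add: nn_integral_cmult)
    also have "\<dots> < \<infinity>" using mass by (simp add: ennreal_mult_less_top)
    finally show "(\<integral>\<^sup>+z. ennreal (norm (case z of (y, s) \<Rightarrow> p n t x y * ?h y s)) \<partial>(M \<Otimes>\<^sub>M lborel)) < \<infinity>" .
  qed
  have "Q n t (weyl_op k \<beta> f) x = (\<integral>y. \<integral>s. p n t x y * ?h y s \<partial>lborel \<partial>M)"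
    unfolding Q_def[of n] weyl_op_def set_lebesgue_integral_def by simp
  also have "\<dots> = (\<integral>s. \<integral>y. p n t x y * ?h y s \<partial>M \<partial>lborel)"
    by (rule prod_lborel.Fubini_integral[symmetric]) (rule int)
  also have "\<dots> = (\<integral>s. indicator {0<..} s *\<^sub>R (s powr (real k - \<beta> - 1) * (exp (- s) * damped_deriv k (\<lambda>i. Q i (t + s) f x) n)) \<partial>lborel)"
  proof (rule Bochner_Integration.integral_cong[OF refl])
    fix s :: real
    show "(\<integral>y. p n t x y * ?h y s \<partial>M) = indicator {0<..} s *\<^sub>R (s powr (real k - \<beta> - 1) * (exp (- s) * damped_deriv k (\<lambda>i. Q i (t + s) f x) n))"
    proof (cases "0 < s")
      case True
      have "(\<integral>y. p n t x y * ?h y s \<partial>M) = (\<integral>y. s powr (real k - \<beta> - 1) * exp (- s) * (p n t x y * damped_deriv k (\<lambda>i. Q i s f y) 0) \<partial>M)"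
        using True by (simp add: mult_ac)
      also have "\<dots> = s powr (real k - \<beta> - 1) * exp (- s) * Q n t (\<lambda>y. damped_deriv k (\<lambda>i. Q i s f y) 0) x"
        unfolding Q_def[of n t "\<lambda>y. damped_deriv k (\<lambda>i. Q i s f y) 0"] by (rule integral_mult_right_zero)
      also have "\<dots> = s powr (real k - \<beta> - 1) * exp (- s) * damped_deriv k (\<lambda>i. Q i (t + s) f x) n"
        using Q_damped_deriv[OF f t True, of n k 0 x] by simp
      finally show ?thesis using True by (simp add: mult.assoc)
    qed simp
  qed
  finally show ?thesis by (simp only: set_lebesgue_integral_def)
qed

text \<open>Both estimates reduce to the function R, the sum of the q-th power of the maximal
  function and the local square function of order k + n. The maximal theorem handles the first
  summand, raising the order from m to k + n the second.\<close>

lemma bessel_op_bounded: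
  fixes \<alpha> \<beta> q r c :: real and k m n :: nat
  assumes \<beta>: "0 < \<beta>" "\<beta> < \<alpha>" and r: "1 < r" and q: "1 \<le> q"
    and k: "real k - 1 \<le> \<beta>" "\<beta> < real k" and m: "\<alpha> < real m" "m \<le> k + n"
    and n: "\<alpha> - \<beta> < real n" "1 \<le> n"
  shows "\<exists>C>0. \<forall>f. f \<in> borel_measurable M \<longrightarrow> approx_identity f \<longrightarrow> (\<integral>\<^sup>+x. epowr (ennreal \<bar>f x\<bar>) r \<partial>M) < top \<longrightarrow>
    (\<integral>\<^sup>+x. epowr (kernel_square \<alpha> q m f x) (r / q) \<partial>M) < top \<longrightarrow>
    (AE x in M. set_integrable lborel {0<..} (bessel_diff k \<beta> f x)) \<and>
    (\<integral>\<^sup>+x. epowr (ennreal \<bar>bessel_op c k \<beta> f x\<bar>) r \<partial>M)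
      \<le> ennreal C * ((\<integral>\<^sup>+x. epowr (ennreal \<bar>f x\<bar>) r \<partial>M) + (\<integral>\<^sup>+x. epowr (kernel_square \<alpha> q m f x) (r / q) \<partial>M)) \<and>
    (\<integral>\<^sup>+x. epowr (kernel_square (\<alpha> - \<beta>) q n (bessel_op c k \<beta> f) x) (r / q) \<partial>M)
      \<le> ennreal C * ((\<integral>\<^sup>+x. epowr (ennreal \<bar>f x\<bar>) r \<partial>M) + (\<integral>\<^sup>+x. epowr (kernel_square \<alpha> q m f x) (r / q) \<partial>M))"
proof -
  have k1: "1 \<le> k" using \<beta> k by (cases k) auto
  define N where "N = k + n"
  obtain C1 where C1: "0 < C1" "\<And>A H. smooth_decay (k + n) A H \<Longrightarrow>
    epowr (\<integral>\<^sup>+s\<in>{0<..}. ennreal (s powr (real k - \<beta> - 1) * exp (- s) * (\<Sum>l\<le>k. \<bar>H l s\<bar>)) \<partial>lborel) q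
    \<le> ennreal C1 * (ennreal (A powr q) + local_square \<alpha> q (k + n) H)"
    by (rule bessel_pointwise_bound[OF \<beta>(2) q k n(2)]) (rule that)
  obtain C2 where C2: "0 < C2" "\<And>A H. smooth_decay (k + n) A H \<Longrightarrow>
    (\<integral>\<^sup>+t\<in>{0<..}. epowr (ennreal (t powr (real n - (\<alpha> - \<beta>))) *
        (\<integral>\<^sup>+s\<in>{0<..}. ennreal (s powr (real k - \<beta> - 1) * exp (- s) * (\<Sum>l\<le>k. \<bar>H (l + n) (t + s)\<bar>)) \<partial>lborel)) q
      * ennreal (1 / t) \<partial>lborel)
    \<le> ennreal C2 * (ennreal (A powr q) + local_square \<alpha> q (k + n) H)"
    by (rule bessel_square_bound[OF \<beta>(2) q k n(2,1)]) (rule that)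
  obtain C3 where C3: "0 < C3" "\<And>f. integrable M f \<Longrightarrow>
    (\<integral>\<^sup>+x. epowr (local_square \<alpha> q (k + n) (\<lambda>j t. Q j t f x)) (r / q) \<partial>M)
    \<le> ennreal C3 * (\<integral>\<^sup>+x. epowr (kernel_square \<alpha> q m f x) (r / q) \<partial>M)"
    by (rule square_raise[OF r q m]) (rule that)
  define DD where "DD = 2 * (\<Sum>j\<le>N. D j)"
  have DD: "0 \<le> DD" unfolding DD_def by (intro mult_nonneg_nonneg sum_nonneg) (auto intro: less_imp_le D_pos)
  define c' where "c' = c * weyl_const k \<beta>"
  define K1 where "K1 = 2 powr (r / q) * (DD powr r * max_const r + C3)"
  have K1: "0 < K1" unfolding K1_def using C3(1) DD max_const_pos[OF r] by (intro mult_pos_pos add_nonneg_pos) auto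
  define K2 where "K2 = (\<bar>c'\<bar> * 2 ^ k) powr r * (C1 powr (r / q) * K1)"
  define K3 where "K3 = ((\<bar>c'\<bar> * 2 ^ k) powr q * C2) powr (r / q) * K1"
  have K23: "0 \<le> K2" "0 \<le> K3" unfolding K2_def K3_def using K1 by auto
  define C where "C = 1 + K2 + K3"
  have C: "0 < C" using K23 by (simp add: C_def)
  show ?thesis
  proof (intro exI[of _ C] conjI C allI impI)
    fix f assume [measurable]: "f \<in> borel_measurable M" and ai: "approx_identity f"
      and F_fin: "(\<integral>\<^sup>+x. epowr (ennreal \<bar>f x\<bar>) r \<partial>M) < top" (is "?F < top")
      and S_fin: "(\<integral>\<^sup>+x. epowr (kernel_square \<alpha> q m f x) (r / q) \<partial>M) < top" (is "?S < top")
    have f: "integrable M f" using r F_fin by (intro integrable_of_Lp[of _ r]) auto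
    obtain X where X: "\<And>i. 0 < (X :: nat \<Rightarrow> real) i" "X \<longlonglongrightarrow> 0" "AE x in M. (\<lambda>i. Q 0 (X i) f x) \<longlonglongrightarrow> f x"
      using ai by (auto simp: approx_identity_def)
    define A where "A x = DD * enn2real (grand_max f x)" for x
    define L where "L x = local_square \<alpha> q (k + n) (\<lambda>j t. Q j t f x)" for x
    define R where "R x = ennreal (A x powr q) + L x" for x
    have [measurable]: "A \<in> borel_measurable M" unfolding A_def[abs_def] by measurable
    have [measurable]: "L \<in> borel_measurable M" unfolding L_def[abs_def] by measurable
    have [measurable]: "R \<in> borel_measurable M" unfolding R_def[abs_def] by measurable
    have A_nn: "0 \<le> A x" for x using DD by (simp add: A_def)
    have sd: "smooth_decay (k + n) (A x) (\<lambda>j t. Q j t f x)" if "grand_max f x < top" for x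
      using Q_smooth_decay[OF f that, of "k + n"] by (simp only: A_def DD_def N_def)
    have G_int: "(\<integral>\<^sup>+x. epowr (grand_max f x) r \<partial>M) \<le> ennreal (max_const r) * ?F"
      unfolding grand_max_def using r f F_fin by (intro maximal_inequality) auto
    have "(\<integral>\<^sup>+x. epowr (grand_max f x) r \<partial>M) < top"
      using F_fin by (intro le_less_trans[OF G_int]) (simp add: ennreal_mult_less_top)
    then have "AE x in M. epowr (grand_max f x) r \<noteq> \<infinity>"
      by (intro nn_integral_PInf_AE) auto
    then have G_fin: "AE x in M. grand_max f x < top"
      by eventually_elim (simp add: less_top[symmetric])
    have R_int: "(\<integral>\<^sup>+x. epowr (R x) (r / q) \<partial>M) \<le> ennreal K1 * (?F + ?S)"
    proof -
      have "(\<integral>\<^sup>+x. epowr (R x) (r / q) \<partial>M) \<le> (\<integral>\<^sup>+x. ennreal (2 powr (r / q)) * (ennreal (DD powr r) * epowr (grand_max f x) r + epowr (L x) (r / q)) \<partial>M)"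
      proof (rule nn_integral_mono)
        fix x
        have "epowr (ennreal (A x powr q)) (r / q) \<le> ennreal (DD powr r) * epowr (grand_max f x) r"
        proof (cases "grand_max f x")
          case (real a)
          have "epowr (ennreal (A x powr q)) (r / q) = ennreal ((DD * a) powr r)"
            using real q by (subst epowr_ennreal) (auto simp: A_def powr_powr)
          then show ?thesis using real DD by (simp add: epowr_ennreal powr_mult ennreal_mult)
        next
          \<comment> \<open>Here A is 0, since \<open>enn2real\<close> sends infinity to 0, and the
            estimate is trivial.\<close>
          case top
          then show ?thesis using q r by (simp add: A_def epowr_ennreal)
        qed
        then show "epowr (R x) (r / q) \<le> ennreal (2 powr (r / q)) * (ennreal (DD powr r) * epowr (grand_max f x) r + epowr (L x) (r / q))"
          unfolding R_def using q r by (intro order_trans[OF epowr_add_le] mult_left_mono add_right_mono) auto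
      qed
      also have "\<dots> = ennreal (2 powr (r / q)) * (ennreal (DD powr r) * (\<integral>\<^sup>+x. epowr (grand_max f x) r \<partial>M) + (\<integral>\<^sup>+x. epowr (L x) (r / q) \<partial>M))"
        by (simp add: nn_integral_cmult nn_integral_add)
      also have "\<dots> \<le> ennreal (2 powr (r / q)) * (ennreal (DD powr r) * (ennreal (max_const r) * ?F) + ennreal C3 * ?S)"
        unfolding L_def using C3(2)[OF f] by (intro mult_left_mono add_mono G_int) auto
      also have "\<dots> \<le> ennreal (2 powr (r / q)) * (ennreal (DD powr r * max_const r + C3) * (?F + ?S))"
      proof (intro mult_left_mono)
        have mc: "0 < max_const r" by (rule max_const_pos[OF r])
        have "ennreal (DD powr r) * (ennreal (max_const r) * ?F) + ennreal C3 * ?S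
          = ennreal (DD powr r * max_const r) * ?F + ennreal C3 * ?S"
          using mc by (simp add: ennreal_mult mult.assoc)
        also have "\<dots> \<le> ennreal (DD powr r * max_const r + C3) * ?F + ennreal (DD powr r * max_const r + C3) * ?S"
          using mc C3(1) by (intro add_mono mult_right_mono ennreal_leI) auto
        finally show "ennreal (DD powr r) * (ennreal (max_const r) * ?F) + ennreal C3 * ?S
          \<le> ennreal (DD powr r * max_const r + C3) * (?F + ?S)" by (simp only: distrib_left)
      qed auto
      also have "\<dots> = ennreal K1 * (?F + ?S)"
        unfolding K1_def using C3(1) max_const_pos[OF r] by (subst ennreal_mult[of "2 powr (r / q)"]) (auto simp: mult.assoc)
      finally show ?thesis .
    qed
    have mass_le: "epowr (bessel_mass k \<beta> f x) q \<le> ennreal C1 * R x" if "grand_max f x < top" for x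
      unfolding bessel_mass_def R_def L_def by (rule C1(2)[OF sd[OF that]])
    have mass_le': "epowr (bessel_mass k \<beta> f x) r \<le> ennreal (C1 powr (r / q)) * epowr (R x) (r / q)" if "grand_max f x < top" for x
    proof -
      have "epowr (epowr (bessel_mass k \<beta> f x) q) (r / q) \<le> epowr (ennreal C1 * R x) (r / q)"
        using q r by (intro epowr_mono mass_le that) auto
      then show ?thesis using q C1(1) by (simp add: epowr_epowr epowr_mult epowr_ennreal)
    qed
    have mass_int: "(\<integral>\<^sup>+x. epowr (bessel_mass k \<beta> f x) r \<partial>M) \<le> ennreal (C1 powr (r / q) * K1) * (?F + ?S)"
    proof -
      have "(\<integral>\<^sup>+x. epowr (bessel_mass k \<beta> f x) r \<partial>M) \<le> (\<integral>\<^sup>+x. ennreal (C1 powr (r / q)) * epowr (R x) (r / q) \<partial>M)"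
        by (rule nn_integral_mono_AE) (use G_fin in eventually_elim, rule mass_le')
      also have "\<dots> = ennreal (C1 powr (r / q)) * (\<integral>\<^sup>+x. epowr (R x) (r / q) \<partial>M)"
        by (rule nn_integral_cmult) measurable
      also have "\<dots> \<le> ennreal (C1 powr (r / q)) * (ennreal K1 * (?F + ?S))"
        by (intro mult_left_mono R_int) auto
      finally show ?thesis using K1 by (simp add: ennreal_mult mult.assoc)
    qed
    have mass_r_fin: "(\<integral>\<^sup>+x. epowr (bessel_mass k \<beta> f x) r \<partial>M) < top"
      using F_fin S_fin by (intro le_less_trans[OF mass_int]) (simp add: ennreal_mult_less_top)
    then have "AE x in M. epowr (bessel_mass k \<beta> f x) r \<noteq> \<infinity>"
      by (intro nn_integral_PInf_AE) auto
    then have mass_fin: "AE x in M. bessel_mass k \<beta> f x < top"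
      by eventually_elim (simp add: less_top[symmetric])
    \<comment> \<open>On a probability space L^r is contained in L^1; integrability is what the
      exchange of integrals in \<open>Q_weyl_op\<close> requires.\<close>
    have mass1: "(\<integral>\<^sup>+x. bessel_mass k \<beta> f x \<partial>M) < top"
    proof -
      have "integrable M (\<lambda>x. enn2real (bessel_mass k \<beta> f x))"
      proof (rule integrable_of_Lp[of _ r])
        have "(\<integral>\<^sup>+x. epowr (ennreal \<bar>enn2real (bessel_mass k \<beta> f x)\<bar>) r \<partial>M) \<le> (\<integral>\<^sup>+x. epowr (bessel_mass k \<beta> f x) r \<partial>M)"
          using r by (intro nn_integral_mono epowr_mono) (auto simp: ennreal_enn2real_if)
        then show "(\<integral>\<^sup>+x. epowr (ennreal \<bar>enn2real (bessel_mass k \<beta> f x)\<bar>) r \<partial>M) < top"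
          using mass_r_fin by (rule le_less_trans)
      qed (use r in auto)
      then have "(\<integral>\<^sup>+x. ennreal (norm (enn2real (bessel_mass k \<beta> f x))) \<partial>M) < \<infinity>"
        by (simp only: integrable_iff_bounded)
      moreover have "(\<integral>\<^sup>+x. bessel_mass k \<beta> f x \<partial>M) = (\<integral>\<^sup>+x. ennreal (norm (enn2real (bessel_mass k \<beta> f x))) \<partial>M)"
        by (rule nn_integral_cong_AE) (use mass_fin in eventually_elim, simp)
      ultimately show ?thesis by simp
    qed
    have good: "AE x in M. set_integrable lborel {0<..} (bessel_diff k \<beta> f x) \<and> bessel_op c k \<beta> f x = c' * weyl_op k \<beta> f x"
      using G_fin mass_fin X(3)
    proof eventually_elim
      case (elim x)
      note * = bessel_op_eq_weyl_op[OF f k1 \<beta>(1) elim(1,2) X(1,2) elim(3)]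
      show ?case using *(1) *(2)[of c] by (simp add: c'_def)
    qed
    then show "AE x in M. set_integrable lborel {0<..} (bessel_diff k \<beta> f x)"
      by eventually_elim simp
    have K_le: "ennreal K2 * (?F + ?S) \<le> ennreal C * (?F + ?S)" "ennreal K3 * (?F + ?S) \<le> ennreal C * (?F + ?S)"
      using K23 by (auto intro!: mult_right_mono ennreal_leI simp: C_def)
    have "(\<integral>\<^sup>+x. epowr (ennreal \<bar>bessel_op c k \<beta> f x\<bar>) r \<partial>M)
      \<le> (\<integral>\<^sup>+x. ennreal ((\<bar>c'\<bar> * 2 ^ k) powr r) * epowr (bessel_mass k \<beta> f x) r \<partial>M)"
    proof (rule nn_integral_mono_AE)
      show "AE x in M. epowr (ennreal \<bar>bessel_op c k \<beta> f x\<bar>) r \<le> ennreal ((\<bar>c'\<bar> * 2 ^ k) powr r) * epowr (bessel_mass k \<beta> f x) r"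
        using good
      proof eventually_elim
        case (elim x)
        have "ennreal \<bar>bessel_op c k \<beta> f x\<bar> = ennreal \<bar>c'\<bar> * ennreal \<bar>weyl_op k \<beta> f x\<bar>"
          using elim by (simp add: abs_mult ennreal_mult)
        also have "\<dots> \<le> ennreal \<bar>c'\<bar> * (ennreal (2 ^ k) * bessel_mass k \<beta> f x)"
          by (intro mult_left_mono weyl_op_le) auto
        also have "\<dots> = ennreal (\<bar>c'\<bar> * 2 ^ k) * bessel_mass k \<beta> f x"
          by (subst ennreal_mult) (auto simp: mult.assoc)
        finally have "epowr (ennreal \<bar>bessel_op c k \<beta> f x\<bar>) r \<le> epowr (ennreal (\<bar>c'\<bar> * 2 ^ k) * bessel_mass k \<beta> f x) r"
          using r by (intro epowr_mono) auto
        also have "\<dots> = ennreal ((\<bar>c'\<bar> * 2 ^ k) powr r) * epowr (bessel_mass k \<beta> f x) r"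
          by (subst epowr_mult) (simp add: epowr_ennreal)
        finally show ?case .
      qed
    qed
    also have "\<dots> = ennreal ((\<bar>c'\<bar> * 2 ^ k) powr r) * (\<integral>\<^sup>+x. epowr (bessel_mass k \<beta> f x) r \<partial>M)"
      by (rule nn_integral_cmult) measurable
    also have "\<dots> \<le> ennreal ((\<bar>c'\<bar> * 2 ^ k) powr r) * (ennreal (C1 powr (r / q) * K1) * (?F + ?S))"
      by (intro mult_left_mono mass_int) auto
    also have "\<dots> = ennreal K2 * (?F + ?S)"
      unfolding K2_def using K1 by (subst ennreal_mult[of "(\<bar>c'\<bar> * 2 ^ k) powr r"]) (auto simp: mult.assoc)
    finally show "(\<integral>\<^sup>+x. epowr (ennreal \<bar>bessel_op c k \<beta> f x\<bar>) r \<partial>M) \<le> ennreal C * (?F + ?S)"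
      using K_le(1) by (rule order_trans)
    \<comment> \<open>The operators agree almost everywhere only, but integration against the kernel
      does not see null sets, so the identity holds for all x.\<close>
    have Q_op: "Q n t (bessel_op c k \<beta> f) x = c' * Q n t (weyl_op k \<beta> f) x" for t x
    proof -
      have "Q n t (bessel_op c k \<beta> f) x = (\<integral>y. c' * (p n t x y * weyl_op k \<beta> f y) \<partial>M)"
        unfolding Q_def
      proof (rule integral_cong_AE)
        show "AE y in M. p n t x y * bessel_op c k \<beta> f y = c' * (p n t x y * weyl_op k \<beta> f y)"
          using good by eventually_elim simp
      qed measurable
      then show ?thesis by (simp only: Q_def integral_mult_right_zero)
    qed
    let ?W = "\<lambda>x t. \<integral>\<^sup>+s\<in>{0<..}. ennreal (s powr (real k - \<beta> - 1) * exp (- s) * (\<Sum>l\<le>k. \<bar>Q (l + n) (t + s) f x\<bar>)) \<partial>lborel"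
    have Q_op_le: "ennreal \<bar>Q n t (bessel_op c k \<beta> f) x\<bar> \<le> ennreal (\<bar>c'\<bar> * 2 ^ k) * ?W x t" if t: "0 < t" for t x
    proof -
      let ?h = "\<lambda>s. indicator {0<..} s *\<^sub>R (s powr (real k - \<beta> - 1) * (exp (- s) * damped_deriv k (\<lambda>i. Q i (t + s) f x) n))"
      have "ennreal \<bar>Q n t (weyl_op k \<beta> f) x\<bar> \<le> (\<integral>\<^sup>+s. ennreal (norm (?h s)) \<partial>lborel)"
      proof (cases "integrable lborel ?h")
        case True
        from integral_norm_bound_ennreal[OF this] show ?thesis
          by (simp only: Q_weyl_op[OF f mass1 t] set_lebesgue_integral_def real_norm_def)
      next
        case False
        then show ?thesis by (simp add: Q_weyl_op[OF f mass1 t] set_lebesgue_integral_def not_integrable_integral_eq)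
      qed
      also have "\<dots> \<le> (\<integral>\<^sup>+s. ennreal (2 ^ k) * (ennreal (s powr (real k - \<beta> - 1) * exp (- s) * (\<Sum>l\<le>k. \<bar>Q (l + n) (t + s) f x\<bar>)) * indicator {0<..} s) \<partial>lborel)"
      proof (rule nn_integral_mono)
        fix s :: real
        have "s powr (real k - \<beta> - 1) * (exp (- s) * \<bar>damped_deriv k (\<lambda>i. Q i (t + s) f x) n\<bar>)
          \<le> s powr (real k - \<beta> - 1) * (exp (- s) * (2 ^ k * (\<Sum>l\<le>k. \<bar>Q (l + n) (t + s) f x\<bar>)))"
          by (intro mult_left_mono damped_deriv_bound) auto
        also have "\<dots> = 2 ^ k * (s powr (real k - \<beta> - 1) * exp (- s) * (\<Sum>l\<le>k. \<bar>Q (l + n) (t + s) f x\<bar>))"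
          by (simp add: mult_ac)
        finally have "ennreal (s powr (real k - \<beta> - 1) * (exp (- s) * \<bar>damped_deriv k (\<lambda>i. Q i (t + s) f x) n\<bar>))
          \<le> ennreal (2 ^ k) * ennreal (s powr (real k - \<beta> - 1) * exp (- s) * (\<Sum>l\<le>k. \<bar>Q (l + n) (t + s) f x\<bar>))"
          by (subst ennreal_mult[symmetric]) (auto intro!: ennreal_leI sum_nonneg mult_nonneg_nonneg)
        then show "ennreal (norm (?h s)) \<le> ennreal (2 ^ k) * (ennreal (s powr (real k - \<beta> - 1) * exp (- s) * (\<Sum>l\<le>k. \<bar>Q (l + n) (t + s) f x\<bar>)) * indicator {0<..} s)"
          by (auto simp: abs_mult split: split_indicator)
      qed
      also have "\<dots> = ennreal (2 ^ k) * ?W x t"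
        by (rule nn_integral_cmult) measurable
      finally have "ennreal \<bar>c'\<bar> * ennreal \<bar>Q n t (weyl_op k \<beta> f) x\<bar> \<le> ennreal \<bar>c'\<bar> * (ennreal (2 ^ k) * ?W x t)"
        by (rule mult_left_mono) simp
      also have "\<dots> = ennreal (\<bar>c'\<bar> * 2 ^ k) * ?W x t"
        by (subst ennreal_mult) (auto simp: mult.assoc)
      finally show ?thesis by (simp add: Q_op abs_mult ennreal_mult)
    qed
    have square_le: "kernel_square (\<alpha> - \<beta>) q n (bessel_op c k \<beta> f) x \<le> ennreal ((\<bar>c'\<bar> * 2 ^ k) powr q * C2) * R x"
      if x: "grand_max f x < top" for x
    proof -
      have "kernel_square (\<alpha> - \<beta>) q n (bessel_op c k \<beta> f) x
        \<le> (\<integral>\<^sup>+t. ennreal ((\<bar>c'\<bar> * 2 ^ k) powr q) * (epowr (ennreal (t powr (real n - (\<alpha> - \<beta>))) * ?W x t) q * ennreal (1 / t) * indicator {0<..} t) \<partial>lborel)"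
        unfolding kernel_square_def
      proof (rule nn_integral_mono)
        fix t :: real
        show "epowr (ennreal (t powr (real n - (\<alpha> - \<beta>)) * \<bar>Q n t (bessel_op c k \<beta> f) x\<bar>)) q * ennreal (1 / t) * indicator {0<..} t
          \<le> ennreal ((\<bar>c'\<bar> * 2 ^ k) powr q) * (epowr (ennreal (t powr (real n - (\<alpha> - \<beta>))) * ?W x t) q * ennreal (1 / t) * indicator {0<..} t)"
        proof (cases "0 < t")
          case True
          have "ennreal (t powr (real n - (\<alpha> - \<beta>)) * \<bar>Q n t (bessel_op c k \<beta> f) x\<bar>)
            \<le> ennreal (t powr (real n - (\<alpha> - \<beta>))) * (ennreal (\<bar>c'\<bar> * 2 ^ k) * ?W x t)"
            by (subst ennreal_mult) (auto intro!: mult_left_mono Q_op_le True)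
          also have "\<dots> = ennreal (\<bar>c'\<bar> * 2 ^ k) * (ennreal (t powr (real n - (\<alpha> - \<beta>))) * ?W x t)"
            by (simp only: mult.left_commute)
          finally have "epowr (ennreal (t powr (real n - (\<alpha> - \<beta>)) * \<bar>Q n t (bessel_op c k \<beta> f) x\<bar>)) q
            \<le> epowr (ennreal (\<bar>c'\<bar> * 2 ^ k) * (ennreal (t powr (real n - (\<alpha> - \<beta>))) * ?W x t)) q"
            using q by (intro epowr_mono) auto
          also have "\<dots> = ennreal ((\<bar>c'\<bar> * 2 ^ k) powr q) * epowr (ennreal (t powr (real n - (\<alpha> - \<beta>))) * ?W x t) q"
            by (subst epowr_mult) (simp add: epowr_ennreal)
          finally have "epowr (ennreal (t powr (real n - (\<alpha> - \<beta>)) * \<bar>Q n t (bessel_op c k \<beta> f) x\<bar>)) q * ennreal (1 / t)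
            \<le> ennreal ((\<bar>c'\<bar> * 2 ^ k) powr q) * epowr (ennreal (t powr (real n - (\<alpha> - \<beta>))) * ?W x t) q * ennreal (1 / t)"
            by (rule mult_right_mono) simp
          then show ?thesis using True by (simp add: mult.assoc)
        qed simp
      qed
      also have "\<dots> = ennreal ((\<bar>c'\<bar> * 2 ^ k) powr q) * (\<integral>\<^sup>+t\<in>{0<..}. epowr (ennreal (t powr (real n - (\<alpha> - \<beta>))) * ?W x t) q * ennreal (1 / t) \<partial>lborel)"
        by (rule nn_integral_cmult) measurable
      also have "\<dots> \<le> ennreal ((\<bar>c'\<bar> * 2 ^ k) powr q) * (ennreal C2 * R x)"
        unfolding R_def L_def by (intro mult_left_mono C2(2)[OF sd[OF x]]) auto
      also have "\<dots> = ennreal ((\<bar>c'\<bar> * 2 ^ k) powr q * C2) * R x"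
        using C2(1) by (subst ennreal_mult[of "(\<bar>c'\<bar> * 2 ^ k) powr q"]) (auto simp: mult.assoc)
      finally show ?thesis .
    qed
    have "(\<integral>\<^sup>+x. epowr (kernel_square (\<alpha> - \<beta>) q n (bessel_op c k \<beta> f) x) (r / q) \<partial>M)
      \<le> (\<integral>\<^sup>+x. ennreal (((\<bar>c'\<bar> * 2 ^ k) powr q * C2) powr (r / q)) * epowr (R x) (r / q) \<partial>M)"
    proof (rule nn_integral_mono_AE)
      show "AE x in M. epowr (kernel_square (\<alpha> - \<beta>) q n (bessel_op c k \<beta> f) x) (r / q)
        \<le> ennreal (((\<bar>c'\<bar> * 2 ^ k) powr q * C2) powr (r / q)) * epowr (R x) (r / q)"
        using G_fin
      proof eventually_elim
        case (elim x)
        have "epowr (kernel_square (\<alpha> - \<beta>) q n (bessel_op c k \<beta> f) x) (r / q) \<le> epowr (ennreal ((\<bar>c'\<bar> * 2 ^ k) powr q * C2) * R x) (r / q)"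
          using q r by (intro epowr_mono square_le elim) auto
        also have "\<dots> = ennreal (((\<bar>c'\<bar> * 2 ^ k) powr q * C2) powr (r / q)) * epowr (R x) (r / q)"
          using C2(1) by (subst epowr_mult) (simp add: epowr_ennreal)
        finally show ?case .
      qed
    qed
    also have "\<dots> = ennreal (((\<bar>c'\<bar> * 2 ^ k) powr q * C2) powr (r / q)) * (\<integral>\<^sup>+x. epowr (R x) (r / q) \<partial>M)"
      by (rule nn_integral_cmult) measurable
    also have "\<dots> \<le> ennreal (((\<bar>c'\<bar> * 2 ^ k) powr q * C2) powr (r / q)) * (ennreal K1 * (?F + ?S))"
      by (intro mult_left_mono R_int) auto
    also have "\<dots> = ennreal K3 * (?F + ?S)"
      unfolding K3_def using K1 by (subst ennreal_mult[of "((\<bar>c'\<bar> * 2 ^ k) powr q * C2) powr (r / q)"]) (auto simp: mult.assoc)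
    finally show "(\<integral>\<^sup>+x. epowr (kernel_square (\<alpha> - \<beta>) q n (bessel_op c k \<beta> f) x) (r / q) \<partial>M) \<le> ennreal C * (?F + ?S)"
      using K_le(2) by (rule order_trans)
  qed
qed

end

section \<open>The Mehler kernel\<close>

lemma nn_integral_gauss_real: "(\<integral>\<^sup>+x. ennreal (exp (- x\<^sup>2)) \<partial>lborel) = ennreal (sqrt pi)"
proof -
  have "has_bochner_integral lborel (\<lambda>x::real. exp (- x\<^sup>2)) (2 *\<^sub>R (sqrt pi / 2))"
    by (rule has_bochner_integral_even_function[OF gaussian_moment_0]) simp
  then show ?thesis
    by (subst nn_integral_eq_integral) (auto simp: has_bochner_integral_iff)
qed

text \<open>Complete the square: the substitution by b / A + x / sqrt A turns the exponent into b^2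
  / A - x^2.\<close>

lemma nn_integral_gauss_linear:
  assumes A: "0 < A"
  shows "(\<integral>\<^sup>+x. ennreal (exp (- A * x\<^sup>2 + 2 * b * x)) \<partial>lborel) = ennreal (sqrt (pi / A) * exp (b\<^sup>2 / A))"
proof -
  have sq: "- A * (b / A + 1 / sqrt A * x)\<^sup>2 + 2 * b * (b / A + 1 / sqrt A * x) = b\<^sup>2 / A + - x\<^sup>2" for x
  proof -
    define a where "a = sqrt A"
    have "A = a * a" "0 < a" using A by (auto simp: a_def)
    then show ?thesis unfolding a_def[symmetric] by (simp add: power2_eq_square field_simps)
  qed
  have "(\<integral>\<^sup>+x. ennreal (exp (- A * x\<^sup>2 + 2 * b * x)) \<partial>lborel)
    = ennreal \<bar>1 / sqrt A\<bar> * (\<integral>\<^sup>+x. ennreal (exp (- A * (b / A + 1 / sqrt A * x)\<^sup>2 + 2 * b * (b / A + 1 / sqrt A * x))) \<partial>lborel)"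
    using A by (intro nn_integral_real_affine) auto
  also have "\<dots> = ennreal \<bar>1 / sqrt A\<bar> * (\<integral>\<^sup>+x. ennreal (exp (b\<^sup>2 / A + - x\<^sup>2)) \<partial>lborel)"
    by (simp only: sq)
  also have "(\<integral>\<^sup>+x. ennreal (exp (b\<^sup>2 / A + - x\<^sup>2)) \<partial>lborel) = ennreal (exp (b\<^sup>2 / A)) * ennreal (sqrt pi)"
    unfolding exp_add by (simp add: ennreal_mult nn_integral_cmult nn_integral_gauss_real)
  finally show ?thesis
    using A by (simp add: real_sqrt_divide mult_ac flip: ennreal_mult)
qed

lemma nn_integral_gauss:
  fixes b :: "'a::euclidean_space"
  assumes A: "0 < A"
  shows "(\<integral>\<^sup>+z. ennreal (exp (- A * (norm z)\<^sup>2 + 2 * (b \<bullet> z))) \<partial>lborel)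
    = ennreal (sqrt (pi / A) ^ DIM('a) * exp ((norm b)\<^sup>2 / A))"
proof -
  have "exp (- A * (norm z)\<^sup>2 + 2 * (b \<bullet> z)) = (\<Prod>i\<in>Basis. exp (- A * (z \<bullet> i)\<^sup>2 + 2 * (b \<bullet> i) * (z \<bullet> i)))" for z :: 'a
  proof -
    have "(norm z)\<^sup>2 = (\<Sum>i\<in>Basis. (z \<bullet> i)\<^sup>2)"
      unfolding power2_norm_eq_inner by (subst euclidean_inner) (simp add: power2_eq_square)
    moreover have "b \<bullet> z = (\<Sum>i\<in>Basis. (b \<bullet> i) * (z \<bullet> i))" by (rule euclidean_inner)
    ultimately have "- A * (norm z)\<^sup>2 + 2 * (b \<bullet> z) = (\<Sum>i\<in>Basis. - A * (z \<bullet> i)\<^sup>2 + 2 * (b \<bullet> i) * (z \<bullet> i))"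
      by (simp only: sum.distrib sum_distrib_left mult.assoc)
    then show ?thesis by (simp only: exp_sum finite_Basis)
  qed
  then have "(\<integral>\<^sup>+z. ennreal (exp (- A * (norm z)\<^sup>2 + 2 * (b \<bullet> z))) \<partial>lborel)
    = (\<integral>\<^sup>+z. (\<Prod>i\<in>Basis. ennreal (exp (- A * (z \<bullet> i)\<^sup>2 + 2 * (b \<bullet> i) * (z \<bullet> i)))) \<partial>(lborel :: 'a measure))"
    by (simp only:) (simp add: prod_ennreal)
  also have "\<dots> = (\<Prod>i\<in>Basis. \<integral>\<^sup>+x. ennreal (exp (- A * x\<^sup>2 + 2 * (b \<bullet> i) * x)) \<partial>lborel)"
    by (rule nn_integral_lborel_prod) auto
  also have "\<dots> = (\<Prod>i\<in>Basis. ennreal (sqrt (pi / A) * exp ((b \<bullet> i)\<^sup>2 / A)))"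
    using A by (intro prod.cong refl nn_integral_gauss_linear)
  also have "\<dots> = ennreal (\<Prod>i\<in>Basis. sqrt (pi / A) * exp ((b \<bullet> i)\<^sup>2 / A))"
    using A by (intro prod_ennreal) auto
  also have "(\<Prod>i\<in>Basis. sqrt (pi / A) * exp ((b \<bullet> i)\<^sup>2 / A)) = sqrt (pi / A) ^ DIM('a) * exp ((norm b)\<^sup>2 / A)"
  proof -
    have "(norm b)\<^sup>2 = (\<Sum>i\<in>Basis. (b \<bullet> i)\<^sup>2)"
      unfolding power2_norm_eq_inner by (subst euclidean_inner) (simp add: power2_eq_square)
    then show ?thesis
      by (simp add: prod.distrib exp_sum[symmetric] sum_divide_distrib)
  qed
  finally show ?thesis .
qed

definition gauss_density :: "'a::euclidean_space \<Rightarrow> real" where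
  "gauss_density x = pi powr (- real DIM('a) / 2) * exp (- (norm x)\<^sup>2)"

lemma gauss_density_measurable [measurable]: "gauss_density \<in> borel_measurable borel"
  unfolding gauss_density_def[abs_def] by measurable

lemma gauss_density_pos: "0 < gauss_density x"
  by (simp add: gauss_density_def)

lemma gaussian_eq: "(gaussian :: 'a::euclidean_space measure) = density lborel (\<lambda>x. ennreal (gauss_density x))"
  by (simp add: gaussian_def gauss_density_def)

lemma sets_gaussian [simp, measurable_cong]: "sets (gaussian :: 'a::euclidean_space measure) = sets borel"
  by (simp add: gaussian_def)

lemma space_gaussian [simp]: "space gaussian = UNIV"
  by (simp add: gaussian_def)

lemma nn_integral_gaussian:
  assumes [measurable]: "F \<in> borel_measurable borel"
  shows "(\<integral>\<^sup>+x. F x \<partial>gaussian) = (\<integral>\<^sup>+x. ennreal (gauss_density x) * F x \<partial>lborel)"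
  unfolding gaussian_eq by (rule nn_integral_density) auto

lemma pi_powr_eq: "pi powr (- real n / 2) = (1 / sqrt pi) ^ n"
proof -
  have "pi powr (- real n / 2) = (pi powr (- (1 / 2))) powr real n"
    by (simp add: powr_powr)
  also have "pi powr (- (1 / 2)) = 1 / sqrt pi"
    using powr_half_sqrt[of pi] by (simp only: powr_minus_divide pi_ge_zero)
  finally show ?thesis by (simp add: powr_realpow)
qed

lemma prob_space_gaussian: "prob_space (gaussian :: 'a::euclidean_space measure)"
proof
  have gauss: "(\<integral>\<^sup>+x. ennreal (exp (- (norm x)\<^sup>2)) \<partial>(lborel :: 'a measure)) = ennreal (sqrt pi ^ DIM('a))"
    using nn_integral_gauss[of 1 "0::'a"] by simp
  have "emeasure (gaussian :: 'a measure) UNIV = (\<integral>\<^sup>+x. 1 \<partial>(gaussian :: 'a measure))"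
    by simp
  also have "\<dots> = (\<integral>\<^sup>+x. ennreal (pi powr (- real DIM('a) / 2)) * ennreal (exp (- (norm x)\<^sup>2)) \<partial>(lborel :: 'a measure))"
    by (subst nn_integral_gaussian) (auto simp: gauss_density_def ennreal_mult)
  also have "\<dots> = ennreal (pi powr (- real DIM('a) / 2)) * ennreal (sqrt pi ^ DIM('a))"
    unfolding gauss[symmetric] by (rule nn_integral_cmult) measurable
  also have "\<dots> = ennreal ((1 / sqrt pi) ^ DIM('a) * sqrt pi ^ DIM('a))"
    unfolding pi_powr_eq by (rule ennreal_mult[symmetric]) auto
  also have "(1 / sqrt pi) ^ DIM('a) * sqrt pi ^ DIM('a) = 1"
    by (simp add: power_divide)
  also have "ennreal 1 = 1" by simp
  finally show "emeasure (gaussian :: 'a measure) (space gaussian) = 1" by simp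
qed

text \<open>The kernel of the Ornstein-Uhlenbeck semigroup with respect to \<open>gaussian\<close>, with \<open>\<rho> = exp (-t)\<close>.\<close>

definition mehler :: "real \<Rightarrow> 'a::euclidean_space \<Rightarrow> 'a \<Rightarrow> real" where
  "mehler \<rho> x y = (1 / sqrt (1 - \<rho>\<^sup>2)) ^ DIM('a) *
     exp ((2 * \<rho> * (x \<bullet> y) - \<rho>\<^sup>2 * (norm x)\<^sup>2 - \<rho>\<^sup>2 * (norm y)\<^sup>2) / (1 - \<rho>\<^sup>2))"

lemma mehler_measurable [measurable (raw)]:
  assumes [measurable]: "f \<in> borel_measurable M" "g \<in> borel_measurable M" "h \<in> borel_measurable M"
  shows "(\<lambda>x. mehler (f x) (g x) (h x)) \<in> borel_measurable M"
  unfolding mehler_def by measurable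

lemma mehler_sym: "mehler \<rho> x y = mehler \<rho> y x"
  by (simp add: mehler_def inner_commute algebra_simps)

lemma mehler_nonneg: "\<bar>\<rho>\<bar> < 1 \<Longrightarrow> 0 \<le> mehler \<rho> x y"
proof -
  assume "\<bar>\<rho>\<bar> < 1"
  then have "0 \<le> 1 - \<rho>\<^sup>2" using abs_square_le_1[of \<rho>] by simp
  then show ?thesis unfolding mehler_def by (intro mult_nonneg_nonneg zero_le_power) auto
qed

text \<open>The exponent equals the square of the norm of x minus the square of the norm of \<rho> y
  - x, divided by 1 - \<rho>^2. The second part has a sign, so the bound is uniform in y.\<close>

lemma mehler_le:
  fixes x y :: "'a::euclidean_space"
  assumes \<rho>: "0 < \<rho>" "\<rho> < 1"
  shows "mehler \<rho> x y \<le> (1 / sqrt (1 - \<rho>\<^sup>2)) ^ DIM('a) * exp ((norm x)\<^sup>2)"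
proof -
  have \<sigma>: "0 < 1 - \<rho>\<^sup>2" using \<rho> by (simp add: power_less_one_iff)
  have "(norm (\<rho> *\<^sub>R y - x))\<^sup>2 = \<rho>\<^sup>2 * (norm y)\<^sup>2 - 2 * \<rho> * (x \<bullet> y) + (norm x)\<^sup>2"
    unfolding power2_norm_eq_inner by (simp add: inner_diff inner_commute power2_eq_square algebra_simps)
  then have "2 * \<rho> * (x \<bullet> y) - \<rho>\<^sup>2 * (norm x)\<^sup>2 - \<rho>\<^sup>2 * (norm y)\<^sup>2
    = (norm x)\<^sup>2 * (1 - \<rho>\<^sup>2) - (norm (\<rho> *\<^sub>R y - x))\<^sup>2"
    by (simp add: algebra_simps)
  also have "\<dots> \<le> (norm x)\<^sup>2 * (1 - \<rho>\<^sup>2)" by simp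
  finally have "(2 * \<rho> * (x \<bullet> y) - \<rho>\<^sup>2 * (norm x)\<^sup>2 - \<rho>\<^sup>2 * (norm y)\<^sup>2) / (1 - \<rho>\<^sup>2) \<le> (norm x)\<^sup>2"
    using \<sigma> by (simp add: divide_le_eq)
  then show ?thesis
    unfolding mehler_def using \<sigma> by (intro mult_left_mono) auto
qed

text \<open>The left side is the Lebesgue density of sqrt (1 - \<rho>^2) u + \<rho> x for Gaussian
  u; the Mehler kernel is its quotient by the Gaussian density.\<close>

lemma mehler_density:
  fixes x y :: "'a::euclidean_space"
  assumes \<rho>: "0 < \<rho>" "\<rho> < 1"
  shows "(1 / sqrt (1 - \<rho>\<^sup>2)) ^ DIM('a) * gauss_density ((1 / sqrt (1 - \<rho>\<^sup>2)) *\<^sub>R (y - \<rho> *\<^sub>R x)) = gauss_density y * mehler \<rho> x y"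
proof -
  have \<sigma>: "0 < 1 - \<rho>\<^sup>2" using \<rho> by (simp add: power_less_one_iff)
  have "(norm (y - \<rho> *\<^sub>R x))\<^sup>2 = (norm y)\<^sup>2 - 2 * \<rho> * (x \<bullet> y) + \<rho>\<^sup>2 * (norm x)\<^sup>2"
    unfolding power2_norm_eq_inner by (simp add: inner_diff inner_commute power2_eq_square algebra_simps)
  then have "- (norm ((1 / sqrt (1 - \<rho>\<^sup>2)) *\<^sub>R (y - \<rho> *\<^sub>R x)))\<^sup>2
    = - (norm y)\<^sup>2 + (2 * \<rho> * (x \<bullet> y) - \<rho>\<^sup>2 * (norm x)\<^sup>2 - \<rho>\<^sup>2 * (norm y)\<^sup>2) / (1 - \<rho>\<^sup>2)"
    using \<sigma> by (simp add: power_mult_distrib power_divide divide_simps) (simp add: algebra_simps)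
  then show ?thesis
    unfolding gauss_density_def mehler_def by (simp only: exp_add) (simp only: mult_ac)
qed

lemma nn_integral_mehler:
  fixes x :: "'a::euclidean_space"
  assumes \<rho>: "0 < \<rho>" "\<rho> < 1" and [measurable]: "F \<in> borel_measurable borel"
  shows "(\<integral>\<^sup>+u. F (sqrt (1 - \<rho>\<^sup>2) *\<^sub>R u + \<rho> *\<^sub>R x) \<partial>gaussian) = (\<integral>\<^sup>+y. ennreal (mehler \<rho> x y) * F y \<partial>gaussian)"
proof -
  define \<sigma> where "\<sigma> = sqrt (1 - \<rho>\<^sup>2)"
  have \<sigma>: "0 < \<sigma>" using \<rho> by (simp add: \<sigma>_def power_less_one_iff)
  let ?h = "\<lambda>y. ennreal ((1 / \<sigma>) ^ DIM('a) * gauss_density ((1 / \<sigma>) *\<^sub>R (y - \<rho> *\<^sub>R x))) * F y"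
  have "(\<integral>\<^sup>+y. ennreal (mehler \<rho> x y) * F y \<partial>gaussian) = (\<integral>\<^sup>+y. ?h y \<partial>lborel)"
    unfolding \<sigma>_def mehler_density[OF \<rho>]
    using \<rho> mehler_nonneg[of \<rho> x] gauss_density_pos[where 'a='a]
    by (subst nn_integral_gaussian) (auto simp: ennreal_mult less_imp_le mult.assoc)
  also have "\<dots> = (\<integral>\<^sup>+y. ?h y \<partial>density (distr lborel borel (\<lambda>u. \<rho> *\<^sub>R x + \<sigma> *\<^sub>R u)) (\<lambda>_. \<bar>\<sigma>\<bar> ^ DIM('a)))"
    using \<sigma> by (subst lborel_affine[of \<sigma> "\<rho> *\<^sub>R x"]) auto
  also have "\<dots> = (\<integral>\<^sup>+u. ennreal (\<sigma> ^ DIM('a)) * ?h (\<rho> *\<^sub>R x + \<sigma> *\<^sub>R u) \<partial>lborel)"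
    using \<sigma> by (simp add: nn_integral_density nn_integral_distr)
  also have "\<dots> = (\<integral>\<^sup>+u. ennreal (gauss_density u) * F (\<sigma> *\<^sub>R u + \<rho> *\<^sub>R x) \<partial>lborel)"
  proof (rule nn_integral_cong)
    fix u :: 'a
    have "\<sigma> ^ DIM('a) * ((1 / \<sigma>) ^ DIM('a) * gauss_density u) = gauss_density u"
      using \<sigma> by (simp add: power_divide)
    then show "ennreal (\<sigma> ^ DIM('a)) * ?h (\<rho> *\<^sub>R x + \<sigma> *\<^sub>R u) = ennreal (gauss_density u) * F (\<sigma> *\<^sub>R u + \<rho> *\<^sub>R x)"
      using \<sigma> gauss_density_pos[of u]
      by (simp add: mult.assoc[symmetric] add.commute less_imp_le flip: ennreal_mult)
  qed
  also have "\<dots> = (\<integral>\<^sup>+u. F (\<sigma> *\<^sub>R u + \<rho> *\<^sub>R x) \<partial>gaussian)"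
    by (subst nn_integral_gaussian) auto
  finally show ?thesis by (simp add: \<sigma>_def)
qed

lemma mehler_total:
  fixes x :: "'a::euclidean_space"
  assumes \<rho>: "0 < \<rho>" "\<rho> < 1"
  shows "(\<integral>\<^sup>+y. ennreal (mehler \<rho> x y) \<partial>gaussian) = 1"
  using nn_integral_mehler[OF \<rho>, of "\<lambda>_. 1" x] prob_space.emeasure_space_1[OF prob_space_gaussian[where 'a='a]] by simp

text \<open>An identity between measures, so the two integrals agree for every measurable f,
  including the default value 0 when they diverge.\<close>

lemma integral_mehler:
  fixes x :: "'a::euclidean_space" and f :: "'a \<Rightarrow> real"
  assumes \<rho>: "0 < \<rho>" "\<rho> < 1" and [measurable]: "f \<in> borel_measurable borel"
  shows "(\<integral>u. f (sqrt (1 - \<rho>\<^sup>2) *\<^sub>R u + \<rho> *\<^sub>R x) \<partial>gaussian) = (\<integral>y. mehler \<rho> x y * f y \<partial>gaussian)"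
proof -
  have eq: "distr gaussian borel (\<lambda>u. sqrt (1 - \<rho>\<^sup>2) *\<^sub>R u + \<rho> *\<^sub>R x) = density gaussian (\<lambda>y. ennreal (mehler \<rho> x y))"
  proof (rule measure_eqI)
    fix A assume "A \<in> sets (distr gaussian borel (\<lambda>u::'a. sqrt (1 - \<rho>\<^sup>2) *\<^sub>R u + \<rho> *\<^sub>R x))"
    then have [measurable]: "A \<in> sets borel" by simp
    have "emeasure (distr gaussian borel (\<lambda>u. sqrt (1 - \<rho>\<^sup>2) *\<^sub>R u + \<rho> *\<^sub>R x)) A
      = (\<integral>\<^sup>+y. indicator A y \<partial>distr gaussian borel (\<lambda>u. sqrt (1 - \<rho>\<^sup>2) *\<^sub>R u + \<rho> *\<^sub>R x))"
      by simp
    also have "\<dots> = (\<integral>\<^sup>+u. indicator A (sqrt (1 - \<rho>\<^sup>2) *\<^sub>R u + \<rho> *\<^sub>R x) \<partial>gaussian)"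
      by (rule nn_integral_distr) auto
    also have "\<dots> = (\<integral>\<^sup>+y. ennreal (mehler \<rho> x y) * indicator A y \<partial>gaussian)"
      by (rule nn_integral_mehler[OF \<rho>]) measurable
    also have "\<dots> = emeasure (density gaussian (\<lambda>y. ennreal (mehler \<rho> x y))) A"
      by (rule emeasure_density[symmetric]) auto
    finally show "emeasure (distr gaussian borel (\<lambda>u. sqrt (1 - \<rho>\<^sup>2) *\<^sub>R u + \<rho> *\<^sub>R x)) A
      = emeasure (density gaussian (\<lambda>y. ennreal (mehler \<rho> x y))) A" .
  qed simp
  have "(\<integral>u. f (sqrt (1 - \<rho>\<^sup>2) *\<^sub>R u + \<rho> *\<^sub>R x) \<partial>gaussian)
    = (\<integral>y. f y \<partial>distr gaussian borel (\<lambda>u. sqrt (1 - \<rho>\<^sup>2) *\<^sub>R u + \<rho> *\<^sub>R x))"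
    by (rule integral_distr[symmetric]) auto
  also have "\<dots> = (\<integral>y. mehler \<rho> x y * f y \<partial>gaussian)"
    unfolding eq using mehler_nonneg[of \<rho> x] \<rho> by (subst integral_density) auto
  finally show ?thesis .
qed

text \<open>As a function of z the product of the two kernels with the Gaussian density is the
  exponential of a quadratic form plus a linear one, so \<open>nn_integral_gauss\<close> evaluates
  the integral; the rest is algebra in R, S and W.\<close>

lemma mehler_semigroup:
  fixes x y :: "'a::euclidean_space"
  assumes \<rho>: "0 < \<rho>" "\<rho> < 1" and \<sigma>: "0 < \<sigma>" "\<sigma> < 1"
  shows "(\<integral>\<^sup>+z. ennreal (mehler \<rho> x z) * ennreal (mehler \<sigma> z y) \<partial>gaussian) = ennreal (mehler (\<rho> * \<sigma>) x y)"
proof -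
  let ?d = "DIM('a)"
  define R where "R = 1 - \<rho>\<^sup>2"
  define S where "S = 1 - \<sigma>\<^sup>2"
  define W where "W = 1 - (\<rho> * \<sigma>)\<^sup>2"
  have "\<rho> * \<sigma> < 1 * 1" using \<rho> \<sigma> by (intro mult_strict_mono) auto
  then have R: "0 < R" and S: "0 < S" and W: "0 < W"
    using \<rho> \<sigma> by (auto simp: R_def S_def W_def power_less_one_iff)
  define A where "A = W / (R * S)"
  have A: "0 < A" using R S W by (simp add: A_def)
  define b where "b = (\<rho> / R) *\<^sub>R x + (\<sigma> / S) *\<^sub>R y"
  define c where "c = pi powr (- real ?d / 2) * ((1 / sqrt R) ^ ?d * (1 / sqrt S) ^ ?d) * exp (- (\<rho>\<^sup>2 * (norm x)\<^sup>2) / R - (\<sigma>\<^sup>2 * (norm y)\<^sup>2) / S)"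
  have c: "0 \<le> c" using R S by (simp add: c_def)
  \<comment> \<open>The coefficient of the quadratic form in z; it equals W / (R S) because W = 1 -
    (\<rho> \<sigma>)^2.\<close>
  have A_eq: "A = 1 + \<rho>\<^sup>2 / R + \<sigma>\<^sup>2 / S"
    using R S by (simp add: A_def W_def field_simps) (simp add: R_def S_def algebra_simps power_mult_distrib)
  have pw: "gauss_density z * (mehler \<rho> x z * mehler \<sigma> z y) = c * exp (- A * (norm z)\<^sup>2 + 2 * (b \<bullet> z))" for z
  proof -
    have "- (norm z)\<^sup>2 + (2 * \<rho> * (x \<bullet> z) - \<rho>\<^sup>2 * (norm x)\<^sup>2 - \<rho>\<^sup>2 * (norm z)\<^sup>2) / R
        + (2 * \<sigma> * (z \<bullet> y) - \<sigma>\<^sup>2 * (norm z)\<^sup>2 - \<sigma>\<^sup>2 * (norm y)\<^sup>2) / S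
      = (- (\<rho>\<^sup>2 * (norm x)\<^sup>2) / R - (\<sigma>\<^sup>2 * (norm y)\<^sup>2) / S) + (- A * (norm z)\<^sup>2 + 2 * (b \<bullet> z))"
      unfolding A_eq b_def
      by (simp add: inner_add inner_commute[of y z] diff_divide_distrib add_divide_distrib algebra_simps)
    then have "exp (- (norm z)\<^sup>2) * exp ((2 * \<rho> * (x \<bullet> z) - \<rho>\<^sup>2 * (norm x)\<^sup>2 - \<rho>\<^sup>2 * (norm z)\<^sup>2) / R)
        * exp ((2 * \<sigma> * (z \<bullet> y) - \<sigma>\<^sup>2 * (norm z)\<^sup>2 - \<sigma>\<^sup>2 * (norm y)\<^sup>2) / S)
      = exp (- (\<rho>\<^sup>2 * (norm x)\<^sup>2) / R - (\<sigma>\<^sup>2 * (norm y)\<^sup>2) / S) * exp (- A * (norm z)\<^sup>2 + 2 * (b \<bullet> z))"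
      unfolding exp_add[symmetric] by (rule arg_cong)
    note E = this
    have "gauss_density z * (mehler \<rho> x z * mehler \<sigma> z y)
      = pi powr (- real ?d / 2) * ((1 / sqrt R) ^ ?d * (1 / sqrt S) ^ ?d) * (exp (- (norm z)\<^sup>2) * exp ((2 * \<rho> * (x \<bullet> z) - \<rho>\<^sup>2 * (norm x)\<^sup>2 - \<rho>\<^sup>2 * (norm z)\<^sup>2) / R)
        * exp ((2 * \<sigma> * (z \<bullet> y) - \<sigma>\<^sup>2 * (norm z)\<^sup>2 - \<sigma>\<^sup>2 * (norm y)\<^sup>2) / S))"
      unfolding gauss_density_def mehler_def R_def[symmetric] S_def[symmetric]
      by (simp only: mult_ac)
    then show ?thesis unfolding E c_def by (simp only: mult_ac)
  qed
  have "(\<integral>\<^sup>+z. ennreal (mehler \<rho> x z) * ennreal (mehler \<sigma> z y) \<partial>gaussian)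
    = (\<integral>\<^sup>+z. ennreal c * ennreal (exp (- A * (norm z)\<^sup>2 + 2 * (b \<bullet> z))) \<partial>lborel)"
  proof (subst nn_integral_gaussian, measurable, rule nn_integral_cong)
    fix z :: 'a
    show "ennreal (gauss_density z) * (ennreal (mehler \<rho> x z) * ennreal (mehler \<sigma> z y))
      = ennreal c * ennreal (exp (- A * (norm z)\<^sup>2 + 2 * (b \<bullet> z)))"
      using pw[of z] mehler_nonneg[of \<rho> x z] mehler_nonneg[of \<sigma> z y] \<rho> \<sigma> c gauss_density_pos[of z]
      by (simp add: less_imp_le flip: ennreal_mult)
  qed
  also have "\<dots> = ennreal c * ennreal (sqrt (pi / A) ^ ?d * exp ((norm b)\<^sup>2 / A))"
    by (subst nn_integral_cmult) (simp, simp only: nn_integral_gauss[OF A])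
  also have "\<dots> = ennreal (c * (sqrt (pi / A) ^ ?d * exp ((norm b)\<^sup>2 / A)))"
    using c A by (intro ennreal_mult[symmetric]) auto
  also have "c * (sqrt (pi / A) ^ ?d * exp ((norm b)\<^sup>2 / A)) = mehler (\<rho> * \<sigma>) x y"
  proof -
    have 1: "pi powr (- real ?d / 2) * ((1 / sqrt R) ^ ?d * (1 / sqrt S) ^ ?d) * sqrt (pi / A) ^ ?d = (1 / sqrt W) ^ ?d"
    proof -
      have "(1 / sqrt pi) * ((1 / sqrt R) * (1 / sqrt S)) * sqrt (pi / A) = 1 / sqrt W"
        using R S W by (simp add: A_def real_sqrt_divide real_sqrt_mult field_simps)
      then show ?thesis unfolding pi_powr_eq by (simp only: power_mult_distrib[symmetric])
    qed
    have nb: "(norm b)\<^sup>2 = (\<rho> / R)\<^sup>2 * (norm x)\<^sup>2 + 2 * (\<rho> / R) * (\<sigma> / S) * (x \<bullet> y) + (\<sigma> / S)\<^sup>2 * (norm y)\<^sup>2"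
      unfolding b_def power2_norm_eq_inner by (simp add: inner_add inner_commute[of y x] power2_eq_square algebra_simps)
    have "(norm b)\<^sup>2 / A = (\<rho>\<^sup>2 * S / R * (norm x)\<^sup>2 + 2 * (\<rho> * \<sigma>) * (x \<bullet> y) + \<sigma>\<^sup>2 * R / S * (norm y)\<^sup>2) / W"
      unfolding nb A_def using R S W by (simp add: power2_eq_square field_simps)
    then have "- (\<rho>\<^sup>2 * (norm x)\<^sup>2) / R - (\<sigma>\<^sup>2 * (norm y)\<^sup>2) / S + (norm b)\<^sup>2 / A
      = (2 * (\<rho> * \<sigma>) * (x \<bullet> y) - (\<rho>\<^sup>2 * (W - S) / R) * (norm x)\<^sup>2 - (\<sigma>\<^sup>2 * (W - R) / S) * (norm y)\<^sup>2) / W"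
      using R S W by (simp add: field_simps)
    also have "\<rho>\<^sup>2 * (W - S) / R = (\<rho> * \<sigma>)\<^sup>2"
    proof -
      have "W - S = \<sigma>\<^sup>2 * R" by (simp add: W_def S_def R_def power_mult_distrib algebra_simps)
      then show ?thesis using R by (simp add: power_mult_distrib)
    qed
    also have "\<sigma>\<^sup>2 * (W - R) / S = (\<rho> * \<sigma>)\<^sup>2"
    proof -
      have "W - R = \<rho>\<^sup>2 * S" by (simp add: W_def S_def R_def power_mult_distrib algebra_simps)
      then show ?thesis using S by (simp add: power_mult_distrib)
    qed
    finally have 2: "exp (- (\<rho>\<^sup>2 * (norm x)\<^sup>2) / R - (\<sigma>\<^sup>2 * (norm y)\<^sup>2) / S) * exp ((norm b)\<^sup>2 / A)
      = exp ((2 * (\<rho> * \<sigma>) * (x \<bullet> y) - (\<rho> * \<sigma>)\<^sup>2 * (norm x)\<^sup>2 - (\<rho> * \<sigma>)\<^sup>2 * (norm y)\<^sup>2) / W)"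
      unfolding exp_add[symmetric] by (rule arg_cong)
    have "c * (sqrt (pi / A) ^ ?d * exp ((norm b)\<^sup>2 / A))
      = (pi powr (- real ?d / 2) * ((1 / sqrt R) ^ ?d * (1 / sqrt S) ^ ?d) * sqrt (pi / A) ^ ?d)
        * (exp (- (\<rho>\<^sup>2 * (norm x)\<^sup>2) / R - (\<sigma>\<^sup>2 * (norm y)\<^sup>2) / S) * exp ((norm b)\<^sup>2 / A))"
      unfolding c_def by (simp only: mult_ac)
    then show ?thesis unfolding 1 2 mehler_def W_def .
  qed
  finally show ?thesis .
qed

section \<open>The one-sided stable subordinator of order 1/2\<close>

text \<open>Extended by 0 to r \<le> 0, so that averages and convolutions become integrals over the
  whole line.\<close>

definition sub_density :: "real \<Rightarrow> real \<Rightarrow> real" where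
  "sub_density t r = (if 0 < r then t / (2 * sqrt pi) * r powr (- 3 / 2) * exp (- t\<^sup>2 / (4 * r)) else 0)"

lemma sub_density_measurable [measurable (raw)]:
  assumes [measurable]: "f \<in> borel_measurable M" "g \<in> borel_measurable M"
  shows "(\<lambda>x. sub_density (f x) (g x)) \<in> borel_measurable M"
  unfolding sub_density_def by measurable

lemma sub_density_nonneg: "0 \<le> t \<Longrightarrow> 0 \<le> sub_density t r"
  by (simp add: sub_density_def)

text \<open>The exponential decreases in t for t > 0, so only the linear factor t can grow.\<close>

lemma sub_density_harnack:
  assumes "0 < s" "s \<le> t"
  shows "sub_density t r \<le> t / s * sub_density s r"
proof (cases "0 < r")
  case True
  have "exp (- t\<^sup>2 / (4 * r)) \<le> exp (- s\<^sup>2 / (4 * r))"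
    using assms True by (simp add: divide_right_mono power_mono)
  then have "t / (2 * sqrt pi) * r powr (- 3 / 2) * exp (- t\<^sup>2 / (4 * r))
    \<le> t / (2 * sqrt pi) * r powr (- 3 / 2) * exp (- s\<^sup>2 / (4 * r))"
    using assms by (intro mult_left_mono) auto
  also have "\<dots> = t / s * (s / (2 * sqrt pi) * r powr (- 3 / 2) * exp (- s\<^sup>2 / (4 * r)))"
    using assms by simp
  finally show ?thesis using True by (simp add: sub_density_def)
qed (simp add: sub_density_def)

lemma absolutely_integrable_iff_lborel:
  fixes f :: "real \<Rightarrow> real"
  assumes "f \<in> borel_measurable borel" "S \<in> sets borel"
  shows "f absolutely_integrable_on S \<longleftrightarrow> set_integrable lborel S f"
  unfolding set_integrable_def using assms by (intro integrable_completion) auto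

text \<open>The substitution u = t^2 / (4 r) is an involution of the half-line. It turns the weight
  exp (-u) / sqrt u into \<open>sub_density t\<close>, and it preserves absolute integrability in
  both directions.\<close>

lemma subordination_substitution:
  fixes a :: "real \<Rightarrow> real"
  assumes t: "0 < t" and [measurable]: "a \<in> borel_measurable borel"
  defines "f \<equiv> \<lambda>u. exp (- u) / sqrt u * a (t\<^sup>2 / (4 * u))"
  shows "integrable lborel (\<lambda>r. sub_density t r * a r) \<longleftrightarrow> set_integrable lborel {0<..} f"
    and "integrable lborel (\<lambda>r. sub_density t r * a r) \<Longrightarrow>
      1 / sqrt pi * (LINT u:{0<..}|lborel. f u) = (\<integral>r. sub_density t r * a r \<partial>lborel)"
proof -
  have [measurable]: "f \<in> borel_measurable borel" unfolding f_def by measurable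
  let ?g = "\<lambda>r. t\<^sup>2 / (4 * r)" and ?g' = "\<lambda>r. - (t\<^sup>2 / (4 * r\<^sup>2))"
  have h: "\<bar>?g' r\<bar> * f (?g r) = sqrt pi * (sub_density t r * a r)" if r: "0 < r" for r
  proof -
    have 1: "sqrt (t\<^sup>2 / (4 * r)) = t / (2 * sqrt r)"
      using t r by (simp add: real_sqrt_divide real_sqrt_mult)
    have 2: "r powr (- 3 / 2) = 1 / (r * sqrt r)"
    proof -
      have "r powr (- 3 / 2) = 1 / (r powr 1 * r powr (1 / 2))"
        by (subst powr_add[symmetric]) (simp add: powr_minus_divide[symmetric])
      then show ?thesis using r by (simp add: powr_half_sqrt)
    qed
    have 3: "t\<^sup>2 / (4 * (t\<^sup>2 / (4 * r))) = r" using t r by simp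
    obtain s where s: "r = s * s" "0 < s" "sqrt r = s"
      using r by (metis real_sqrt_gt_zero real_sqrt_mult_self abs_of_pos)
    show ?thesis
      unfolding f_def sub_density_def 1 2 3 using t r s(2)
      by (simp only: s(3)) (simp add: s(1) power2_eq_square field_simps)
  qed
  have cov: "(\<lambda>r. \<bar>?g' r\<bar> * f (?g r)) absolutely_integrable_on {0<..} \<and>
      integral {0<..} (\<lambda>r. \<bar>?g' r\<bar> * f (?g r)) = b
    \<longleftrightarrow> f absolutely_integrable_on (?g ` {0<..}) \<and> integral (?g ` {0<..}) f = b" for b
  proof (rule has_absolute_integral_change_of_variables_1')
    show "inj_on ?g {0<..}" using t by (auto simp: inj_on_def)
    show "(?g has_field_derivative ?g' r) (at r within {0<..})" if "r \<in> {0<..}" for r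
      using that by (auto intro!: derivative_eq_intros simp: power2_eq_square)
  qed simp
  have img: "?g ` {0<..} = {0<..}"
  proof
    show "{0<..} \<subseteq> ?g ` {0<..}"
    proof
      fix u :: real assume "u \<in> {0<..}"
      then have "u = ?g (?g u)" "?g u \<in> {0<..}" using t by auto
      then show "u \<in> ?g ` {0<..}" by blast
    qed
  qed (use t in auto)
  have eq: "indicator {0<..} r *\<^sub>R (\<bar>?g' r\<bar> * f (?g r)) = sqrt pi * (sub_density t r * a r)" for r
  proof (cases "0 < r")
    case True
    then show ?thesis using h[OF True] by (simp only: indicator_simps greaterThan_iff scaleR_one)
  next
    case False
    then have "indicator {0<..} r = (0::real)" "sub_density t r = 0" by (auto simp: sub_density_def)
    then show ?thesis by (simp only: scaleR_zero_left mult_zero_left mult_zero_right)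
  qed
  have int_h: "(\<lambda>r. \<bar>?g' r\<bar> * f (?g r)) absolutely_integrable_on {0<..} \<longleftrightarrow> integrable lborel (\<lambda>r. sub_density t r * a r)"
  proof -
    have "(\<lambda>r. \<bar>?g' r\<bar> * f (?g r)) absolutely_integrable_on {0<..} \<longleftrightarrow> set_integrable lborel {0<..} (\<lambda>r. \<bar>?g' r\<bar> * f (?g r))"
      by (rule absolutely_integrable_iff_lborel) auto
    also have "\<dots> \<longleftrightarrow> integrable lborel (\<lambda>r. sqrt pi * (sub_density t r * a r))"
      unfolding set_integrable_def eq ..
    finally show ?thesis by simp
  qed
  have int_f: "f absolutely_integrable_on {0<..} \<longleftrightarrow> set_integrable lborel {0<..} f"
    by (rule absolutely_integrable_iff_lborel) auto
  show *: "integrable lborel (\<lambda>r. sub_density t r * a r) \<longleftrightarrow> set_integrable lborel {0<..} f"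
    using cov int_h int_f unfolding img by blast
  assume i: "integrable lborel (\<lambda>r. sub_density t r * a r)"
  then have "set_integrable lborel {0<..} f" using * by simp
  then have "(LINT u:{0<..}|lborel. f u) = integral {0<..} f" by (rule set_borel_integral_eq_integral)
  also have "\<dots> = integral {0<..} (\<lambda>r. \<bar>?g' r\<bar> * f (?g r))"
    using cov[of "integral {0<..} (\<lambda>r. \<bar>?g' r\<bar> * f (?g r))"] int_h i unfolding img by simp
  also have "\<dots> = (LINT r:{0<..}|lborel. \<bar>?g' r\<bar> * f (?g r))"
    using i unfolding set_integrable_def eq[symmetric]
    by (intro set_borel_integral_eq_integral(2)[symmetric]) (simp only: set_integrable_def eq integrable_mult_right)
  also have "\<dots> = sqrt pi * (\<integral>r. sub_density t r * a r \<partial>lborel)"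
    unfolding set_lebesgue_integral_def eq by (rule integral_mult_right_zero)
  finally show "1 / sqrt pi * (LINT u:{0<..}|lborel. f u) = (\<integral>r. sub_density t r * a r \<partial>lborel)"
    by simp
qed

lemma gamma_half_integral:
  "((\<lambda>u::real. exp (- u) / sqrt u) has_integral sqrt pi) {0<..}"
proof -
  have "((\<lambda>t::real. t powr (1 / 2 - 1) / exp t) has_integral Gamma (1 / 2)) {0..}"
    by (rule Gamma_integral_real) simp
  then have "((\<lambda>x::real. if x \<in> {0..} then x powr (1 / 2 - 1) / exp x else 0) has_integral sqrt pi) UNIV"
    by (simp only: has_integral_restrict_UNIV Gamma_one_half_real)
  also have "(\<lambda>x::real. if x \<in> {0..} then x powr (1 / 2 - 1) / exp x else 0)
    = (\<lambda>x. if x \<in> {0<..} then exp (- x) / sqrt x else 0)"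
  proof (rule ext)
    fix x :: real
    show "(if x \<in> {0..} then x powr (1 / 2 - 1) / exp x else 0) = (if x \<in> {0<..} then exp (- x) / sqrt x else 0)"
    proof (cases "0 < x")
      case True
      have "x powr (1 / 2 - 1) = 1 / x powr (1 / 2)" by (simp add: powr_minus_divide[symmetric])
      then show ?thesis using True by (simp add: powr_half_sqrt exp_minus field_simps)
    qed (cases "x = 0", auto)
  qed
  finally show ?thesis by (simp only: has_integral_restrict_UNIV)
qed

text \<open>After the substitution the integral is that of exp (-u) / sqrt u, which is Gamma (1/2) =
  sqrt pi.\<close>

lemma sub_density_total:
  assumes t: "0 < t"
  shows "(\<integral>\<^sup>+r. ennreal (sub_density t r) \<partial>lborel) = 1"
proof -
  have si: "set_integrable lborel {0<..} (\<lambda>u::real. exp (- u) / sqrt u)"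
    using gamma_half_integral
    by (subst absolutely_integrable_iff_lborel[symmetric]) (auto intro!: nonnegative_absolutely_integrable_1)
  have i: "integrable lborel (\<lambda>r. sub_density t r * 1)"
    using si by (subst subordination_substitution(1)[OF t]) auto
  have "(\<integral>r. sub_density t r * 1 \<partial>lborel) = 1 / sqrt pi * (LINT u:{0<..}|lborel. exp (- u) / sqrt u)"
    using subordination_substitution(2)[OF t, of "\<lambda>_. 1"] i by simp
  also have "(LINT u:{0<..}|lborel. exp (- u) / sqrt u) = sqrt pi"
    using set_borel_integral_eq_integral(2)[OF si] gamma_half_integral by (simp add: integral_unique)
  finally have "(\<integral>r. sub_density t r \<partial>lborel) = 1" by simp
  then show ?thesis
    using i t by (subst nn_integral_eq_integral) (auto simp: sub_density_nonneg)
qed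

text \<open>The integral from -\<infinity>, an error function up to scaling. The limit at
  -\<infinity> follows from the one at +\<infinity>, since the integrand is even.\<close>

lemma gauss_primitive:
  assumes w: "0 < w"
  obtains \<Phi> :: "real \<Rightarrow> real" where
    "\<And>x. (\<Phi> has_real_derivative exp (- x\<^sup>2 / (4 * w))) (at x)"
    "(\<Phi> \<longlongrightarrow> 2 * sqrt (pi * w)) at_top" "(\<Phi> \<longlongrightarrow> 0) at_bot"
proof -
  define e where "e x = exp (- x\<^sup>2 / (4 * w))" for x :: real
  have [measurable]: "e \<in> borel_measurable borel" unfolding e_def[abs_def] by measurable
  have e_nn: "0 \<le> e x" for x by (simp add: e_def)
  have nn: "(\<integral>\<^sup>+x. ennreal (e x) \<partial>lborel) = ennreal (2 * sqrt (pi * w))"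
    using nn_integral_gauss_linear[of "1 / (4 * w)" 0] w by (simp add: e_def real_sqrt_mult)
  have int: "integrable lborel e"
    using nn e_nn by (intro integrableI_nonneg) auto
  have total: "(\<integral>x. e x \<partial>lborel) = 2 * sqrt (pi * w)"
    using nn e_nn w by (subst integral_eq_nn_integral) auto
  define \<Phi> where "\<Phi> x = (\<integral>y. indicator {..x} y *\<^sub>R e y \<partial>lborel)" for x
  have int': "integrable lborel (\<lambda>y. indicator A y *\<^sub>R e y)" if "A \<in> sets borel" for A
    using int that by (intro integrable_mult_indicator) auto
  have cont: "continuous_on S e" for S
    unfolding e_def[abs_def] using w by (intro continuous_intros) auto
  show ?thesis
  proof (rule that[of \<Phi>])
    fix x :: real
    have \<Phi>: "\<Phi> y = \<Phi> (x - 1) + integral {x - 1..y} e" if y: "x - 1 \<le> y" for y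
    proof -
      have "\<Phi> y = (\<integral>z. indicator {..x - 1} z *\<^sub>R e z + indicator {x - 1..y} z *\<^sub>R e z \<partial>lborel)"
        unfolding \<Phi>_def
      proof (rule integral_cong_AE)
        have "AE z in lborel. z \<noteq> x - 1" by (rule AE_lborel_singleton)
        then show "AE z in lborel. indicator {..y} z *\<^sub>R e z = indicator {..x - 1} z *\<^sub>R e z + indicator {x - 1..y} z *\<^sub>R e z"
          by eventually_elim (use y in \<open>auto split: split_indicator\<close>)
      qed measurable
      also have "\<dots> = \<Phi> (x - 1) + (LINT z:{x - 1..y}|lborel. e z)"
        unfolding \<Phi>_def set_lebesgue_integral_def by (intro Bochner_Integration.integral_add int') auto
      also have "(LINT z:{x - 1..y}|lborel. e z) = integral {x - 1..y} e"
        using int' by (intro set_borel_integral_eq_integral) (auto simp: set_integrable_def)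
      finally show ?thesis .
    qed
    have "((\<lambda>y. integral {x - 1..y} e) has_real_derivative e x) (at x within {x - 1..x + 1})"
      by (intro integral_has_real_derivative cont) auto
    then have "((\<lambda>y. integral {x - 1..y} e) has_real_derivative e x) (at x)"
      by (subst (asm) at_within_Icc_at) auto
    then have "((\<lambda>y. \<Phi> (x - 1) + integral {x - 1..y} e) has_real_derivative 0 + e x) (at x)"
      by (intro DERIV_add DERIV_const)
    then have "((\<lambda>y. \<Phi> (x - 1) + integral {x - 1..y} e) has_real_derivative e x) (at x)" by simp
    then have "(\<Phi> has_real_derivative e x) (at x)"
      by (rule has_field_derivative_transform_within_open[where S="{x - 1<..}"]) (auto intro!: \<Phi>[symmetric])
    then show "(\<Phi> has_real_derivative exp (- x\<^sup>2 / (4 * w))) (at x)" by (simp add: e_def)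
  next
    show top: "(\<Phi> \<longlongrightarrow> 2 * sqrt (pi * w)) at_top"
      unfolding \<Phi>_def total[symmetric] by (rule tendsto_integral_at_top) (use int in auto)
    have refl: "\<Phi> y = 2 * sqrt (pi * w) - \<Phi> (- y)" for y
    proof -
      have "\<Phi> y = (\<integral>z. indicator {..y} (- z) *\<^sub>R e (- z) \<partial>lborel)"
        unfolding \<Phi>_def using lborel_integral_real_affine[of "-1" "\<lambda>z. indicator {..y} z *\<^sub>R e z" 0] by simp
      also have "\<dots> = (\<integral>z. e z - indicator {..- y} z *\<^sub>R e z \<partial>lborel)"
      proof (rule integral_cong_AE)
        have "AE z in lborel. z \<noteq> - y" by (rule AE_lborel_singleton)
        then show "AE z in lborel. indicator {..y} (- z) *\<^sub>R e (- z) = e z - indicator {..- y} z *\<^sub>R e z"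
          by eventually_elim (auto simp: e_def split: split_indicator)
      qed measurable
      also have "\<dots> = (\<integral>z. e z \<partial>lborel) - \<Phi> (- y)"
        unfolding \<Phi>_def by (intro Bochner_Integration.integral_diff int int') auto
      finally show ?thesis by (simp add: total)
    qed
    have "((\<lambda>y. 2 * sqrt (pi * w) - \<Phi> (- y)) \<longlongrightarrow> 2 * sqrt (pi * w) - 2 * sqrt (pi * w)) at_bot"
      by (intro tendsto_intros filterlim_compose[OF top] filterlim_uminus_at_top_at_bot)
    then show "(\<Phi> \<longlongrightarrow> 0) at_bot" unfolding refl[symmetric] by simp
  qed
qed

lemma powr_three_halves: "0 < x \<Longrightarrow> x powr (- 3 / 2) = 1 / (x * sqrt x)"
proof -
  assume "0 < (x::real)"
  have "x powr (- 3 / 2) = 1 / (x powr 1 * x powr (1 / 2))"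
    by (subst powr_add[symmetric]) (simp add: powr_minus_divide[symmetric])
  then show ?thesis using \<open>0 < x\<close> by (simp add: powr_half_sqrt)
qed

text \<open>The integrand has an explicit primitive: with \<open>\<xi>, \<eta> = (s (w - v) \<mp> t v) / sqrt (v (w - v))\<close> and
  \<open>\<Phi>' x = exp (- x\<^sup>2 / (4 w))\<close> it is a combination of \<open>\<Phi> \<xi>\<close> and \<open>exp (s t / w) \<Phi> \<eta>\<close>.\<close>

lemma sub_density_convolution:
  assumes s: "0 < s" and t: "0 < t" and w: "0 < w"
  shows "(\<integral>\<^sup>+v. ennreal (sub_density s v) * ennreal (sub_density t (w - v)) \<partial>lborel) = ennreal (sub_density (s + t) w)"
proof -
  obtain \<Phi> where \<Phi>: "\<And>x. (\<Phi> has_real_derivative exp (- x\<^sup>2 / (4 * w))) (at x)"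
    "(\<Phi> \<longlongrightarrow> 2 * sqrt (pi * w)) at_top" "(\<Phi> \<longlongrightarrow> 0) at_bot"
    by (rule gauss_primitive[OF w]) (rule that)
  define T where "T = 2 * sqrt (pi * w)"
  define Z where "Z c v = (s * (w - v) + c * v) / sqrt (v * (w - v))" for c v
  define K where "K = s * t / (2 * pi * w\<^sup>2) * exp (- (s + t)\<^sup>2 / (4 * w))"
  \<comment> \<open>Chosen so that, after the common exponential is factored out of the derivative,
    the two linear forms s (w - v) + t v and s (w - v) - t v combine to the constant w.\<close>
  define c1 where "c1 = 1 / (2 * s) + 1 / (2 * t)"
  define c2 where "c2 = (1 / (2 * s) - 1 / (2 * t)) * exp (s * t / w)"
  define F where "F v = - K * (c1 * \<Phi> (Z (- t) v) + c2 * \<Phi> (Z t v))" for v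
  let ?f = "\<lambda>v. sub_density s v * sub_density t (w - v)"
  have Z_deriv: "(Z c has_real_derivative - (w / 2) * (s * (w - v) - c * v) / (v * (w - v) * sqrt (v * (w - v)))) (at v)"
    if v: "0 < v" "v < w" for c v
  proof -
    define q where "q = sqrt (v * (w - v))"
    have q: "0 < q" "q * q = v * (w - v)" using v by (auto simp: q_def)
    have S: "((\<lambda>v. sqrt (v * (w - v))) has_real_derivative (w - 2 * v) / (2 * q)) (at v)"
      using v by (auto intro!: derivative_eq_intros simp: q_def field_simps)
    have N: "((\<lambda>v. s * (w - v) + c * v) has_real_derivative (c - s)) (at v)"
      by (auto intro!: derivative_eq_intros)
    have "(Z c has_real_derivative ((c - s) * q - (s * (w - v) + c * v) * ((w - 2 * v) / (2 * q))) / (q * q)) (at v)"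
      using DERIV_divide[OF N S] less_imp_neq[OF q(1), symmetric] unfolding Z_def[abs_def] q_def by blast
    moreover have "((c - s) * q - (s * (w - v) + c * v) * ((w - 2 * v) / (2 * q))) / (q * q)
      = ((c - s) * (q * q) * 2 - (s * (w - v) + c * v) * (w - 2 * v)) / (2 * q * (q * q))"
      using q(1) by (simp add: field_simps)
    moreover have "(c - s) * (q * q) * 2 - (s * (w - v) + c * v) * (w - 2 * v) = - w * (s * (w - v) - c * v)"
      unfolding q(2) by (simp add: algebra_simps)
    ultimately have "(Z c has_real_derivative - w * (s * (w - v) - c * v) / (2 * q * (q * q))) (at v)" by simp
    moreover have "- w * (s * (w - v) - c * v) / (2 * q * (q * q)) = - (w / 2) * (s * (w - v) - c * v) / ((q * q) * q)"
      using q(1) by (simp add: field_simps)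
    ultimately show ?thesis by (simp only: q(2)) (simp only: q_def)
  qed
  have F_deriv: "(F has_real_derivative ?f v) (at v)" if v: "0 < v" "v < w" for v
  proof -
    define q where "q = sqrt (v * (w - v))"
    define E where "E = exp (- (Z (- t) v)\<^sup>2 / (4 * w))"
    have q: "0 < q" "q\<^sup>2 = v * (w - v)" using v by (auto simp: q_def)
    have Z2: "(Z c v)\<^sup>2 = (s * (w - v) + c * v)\<^sup>2 / (v * (w - v))" for c
      using v by (simp add: Z_def power_divide)
    \<comment> \<open>The squares of the two arguments differ by the constant 4 s t, so the factor
      exp (s t / w) makes the exponentials of both terms coincide.\<close>
    have "exp (s * t / w) * exp (- (Z t v)\<^sup>2 / (4 * w)) = E"
    proof -
      have "(Z t v)\<^sup>2 = (Z (- t) v)\<^sup>2 + 4 * s * t"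
        unfolding Z2 using v by (simp add: field_simps) (simp add: power2_eq_square algebra_simps)
      then have "s * t / w + - (Z t v)\<^sup>2 / (4 * w) = - (Z (- t) v)\<^sup>2 / (4 * w)"
        using w by (simp add: field_simps)
      then show ?thesis unfolding E_def exp_add[symmetric] by (rule arg_cong)
    qed
    note E' = this
    have "(F has_real_derivative - K * (c1 * (exp (- (Z (- t) v)\<^sup>2 / (4 * w)) * (- (w / 2) * (s * (w - v) - (- t) * v) / (v * (w - v) * q)))
      + c2 * (exp (- (Z t v)\<^sup>2 / (4 * w)) * (- (w / 2) * (s * (w - v) - t * v) / (v * (w - v) * q))))) (at v)"
      unfolding F_def[abs_def] q_def
      by (intro DERIV_cmult DERIV_add DERIV_chain2[OF \<Phi>(1)] Z_deriv v)
    moreover have "- K * (c1 * (exp (- (Z (- t) v)\<^sup>2 / (4 * w)) * (- (w / 2) * (s * (w - v) - (- t) * v) / (v * (w - v) * q)))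
      + c2 * (exp (- (Z t v)\<^sup>2 / (4 * w)) * (- (w / 2) * (s * (w - v) - t * v) / (v * (w - v) * q)))) = ?f v"
    proof -
      have "- K * (c1 * (exp (- (Z (- t) v)\<^sup>2 / (4 * w)) * (- (w / 2) * (s * (w - v) - (- t) * v) / (v * (w - v) * q)))
        + c2 * (exp (- (Z t v)\<^sup>2 / (4 * w)) * (- (w / 2) * (s * (w - v) - t * v) / (v * (w - v) * q))))
        = K * (w / 2) / (v * (w - v) * q) * E * (c1 * (s * (w - v) + t * v) + (1 / (2 * s) - 1 / (2 * t)) * (s * (w - v) - t * v))"
      proof -
        have step: "- K * (a * ((x * y) * (- (w / 2) * i / d)) + b * x * (y * (- (w / 2) * m / d))) = K * (w / 2) / d * (x * y) * (a * i + b * m)"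
          for a b x y i m d :: real
          by (simp add: algebra_simps add_divide_distrib)
        have "s * (w - v) - (- t) * v = s * (w - v) + t * v" by simp
        then show ?thesis
          unfolding E_def[symmetric] c2_def using step[of c1 "exp (s * t / w)" "exp (- (Z t v)\<^sup>2 / (4 * w))" _ _ "1 / (2 * s) - 1 / (2 * t)", unfolded E']
          by (simp only:)
      qed
      also have "c1 * (s * (w - v) + t * v) + (1 / (2 * s) - 1 / (2 * t)) * (s * (w - v) - t * v) = w"
        unfolding c1_def using s t by (simp add: field_simps)
      also have "K * (w / 2) / (v * (w - v) * q) * E * w = s * t / (4 * pi) / (v * (w - v) * q) * (exp (- (s + t)\<^sup>2 / (4 * w)) * E)"
        unfolding K_def using w by (simp add: power2_eq_square)
      also have "exp (- (s + t)\<^sup>2 / (4 * w)) * E = exp (- s\<^sup>2 / (4 * v)) * exp (- t\<^sup>2 / (4 * (w - v)))"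
      proof -
        have "(s + t)\<^sup>2 + (Z (- t) v)\<^sup>2 = w * (s\<^sup>2 / v + t\<^sup>2 / (w - v))"
          unfolding Z2 using v by (simp add: field_simps) (simp add: power2_eq_square algebra_simps)
        then have "((s + t)\<^sup>2 + (Z (- t) v)\<^sup>2) / (4 * w) = (s\<^sup>2 / v + t\<^sup>2 / (w - v)) / 4"
          using w by simp
        then have "- (s + t)\<^sup>2 / (4 * w) + - (Z (- t) v)\<^sup>2 / (4 * w) = - s\<^sup>2 / (4 * v) + - t\<^sup>2 / (4 * (w - v))"
          unfolding minus_divide_left[symmetric] add_divide_distrib divide_divide_eq_left mult.commute[of _ 4] by linarith
        then show ?thesis unfolding E_def exp_add[symmetric] by (rule arg_cong)
      qed
      also have "s * t / (4 * pi) / (v * (w - v) * q) * (exp (- s\<^sup>2 / (4 * v)) * exp (- t\<^sup>2 / (4 * (w - v)))) = ?f v"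
      proof -
        have "sqrt pi * sqrt pi = pi" by simp
        then have "s * t / (4 * pi) / (v * (w - v) * q) = (s / (2 * sqrt pi) * v powr (- 3 / 2)) * (t / (2 * sqrt pi) * (w - v) powr (- 3 / 2))"
          unfolding powr_three_halves[OF v(1)] powr_three_halves[OF v(2)[THEN diff_gt_0_iff_gt[THEN iffD2]]] q_def real_sqrt_mult
          by simp
        then show ?thesis using v by (simp add: sub_density_def)
      qed
      finally show ?thesis .
    qed
    ultimately show ?thesis by simp
  qed
  have q_lim: "((\<lambda>v. sqrt (v * (w - v))) \<longlongrightarrow> 0) (at_right 0)" "((\<lambda>v. sqrt (v * (w - v))) \<longlongrightarrow> 0) (at_left w)"
    by (auto intro!: tendsto_eq_intros)
  have q_pos: "eventually (\<lambda>v. 0 < sqrt (v * (w - v))) (at_right 0)" "eventually (\<lambda>v. 0 < sqrt (v * (w - v))) (at_left w)"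
    using w by (auto simp: eventually_at_right_field eventually_at_left_field intro: exI[of _ w] exI[of _ 0])
  have Z0: "filterlim (Z c) at_top (at_right 0)" for c
    unfolding Z_def
  proof (rule LIM_at_top_divide)
    show "((\<lambda>v. s * (w - v) + c * v) \<longlongrightarrow> s * w) (at_right 0)" by (auto intro!: tendsto_eq_intros)
    show "0 < s * w" using s w by simp
  qed (rule q_lim(1) q_pos(1))+
  have Zw_pos: "filterlim (Z t) at_top (at_left w)"
    unfolding Z_def
  proof (rule LIM_at_top_divide)
    show "((\<lambda>v. s * (w - v) + t * v) \<longlongrightarrow> t * w) (at_left w)" by (auto intro!: tendsto_eq_intros)
    show "0 < t * w" using t w by simp
  qed (rule q_lim(2) q_pos(2))+
  have Zw_neg: "filterlim (Z (- t)) at_bot (at_left w)"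
  proof -
    have "filterlim (\<lambda>v. (t * v - s * (w - v)) / sqrt (v * (w - v))) at_top (at_left w)"
    proof (rule LIM_at_top_divide)
      show "((\<lambda>v. t * v - s * (w - v)) \<longlongrightarrow> t * w) (at_left w)" by (auto intro!: tendsto_eq_intros)
      show "0 < t * w" using t w by simp
    qed (rule q_lim(2) q_pos(2))+
    then have "filterlim (\<lambda>v. - ((t * v - s * (w - v)) / sqrt (v * (w - v)))) at_bot (at_left w)"
      by (simp add: filterlim_uminus_at_bot)
    moreover have "(\<lambda>v. - ((t * v - s * (w - v)) / sqrt (v * (w - v)))) = Z (- t)"
      unfolding Z_def minus_divide_left by (rule ext) simp
    ultimately show ?thesis by (simp only:)
  qed
  \<comment> \<open>\<open>Z t\<close> tends to +\<infinity> at both ends, so its term cancels in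
    the difference of the limits. \<open>Z (- t)\<close> runs from +\<infinity> to -\<infinity> and
    contributes the full Gaussian mass T.\<close>
  have FA: "(F \<longlongrightarrow> - K * (c1 * T + c2 * T)) (at_right 0)"
    unfolding F_def T_def by (intro tendsto_intros filterlim_compose[OF \<Phi>(2) Z0])
  have FB: "(F \<longlongrightarrow> - K * (c1 * 0 + c2 * T)) (at_left w)"
    unfolding F_def T_def by (intro tendsto_intros filterlim_compose[OF \<Phi>(3) Zw_neg] filterlim_compose[OF \<Phi>(2) Zw_pos])
  have f_nn: "0 \<le> ?f v" for v using s t by (intro mult_nonneg_nonneg sub_density_nonneg) auto
  have f_cont: "isCont ?f v" if "0 < v" "v < w" for v
  proof -
    have "isCont (\<lambda>v. (s / (2 * sqrt pi) * v powr (- 3 / 2) * exp (- s\<^sup>2 / (4 * v))) *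
        (t / (2 * sqrt pi) * (w - v) powr (- 3 / 2) * exp (- t\<^sup>2 / (4 * (w - v))))) v"
      using that by (intro continuous_intros) auto
    moreover have "eventually (\<lambda>v. ?f v = (s / (2 * sqrt pi) * v powr (- 3 / 2) * exp (- s\<^sup>2 / (4 * v))) *
        (t / (2 * sqrt pi) * (w - v) powr (- 3 / 2) * exp (- t\<^sup>2 / (4 * (w - v))))) (nhds v)"
      using that by (intro eventually_nhds_in_open[of "{0<..<w}", THEN eventually_mono]) (auto simp: sub_density_def)
    ultimately show ?thesis by (subst isCont_cong)
  qed
  \<comment> \<open>The primitive is differentiable only inside (0, w). As the integrand is
    nonnegative, the one-sided limits of the primitive yield both integrability and the
    value.\<close>
  have "set_integrable lborel (einterval (ereal 0) (ereal w)) ?f" and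
    val: "(LBINT v=ereal 0..ereal w. ?f v) = - K * (c1 * 0 + c2 * T) - (- K * (c1 * T + c2 * T))"
    using w F_deriv f_cont f_nn FA FB
    by (intro interval_integral_FTC_nonneg; auto simp: ereal_tendsto_simps1)+
  then have int: "integrable lborel ?f"
  proof -
    have eq: "indicator (einterval (ereal 0) (ereal w)) v *\<^sub>R ?f v = ?f v" for v
      by (auto simp: sub_density_def einterval_def split: split_indicator)
    show ?thesis using \<open>set_integrable lborel (einterval (ereal 0) (ereal w)) ?f\<close>
      unfolding set_integrable_def eq .
  qed
  have "(\<integral>v. ?f v \<partial>lborel) = (LBINT v=ereal 0..ereal w. ?f v)"
    using w by (auto simp: interval_integral_Ioo set_lebesgue_integral_def sub_density_def
        intro!: Bochner_Integration.integral_cong split: split_indicator)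
  also have "\<dots> = K * c1 * T" unfolding val by (simp add: algebra_simps)
  also have "\<dots> = sub_density (s + t) w"
  proof -
    have "K * c1 = (s + t) / (4 * pi * w\<^sup>2) * exp (- (s + t)\<^sup>2 / (4 * w))"
    proof -
      have "c1 = (s + t) / (2 * (s * t))" using s t by (simp add: c1_def field_simps)
      then show ?thesis unfolding K_def using s t by (simp add: mult_ac)
    qed
    then have "K * c1 * T = (s + t) * (2 * (sqrt pi * sqrt w)) / (4 * (sqrt pi * sqrt pi) * (w * (sqrt w * sqrt w))) * exp (- (s + t)\<^sup>2 / (4 * w))"
      using w by (simp add: T_def real_sqrt_mult power2_eq_square)
    also have "(s + t) * (2 * (sqrt pi * sqrt w)) / (4 * (sqrt pi * sqrt pi) * (w * (sqrt w * sqrt w))) = (s + t) / (2 * sqrt pi * (w * sqrt w))"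
      using w by (simp add: divide_simps del: real_sqrt_mult_self)
    finally show ?thesis unfolding sub_density_def powr_three_halves[OF w] using w by simp
  qed
  finally have "(\<integral>\<^sup>+v. ennreal (?f v) \<partial>lborel) = ennreal (sub_density (s + t) w)"
    using int f_nn by (subst nn_integral_eq_integral) auto
  then show ?thesis using s t by (simp add: ennreal_mult sub_density_nonneg)
qed

section \<open>Time derivatives of the stable density\<close>

lemma poly_exp_bound:
  fixes q :: "real poly"
  shows "0 < \<epsilon> \<Longrightarrow> \<exists>C>0. \<forall>z\<ge>0. \<bar>poly q z\<bar> \<le> C * exp (\<epsilon> * z)"
proof (induction q arbitrary: \<epsilon>)
  case 0
  then show ?case by (intro exI[of _ 1]) auto
next
  case (pCons a q)
  from pCons.IH[of "\<epsilon> / 2"] pCons.prems obtain C where C: "0 < C" "\<And>z. 0 \<le> z \<Longrightarrow> \<bar>poly q z\<bar> \<le> C * exp (\<epsilon> / 2 * z)" by auto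
  show ?case
  proof (intro exI[of _ "\<bar>a\<bar> + 2 / \<epsilon> * C"] conjI allI impI)
    show "0 < \<bar>a\<bar> + 2 / \<epsilon> * C" using C pCons.prems by (intro add_nonneg_pos) auto
    fix z :: real assume z: "0 \<le> z"
    have "\<epsilon> / 2 * z \<le> exp (\<epsilon> / 2 * z)" using exp_ge_add_one_self[of "\<epsilon> / 2 * z"] by linarith
    then have "z \<le> 2 / \<epsilon> * exp (\<epsilon> / 2 * z)" using pCons.prems by (simp add: field_simps)
    then have "z * \<bar>poly q z\<bar> \<le> (2 / \<epsilon> * exp (\<epsilon> / 2 * z)) * (C * exp (\<epsilon> / 2 * z))"
      using C z pCons.prems by (intro mult_mono) auto
    also have "\<dots> = 2 / \<epsilon> * C * exp (\<epsilon> * z)"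
      by (simp add: exp_add[symmetric] mult_ac)
    finally have 1: "z * \<bar>poly q z\<bar> \<le> 2 / \<epsilon> * C * exp (\<epsilon> * z)" .
    have "\<bar>a\<bar> * 1 \<le> \<bar>a\<bar> * exp (\<epsilon> * z)" using z pCons.prems by (intro mult_left_mono) auto
    moreover have "\<bar>poly (pCons a q) z\<bar> \<le> \<bar>a\<bar> + z * \<bar>poly q z\<bar>"
      using z by (simp add: abs_mult order_trans[OF abs_triangle_ineq])
    ultimately show "\<bar>poly (pCons a q) z\<bar> \<le> (\<bar>a\<bar> + 2 / \<epsilon> * C) * exp (\<epsilon> * z)"
      using 1 by (simp add: distrib_right)
  qed
qed

text \<open>The \<open>j\<close>-th derivative of \<open>sub_density t r\<close> in \<open>t\<close> is
  \<open>t\<^sup>-\<^sup>j\<close> times a polynomial in \<open>t\<^sup>2 / r\<close> times \<open>sub_density t r\<close>.\<close>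

fun sub_poly :: "nat \<Rightarrow> real poly" where
  "sub_poly 0 = 1"
| "sub_poly (Suc j) = smult (- real j) (sub_poly j) + [:0, 2:] * pderiv (sub_poly j) + [:1, - 1 / 2:] * sub_poly j"

definition sub_deriv :: "nat \<Rightarrow> real \<Rightarrow> real \<Rightarrow> real" where
  "sub_deriv j t r = poly (sub_poly j) (t\<^sup>2 / r) / t ^ j * sub_density t r"

lemma sub_deriv_0 [simp]: "sub_deriv 0 t r = sub_density t r"
  by (simp add: sub_deriv_def)

lemma sub_deriv_measurable [measurable (raw)]:
  assumes [measurable]: "f \<in> borel_measurable M" "g \<in> borel_measurable M"
  shows "(\<lambda>x. sub_deriv j (f x) (g x)) \<in> borel_measurable M"
proof -
  have [measurable]: "poly (sub_poly j) \<in> borel_measurable borel"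
    by (intro borel_measurable_continuous_onI continuous_intros)
  show ?thesis unfolding sub_deriv_def by measurable
qed

lemma sub_deriv_has_derivative:
  assumes t: "0 < t"
  shows "((\<lambda>t. sub_deriv j t r) has_real_derivative sub_deriv (Suc j) t r) (at t)"
proof (cases "0 < r")
  case True
  define z where "z = t\<^sup>2 / r"
  have "((\<lambda>t. t\<^sup>2 / r) has_real_derivative 2 * t / r) (at t)"
    using True by (auto intro!: derivative_eq_intros)
  from DERIV_chain2[OF poly_DERIV[of "sub_poly j"] this]
  have P: "((\<lambda>t. poly (sub_poly j) (t\<^sup>2 / r)) has_real_derivative poly (pderiv (sub_poly j)) z * (2 * t / r)) (at t)"
    by (simp add: z_def)
  have I: "((\<lambda>t. inverse (t ^ j)) has_real_derivative - real j / t * inverse (t ^ j)) (at t)"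
  proof (cases j)
    case (Suc i)
    have "((\<lambda>t. inverse (t ^ j)) has_real_derivative - (real j * t ^ (j - 1)) / (t ^ j * t ^ j)) (at t)"
      using t by (auto intro!: derivative_eq_intros simp: divide_inverse)
    moreover have "- (real j * t ^ (j - 1)) / (t ^ j * t ^ j) = - real j / t * inverse (t ^ j)"
      using t Suc by (simp add: field_simps)
    ultimately show ?thesis by simp
  qed simp
  have G: "((\<lambda>t. sub_density t r) has_real_derivative (1 - z / 2) / t * sub_density t r) (at t)"
  proof -
    define c where "c = r powr (- 3 / 2) / (2 * sqrt pi)"
    have eq: "sub_density u r = c * (u * exp (- u\<^sup>2 / (4 * r)))" for u
      using True by (simp add: sub_density_def c_def)
    have "((\<lambda>u. u * exp (- u\<^sup>2 / (4 * r))) has_real_derivative exp (- t\<^sup>2 / (4 * r)) * (1 - z / 2)) (at t)"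
      using True by (auto intro!: derivative_eq_intros simp: z_def field_simps power2_eq_square)
    then have "((\<lambda>u. c * (u * exp (- u\<^sup>2 / (4 * r)))) has_real_derivative c * (exp (- t\<^sup>2 / (4 * r)) * (1 - z / 2))) (at t)"
      by (rule DERIV_cmult)
    moreover have "c * (exp (- t\<^sup>2 / (4 * r)) * (1 - z / 2)) = (1 - z / 2) / t * (c * (t * exp (- t\<^sup>2 / (4 * r))))"
      using t by simp
    ultimately show ?thesis unfolding eq by (simp only:)
  qed
  have "((\<lambda>t. poly (sub_poly j) (t\<^sup>2 / r) * inverse (t ^ j) * sub_density t r) has_real_derivative
    (poly (pderiv (sub_poly j)) z * (2 * t / r) * inverse (t ^ j) + - real j / t * inverse (t ^ j) * poly (sub_poly j) (t\<^sup>2 / r)) * sub_density t r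
      + (1 - z / 2) / t * sub_density t r * (poly (sub_poly j) (t\<^sup>2 / r) * inverse (t ^ j))) (at t)"
    by (intro DERIV_mult P I G)
  moreover have "(poly (pderiv (sub_poly j)) z * (2 * t / r) * inverse (t ^ j) + - real j / t * inverse (t ^ j) * poly (sub_poly j) (t\<^sup>2 / r)) * sub_density t r
      + (1 - z / 2) / t * sub_density t r * (poly (sub_poly j) (t\<^sup>2 / r) * inverse (t ^ j)) = sub_deriv (Suc j) t r"
  proof -
    define P P' i g where "P = poly (sub_poly j) z" and "P' = poly (pderiv (sub_poly j)) z"
      and "i = inverse (t ^ j)" and "g = sub_density t r"
    have tz: "2 * t / r = 2 * z / t" using t by (simp add: z_def power2_eq_square)
    have "poly (sub_poly (Suc j)) z = - real j * P + 2 * z * P' + (1 - z / 2) * P"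
      by (simp add: P_def P'_def left_diff_distrib)
    moreover have "N / t ^ Suc j = N * (i / t)" for N
      using t by (simp add: i_def field_simps)
    ultimately have "sub_deriv (Suc j) t r = (- real j * P + 2 * z * P' + (1 - z / 2) * P) * (i / t) * g"
      unfolding sub_deriv_def z_def[symmetric] g_def by (simp only:)
    also have "\<dots> = (P' * (2 * z / t) * i + - real j / t * i * P) * g + (1 - z / 2) / t * g * (P * i)"
      using t by (simp add: field_simps)
    finally show ?thesis
      unfolding tz z_def[symmetric] P_def[symmetric] P'_def[symmetric] i_def[symmetric] g_def[symmetric] by simp
  qed
  moreover have "(\<lambda>t. sub_deriv j t r) = (\<lambda>t. poly (sub_poly j) (t\<^sup>2 / r) * inverse (t ^ j) * sub_density t r)"
    unfolding sub_deriv_def by (rule ext) (simp only: divide_inverse[of _ "_ ^ j"])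
  ultimately show ?thesis by (simp only:)
qed (simp add: sub_deriv_def[abs_def] sub_density_def[abs_def])

text \<open>Replacing t by t / 2 in \<open>sub_density\<close> frees exp (- 3/16 t^2 / r), because
  1/4 - 1/16 = 3/16, and costs the factor 2 from the linear term. The freed exponential absorbs the
  polynomial.\<close>

definition sub_const :: "nat \<Rightarrow> real" where
  "sub_const j = 2 * (SOME C. 0 < C \<and> (\<forall>z\<ge>0. \<bar>poly (sub_poly j) z\<bar> \<le> C * exp (3 / 16 * z)))"

lemma sub_const:
  shows "0 < sub_const j" "0 \<le> z \<Longrightarrow> 2 * \<bar>poly (sub_poly j) z\<bar> \<le> sub_const j * exp (3 / 16 * z)"
proof -
  have "\<exists>C>0. \<forall>z\<ge>0. \<bar>poly (sub_poly j) z\<bar> \<le> C * exp (3 / 16 * z)" by (rule poly_exp_bound) simp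
  then have "\<exists>C. 0 < C \<and> (\<forall>z\<ge>0. \<bar>poly (sub_poly j) z\<bar> \<le> C * exp (3 / 16 * z))" by blast
  from someI_ex[OF this]
  show "0 < sub_const j" "0 \<le> z \<Longrightarrow> 2 * \<bar>poly (sub_poly j) z\<bar> \<le> sub_const j * exp (3 / 16 * z)"
    by (auto simp: sub_const_def)
qed

lemma sub_density_half:
  assumes "0 < r"
  shows "sub_density t r = 2 * exp (- (3 / 16 * (t\<^sup>2 / r))) * sub_density (t / 2) r"
proof -
  have "- t\<^sup>2 / (4 * r) = - (3 / 16 * (t\<^sup>2 / r)) + - (t / 2)\<^sup>2 / (4 * r)"
    using assms by (simp add: field_simps)
  then have "exp (- t\<^sup>2 / (4 * r)) = exp (- (3 / 16 * (t\<^sup>2 / r))) * exp (- (t / 2)\<^sup>2 / (4 * r))"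
    unfolding exp_add[symmetric] by (rule arg_cong)
  then show ?thesis using assms by (simp add: sub_density_def)
qed

lemma sub_deriv_bound:
  assumes t: "0 < t"
  shows "\<bar>sub_deriv j t r\<bar> \<le> sub_const j / t ^ j * sub_density (t / 2) r"
proof (cases "0 < r")
  case True
  have nn: "0 \<le> sub_density (t / 2) r" using t by (intro sub_density_nonneg) simp
  have "\<bar>sub_deriv j t r\<bar> = (2 * \<bar>poly (sub_poly j) (t\<^sup>2 / r)\<bar>) * exp (- (3 / 16 * (t\<^sup>2 / r))) / t ^ j * sub_density (t / 2) r"
    unfolding sub_deriv_def sub_density_half[OF True, of t] using t nn by (simp add: abs_mult)
  also have "\<dots> \<le> (sub_const j * exp (3 / 16 * (t\<^sup>2 / r))) * exp (- (3 / 16 * (t\<^sup>2 / r))) / t ^ j * sub_density (t / 2) r"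
    using True t nn by (intro mult_right_mono divide_right_mono sub_const) auto
  also have "\<dots> = sub_const j / t ^ j * sub_density (t / 2) r"
    by (simp add: mult.assoc flip: exp_add)
  finally show ?thesis .
qed (simp add: sub_deriv_def sub_density_def)

section \<open>The Poisson-Hermite kernel\<close>

text \<open>Time enters through the stable density alone, so the j-th derivative falls on
  \<open>sub_deriv\<close> and leaves the Mehler kernel untouched.\<close>

definition ph_kernel :: "nat \<Rightarrow> real \<Rightarrow> 'a::euclidean_space \<Rightarrow> 'a \<Rightarrow> real" where
  "ph_kernel j t x y = (\<integral>r. sub_deriv j t r * mehler (exp (- r)) x y \<partial>lborel)"

lemma sub_mehler_nonneg:
  assumes "0 \<le> t"
  shows "0 \<le> sub_density t r * mehler (exp (- r)) x y"
proof (cases "0 < r")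
  case True
  then show ?thesis using assms by (intro mult_nonneg_nonneg sub_density_nonneg mehler_nonneg) auto
qed (simp add: sub_density_def)

text \<open>The singularity of the Mehler kernel at r = 0 is at most (1 + 1 / r)^d with d the
  dimension, a polynomial in t^2 / r for fixed t, and the spare exponential of the stable density
  absorbs it. Uniformity in y yields the boundedness of the kernel for fixed x.\<close>

lemma sub_mehler_bound:
  assumes t: "0 < t"
  shows "\<exists>B>0. \<forall>r (x :: 'a::euclidean_space) y. sub_density t r * mehler (exp (- r)) x y \<le> B * exp ((norm x)\<^sup>2) * sub_density (t / 2) r"
proof -
  let ?d = "DIM('a)"
  obtain C where C: "0 < C" "\<And>z. 0 \<le> z \<Longrightarrow> \<bar>poly ([:1, 1 / t\<^sup>2:] ^ ?d) z\<bar> \<le> C * exp (3 / 16 * z)"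
    using poly_exp_bound[of "3 / 16" "[:1, 1 / t\<^sup>2:] ^ ?d"] by auto
  show ?thesis
  proof (intro exI[of _ "2 * C"] conjI allI)
    show "0 < 2 * C" using C by simp
    fix r :: real and x y :: 'a
    show "sub_density t r * mehler (exp (- r)) x y \<le> 2 * C * exp ((norm x)\<^sup>2) * sub_density (t / 2) r"
    proof (cases "0 < r")
      case True
      define \<rho> where "\<rho> = exp (- r)"
      have \<rho>: "0 < \<rho>" "\<rho> < 1" using True by (auto simp: \<rho>_def)
      have nn: "0 \<le> sub_density (t / 2) r" using t by (intro sub_density_nonneg) simp
      \<comment> \<open>By exp (2 r) \<ge> 1 + 2 r, the quantity 1 - exp (-2 r) is at least 2 r / (1
        + 2 r), and this is at least (r / (1 + r))^2.\<close>
      have "1 / sqrt (1 - \<rho>\<^sup>2) \<le> 1 + 1 / r"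
      proof -
        have "\<rho>\<^sup>2 = 1 / exp (2 * r)"
        proof -
          have "exp (2 * r) = exp r * exp r" by (simp flip: exp_add)
          then show ?thesis by (simp add: \<rho>_def power2_eq_square exp_minus field_simps)
        qed
        also have "\<dots> \<le> 1 / (1 + 2 * r)"
          using True exp_ge_add_one_self[of "2 * r"] by (intro divide_left_mono) auto
        finally have "2 * r / (1 + 2 * r) \<le> 1 - \<rho>\<^sup>2" using True by (simp add: field_simps)
        moreover have "1 / (1 + 1 / r)\<^sup>2 \<le> 2 * r / (1 + 2 * r)"
        proof -
          have "0 \<le> 3 * (r * r) + 2 * r" using True by simp
          then have "r\<^sup>2 * (1 + 2 * r) \<le> 2 * r * (r + 1)\<^sup>2" by (simp add: power2_eq_square algebra_simps)
          moreover have "a / b \<le> c / d" if "0 < b" "0 < d" "a * d \<le> c * b" for a b c d :: real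
            using that by (simp add: field_simps)
          ultimately have "r\<^sup>2 / (r + 1)\<^sup>2 \<le> 2 * r / (1 + 2 * r)" using True by simp
          moreover have "1 + 1 / r = (r + 1) / r" using True by (simp add: field_simps)
          ultimately show ?thesis by (simp add: power_divide)
        qed
        ultimately have "sqrt (1 / (1 + 1 / r)\<^sup>2) \<le> sqrt (1 - \<rho>\<^sup>2)" by (intro real_sqrt_le_mono) linarith
        then have "1 / (1 + 1 / r) \<le> sqrt (1 - \<rho>\<^sup>2)" using True by (simp add: real_sqrt_divide)
        moreover have "0 < sqrt (1 - \<rho>\<^sup>2)" using \<rho> by (simp add: power_less_one_iff)
        moreover have "0 < 1 + 1 / r" using True by (simp add: add_pos_pos)
        ultimately show ?thesis by (simp add: divide_le_eq pos_divide_le_eq mult.commute)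
      qed
      then have "(1 / sqrt (1 - \<rho>\<^sup>2)) ^ ?d \<le> (1 + 1 / r) ^ ?d"
        using \<rho> by (intro power_mono) (auto simp: power_le_one)
      also have "\<dots> = poly ([:1, 1 / t\<^sup>2:] ^ ?d) (t\<^sup>2 / r)" using t by (simp add: poly_power)
      also have "\<dots> \<le> C * exp (3 / 16 * (t\<^sup>2 / r))"
        using C(2)[of "t\<^sup>2 / r"] True by simp
      finally have A: "(1 / sqrt (1 - \<rho>\<^sup>2)) ^ ?d \<le> C * exp (3 / 16 * (t\<^sup>2 / r))" .
      have "mehler \<rho> x y \<le> (1 / sqrt (1 - \<rho>\<^sup>2)) ^ ?d * exp ((norm x)\<^sup>2)"
        by (rule mehler_le[OF \<rho>])
      also have "\<dots> \<le> C * exp (3 / 16 * (t\<^sup>2 / r)) * exp ((norm x)\<^sup>2)"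
        by (intro mult_right_mono A) auto
      finally have "sub_density t r * mehler \<rho> x y \<le> sub_density t r * (C * exp (3 / 16 * (t\<^sup>2 / r)) * exp ((norm x)\<^sup>2))"
        using t by (intro mult_left_mono sub_density_nonneg) auto
      also have "\<dots> = 2 * C * exp ((norm x)\<^sup>2) * sub_density (t / 2) r * (exp (- (3 / 16 * (t\<^sup>2 / r))) * exp (3 / 16 * (t\<^sup>2 / r)))"
        unfolding sub_density_half[OF True, of t] by (simp only: mult_ac)
      also have "exp (- (3 / 16 * (t\<^sup>2 / r))) * exp (3 / 16 * (t\<^sup>2 / r)) = 1" by (simp flip: exp_add)
      finally show ?thesis by (simp add: \<rho>_def)
    qed (simp add: sub_density_def)
  qed
qed

lemma sub_density_integrable:
  assumes "0 < t"
  shows "integrable lborel (sub_density t)"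
  using sub_density_total[OF assms] sub_density_nonneg[of t] assms
  by (intro integrableI_nonneg) auto

lemma sub_mehler_integrable:
  fixes x y :: "'a::euclidean_space"
  assumes t: "0 < t"
  shows "integrable lborel (\<lambda>r. sub_density t r * mehler (exp (- r)) x y)"
proof -
  obtain B where B: "0 < B" "\<And>r (x :: 'a) y. sub_density t r * mehler (exp (- r)) x y \<le> B * exp ((norm x)\<^sup>2) * sub_density (t / 2) r"
    using sub_mehler_bound[OF t, where 'a='a] by auto
  show ?thesis
  proof (rule Bochner_Integration.integrable_bound)
    show "integrable lborel (\<lambda>r. B * exp ((norm x)\<^sup>2) * sub_density (t / 2) r)"
      using sub_density_integrable[of "t / 2"] t by simp
    show "AE r in lborel. norm (sub_density t r * mehler (exp (- r)) x y) \<le> norm (B * exp ((norm x)\<^sup>2) * sub_density (t / 2) r)"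
    proof (rule AE_I2)
      fix r
      have "norm (sub_density t r * mehler (exp (- r)) x y) = sub_density t r * mehler (exp (- r)) x y"
        using sub_mehler_nonneg[of t r x y] t by simp
      also have "\<dots> \<le> B * exp ((norm x)\<^sup>2) * sub_density (t / 2) r" by (rule B(2))
      also have "\<dots> \<le> norm (B * exp ((norm x)\<^sup>2) * sub_density (t / 2) r)" by simp
      finally show "norm (sub_density t r * mehler (exp (- r)) x y) \<le> norm (B * exp ((norm x)\<^sup>2) * sub_density (t / 2) r)" .
    qed
  qed measurable
qed

lemma sub_deriv_mehler_bound:
  assumes t: "0 < t"
  shows "\<bar>sub_deriv j t r * mehler (exp (- r)) x y\<bar> \<le> sub_const j / t ^ j * (sub_density (t / 2) r * mehler (exp (- r)) x y)"
proof (cases "0 < r")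
  case True
  then have nn: "0 \<le> mehler (exp (- r)) x y" by (intro mehler_nonneg) auto
  have "\<bar>sub_deriv j t r\<bar> * mehler (exp (- r)) x y \<le> sub_const j / t ^ j * sub_density (t / 2) r * mehler (exp (- r)) x y"
    by (intro mult_right_mono sub_deriv_bound t nn)
  then show ?thesis using nn by (simp only: abs_mult abs_of_nonneg mult.assoc)
qed (simp add: sub_deriv_def sub_density_def)

lemma sub_deriv_mehler_integrable:
  fixes x y :: "'a::euclidean_space"
  assumes t: "0 < t"
  shows "integrable lborel (\<lambda>r. sub_deriv j t r * mehler (exp (- r)) x y)"
proof (rule Bochner_Integration.integrable_bound)
  show "integrable lborel (\<lambda>r. sub_const j / t ^ j * (sub_density (t / 2) r * mehler (exp (- r)) x y))"
    using sub_mehler_integrable[of "t / 2" x y] t by simp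
  show "AE r in lborel. norm (sub_deriv j t r * mehler (exp (- r)) x y) \<le> norm (sub_const j / t ^ j * (sub_density (t / 2) r * mehler (exp (- r)) x y))"
    unfolding real_norm_def by (intro AE_I2 order_trans[OF sub_deriv_mehler_bound[OF t] abs_ge_self])
qed measurable

lemma ph_kernel_nn_integral:
  fixes x y :: "'a::euclidean_space"
  assumes t: "0 < t"
  shows "ennreal (ph_kernel 0 t x y) = (\<integral>\<^sup>+r. ennreal (sub_density t r) * ennreal (mehler (exp (- r)) x y) \<partial>lborel)"
proof -
  have "ennreal (ph_kernel 0 t x y) = (\<integral>\<^sup>+r. ennreal (sub_density t r * mehler (exp (- r)) x y) \<partial>lborel)"
    unfolding ph_kernel_def using sub_mehler_integrable[OF t, of x y] sub_mehler_nonneg[of t _ x y] t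
    by (subst nn_integral_eq_integral) auto
  also have "\<dots> = (\<integral>\<^sup>+r. ennreal (sub_density t r) * ennreal (mehler (exp (- r)) x y) \<partial>lborel)"
  proof (rule nn_integral_cong)
    fix r
    show "ennreal (sub_density t r * mehler (exp (- r)) x y) = ennreal (sub_density t r) * ennreal (mehler (exp (- r)) x y)"
    proof (cases "0 < r")
      case True
      then show ?thesis using t by (intro ennreal_mult sub_density_nonneg mehler_nonneg) auto
    qed (simp add: sub_density_def)
  qed
  finally show ?thesis .
qed

lemma ph_kernel_measurable [measurable (raw)]:
  assumes [measurable]: "f \<in> borel_measurable N" "g \<in> borel_measurable N" "h \<in> borel_measurable N"
  shows "(\<lambda>x. ph_kernel j (f x) (g x) (h x)) \<in> borel_measurable N"
  unfolding ph_kernel_def by measurable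

lemma sub_density_convolution_integral:
  assumes s: "0 < s" and t: "0 < t" and [measurable]: "H \<in> borel_measurable borel"
  shows "(\<integral>\<^sup>+r. \<integral>\<^sup>+r'. ennreal (sub_density s r) * (ennreal (sub_density t r') * H (r + r')) \<partial>lborel \<partial>lborel)
    = (\<integral>\<^sup>+w. ennreal (sub_density (s + t) w) * H w \<partial>lborel)"
proof -
  have "(\<integral>\<^sup>+r. \<integral>\<^sup>+r'. ennreal (sub_density s r) * (ennreal (sub_density t r') * H (r + r')) \<partial>lborel \<partial>lborel)
    = (\<integral>\<^sup>+r. \<integral>\<^sup>+w. ennreal (sub_density s r) * ennreal (sub_density t (w - r)) * H w \<partial>lborel \<partial>lborel)"
  proof (rule nn_integral_cong)
    fix r :: real
    show "(\<integral>\<^sup>+r'. ennreal (sub_density s r) * (ennreal (sub_density t r') * H (r + r')) \<partial>lborel)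
      = (\<integral>\<^sup>+w. ennreal (sub_density s r) * ennreal (sub_density t (w - r)) * H w \<partial>lborel)"
      by (subst (2) nn_integral_real_affine[of _ 1 r]) (auto simp: mult.assoc)
  qed
  also have "\<dots> = (\<integral>\<^sup>+w. \<integral>\<^sup>+r. ennreal (sub_density s r) * ennreal (sub_density t (w - r)) * H w \<partial>lborel \<partial>lborel)"
    by (rule lborel_pair.Fubini') measurable
  also have "\<dots> = (\<integral>\<^sup>+w. ennreal (sub_density (s + t) w) * H w \<partial>lborel)"
  proof (rule nn_integral_cong)
    fix w :: real
    have "(\<integral>\<^sup>+r. ennreal (sub_density s r) * ennreal (sub_density t (w - r)) \<partial>lborel) = ennreal (sub_density (s + t) w)"
    proof (cases "0 < w")
      case False
      have "(\<integral>\<^sup>+r. ennreal (sub_density s r) * ennreal (sub_density t (w - r)) \<partial>lborel) = (\<integral>\<^sup>+r. 0 \<partial>(lborel :: real measure))"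
        by (intro nn_integral_cong) (use False in \<open>auto simp: sub_density_def\<close>)
      then show ?thesis using False by (simp add: sub_density_def[of _ w])
    qed (rule sub_density_convolution[OF s t])
    then show "(\<integral>\<^sup>+r. ennreal (sub_density s r) * ennreal (sub_density t (w - r)) * H w \<partial>lborel) = ennreal (sub_density (s + t) w) * H w"
      by (subst nn_integral_multc) auto
  qed
  finally show ?thesis .
qed

interpretation gauss: prob_space "gaussian :: 'a::euclidean_space measure"
  by (rule prob_space_gaussian)

lemma ph_kernel_semigroup:
  fixes x y :: "'a::euclidean_space"
  assumes s: "0 < s" and t: "0 < t"
  shows "(\<integral>\<^sup>+z. ennreal (ph_kernel 0 s x z) * ennreal (ph_kernel 0 t z y) \<partial>gaussian) = ennreal (ph_kernel 0 (s + t) x y)"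
proof -
  interpret gl: pair_sigma_finite "gaussian :: 'a measure" "lborel :: real measure" by standard
  let ?K = "\<lambda>r. mehler (exp (- r)) :: 'a \<Rightarrow> 'a \<Rightarrow> real"
  let ?I = "\<lambda>z r r'. ennreal (sub_density s r) * ennreal (?K r x z) * (ennreal (sub_density t r') * ennreal (?K r' z y))"
  have "(\<integral>\<^sup>+z. ennreal (ph_kernel 0 s x z) * ennreal (ph_kernel 0 t z y) \<partial>gaussian)
    = (\<integral>\<^sup>+z. \<integral>\<^sup>+r. \<integral>\<^sup>+r'. ?I z r r' \<partial>lborel \<partial>lborel \<partial>gaussian)"
    unfolding ph_kernel_nn_integral[OF s] ph_kernel_nn_integral[OF t]
    by (subst nn_integral_multc[symmetric], measurable, subst nn_integral_cmult[symmetric], measurable)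
  also have "\<dots> = (\<integral>\<^sup>+r. \<integral>\<^sup>+z. \<integral>\<^sup>+r'. ?I z r r' \<partial>lborel \<partial>gaussian \<partial>lborel)"
    by (rule gl.Fubini'[symmetric]) measurable
  also have "\<dots> = (\<integral>\<^sup>+r. \<integral>\<^sup>+r'. \<integral>\<^sup>+z. ?I z r r' \<partial>gaussian \<partial>lborel \<partial>lborel)"
    by (intro nn_integral_cong gl.Fubini'[symmetric]) measurable
  also have "\<dots> = (\<integral>\<^sup>+r. \<integral>\<^sup>+r'. ennreal (sub_density s r) * (ennreal (sub_density t r') * ennreal (?K (r + r') x y)) \<partial>lborel \<partial>lborel)"
  proof (intro nn_integral_cong)
    fix r r' :: real
    show "(\<integral>\<^sup>+z. ?I z r r' \<partial>gaussian) = ennreal (sub_density s r) * (ennreal (sub_density t r') * ennreal (?K (r + r') x y))"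
    proof (cases "0 < r \<and> 0 < r'")
      case True
      have "(\<integral>\<^sup>+z. ?I z r r' \<partial>gaussian) = (\<integral>\<^sup>+z. ennreal (sub_density s r) * ennreal (sub_density t r') * (ennreal (?K r x z) * ennreal (?K r' z y)) \<partial>gaussian)"
        by (simp only: mult_ac)
      also have "\<dots> = ennreal (sub_density s r) * ennreal (sub_density t r') * (\<integral>\<^sup>+z. ennreal (?K r x z) * ennreal (?K r' z y) \<partial>gaussian)"
        by (rule nn_integral_cmult) measurable
      also have "(\<integral>\<^sup>+z. ennreal (?K r x z) * ennreal (?K r' z y) \<partial>gaussian) = ennreal (mehler (exp (- r) * exp (- r')) x y)"
        using True by (intro mehler_semigroup) auto
      also have "exp (- r) * exp (- r') = exp (- (r + r'))" by (simp flip: exp_add)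
      finally show ?thesis by (simp add: mult.assoc)
    qed (auto simp: sub_density_def)
  qed
  also have "\<dots> = (\<integral>\<^sup>+w. ennreal (sub_density (s + t) w) * ennreal (?K w x y) \<partial>lborel)"
    by (rule sub_density_convolution_integral[OF s t]) measurable
  also have "\<dots> = ennreal (ph_kernel 0 (s + t) x y)"
    using s t by (simp add: ph_kernel_nn_integral)
  finally show ?thesis .
qed

lemma ph_kernel_harnack:
  assumes s: "0 < s" "s \<le> t"
  shows "ph_kernel 0 t x y \<le> t / s * ph_kernel 0 s x y"
proof -
  have "ph_kernel 0 t x y \<le> (\<integral>r. t / s * (sub_density s r * mehler (exp (- r)) x y) \<partial>lborel)"
    unfolding ph_kernel_def sub_deriv_0
  proof (rule integral_mono)
    fix r :: real
    show "sub_density t r * mehler (exp (- r)) x y \<le> t / s * (sub_density s r * mehler (exp (- r)) x y)"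
    proof (cases "0 < r")
      case True
      then show ?thesis unfolding mult.assoc[symmetric] using s
        by (intro mult_right_mono sub_density_harnack mehler_nonneg) auto
    qed (simp add: sub_density_def)
  qed (use sub_mehler_integrable[of s x y] sub_mehler_integrable[of t x y] s in auto)
  then show ?thesis by (simp only: ph_kernel_def sub_deriv_0 integral_mult_right_zero)
qed

text \<open>Integration against the nonnegative Mehler kernel preserves the pointwise bounds of the
  stable density; total mass and semigroup law combine those of both factors by Tonelli's
  theorem.\<close>

interpretation ph: poisson_kernel "gaussian :: 'a::euclidean_space measure" ph_kernel sub_const
proof unfold_locales
  fix s t :: real and x y :: 'a and j :: nat
  show "space (gaussian :: 'a measure) = UNIV" by simp
  show "(\<lambda>z. ph_kernel j (fst z) (fst (snd z)) (snd (snd z) :: 'a)) \<in> borel_measurable (borel \<Otimes>\<^sub>M (gaussian \<Otimes>\<^sub>M gaussian))"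
    by measurable
  show "0 < sub_const j" by (rule sub_const)
  assume t: "0 < t"
  show "0 \<le> ph_kernel 0 t x y"
    unfolding ph_kernel_def sub_deriv_0 using t by (intro integral_nonneg_AE AE_I2 sub_mehler_nonneg) auto
  show "ph_kernel 0 t x y = ph_kernel 0 t y x"
    unfolding ph_kernel_def by (simp only: mehler_sym[of _ x y])
  show "(\<integral>\<^sup>+y. ennreal (ph_kernel 0 t x y) \<partial>gaussian) = 1"
  proof -
    interpret gl: pair_sigma_finite "gaussian :: 'a measure" "lborel :: real measure" by standard
    have "(\<integral>\<^sup>+y. ennreal (ph_kernel 0 t x y) \<partial>gaussian) = (\<integral>\<^sup>+y. \<integral>\<^sup>+r. ennreal (sub_density t r) * ennreal (mehler (exp (- r)) x y) \<partial>lborel \<partial>gaussian)"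
      by (simp add: ph_kernel_nn_integral t)
    also have "\<dots> = (\<integral>\<^sup>+r. \<integral>\<^sup>+y. ennreal (sub_density t r) * ennreal (mehler (exp (- r)) x y) \<partial>gaussian \<partial>lborel)"
      by (rule gl.Fubini'[symmetric]) measurable
    also have "\<dots> = (\<integral>\<^sup>+r. ennreal (sub_density t r) \<partial>lborel)"
    proof (rule nn_integral_cong)
      fix r :: real
      show "(\<integral>\<^sup>+y. ennreal (sub_density t r) * ennreal (mehler (exp (- r)) x y) \<partial>gaussian) = ennreal (sub_density t r)"
      proof (cases "0 < r")
        case True
        then show ?thesis by (subst nn_integral_cmult) (auto simp: mehler_total)
      qed (simp add: sub_density_def)
    qed
    finally show ?thesis by (simp add: sub_density_total t)
  qed
  show "\<bar>ph_kernel j t x y\<bar> \<le> sub_const j / t ^ j * ph_kernel 0 (t / 2) x y"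
  proof -
    have "\<bar>ph_kernel j t x y\<bar> \<le> (\<integral>r. \<bar>sub_deriv j t r * mehler (exp (- r)) x y\<bar> \<partial>lborel)"
      unfolding ph_kernel_def by (rule integral_abs_bound)
    also have "\<dots> \<le> (\<integral>r. sub_const j / t ^ j * (sub_density (t / 2) r * mehler (exp (- r)) x y) \<partial>lborel)"
      using sub_mehler_integrable[of "t / 2" x y] sub_deriv_mehler_integrable[OF t, of j x y] t
      by (intro integral_mono sub_deriv_mehler_bound) auto
    also have "\<dots> = sub_const j / t ^ j * ph_kernel 0 (t / 2) x y"
      unfolding ph_kernel_def sub_deriv_0 by (rule integral_mult_right_zero)
    finally show ?thesis .
  qed
  show "\<exists>B. \<forall>y. ph_kernel 0 t x y \<le> B"
  proof -
    obtain B where B: "0 < B" "\<And>r (x :: 'a) y. sub_density t r * mehler (exp (- r)) x y \<le> B * exp ((norm x)\<^sup>2) * sub_density (t / 2) r"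
      using sub_mehler_bound[OF t, where 'a='a] by auto
    have "ph_kernel 0 t x y \<le> (\<integral>r. B * exp ((norm x)\<^sup>2) * sub_density (t / 2) r \<partial>lborel)" for y
      unfolding ph_kernel_def sub_deriv_0
      using sub_mehler_integrable[OF t, of x y] sub_density_integrable[of "t / 2"] t
      by (intro integral_mono B) auto
    then show ?thesis by auto
  qed
  show "((\<lambda>t. ph_kernel j t x y) has_real_derivative ph_kernel (Suc j) t x y) (at t)"
  proof -
    define a where "a = t / 2"
    have a: "0 < a" "a < t" "t < 2 * t" using t by (auto simp: a_def)
    show ?thesis
      unfolding ph_kernel_def
    proof (rule has_real_derivative_integral[where a=a and b="2 * t"
          and w="\<lambda>r. sub_const (Suc j) / a ^ Suc j * (2 * t / a) * (sub_density (a / 2) r * mehler (exp (- r)) x y)"])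
      fix u r assume u: "a < u" "u < 2 * t"
      then have u0: "0 < u" using a by simp
      from DERIV_mult[OF sub_deriv_has_derivative[OF this, of j r] DERIV_const[of "mehler (exp (- r)) x y"]]
      show "((\<lambda>u. sub_deriv j u r * mehler (exp (- r)) x y) has_real_derivative sub_deriv (Suc j) u r * mehler (exp (- r)) x y) (at u)"
        by simp
      have nn: "0 \<le> sub_density (a / 2) r * mehler (exp (- r)) x y" using a by (intro sub_mehler_nonneg) simp
      have "\<bar>sub_deriv (Suc j) u r * mehler (exp (- r)) x y\<bar> \<le> sub_const (Suc j) / u ^ Suc j * (sub_density (u / 2) r * mehler (exp (- r)) x y)"
        by (rule sub_deriv_mehler_bound[OF u0])
      also have "\<dots> \<le> sub_const (Suc j) / a ^ Suc j * (2 * t / a * (sub_density (a / 2) r * mehler (exp (- r)) x y))"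
      proof (rule mult_mono)
        show "sub_const (Suc j) / u ^ Suc j \<le> sub_const (Suc j) / a ^ Suc j"
          using u a sub_const(1)[of "Suc j"] by (intro divide_left_mono power_mono) auto
        show "sub_density (u / 2) r * mehler (exp (- r)) x y \<le> 2 * t / a * (sub_density (a / 2) r * mehler (exp (- r)) x y)"
        proof (cases "0 < r")
          case True
          have "sub_density (u / 2) r \<le> (u / 2) / (a / 2) * sub_density (a / 2) r"
            using u a by (intro sub_density_harnack) auto
          also have "\<dots> \<le> 2 * t / a * sub_density (a / 2) r"
            using u a by (intro mult_right_mono sub_density_nonneg) (auto simp: divide_right_mono)
          finally show ?thesis
            unfolding mult.assoc[symmetric] using True by (intro mult_right_mono mehler_nonneg) auto
        qed (simp add: sub_density_def)
      qed (use a u sub_const(1)[of "Suc j"] in \<open>auto intro!: sub_mehler_nonneg\<close>)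
      finally show "\<bar>sub_deriv (Suc j) u r * mehler (exp (- r)) x y\<bar> \<le> sub_const (Suc j) / a ^ Suc j * (2 * t / a) * (sub_density (a / 2) r * mehler (exp (- r)) x y)"
        by (simp only: mult.assoc)
    qed (use a in \<open>auto intro!: sub_deriv_mehler_integrable sub_mehler_integrable integrable_mult_right simp del: power_Suc\<close>)
  qed
  assume s: "0 < s"
  show "(\<integral>\<^sup>+z. ennreal (ph_kernel 0 s x z) * ennreal (ph_kernel 0 t z y) \<partial>gaussian) = ennreal (ph_kernel 0 (s + t) x y)"
    by (rule ph_kernel_semigroup[OF s t])
next
  fix s t :: real and x y :: 'a
  assume "0 < s" "s \<le> t"
  then show "ph_kernel 0 t x y \<le> t / s * ph_kernel 0 s x y" by (rule ph_kernel_harnack)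
qed

section \<open>The Poisson-Hermite semigroup\<close>

lemma ou_semigroup_eq:
  assumes "0 < r" and [measurable]: "f \<in> borel_measurable borel"
  shows "ou_semigroup r f x = (\<integral>y. mehler (exp (- r)) x y * f y \<partial>gaussian)"
proof -
  have "exp (- 2 * r) = (exp (- r))\<^sup>2" by (simp add: power2_eq_square flip: exp_add)
  then show ?thesis
    unfolding ou_semigroup_def using assms by (simp only:) (intro integral_mehler, auto)
qed

lemma ou_semigroup_measurable [measurable (raw)]:
  assumes [measurable]: "f \<in> borel_measurable borel" "g \<in> borel_measurable M" "h \<in> borel_measurable M"
  shows "(\<lambda>x. ou_semigroup (g x) f (h x)) \<in> borel_measurable M"
  unfolding ou_semigroup_def by measurable

text \<open>Fubini's theorem in y and r; absolute convergence at every x comes from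
  \<open>sub_mehler_bound\<close>, which is uniform in y.\<close>

lemma poisson_hermite_eq:
  fixes f :: "'a::euclidean_space \<Rightarrow> real"
  assumes t: "0 < t" and f: "integrable gaussian f"
  shows "poisson_hermite t f x = ph.Q 0 t f x"
proof -
  have [measurable]: "f \<in> borel_measurable borel" using f by auto
  interpret gl: pair_sigma_finite "gaussian :: 'a measure" "lborel :: real measure" by standard
  let ?h = "\<lambda>y r. sub_density t r * mehler (exp (- r)) x y * f y"
  obtain B where B: "0 < B" "\<And>r (x :: 'a) y. sub_density t r * mehler (exp (- r)) x y \<le> B * exp ((norm x)\<^sup>2) * sub_density (t / 2) r"
    using sub_mehler_bound[OF t, where 'a='a] by auto
  have int: "integrable (gaussian \<Otimes>\<^sub>M lborel) (\<lambda>(y, r). ?h y r)"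
  proof (rule integrableI_bounded)
    have "(\<integral>\<^sup>+z. ennreal (norm (case z of (y, r) \<Rightarrow> ?h y r)) \<partial>(gaussian \<Otimes>\<^sub>M lborel))
      = (\<integral>\<^sup>+y. \<integral>\<^sup>+r. ennreal (norm (?h y r)) \<partial>lborel \<partial>gaussian)"
      by (subst lborel.nn_integral_fst[symmetric]) auto
    also have "\<dots> \<le> (\<integral>\<^sup>+y. \<integral>\<^sup>+r. ennreal (B * exp ((norm x)\<^sup>2) * \<bar>f y\<bar>) * ennreal (sub_density (t / 2) r) \<partial>lborel \<partial>gaussian)"
    proof (intro nn_integral_mono)
      fix y r
      have "norm (?h y r) = (sub_density t r * mehler (exp (- r)) x y) * \<bar>f y\<bar>"
        by (simp only: real_norm_def abs_mult[of "sub_density t r * mehler (exp (- r)) x y"] abs_of_nonneg[OF sub_mehler_nonneg[OF less_imp_le[OF t]]])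
      also have "\<dots> \<le> B * exp ((norm x)\<^sup>2) * sub_density (t / 2) r * \<bar>f y\<bar>"
        by (intro mult_right_mono B) auto
      finally have "norm (?h y r) \<le> (B * exp ((norm x)\<^sup>2) * \<bar>f y\<bar>) * sub_density (t / 2) r" by (simp add: mult_ac)
      then show "ennreal (norm (?h y r)) \<le> ennreal (B * exp ((norm x)\<^sup>2) * \<bar>f y\<bar>) * ennreal (sub_density (t / 2) r)"
        using B(1) t by (subst ennreal_mult[symmetric]) (auto intro: ennreal_leI sub_density_nonneg)
    qed
    also have "\<dots> = (\<integral>\<^sup>+y. ennreal (B * exp ((norm x)\<^sup>2) * \<bar>f y\<bar>) \<partial>gaussian)"
      using sub_density_total[of "t / 2"] t by (simp add: nn_integral_cmult)
    also have "\<dots> = ennreal (B * exp ((norm x)\<^sup>2)) * (\<integral>\<^sup>+y. ennreal \<bar>f y\<bar> \<partial>gaussian)"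
      using B(1) by (simp add: ennreal_mult nn_integral_cmult mult.assoc)
    also have "\<dots> < \<infinity>" using f by (simp add: integrable_iff_bounded ennreal_mult_less_top)
    finally show "(\<integral>\<^sup>+z. ennreal (norm (case z of (y, r) \<Rightarrow> ?h y r)) \<partial>(gaussian \<Otimes>\<^sub>M lborel)) < \<infinity>" .
  qed measurable
  have inner: "(\<integral>y. ?h y r \<partial>gaussian) = sub_density t r * ou_semigroup r f x" for r
  proof (cases "0 < r")
    case True
    have "(\<integral>y. ?h y r \<partial>gaussian) = sub_density t r * (\<integral>y. mehler (exp (- r)) x y * f y \<partial>gaussian)"
      unfolding mult.assoc by (rule integral_mult_right_zero)
    then show ?thesis using True by (simp add: ou_semigroup_eq)
  qed (simp add: sub_density_def)
  have int': "integrable lborel (\<lambda>r. sub_density t r * ou_semigroup r f x)"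
    using gl.integrable_snd[OF int] by (simp only: inner)
  have "poisson_hermite t f x = (\<integral>r. sub_density t r * ou_semigroup r f x \<partial>lborel)"
    using subordination_substitution(2)[OF t _ int'] t by (simp add: poisson_hermite_def)
  also have "\<dots> = (\<integral>r. \<integral>y. ?h y r \<partial>gaussian \<partial>lborel)" by (simp only: inner)
  also have "\<dots> = (\<integral>y. \<integral>r. ?h y r \<partial>lborel \<partial>gaussian)"
    by (rule gl.Fubini_integral[OF int])
  also have "\<dots> = ph.Q 0 t f x"
    unfolding ph.Q_def ph_kernel_def sub_deriv_0 by simp
  finally show ?thesis .
qed

section \<open>Convergence of the semigroup at time 0\<close>

lemma gaussian_AE_lborel:
  assumes "AE x in lborel. P x"
  shows "AE x in gaussian. P x"
  unfolding gaussian_eq by (subst AE_density) (use assms in auto)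

text \<open>A measurable function is an almost everywhere limit of continuous ones. Truncating f and
  these at the same height n keeps the convergence and gives the constant majorant 2 n.\<close>

lemma gaussian_dense_continuous:
  fixes f :: "'a::euclidean_space \<Rightarrow> real"
  assumes f: "integrable gaussian f" and e: "0 < e"
  shows "\<exists>\<phi> K. continuous_on UNIV \<phi> \<and> (\<forall>x. \<bar>\<phi> x\<bar> \<le> K) \<and> (\<integral>x. \<bar>f x - \<phi> x\<bar> \<partial>gaussian) < e"
proof -
  have [measurable]: "f \<in> borel_measurable borel" using f by auto
  define tr where "tr n y = max (- real n) (min (real n) y)" for n y
  have tr_le: "\<bar>tr n y\<bar> \<le> real n" "\<bar>y - tr n y\<bar> \<le> \<bar>y\<bar>" for n y
    by (auto simp: tr_def)
  have tr_meas [measurable]: "tr n \<in> borel_measurable borel" for n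
    unfolding tr_def[abs_def] by measurable
  have "(\<lambda>n. \<integral>x. \<bar>f x - tr n (f x)\<bar> \<partial>gaussian) \<longlonglongrightarrow> (\<integral>x. 0 \<partial>(gaussian :: 'a measure))"
  proof (rule integral_dominated_convergence[where w="\<lambda>x. \<bar>f x\<bar>"])
    show "AE x in gaussian. (\<lambda>n. \<bar>f x - tr n (f x)\<bar>) \<longlonglongrightarrow> 0"
    proof (rule AE_I2)
      fix x
      obtain N :: nat where N: "\<bar>f x\<bar> \<le> real N" using real_arch_simple by blast
      have "eventually (\<lambda>n. \<bar>f x - tr n (f x)\<bar> = 0) sequentially"
        using eventually_ge_at_top[of N]
        by eventually_elim (use N in \<open>auto simp: tr_def\<close>)
      then show "(\<lambda>n. \<bar>f x - tr n (f x)\<bar>) \<longlonglongrightarrow> 0" by (rule tendsto_eventually)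
    qed
  qed (use f tr_le in auto)
  then have "eventually (\<lambda>n. (\<integral>x. \<bar>f x - tr n (f x)\<bar> \<partial>gaussian) < e / 2) sequentially"
    using e by (intro order_tendstoD(2)) auto
  then obtain n where n: "(\<integral>x. \<bar>f x - tr n (f x)\<bar> \<partial>gaussian) < e / 2"
    by (meson eventually_happens' sequentially_bot)
  have "f \<in> borel_measurable lebesgue" by (rule measurable_completion) auto
  then have "f measurable_on UNIV"
    by (simp add: measurable_on_iff_borel_measurable lebesgue_on_UNIV_eq)
  then obtain N g where Ng: "negligible N" "\<And>i. continuous_on UNIV (g i :: 'a \<Rightarrow> real)" "\<And>x. x \<notin> N \<Longrightarrow> (\<lambda>i. g i x) \<longlonglongrightarrow> f x"
    unfolding measurable_on_def by auto
  have g_cont: "continuous_on UNIV (\<lambda>x. tr n (g i x))" for i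
    unfolding tr_def by (intro continuous_intros Ng)
  then have [measurable]: "(\<lambda>x. tr n (g i x)) \<in> borel_measurable borel" for i
    by (rule borel_measurable_continuous_onI)
  have "AE x in lebesgue. x \<notin> N"
    using Ng(1) by (intro AE_not_in) (simp add: negligible_iff_null_sets)
  then have "AE x in lborel. x \<notin> N" by (simp add: AE_completion_iff)
  then have N_AE: "AE x in gaussian. x \<notin> N" by (rule gaussian_AE_lborel)
  have "(\<lambda>i. \<integral>x. \<bar>tr n (f x) - tr n (g i x)\<bar> \<partial>gaussian) \<longlonglongrightarrow> (\<integral>x. 0 \<partial>(gaussian :: 'a measure))"
  proof (rule integral_dominated_convergence[where w="\<lambda>_. 2 * real n"])
    show "AE x in gaussian. (\<lambda>i. \<bar>tr n (f x) - tr n (g i x)\<bar>) \<longlonglongrightarrow> 0"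
      using N_AE
    proof eventually_elim
      case (elim x)
      have "(\<lambda>i. \<bar>tr n (f x) - tr n (g i x)\<bar>) \<longlonglongrightarrow> \<bar>tr n (f x) - tr n (f x)\<bar>"
        unfolding tr_def by (intro tendsto_intros Ng elim)
      then show ?case by simp
    qed
    show "AE x in gaussian. norm \<bar>tr n (f x) - tr n (g i x)\<bar> \<le> 2 * real n" for i
    proof (rule AE_I2)
      fix x
      have "\<bar>tr n (f x)\<bar> \<le> real n" "\<bar>tr n (g i x)\<bar> \<le> real n" by (rule tr_le)+
      then show "norm \<bar>tr n (f x) - tr n (g i x)\<bar> \<le> 2 * real n" unfolding real_norm_def by linarith
    qed
  qed (auto simp: gauss.emeasure_space_1)
  then have "eventually (\<lambda>i. (\<integral>x. \<bar>tr n (f x) - tr n (g i x)\<bar> \<partial>gaussian) < e / 2) sequentially"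
    using e by (intro order_tendstoD(2)) auto
  then obtain i where i: "(\<integral>x. \<bar>tr n (f x) - tr n (g i x)\<bar> \<partial>gaussian) < e / 2"
    by (meson eventually_happens' sequentially_bot)
  have int_tr: "integrable gaussian (\<lambda>x. tr n (h x))" if "(\<lambda>x. tr n (h x)) \<in> borel_measurable borel" for h :: "'a \<Rightarrow> real"
    by (rule gauss.integrable_const_bound[where B="real n"]) (use that tr_le in auto)
  have ints: "integrable gaussian (\<lambda>x. tr n (f x))" "integrable gaussian (\<lambda>x. tr n (g i x))"
    by (rule int_tr; measurable)+
  have "(\<integral>x. \<bar>f x - tr n (g i x)\<bar> \<partial>gaussian) \<le> (\<integral>x. \<bar>f x - tr n (f x)\<bar> + \<bar>tr n (f x) - tr n (g i x)\<bar> \<partial>gaussian)"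
    using f ints by (intro integral_mono Bochner_Integration.integrable_add integrable_abs Bochner_Integration.integrable_diff) auto
  also have "\<dots> = (\<integral>x. \<bar>f x - tr n (f x)\<bar> \<partial>gaussian) + (\<integral>x. \<bar>tr n (f x) - tr n (g i x)\<bar> \<partial>gaussian)"
    using f ints by (intro Bochner_Integration.integral_add integrable_abs Bochner_Integration.integrable_diff)
  also have "\<dots> < e" using n i by simp
  finally show ?thesis using g_cont tr_le(1) by blast
qed

text \<open>Dominated convergence in the original variables: the time parameter sits inside the
  argument of \<phi>, while the measure in u and the weight exp (-u) / sqrt u stay fixed.\<close>

lemma poisson_hermite_continuous:
  fixes \<phi> :: "'a::euclidean_space \<Rightarrow> real"
  assumes \<phi>: "continuous_on UNIV \<phi>" "\<And>x. \<bar>\<phi> x\<bar> \<le> K" and X: "\<And>i. 0 < (X :: nat \<Rightarrow> real) i" "X \<longlonglongrightarrow> 0"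
  shows "(\<lambda>i. poisson_hermite (X i) \<phi> x) \<longlonglongrightarrow> \<phi> x"
proof -
  have [measurable]: "\<phi> \<in> borel_measurable borel" using \<phi>(1) by (rule borel_measurable_continuous_onI)
  have K: "0 \<le> K" using \<phi>(2)[of 0] by linarith
  have ou_le: "\<bar>ou_semigroup r \<phi> x\<bar> \<le> K" for r
  proof -
    have "\<bar>ou_semigroup r \<phi> x\<bar> \<le> (\<integral>u. K \<partial>(gaussian :: 'a measure))"
      unfolding ou_semigroup_def
      by (rule order_trans[OF integral_abs_bound], rule integral_mono')
        (use \<phi>(2) K in \<open>auto simp: gauss.emeasure_space_1\<close>)
    then show ?thesis using gauss.prob_space[where 'a='a] by simp
  qed
  have ou_lim: "(\<lambda>i. ou_semigroup (r i) \<phi> x) \<longlonglongrightarrow> \<phi> x" if r: "\<And>i. 0 \<le> r i" "r \<longlonglongrightarrow> 0" for r :: "nat \<Rightarrow> real"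
  proof -
    have "(\<lambda>i. ou_semigroup (r i) \<phi> x) \<longlonglongrightarrow> (\<integral>u. \<phi> x \<partial>(gaussian :: 'a measure))"
      unfolding ou_semigroup_def
    proof (rule integral_dominated_convergence[where w="\<lambda>_. K"])
      show "AE u in gaussian. (\<lambda>i. \<phi> (sqrt (1 - exp (- 2 * r i)) *\<^sub>R u + exp (- r i) *\<^sub>R x)) \<longlonglongrightarrow> \<phi> x"
      proof (rule AE_I2)
        fix u :: 'a
        have "(\<lambda>i. sqrt (1 - exp (- 2 * r i)) *\<^sub>R u + exp (- r i) *\<^sub>R x) \<longlonglongrightarrow> sqrt (1 - exp (- 2 * 0)) *\<^sub>R u + exp (- 0) *\<^sub>R x"
          by (intro tendsto_intros r)
        then have "(\<lambda>i. sqrt (1 - exp (- 2 * r i)) *\<^sub>R u + exp (- r i) *\<^sub>R x) \<longlonglongrightarrow> x" by simp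
        then show "(\<lambda>i. \<phi> (sqrt (1 - exp (- 2 * r i)) *\<^sub>R u + exp (- r i) *\<^sub>R x)) \<longlonglongrightarrow> \<phi> x"
          by (rule continuous_on_tendsto_compose[OF \<phi>(1)]) auto
      qed
    qed (use \<phi>(2) in \<open>auto simp: gauss.emeasure_space_1\<close>)
    then show ?thesis using gauss.prob_space[where 'a='a] by simp
  qed
  let ?e = "\<lambda>u::real. indicator {0<..} u *\<^sub>R (exp (- u) / sqrt u)"
  have si: "set_integrable lborel {0<..} (\<lambda>u::real. exp (- u) / sqrt u)"
    using gamma_half_integral
    by (subst absolutely_integrable_iff_lborel[symmetric]) (auto intro!: nonnegative_absolutely_integrable_1)
  then have e_int: "integrable lborel ?e" by (simp add: set_integrable_def)
  have e_total: "(\<integral>u. ?e u \<partial>lborel) = sqrt pi"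
    using set_borel_integral_eq_integral(2)[OF si] gamma_half_integral
    by (simp add: integral_unique set_lebesgue_integral_def)
  have "(\<lambda>i. LINT u:{0<..}|lborel. exp (- u) / sqrt u * ou_semigroup ((X i)\<^sup>2 / (4 * u)) \<phi> x) \<longlonglongrightarrow> (\<integral>u. ?e u * \<phi> x \<partial>lborel)"
    unfolding set_lebesgue_integral_def
  proof (rule integral_dominated_convergence[where w="\<lambda>u. ?e u * K"])
    show "AE u in lborel. (\<lambda>i. indicator {0<..} u *\<^sub>R (exp (- u) / sqrt u * ou_semigroup ((X i)\<^sup>2 / (4 * u)) \<phi> x)) \<longlonglongrightarrow> ?e u * \<phi> x"
    proof (rule AE_I2)
      fix u :: real
      show "(\<lambda>i. indicator {0<..} u *\<^sub>R (exp (- u) / sqrt u * ou_semigroup ((X i)\<^sup>2 / (4 * u)) \<phi> x)) \<longlonglongrightarrow> ?e u * \<phi> x"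
      proof (cases "0 < u")
        case True
        have "(\<lambda>i. (X i)\<^sup>2 / (4 * u)) \<longlonglongrightarrow> 0\<^sup>2 / (4 * u)"
          using True by (intro tendsto_intros X) auto
        then have "(\<lambda>i. (X i)\<^sup>2 / (4 * u)) \<longlonglongrightarrow> 0" by simp
        then have "(\<lambda>i. ou_semigroup ((X i)\<^sup>2 / (4 * u)) \<phi> x) \<longlonglongrightarrow> \<phi> x"
          using True by (intro ou_lim) auto
        then have "(\<lambda>i. exp (- u) / sqrt u * ou_semigroup ((X i)\<^sup>2 / (4 * u)) \<phi> x) \<longlonglongrightarrow> exp (- u) / sqrt u * \<phi> x"
          by (intro tendsto_intros)
        then show ?thesis using True by simp
      qed simp
    qed
    show "AE u in lborel. norm (indicator {0<..} u *\<^sub>R (exp (- u) / sqrt u * ou_semigroup ((X i)\<^sup>2 / (4 * u)) \<phi> x)) \<le> ?e u * K" for i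
    proof (rule AE_I2)
      fix u :: real
      show "norm (indicator {0<..} u *\<^sub>R (exp (- u) / sqrt u * ou_semigroup ((X i)\<^sup>2 / (4 * u)) \<phi> x)) \<le> ?e u * K"
      proof (cases "0 < u")
        case True
        then have "exp (- u) / sqrt u * \<bar>ou_semigroup ((X i)\<^sup>2 / (4 * u)) \<phi> x\<bar> \<le> exp (- u) / sqrt u * K"
          by (intro mult_left_mono ou_le) auto
        then show ?thesis using True by (simp add: abs_mult)
      qed simp
    qed
    show "integrable lborel (\<lambda>u. ?e u * K)" using e_int by (rule integrable_mult_left)
  qed measurable
  then have "(\<lambda>i. 1 / sqrt pi * (LINT u:{0<..}|lborel. exp (- u) / sqrt u * ou_semigroup ((X i)\<^sup>2 / (4 * u)) \<phi> x))
    \<longlonglongrightarrow> 1 / sqrt pi * (\<integral>u. ?e u * \<phi> x \<partial>lborel)"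
    by (intro tendsto_intros)
  moreover have "(\<integral>u. ?e u * \<phi> x \<partial>lborel) = sqrt pi * \<phi> x"
    by (simp only: integral_mult_left_zero e_total)
  moreover have "poisson_hermite (X i) \<phi> x = 1 / sqrt pi * (LINT u:{0<..}|lborel. exp (- u) / sqrt u * ou_semigroup ((X i)\<^sup>2 / (4 * u)) \<phi> x)" for i
    using X(1)[of i] by (simp add: poisson_hermite_def)
  ultimately show ?thesis by simp
qed

text \<open>P_t is a contraction of L^1, and on bounded continuous functions it converges pointwise
  and boundedly. The usual three-term estimate gives convergence in L^1 for every f, and a
  subsequence converges almost everywhere.\<close>

lemma gaussian_approx_identity:
  fixes f :: "'a::euclidean_space \<Rightarrow> real"
  assumes f: "integrable gaussian f"
  shows "ph.approx_identity f"
proof -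
  have [measurable]: "f \<in> borel_measurable borel" using f by auto
  define X :: "nat \<Rightarrow> real" where "X i = 1 / real (Suc i)" for i
  have X: "0 < X i" "X \<longlonglongrightarrow> 0" for i
    using lim_inverse_n' LIMSEQ_Suc[OF lim_1_over_n] by (auto simp: X_def[abs_def])
  have Qf: "integrable gaussian (\<lambda>x. ph.Q 0 (X i) f x)" for i
    using ph.Q_integrable[OF f X(1)] by simp
  have contr: "(\<integral>x. \<bar>ph.Q 0 (X i) h x\<bar> \<partial>gaussian) \<le> (\<integral>x. \<bar>h x\<bar> \<partial>gaussian)" if h: "integrable gaussian h" for h :: "'a \<Rightarrow> real" and i
  proof -
    have ah: "integrable gaussian (\<lambda>y. \<bar>h y\<bar>)" using h by auto
    have "(\<integral>x. \<bar>ph.Q 0 (X i) h x\<bar> \<partial>gaussian) \<le> (\<integral>x. ph.Q 0 (X i) (\<lambda>y. \<bar>h y\<bar>) x \<partial>gaussian)"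
    proof (rule integral_mono)
      fix x
      have "\<bar>ph.Q 0 (X i) h x\<bar> \<le> (\<integral>y. \<bar>ph_kernel 0 (X i) x y * h y\<bar> \<partial>gaussian)"
        unfolding ph.Q_def by (rule integral_abs_bound)
      also have "\<dots> = ph.Q 0 (X i) (\<lambda>y. \<bar>h y\<bar>) x"
        unfolding ph.Q_def by (simp only: abs_mult abs_of_nonneg[OF ph.p_nonneg[OF X(1)]])
      finally show "\<bar>ph.Q 0 (X i) h x\<bar> \<le> ph.Q 0 (X i) (\<lambda>y. \<bar>h y\<bar>) x" .
    qed (use ph.Q_integrable[OF h X(1), of 0 i] ph.Q_integrable[OF ah X(1), of 0 i] in auto)
    also have "\<dots> = (\<integral>x. \<bar>h x\<bar> \<partial>gaussian)"
      by (rule ph.Q_integral_real[OF ah _ X(1)]) auto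
    finally show ?thesis .
  qed
  have lim: "(\<lambda>i. \<integral>x. norm (ph.Q 0 (X i) f x - f x) \<partial>gaussian) \<longlonglongrightarrow> 0"
  proof (rule LIMSEQ_I)
    fix e :: real assume e: "0 < e"
    obtain \<phi> K where \<phi>: "continuous_on UNIV \<phi>" "\<And>x. \<bar>\<phi> x\<bar> \<le> K" "(\<integral>x. \<bar>f x - \<phi> x\<bar> \<partial>gaussian) < e / 3"
      using gaussian_dense_continuous[OF f, of "e / 3"] e by auto
    have [measurable]: "\<phi> \<in> borel_measurable borel" using \<phi>(1) by (rule borel_measurable_continuous_onI)
    have \<phi>_int: "integrable gaussian \<phi>"
      by (rule gauss.integrable_const_bound[where B=K]) (use \<phi>(2) in auto)
    have Q\<phi>: "integrable gaussian (\<lambda>x. ph.Q 0 (X i) \<phi> x)" for i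
      using ph.Q_integrable[OF \<phi>_int X(1)] by simp
    have Q\<phi>_le: "\<bar>ph.Q 0 (X i) \<phi> x\<bar> \<le> K" for i x
    proof -
      have "ph.Q 0 (X i) \<phi> x \<le> ph.Q 0 (X i) (\<lambda>_. K) x" "ph.Q 0 (X i) (\<lambda>_. - K) x \<le> ph.Q 0 (X i) \<phi> x"
        using \<phi>_int \<phi>(2) X(1)[of i] by (auto intro!: ph.Q_mono simp: gauss.emeasure_space_1 abs_le_iff minus_le_iff)
      then show ?thesis using ph.Q_const[OF X(1), of i K x] ph.Q_const[OF X(1), of i "- K" x] by simp
    qed
    have "(\<lambda>i. \<integral>x. \<bar>ph.Q 0 (X i) \<phi> x - \<phi> x\<bar> \<partial>gaussian) \<longlonglongrightarrow> (\<integral>x. 0 \<partial>(gaussian :: 'a measure))"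
    proof (rule integral_dominated_convergence[where w="\<lambda>_. 2 * K"])
      show "AE x in gaussian. (\<lambda>i. \<bar>ph.Q 0 (X i) \<phi> x - \<phi> x\<bar>) \<longlonglongrightarrow> 0"
      proof (rule AE_I2)
        fix x
        have "(\<lambda>i. poisson_hermite (X i) \<phi> x) \<longlonglongrightarrow> \<phi> x"
          by (rule poisson_hermite_continuous[OF \<phi>(1,2) X])
        then have "(\<lambda>i. ph.Q 0 (X i) \<phi> x) \<longlonglongrightarrow> \<phi> x"
          by (simp only: poisson_hermite_eq[OF X(1) \<phi>_int])
        then have "(\<lambda>i. \<bar>ph.Q 0 (X i) \<phi> x - \<phi> x\<bar>) \<longlonglongrightarrow> \<bar>\<phi> x - \<phi> x\<bar>" by (intro tendsto_intros)
        then show "(\<lambda>i. \<bar>ph.Q 0 (X i) \<phi> x - \<phi> x\<bar>) \<longlonglongrightarrow> 0" by simp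
      qed
      show "AE x in gaussian. norm \<bar>ph.Q 0 (X i) \<phi> x - \<phi> x\<bar> \<le> 2 * K" for i
      proof (rule AE_I2)
        fix x
        show "norm \<bar>ph.Q 0 (X i) \<phi> x - \<phi> x\<bar> \<le> 2 * K"
          using Q\<phi>_le[of i x] \<phi>(2)[of x] unfolding real_norm_def by linarith
      qed
    qed (auto simp: gauss.emeasure_space_1)
    then have "eventually (\<lambda>i. (\<integral>x. \<bar>ph.Q 0 (X i) \<phi> x - \<phi> x\<bar> \<partial>gaussian) < e / 3) sequentially"
      using e by (intro order_tendstoD(2)) auto
    then obtain i0 where i0: "\<And>i. i0 \<le> i \<Longrightarrow> (\<integral>x. \<bar>ph.Q 0 (X i) \<phi> x - \<phi> x\<bar> \<partial>gaussian) < e / 3"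
      by (auto simp: eventually_sequentially)
    show "\<exists>no. \<forall>n\<ge>no. norm ((\<integral>x. norm (ph.Q 0 (X n) f x - f x) \<partial>gaussian) - 0) < e"
    proof (intro exI[of _ i0] allI impI)
      fix i assume i: "i0 \<le> i"
      have d: "integrable gaussian (\<lambda>y. f y - \<phi> y)" using f \<phi>_int by auto
      have "(\<integral>x. norm (ph.Q 0 (X i) f x - f x) \<partial>gaussian)
        \<le> (\<integral>x. \<bar>ph.Q 0 (X i) (\<lambda>y. f y - \<phi> y) x\<bar> + \<bar>ph.Q 0 (X i) \<phi> x - \<phi> x\<bar> + \<bar>f x - \<phi> x\<bar> \<partial>gaussian)"
      proof (rule integral_mono)
        fix x
        have "ph.Q 0 (X i) (\<lambda>y. f y - \<phi> y) x = ph.Q 0 (X i) f x - ph.Q 0 (X i) \<phi> x"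
          by (rule ph.Q_diff[OF f \<phi>_int X(1)])
        then show "norm (ph.Q 0 (X i) f x - f x) \<le> \<bar>ph.Q 0 (X i) (\<lambda>y. f y - \<phi> y) x\<bar> + \<bar>ph.Q 0 (X i) \<phi> x - \<phi> x\<bar> + \<bar>f x - \<phi> x\<bar>"
          unfolding real_norm_def by linarith
      qed (use f \<phi>_int Qf[of i] Q\<phi>[of i] ph.Q_integrable[OF d X(1), of 0 i] in auto)
      also have "\<dots> = (\<integral>x. \<bar>ph.Q 0 (X i) (\<lambda>y. f y - \<phi> y) x\<bar> \<partial>gaussian) + (\<integral>x. \<bar>ph.Q 0 (X i) \<phi> x - \<phi> x\<bar> \<partial>gaussian) + (\<integral>x. \<bar>f x - \<phi> x\<bar> \<partial>gaussian)"
        using f \<phi>_int Q\<phi>[of i] ph.Q_integrable[OF d X(1), of 0 i] by simp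
      also have "\<dots> < e" using contr[OF d, of i] \<phi>(3) i0[OF i] by simp
      finally show "norm ((\<integral>x. norm (ph.Q 0 (X i) f x - f x) \<partial>gaussian) - 0) < e"
        by (simp add: integral_nonneg_AE)
    qed
  qed
  obtain \<sigma> :: "nat \<Rightarrow> nat" where \<sigma>: "strict_mono \<sigma>" "AE x in gaussian. (\<lambda>i. ph.Q 0 (X (\<sigma> i)) f x - f x) \<longlonglongrightarrow> 0"
    using tendsto_L1_AE_subseq[OF _ lim] f Qf by auto
  show ?thesis
    unfolding ph.approx_identity_def
  proof (intro exI[of _ "X \<circ> \<sigma>"] conjI allI)
    show "0 < (X \<circ> \<sigma>) i" for i using X(1) by simp
    show "(X \<circ> \<sigma>) \<longlonglongrightarrow> 0" using X(2) \<sigma>(1) by (rule LIMSEQ_subseq_LIMSEQ)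
    show "AE x in gaussian. (\<lambda>i. ph.Q 0 ((X \<circ> \<sigma>) i) f x) \<longlonglongrightarrow> f x"
      using \<sigma>(2) by eventually_elim (simp add: LIM_zero_iff)
  qed
qed

section \<open>Translation of the norms and of the Bessel derivative into the kernel setting\<close>

lemma deriv_poisson_hermite:
  assumes f: "integrable gaussian f" and t: "0 < t"
  shows "(deriv ^^ j) (\<lambda>s. poisson_hermite s f x) t = ph.Q j t f x"
  using t
proof (induction j arbitrary: t)
  case 0
  then show ?case by (simp add: poisson_hermite_eq f)
next
  case (Suc j)
  have "((deriv ^^ j) (\<lambda>s. poisson_hermite s f x) has_real_derivative ph.Q (Suc j) t f x) (at t)"
    by (rule has_field_derivative_transform_within_open[OF ph.Q_deriv[OF f Suc.prems], where S="{0<..}"])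
      (use Suc in auto)
  then show ?case by (simp add: DERIV_imp_deriv)
qed

lemma tl_square_function_eq:
  assumes f: "integrable gaussian f"
  shows "tl_square_function \<alpha> q f x = epowr (ph.kernel_square \<alpha> q (LEAST m. \<alpha> < real m) f x) (1 / q)"
proof -
  define m where "m = (LEAST m::nat. \<alpha> < real m)"
  have "(\<integral>\<^sup>+t\<in>{0<..}. ennreal ((t powr (real m - \<alpha>) * \<bar>(deriv ^^ m) (\<lambda>s. poisson_hermite s f x) t\<bar>) powr q / t) \<partial>lborel)
    = ph.kernel_square \<alpha> q m f x"
    unfolding ph.kernel_square_def
  proof (rule nn_integral_cong)
    fix t :: real
    show "ennreal ((t powr (real m - \<alpha>) * \<bar>(deriv ^^ m) (\<lambda>s. poisson_hermite s f x) t\<bar>) powr q / t) * indicator {0<..} t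
      = epowr (ennreal (t powr (real m - \<alpha>) * \<bar>ph.Q m t f x\<bar>)) q * ennreal (1 / t) * indicator {0<..} t"
    proof (cases "0 < t")
      case True
      then show ?thesis
        by (simp add: deriv_poisson_hermite[OF f] epowr_ennreal flip: ennreal_mult)
    qed simp
  qed
  then show ?thesis unfolding tl_square_function_def m_def[symmetric] by simp
qed

lemma bessel_derivative_eq:
  assumes f: "integrable gaussian f"
  shows "bessel_derivative \<beta> f x = ph.bessel_op (1 / bessel_const \<beta>) (bessel_order \<beta>) \<beta> f x"
    and "set_integrable lborel {0<..} (bessel_integrand \<beta> f x) \<longleftrightarrow> set_integrable lborel {0<..} (ph.bessel_diff (bessel_order \<beta>) \<beta> f x)"
proof -
  have eq: "bessel_integrand \<beta> f x s = ph.bessel_diff (bessel_order \<beta>) \<beta> f x s" if s: "s \<in> {0<..}" for s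
  proof -
    \<comment> \<open>The value c = 0 occurs for j = k; there both sides reduce to
      \<open>f x\<close>.\<close>
    have "exp (- (c * s)) * poisson_hermite (c * s) f x = ph.damped f x (c * s)" if "0 \<le> c" for c
    proof (cases "c = 0")
      case True
      then show ?thesis by (simp add: ph.damped_def poisson_hermite_def)
    next
      case False
      then have "0 < c * s" using that s by simp
      then show ?thesis unfolding ph.damped_def poisson_hermite_eq[OF \<open>0 < c * s\<close> f] by auto
    qed
    then have "exp (- (real (bessel_order \<beta> - j) * s)) * poisson_hermite (real (bessel_order \<beta> - j) * s) f x
      = ph.damped f x (real (bessel_order \<beta> - j) * s)" for j by simp
    then show ?thesis
      unfolding bessel_integrand_def bessel_difference_def ph.bessel_diff_def
      by (simp only: mult.assoc)
  qed
  have ind: "indicator {0<..} s *\<^sub>R bessel_integrand \<beta> f x s = indicator {0<..} s *\<^sub>R ph.bessel_diff (bessel_order \<beta>) \<beta> f x s" for s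
    by (cases "s \<in> {0<..}") (simp_all add: eq)
  show "bessel_derivative \<beta> f x = ph.bessel_op (1 / bessel_const \<beta>) (bessel_order \<beta>) \<beta> f x"
    unfolding bessel_derivative_def ph.bessel_op_def set_lebesgue_integral_def ind ..
  show "set_integrable lborel {0<..} (bessel_integrand \<beta> f x) \<longleftrightarrow> set_integrable lborel {0<..} (ph.bessel_diff (bessel_order \<beta>) \<beta> f x)"
    unfolding set_integrable_def ind ..
qed

lemma least_nat_greater:
  fixes a :: real
  assumes "0 \<le> a"
  shows "a < real (LEAST m. a < real m)" "real (LEAST m. a < real m) - 1 \<le> a" "1 \<le> (LEAST m. a < real m)"
proof -
  let ?m = "LEAST m::nat. a < real m"
  have "\<exists>m::nat. a < real m" by (rule reals_Archimedean2)
  then show 1: "a < real ?m" by (rule LeastI_ex)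
  with assms show 2: "1 \<le> ?m" by (cases ?m) auto
  have "\<not> a < real (?m - 1)" by (rule not_less_Least) (use 2 in simp)
  then show "real ?m - 1 \<le> a" using 2 by (simp add: of_nat_diff)
qed

theorem theorem2p6:
  fixes \<alpha> \<beta> p q :: real
  assumes "0 < \<beta>" and "\<beta> < \<alpha>" and "1 < p" and "1 \<le> q"
  shows "(\<forall>f \<in> (triebel_lizorkin \<alpha> p q :: (real ^ 'd \<Rightarrow> real) set).
            (AE x in gaussian. set_integrable lborel {0<..} (bessel_integrand \<beta> f x)) \<and>
            bessel_derivative \<beta> f \<in> triebel_lizorkin (\<alpha> - \<beta>) p q) \<and>
         (\<exists>C\<ge>0. \<forall>f \<in> (triebel_lizorkin \<alpha> p q :: (real ^ 'd \<Rightarrow> real) set).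
            tl_norm (\<alpha> - \<beta>) p q (bessel_derivative \<beta> f) \<le> ennreal C * tl_norm \<alpha> p q f)"
proof -
  define k where "k = bessel_order \<beta>"
  define m where "m = (LEAST m::nat. \<alpha> < real m)"
  define n where "n = (LEAST n::nat. \<alpha> - \<beta> < real n)"
  have k: "\<beta> < real k" "real k - 1 \<le> \<beta>"
    using least_nat_greater[of \<beta>] assms by (auto simp: k_def bessel_order_def)
  have m: "\<alpha> < real m" using least_nat_greater(1)[of \<alpha>] assms by (auto simp: m_def)
  have n: "\<alpha> - \<beta> < real n" "1 \<le> n"
    using least_nat_greater[of "\<alpha> - \<beta>"] assms by (auto simp: n_def)
  \<comment> \<open>k + n exceeds \<beta> + (\<alpha> - \<beta>) = \<alpha>, and m is the least
    integer that does.\<close>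
  have mkn: "m \<le> k + n" unfolding m_def by (rule Least_le) (use k n in simp)
  define c where "c = 1 / bessel_const \<beta>"
  let ?N = "\<lambda>f :: real ^ 'd \<Rightarrow> real. \<integral>\<^sup>+x. epowr (ennreal \<bar>f x\<bar>) p \<partial>gaussian"
  let ?S = "\<lambda>\<alpha> m (f :: real ^ 'd \<Rightarrow> real). \<integral>\<^sup>+x. epowr (ph.kernel_square \<alpha> q m f x) (p / q) \<partial>gaussian"
  obtain C where C: "0 < C" "\<And>f :: real ^ 'd \<Rightarrow> real. f \<in> borel_measurable gaussian \<Longrightarrow> ph.approx_identity f \<Longrightarrow> ?N f < top \<Longrightarrow> ?S \<alpha> m f < top \<Longrightarrow>
    (AE x in gaussian. set_integrable lborel {0<..} (ph.bessel_diff k \<beta> f x)) \<and>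
    ?N (ph.bessel_op c k \<beta> f) \<le> ennreal C * (?N f + ?S \<alpha> m f) \<and>
    ?S (\<alpha> - \<beta>) n (ph.bessel_op c k \<beta> f) \<le> ennreal C * (?N f + ?S \<alpha> m f)"
    using ph.bessel_op_bounded[OF assms k(2,1) m mkn n, of c, where 'a="real ^ 'd"] by blast
  \<comment> \<open>The outer 2 counts the two summands of the target norm; the 2 under the root
    comes from splitting the p-th root of a sum.\<close>
  define C' where "C' = 2 * (C * 2) powr (1 / p)"
  have "0 < C'" using C(1) by (simp add: C'_def)
  have tl_norm_eq: "tl_norm a p q f = epowr (?N f) (1 / p) + epowr (?S a (LEAST m. a < real m) f) (1 / p)"
    if "integrable gaussian f" for a and f :: "real ^ 'd \<Rightarrow> real"
    using assms that by (simp add: tl_norm_def gaussian_norm_def tl_square_function_eq epowr_epowr)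
  have main: "(AE x in gaussian. set_integrable lborel {0<..} (bessel_integrand \<beta> f x)) \<and>
      bessel_derivative \<beta> f \<in> triebel_lizorkin (\<alpha> - \<beta>) p q \<and>
      tl_norm (\<alpha> - \<beta>) p q (bessel_derivative \<beta> f) \<le> ennreal C' * tl_norm \<alpha> p q f"
    if f_in: "f \<in> triebel_lizorkin \<alpha> p q" for f :: "real ^ 'd \<Rightarrow> real"
  proof -
    have [measurable]: "f \<in> borel_measurable borel" and N_fin: "?N f < top" and tl_fin: "tl_norm \<alpha> p q f < top"
      using f_in by (auto simp: triebel_lizorkin_def gaussian_Lp_def gaussian_norm_def)
    have f: "integrable gaussian f"
      using assms N_fin by (intro ph.integrable_of_Lp[of _ p]) auto
    have S_fin: "?S \<alpha> m f < top"
      using tl_fin unfolding tl_norm_eq[OF f] m_def by simp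
    let ?g = "ph.bessel_op c k \<beta> f"
    have g: "bessel_derivative \<beta> f = ?g"
      by (rule ext) (simp add: bessel_derivative_eq[OF f] c_def k_def)
    have g_meas: "?g \<in> borel_measurable borel"
      using ph.bessel_op_measurable[of f c k \<beta>] by simp
    note b = C(2)[of f, OF _ gaussian_approx_identity[OF f] N_fin S_fin]
    have "f \<in> borel_measurable gaussian" by simp
    note b = b[OF this]
    let ?R = "ennreal C * (?N f + ?S \<alpha> m f)"
    have R_fin: "?R < top" using N_fin S_fin by (simp add: ennreal_mult_less_top)
    have Ng_fin: "?N ?g < top" using b R_fin by (auto intro: le_less_trans)
    \<comment> \<open>Needed to write the norm of the image through the kernel, where
      \<open>deriv\<close> is replaced by genuine derivatives.\<close>
    have g_int: "integrable gaussian ?g"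
      using assms Ng_fin g_meas by (intro ph.integrable_of_Lp[of _ p]) auto
    have "tl_norm (\<alpha> - \<beta>) p q ?g \<le> epowr ?R (1 / p) + epowr ?R (1 / p)"
      unfolding tl_norm_eq[OF g_int] n_def[symmetric] using b assms by (intro add_mono epowr_mono) auto
    also have "\<dots> = 2 * (ennreal (C powr (1 / p)) * epowr (?N f + ?S \<alpha> m f) (1 / p))"
      using C(1) by (simp add: epowr_mult epowr_ennreal mult_2)
    also have "\<dots> \<le> 2 * (ennreal (C powr (1 / p)) * (ennreal (2 powr (1 / p)) * tl_norm \<alpha> p q f))"
      unfolding tl_norm_eq[OF f] m_def[symmetric] using assms by (intro mult_left_mono epowr_add_le) auto
    also have "\<dots> = ennreal C' * tl_norm \<alpha> p q f"
      using C(1) by (simp add: C'_def powr_mult ennreal_mult mult.assoc)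
    finally have le: "tl_norm (\<alpha> - \<beta>) p q ?g \<le> ennreal C' * tl_norm \<alpha> p q f" .
    have "tl_norm (\<alpha> - \<beta>) p q ?g < top"
      using tl_fin by (intro le_less_trans[OF le]) (simp add: ennreal_mult_less_top)
    then have "?g \<in> triebel_lizorkin (\<alpha> - \<beta>) p q"
      using g_meas Ng_fin by (simp add: triebel_lizorkin_def gaussian_Lp_def gaussian_norm_def)
    moreover have "AE x in gaussian. set_integrable lborel {0<..} (bessel_integrand \<beta> f x)"
      using b by (simp add: bessel_derivative_eq(2)[OF f] k_def)
    ultimately show ?thesis using le g by simp
  qed
  then show ?thesis using \<open>0 < C'\<close> by (intro conjI ballI exI[of _ C']) auto
qed

end
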